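(* For any $c\ge 2$, if one of the following statements is true, then all are: (1) $(1+\varepsilon)$-Approximate Directed APSP can be solved in strongly polynomial time $\tilde{\mathcal{O}}(n^c/\mathrm{poly}(\varepsilon))$; (2) $(1+\varepsilon)$-Approximate Min-Plus Product can be solved in strongly polynomial time $\tilde{\mathcal{O}}(n^c/\mathrm{poly}(\varepsilon))$; (3) exact Min-Max Product can be solved in strongly polynomial time $\tilde{\mathcal{O}}(n^c)$; (4) exact All-Pairs Bottleneck Path can be solved in strongly polynomial time $\tilde{\mathcal{O}}(n^c)$.
   Context: Let $\mathbb{R}_+=\{a\in\mathbb{R}:a\ge1\}\cup\{\infty\}$. $(1+\varepsilon)$-Approximate Directed APSP: given a directed graph on $n$ nodes with weights in $\mathbb{R}_+$, output $\tilde d(u,v)$ with $d_G(u,v)\le\tilde d(u,v)\le(1+\varepsilon)d_G(u,v)$ for all $u,v$. Min-Plus Product: given $A,B\in\mathbb{R}_+^{n\times n}$, compute $C[i,j]=\min_k(A[i,k]+B[k,j])$; the $(1+\varepsilon)$-approximate version outputs $\tilde C$ with $C[i,j]\le\tilde C[i,j]\le(1+\varepsilon)C[i,j]$ for all $i,j$. Min-Max Product: given $A,B$, compute $C[i,j]=\min_k\max\{A[i,k],B[k,j]\}$. All-Pairs Bottleneck Path: given an edge-weighted directed graph on $n$ nodes, for all pairs $u,v$ determine the maximum over all $u$-$v$ paths of the minimum edge weight on the path. Input convention: for approximate problems input numbers are given in floating-point representation (exponent and mantissa of $O(\log n+\log\log W)$ and $O(\log n)$ bits), for exact problems input numbers are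 integers in standard bit representation; arithmetic on such numbers has unit cost. "Strongly polynomial time $T$" means the number of arithmetic operations is at most $T$, independent of the largest input weight $W$. $\tilde{\mathcal{O}}$ hides polylogarithmic factors in $n$ and $1/\varepsilon$, never $\log W$. *)

theory Defs
  imports "HOL-Library.Extended_Real" "Graph_Theory.Graph_Theory"
begin

section \<open>A word RAM with unit-cost arithmetic\<close>

text \<open>
  Memory is split into finitely many (as many as the program names) arrays of integer words.
  A cell that was never written is undefined, and reading it is an error, so programs cannot
  exploit the initial contents of memory outside the input.
\<close>

type_synonym mem = "nat \<Rightarrow> int \<Rightarrow> int option"

datatype exp =
    Const int
  | Cell nat exp
  | Add exp exp
  | Sub exp exp
  | Mul exp exp
  | Div exp exp

datatype com =
    Skip
  | Assign nat exp exp
  | Seq com com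
  | If_Less exp exp com com
  | While_Less exp exp com

text \<open>
  The parameter \<open>B\<close> is the largest absolute value of a machine word. It has to be bounded:
  unit-cost multiplication of unbounded integers would allow packing whole matrices into a
  single number. A computation that leaves the range is an error, it does not wrap around.
\<close>

definition word :: "real \<Rightarrow> int \<Rightarrow> int option" where
  "word B x = (if \<bar>real_of_int x\<bar> \<le> B then Some x else None)"

fun eval :: "real \<Rightarrow> mem \<Rightarrow> exp \<Rightarrow> int option" where
  "eval B s (Const k) = word B k"
| "eval B s (Cell a e) =
     Option.bind (eval B s e) (\<lambda>i. Option.bind (s a i) (word B))"
| "eval B s (Add e f) =
     Option.bind (eval B s e) (\<lambda>x. Option.bind (eval B s f) (\<lambda>y. word B (x + y)))"
| "eval B s (Sub e f) =
     Option.bind (eval B s e) (\<lambda>x. Option.bind (eval B s f) (\<lambda>y. word B (x - y)))"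
| "eval B s (Mul e f) =
     Option.bind (eval B s e) (\<lambda>x. Option.bind (eval B s f) (\<lambda>y. word B (x * y)))"
| "eval B s (Div e f) =
     Option.bind (eval B s e) (\<lambda>x. Option.bind (eval B s f)
       (\<lambda>y. if y = 0 then None else word B (x div y)))"

fun ops :: "exp \<Rightarrow> nat" where
  "ops (Const k) = 1"
| "ops (Cell a e) = Suc (ops e)"
| "ops (Add e f) = Suc (ops e + ops f)"
| "ops (Sub e f) = Suc (ops e + ops f)"
| "ops (Mul e f) = Suc (ops e + ops f)"
| "ops (Div e f) = Suc (ops e + ops f)"

text \<open>
  \<open>exec B c s t s'\<close>: with words bounded by \<open>B\<close>, program \<open>c\<close> started in memory \<open>s\<close> stops
  without error in memory \<open>s'\<close> after exactly \<open>t\<close> unit-cost operations.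
\<close>

inductive exec :: "real \<Rightarrow> com \<Rightarrow> mem \<Rightarrow> nat \<Rightarrow> mem \<Rightarrow> bool" for B where
  Skip: "exec B Skip s 1 s"
| Assign:
    "\<lbrakk>eval B s e = Some i; eval B s f = Some x\<rbrakk>
     \<Longrightarrow> exec B (Assign a e f) s (1 + ops e + ops f) (s(a := (s a)(i \<mapsto> x)))"
| Seq:
    "\<lbrakk>exec B c s t s'; exec B d s' t' s''\<rbrakk> \<Longrightarrow> exec B (Seq c d) s (1 + t + t') s''"
| If_True:
    "\<lbrakk>eval B s e = Some x; eval B s f = Some y; x < y; exec B c s t s'\<rbrakk>
     \<Longrightarrow> exec B (If_Less e f c d) s (1 + ops e + ops f + t) s'"
| If_False:
    "\<lbrakk>eval B s e = Some x; eval B s f = Some y; \<not> x < y; exec B d s t s'\<rbrakk>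
     \<Longrightarrow> exec B (If_Less e f c d) s (1 + ops e + ops f + t) s'"
| While_False:
    "\<lbrakk>eval B s e = Some x; eval B s f = Some y; \<not> x < y\<rbrakk>
     \<Longrightarrow> exec B (While_Less e f c) s (1 + ops e + ops f) s"
| While_True:
    "\<lbrakk>eval B s e = Some x; eval B s f = Some y; x < y;
      exec B c s t s'; exec B (While_Less e f c) s' t' s''\<rbrakk>
     \<Longrightarrow> exec B (While_Less e f c) s (1 + ops e + ops f + t + t') s''"

inductive_cases SkipE: "exec B Skip s t s'"
inductive_cases AssignE: "exec B (Assign a e f) s t s'"
inductive_cases SeqE: "exec B (Seq c d) s t s'"
inductive_cases If_LessE: "exec B (If_Less e f c d) s t s'"
inductive_cases While_LessE: "exec B (While_Less e f c) s t s'"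

lemma exec_deterministic:
  "exec B c s t s' \<Longrightarrow> exec B c s u r \<Longrightarrow> t = u \<and> s' = r"
proof (induction arbitrary: u r rule: exec.induct)
  case (Seq c s t s' d t' s'')
  from Seq.prems obtain t2 r2 t2' where
    "exec B c s t2 r2" "exec B d r2 t2' r" "u = 1 + t2 + t2'"
    by (rule SeqE) simp
  with Seq.IH show ?case by metis
next
  case (While_True s e x f y c t s' t' s'')
  from While_True.prems While_True.hyps(1-3) obtain t2 r2 t2' where
    "exec B c s t2 r2" "exec B (While_Less e f c) r2 t2' r"
    "u = 1 + ops e + ops f + t2 + t2'"
    by (cases rule: While_LessE) auto
  with While_True.IH show ?case by metis
next
  case (If_True s e x f y c t s' d)
  from If_True.prems If_True.hyps(1-3) obtain t2 where
    "exec B c s t2 r" "u = 1 + ops e + ops f + t2"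
    by (cases rule: If_LessE) auto
  with If_True.IH show ?case by metis
next
  case (If_False s e x f y d t s' c)
  from If_False.prems If_False.hyps(1-3) obtain t2 where
    "exec B d s t2 r" "u = 1 + ops e + ops f + t2"
    by (cases rule: If_LessE) auto
  with If_False.IH show ?case by metis
next
  case (While_False s e x f y c)
  from While_False.prems While_False.hyps show ?case
    by (cases rule: While_LessE) auto
next
  case (Assign s e i f x a)
  from Assign.prems Assign.hyps show ?case
    by (cases rule: AssignE) auto
next
  case (Skip s)
  then show ?case by (cases rule: SkipE) auto
qed


section \<open>Number formats and running times\<close>

text \<open>
  Floating point: three words \<open>flag, mantissa, exponent\<close>, where flag 1 marks \<open>\<infinity>\<close>; \<open>M\<close> bounds
  the mantissa. For input weights \<open>1 \<le> m * 2 powr e \<le> W\<close>, a bound of \<open>O(log n)\<close> bits on \<open>m\<close>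
  already implies the bound of \<open>O(log n + log log W)\<close> bits on \<open>e\<close>.

  Integers: two words \<open>flag, value\<close>, where the flags 1 and -1 mark \<open>\<infinity>\<close> and \<open>-\<infinity>\<close>.

  Matrices are stored row by row.
\<close>

definition holds_float :: "real \<Rightarrow> mem \<Rightarrow> nat \<Rightarrow> nat \<Rightarrow> ereal \<Rightarrow> bool" where
  "holds_float M s a i x \<longleftrightarrow>
     (s a (3 * int i) = Some 0 \<and>
       (\<exists>m e. s a (3 * int i + 1) = Some m \<and> s a (3 * int i + 2) = Some e \<and>
         \<bar>real_of_int m\<bar> \<le> M \<and> x = ereal (real_of_int m * 2 powr real_of_int e))) \<or>
     (s a (3 * int i) = Some 1 \<and> x = \<infinity>)"

definition holds_int :: "mem \<Rightarrow> nat \<Rightarrow> nat \<Rightarrow> ereal \<Rightarrow> bool" where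
  "holds_int s a i x \<longleftrightarrow>
     (s a (2 * int i) = Some 0 \<and>
       (\<exists>k. s a (2 * int i + 1) = Some k \<and> x = ereal (real_of_int k))) \<or>
     (s a (2 * int i) = Some 1 \<and> x = \<infinity>) \<or>
     (s a (2 * int i) = Some (-1) \<and> x = -\<infinity>)"

definition holds_float_matrix ::
  "real \<Rightarrow> mem \<Rightarrow> nat \<Rightarrow> nat \<Rightarrow> (nat \<Rightarrow> nat \<Rightarrow> ereal) \<Rightarrow> bool" where
  "holds_float_matrix M s a n A \<longleftrightarrow> (\<forall>i<n. \<forall>j<n. holds_float M s a (i * n + j) (A i j))"

definition holds_int_matrix :: "mem \<Rightarrow> nat \<Rightarrow> nat \<Rightarrow> (nat \<Rightarrow> nat \<Rightarrow> ereal) \<Rightarrow> bool" where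
  "holds_int_matrix s a n A \<longleftrightarrow> (\<forall>i<n. \<forall>j<n. holds_int s a (i * n + j) (A i j))"

text \<open>
  Words have \<open>O(log n + log log W + log (1/\<epsilon>))\<close> bits for approximate problems and
  \<open>O(log n + log W)\<close> bits for exact ones; the exponent \<open>\<kappa>\<close> is the hidden constant.
  The running times do not depend on \<open>W\<close>. The factor \<open>(1 + 1/\<epsilon>) ^ k\<close> renders
  \<open>1/poly(\<epsilon>)\<close>; for \<open>\<epsilon> \<le> 1\<close> it lies between \<open>1 / \<epsilon> ^ k\<close> and \<open>2 ^ k / \<epsilon> ^ k\<close>.
\<close>

definition approx_word :: "nat \<Rightarrow> nat \<Rightarrow> real \<Rightarrow> real \<Rightarrow> real" where
  "approx_word \<kappa> n \<epsilon> W = (2 + real n + 1 / \<epsilon> + log 2 W) ^ \<kappa>"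

definition exact_word :: "nat \<Rightarrow> nat \<Rightarrow> real \<Rightarrow> real" where
  "exact_word \<kappa> n W = (2 + real n + W) ^ \<kappa>"

definition approx_time :: "real \<Rightarrow> nat \<Rightarrow> nat \<Rightarrow> real \<Rightarrow> nat \<Rightarrow> real \<Rightarrow> real" where
  "approx_time C k l c n \<epsilon> =
     C * real n powr c * (1 + 1 / \<epsilon>) ^ k * log 2 (2 + real n + 1 / \<epsilon>) ^ l"

definition exact_time :: "real \<Rightarrow> nat \<Rightarrow> real \<Rightarrow> nat \<Rightarrow> real" where
  "exact_time C l c n = C * real n powr c * log 2 (2 + real n) ^ l"


section \<open>The problems\<close>

definition R_plus :: "ereal set" where
  "R_plus = {ereal a | a. 1 \<le> a} \<union> {\<infinity>}"

definition int_infty :: "ereal set" where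
  "int_infty = {ereal (real_of_int a) | a. True} \<union> {\<infinity>}"

definition min_plus :: "nat \<Rightarrow> (nat \<Rightarrow> nat \<Rightarrow> ereal) \<Rightarrow> (nat \<Rightarrow> nat \<Rightarrow> ereal) \<Rightarrow> nat \<Rightarrow> nat \<Rightarrow> ereal"
  where "min_plus n A B i j = (MIN k\<in>{..<n}. A i k + B k j)"

definition min_max :: "nat \<Rightarrow> (nat \<Rightarrow> nat \<Rightarrow> ereal) \<Rightarrow> (nat \<Rightarrow> nat \<Rightarrow> ereal) \<Rightarrow> nat \<Rightarrow> nat \<Rightarrow> ereal"
  where "min_max n A B i j = (MIN k\<in>{..<n}. max (A i k) (B k j))"

definition graph_on :: "nat \<Rightarrow> (nat \<times> nat) set \<Rightarrow> (nat, nat \<times> nat) pre_digraph" where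
  "graph_on n E = \<lparr>verts = {..<n}, arcs = E, tail = fst, head = snd\<rparr>"

definition distance :: "('a, 'b) pre_digraph \<Rightarrow> ('b \<Rightarrow> ereal) \<Rightarrow> 'a \<Rightarrow> 'a \<Rightarrow> ereal" where
  "distance G w u v = (INF p\<in>{p. pre_digraph.apath G u p v}. \<Sum>e\<leftarrow>p. w e)"

text \<open>
  The lattice conventions give \<open>-\<infinity>\<close> if there is no path, and \<open>\<infinity>\<close> for the empty path
  from a node to itself.
\<close>

definition bottleneck :: "('a, 'b) pre_digraph \<Rightarrow> ('b \<Rightarrow> ereal) \<Rightarrow> 'a \<Rightarrow> 'a \<Rightarrow> ereal" where
  "bottleneck G w u v = (SUP p\<in>{p. pre_digraph.apath G u p v}. INF e\<in>set p. w e)"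

text \<open>
  In all four problems cell 0 of array 0 contains \<open>n\<close>. For approximate problems, cell 1 of
  array 0 contains \<open>\<lceil>1/\<epsilon>\<rceil>\<close>, i.e. the accuracy is part of the input; \<open>b\<close> is the hidden constant
  in the \<open>O(log n)\<close> bits of the input mantissas. Matrix inputs are in arrays 1 and 2 and the
  output is in array 3; a graph is given by its weight matrix in array 1, in which a missing arc
  is \<open>\<infinity>\<close> (distances) or \<open>-\<infinity>\<close> (bottlenecks), and the output is in array 2.
\<close>

definition approx_APSP_solvable :: "real \<Rightarrow> bool" where
  "approx_APSP_solvable c \<longleftrightarrow>
     (\<forall>b. \<exists>P \<kappa> C k l. \<forall>n \<epsilon> W E w s.
        1 \<le> n \<and> 0 < \<epsilon> \<and> 1 \<le> W \<and>
        E \<subseteq> {..<n} \<times> {..<n} \<and>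
        (\<forall>e\<in>E. w e \<in> R_plus \<and> (w e \<noteq> \<infinity> \<longrightarrow> w e \<le> ereal W)) \<and>
        s 0 0 = Some (int n) \<and> s 0 1 = Some \<lceil>1 / \<epsilon>\<rceil> \<and>
        holds_float_matrix ((real n + 1) ^ b) s 1 n
          (\<lambda>u v. if (u, v) \<in> E then w (u, v) else \<infinity>)
      \<longrightarrow> (\<exists>t s' D.
        exec (approx_word \<kappa> n \<epsilon> W) P s t s' \<and>
        real t \<le> approx_time C k l c n \<epsilon> \<and>
        holds_float_matrix (approx_word \<kappa> n \<epsilon> W) s' 2 n D \<and>
        (\<forall>u<n. \<forall>v<n. distance (graph_on n E) w u v \<le> D u v \<and>
           D u v \<le> ereal (1 + \<epsilon>) * distance (graph_on n E) w u v)))"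

definition approx_min_plus_solvable :: "real \<Rightarrow> bool" where
  "approx_min_plus_solvable c \<longleftrightarrow>
     (\<forall>b. \<exists>P \<kappa> C k l. \<forall>n \<epsilon> W A B s.
        1 \<le> n \<and> 0 < \<epsilon> \<and> 1 \<le> W \<and>
        (\<forall>i<n. \<forall>j<n. A i j \<in> R_plus \<and> (A i j \<noteq> \<infinity> \<longrightarrow> A i j \<le> ereal W)) \<and>
        (\<forall>i<n. \<forall>j<n. B i j \<in> R_plus \<and> (B i j \<noteq> \<infinity> \<longrightarrow> B i j \<le> ereal W)) \<and>
        s 0 0 = Some (int n) \<and> s 0 1 = Some \<lceil>1 / \<epsilon>\<rceil> \<and>
        holds_float_matrix ((real n + 1) ^ b) s 1 n A \<and>
        holds_float_matrix ((real n + 1) ^ b) s 2 n B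
      \<longrightarrow> (\<exists>t s' D.
        exec (approx_word \<kappa> n \<epsilon> W) P s t s' \<and>
        real t \<le> approx_time C k l c n \<epsilon> \<and>
        holds_float_matrix (approx_word \<kappa> n \<epsilon> W) s' 3 n D \<and>
        (\<forall>i<n. \<forall>j<n. min_plus n A B i j \<le> D i j \<and>
           D i j \<le> ereal (1 + \<epsilon>) * min_plus n A B i j)))"

definition min_max_solvable :: "real \<Rightarrow> bool" where
  "min_max_solvable c \<longleftrightarrow>
     (\<exists>P \<kappa> C l. \<forall>n W A B s.
        1 \<le> n \<and> 0 \<le> W \<and>
        (\<forall>i<n. \<forall>j<n. A i j \<in> int_infty \<and> (A i j \<noteq> \<infinity> \<longrightarrow> \<bar>A i j\<bar> \<le> ereal W)) \<and>
        (\<forall>i<n. \<forall>j<n. B i j \<in> int_infty \<and> (B i j \<noteq> \<infinity> \<longrightarrow> \<bar>B i j\<bar> \<le> ereal W)) \<and>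
        s 0 0 = Some (int n) \<and>
        holds_int_matrix s 1 n A \<and> holds_int_matrix s 2 n B
      \<longrightarrow> (\<exists>t s'.
        exec (exact_word \<kappa> n W) P s t s' \<and>
        real t \<le> exact_time C l c n \<and>
        holds_int_matrix s' 3 n (min_max n A B)))"

definition bottleneck_solvable :: "real \<Rightarrow> bool" where
  "bottleneck_solvable c \<longleftrightarrow>
     (\<exists>P \<kappa> C l. \<forall>n W E (w :: nat \<times> nat \<Rightarrow> int) s.
        1 \<le> n \<and> 0 \<le> W \<and>
        E \<subseteq> {..<n} \<times> {..<n} \<and>
        (\<forall>e\<in>E. \<bar>real_of_int (w e)\<bar> \<le> W) \<and>
        s 0 0 = Some (int n) \<and>
        holds_int_matrix s 1 n (\<lambda>u v. if (u, v) \<in> E then ereal (real_of_int (w (u, v))) else -\<infinity>)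
      \<longrightarrow> (\<exists>t s'.
        exec (exact_word \<kappa> n W) P s t s' \<and>
        real t \<le> exact_time C l c n \<and>
        holds_int_matrix s' 2 n (bottleneck (graph_on n E) (\<lambda>e. ereal (real_of_int (w e))))))"

end

theory Submission
  imports Defs
begin

text \<open>
  Everything is linked to the Min-Max Product.

  A Min-Plus or Min-Max Product of two \<open>n \<times> n\<close> matrices consists of the distances or minimax values from the
  first to the third layer of a graph with three layers of \<open>n\<close> nodes; negation turns minimax into bottleneck values.

  From approximate sums to exact minimax values: sort the \<open>n\<^sup>2\<close> entries, replace the entry of rank \<open>r\<close>
  by the floating-point number \<open>2 powr (L * r)\<close> with \<open>L = n + 2\<close>, and compute distances or sums up to a
  factor 2. At most \<open>n\<close> summands are added, and \<open>2 (n + 1) < 2 powr L\<close>, so the result determines the rank of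
  the largest summand and hence the minimax value. Floating-point input makes the numbers short.

  From Min-Max Product to approximate APSP: up to a factor \<open>1 + 1 / J\<close>, the sum \<open>X + Y\<close> is the minimum of
  \<open>max (X (a + J) / J) (Y (a + J) / a)\<close> over \<open>a = 1, \<dots>, J\<^sup>2\<close>. So the Min-Plus square of an \<open>n \<times> n\<close> matrix is approximated by one Min-Max
  Product of dimension \<open>n J\<^sup>2\<close>, and \<open>log n\<close> squarings with \<open>J\<close> of order \<open>log n / \<epsilon>\<close> approximate all distances.
\<close>

section \<open>Reasoning about programs\<close>

text \<open>Running times must not depend on \<open>W\<close>, but word lengths may, and this shapes
  both reductions. Passing from entries to ranks makes the numbers handed to the approximate problem
  independent of \<open>W\<close>: their logarithms are polynomial in \<open>n\<close>, and so are
  the callee's words. Conversely, the exact Min-Max Product is called on integer keys of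
  floating-point numbers, that is, on exponents times a radix. These keys are polynomial in
  \<open>log 2 W\<close>, so words polynomial in the largest key still meet the word bound of an
  approximate problem. The product only compares, hence an order-preserving encoding is enough.
  Programs know the accuracy only as \<open>K = \<lceil>1 / \<epsilon>\<rceil>\<close> and aim at
  \<open>1 / K\<close>. Leaving the word range is an error, so every invariant comes with a bound
  \<open>M\<close> on the cells, and the word exponents \<open>\<kappa>\<close> are chosen so that
  \<open>M ^ 32\<close> still fits. The implications proved are Min-Max to APSP, APSP to Min-Plus
  and to bottleneck paths, and Min-Plus and bottleneck paths to Min-Max.\<close>

lemma eval_mono: "eval B s e = Some x \<Longrightarrow> B \<le> B' \<Longrightarrow> eval B' s e = Some x"
  by (induction e arbitrary: x) (fastforce simp: bind_eq_Some_conv word_def split: if_splits)+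

text \<open>Overflow is an error rather than a wrap-around, so a larger word bound cannot change a
  run that succeeds. This is how a callee whose word bound is stated for its own parameters runs
  under the bound of its caller.\<close>

lemma exec_mono: "exec B c s t s' \<Longrightarrow> B \<le> B' \<Longrightarrow> exec B' c s t s'"
  by (induction rule: exec.induct) (blast intro: exec.intros eval_mono)+

text \<open>A program \<open>P\<close> is called as \<open>shift_com 50 P\<close>: the caller keeps to arrays below 50, apart from
  the arrays \<open>50 + a\<close> through which it passes arguments to and takes results from array \<open>a\<close> of \<open>P\<close>.\<close>

fun shift_exp :: "nat \<Rightarrow> exp \<Rightarrow> exp" where
  "shift_exp d (Const k) = Const k"
| "shift_exp d (Cell a e) = Cell (a + d) (shift_exp d e)"
| "shift_exp d (Add e f) = Add (shift_exp d e) (shift_exp d f)"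
| "shift_exp d (Sub e f) = Sub (shift_exp d e) (shift_exp d f)"
| "shift_exp d (Mul e f) = Mul (shift_exp d e) (shift_exp d f)"
| "shift_exp d (Div e f) = Div (shift_exp d e) (shift_exp d f)"

fun shift_com :: "nat \<Rightarrow> com \<Rightarrow> com" where
  "shift_com d Skip = Skip"
| "shift_com d (Assign a e f) = Assign (a + d) (shift_exp d e) (shift_exp d f)"
| "shift_com d (Seq c c') = Seq (shift_com d c) (shift_com d c')"
| "shift_com d (If_Less e f c c') = If_Less (shift_exp d e) (shift_exp d f) (shift_com d c) (shift_com d c')"
| "shift_com d (While_Less e f c) = While_Less (shift_exp d e) (shift_exp d f) (shift_com d c)"

lemma eval_shift: "eval B s (shift_exp d e) = eval B (\<lambda>a. s (a + d)) e"
  by (induction e) auto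

lemma ops_shift [simp]: "ops (shift_exp d e) = ops e"
  by (induction e) auto

definition overlay :: "nat \<Rightarrow> mem \<Rightarrow> mem \<Rightarrow> mem" where
  "overlay d s r = (\<lambda>a. if a < d then s a else r (a - d))"

lemma overlay_apply [simp]: "(\<lambda>a. overlay d s r (a + d)) = r"
  by (simp add: overlay_def)

text \<open>A shifted program touches only arrays from \<open>d\<close> on, so it acts on
  \<open>r\<close> and leaves the caller's part \<open>s\<close> of the overlay alone.\<close>

lemma exec_shift: "exec B c r t r' \<Longrightarrow> exec B (shift_com d c) (overlay d s r) t (overlay d s r')"
proof (induction rule: exec.induct)
  case (Assign r e i f x a)
  have *: "overlay d s (r(a := (r a)(i \<mapsto> x))) =
    (overlay d s r)(a + d := (overlay d s r (a + d))(i \<mapsto> x))"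
    by (auto simp: overlay_def fun_eq_iff)
  show ?case
    unfolding * using exec.Assign[of B "overlay d s r" "shift_exp d e" i "shift_exp d f" x "a + d"] Assign
    by (simp add: eval_shift del: fun_upd_apply)
next
  case (If_True r e x f y c t r' c')
  then show ?case
    using exec.If_True[of B "overlay d s r" "shift_exp d e" x "shift_exp d f" y]
    by (simp add: eval_shift)
next
  case (If_False r e x f y c t r' c')
  then show ?case
    using exec.If_False[of B "overlay d s r" "shift_exp d e" x "shift_exp d f" y]
    by (simp add: eval_shift)
next
  case (While_False r e x f y c)
  then show ?case
    using exec.While_False[of B "overlay d s r" "shift_exp d e" x "shift_exp d f" y]
    by (simp add: eval_shift)
next
  case (While_True r e x f y c t r' t' r'')
  then show ?case
    using exec.While_True[of B "overlay d s r" "shift_exp d e" x "shift_exp d f" y]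
    by (simp add: eval_shift)
next
  case (Skip r)
  show ?case using exec.Skip by simp
next
  case (Seq c r t r' c' t' r'')
  then show ?case using exec.Seq by simp
qed

fun writes :: "com \<Rightarrow> nat set" where
  "writes Skip = {}"
| "writes (Assign a e f) = {a}"
| "writes (Seq c d) = writes c \<union> writes d"
| "writes (If_Less e f c d) = writes c \<union> writes d"
| "writes (While_Less e f c) = writes c"

lemma exec_frame: "exec B c s t s' \<Longrightarrow> a \<notin> writes c \<Longrightarrow> s' a = s a"
  by (induction rule: exec.induct) auto

section \<open>Values and sizes of expressions\<close>

fun ival :: "mem \<Rightarrow> exp \<Rightarrow> int" where
  "ival s (Const k) = k"
| "ival s (Cell a e) = the (s a (ival s e))"
| "ival s (Add e f) = ival s e + ival s f"
| "ival s (Sub e f) = ival s e - ival s f"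
| "ival s (Mul e f) = ival s e * ival s f"
| "ival s (Div e f) = ival s e div ival s f"

text \<open>Evaluation is split in two: \<open>ival\<close> is total, by \<open>the\<close> and by
  total division, and can be rewritten freely, while \<open>safe\<close> collects what must hold for
  \<open>eval\<close> to succeed. Only constants and cell contents are compared with
  \<open>M\<close>; intermediate results are controlled by the number of leaves.\<close>

fun safe :: "int \<Rightarrow> mem \<Rightarrow> exp \<Rightarrow> bool" where
  "safe M s (Const k) \<longleftrightarrow> \<bar>k\<bar> \<le> M"
| "safe M s (Cell a e) \<longleftrightarrow> safe M s e \<and> (\<exists>x. s a (ival s e) = Some x \<and> \<bar>x\<bar> \<le> M)"
| "safe M s (Add e f) \<longleftrightarrow> safe M s e \<and> safe M s f"
| "safe M s (Sub e f) \<longleftrightarrow> safe M s e \<and> safe M s f"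
| "safe M s (Mul e f) \<longleftrightarrow> safe M s e \<and> safe M s f"
| "safe M s (Div e f) \<longleftrightarrow> safe M s e \<and> safe M s f \<and> ival s f \<noteq> 0"

text \<open>The content of a cell is at most \<open>M\<close> whatever its index is. The leaves of
  the index count nevertheless, because the index is evaluated too and has to fit into a
  word.\<close>

fun leaves :: "exp \<Rightarrow> nat" where
  "leaves (Const k) = 1"
| "leaves (Cell a e) = leaves e"
| "leaves (Add e f) = leaves e + leaves f"
| "leaves (Sub e f) = leaves e + leaves f"
| "leaves (Mul e f) = leaves e + leaves f"
| "leaves (Div e f) = leaves e + leaves f"

lemma leaves_pos: "0 < leaves e"
  by (induction e) auto

text \<open>For \<open>x, y \<ge> 2\<close> the product \<open>(x - 1) * (y - 1)\<close> is at least
  1, which is \<open>x + y \<le> x * y\<close>. Hence sums obey the same count of exponents as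
  products in \<open>safe_ival_bound\<close>.\<close>

lemma sum_le_power_add:
  fixes M :: int
  assumes "2 \<le> M" "0 < a" "0 < b"
  shows "M ^ a + M ^ b \<le> M ^ (a + b)"
proof -
  have "2 \<le> M ^ a" "2 \<le> M ^ b"
    using assms self_le_power[of M a] self_le_power[of M b] by linarith+
  then have "0 \<le> (M ^ a - 1) * (M ^ b - 1) - 1"
    using mult_mono[of 1 "M ^ a - 1" 1 "M ^ b - 1"] by simp
  then show ?thesis by (simp add: power_add algebra_simps)
qed

text \<open>Changing both signs keeps the quotient, so a positive divisor suffices. Rounding down
  then cannot pass a negative dividend: \<open>x \<le> x div y < 0\<close>.\<close>

lemma abs_div_le: "\<bar>x div y\<bar> \<le> \<bar>x :: int\<bar>"
proof (cases "y = 0")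
  case False
  have *: "\<bar>x div y\<bar> \<le> \<bar>x\<bar>" if y: "0 < y" for x y :: int
  proof (cases "0 \<le> x")
    case True
    then show ?thesis using y div_le_dividend[of "nat x" "nat y"]
      by (smt (verit) div_by_1 pos_imp_zdiv_nonneg_iff zdiv_mono2)
  next
    case False
    then have "x \<le> x div y"
      using y by (smt (verit) div_by_1 zdiv_mono2_neg)
    then show ?thesis using False y by (smt (verit) div_neg_pos_less0)
  qed
  show ?thesis
  proof (cases "0 < y")
    case True
    then show ?thesis by (rule *)
  next
    case neg: False
    have "x div y = (- x) div (- y)" by simp
    then show ?thesis using *[of "- y" "- x"] neg False by simp
  qed
qed simp

lemma safe_ival_bound:
  assumes "safe M s e" "2 \<le> M"
  shows "\<bar>ival s e\<bar> \<le> M ^ leaves e"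
  using assms
proof (induction e)
  case (Cell a e)
  then obtain x where "s a (ival s e) = Some x" "\<bar>x\<bar> \<le> M" by auto
  moreover have "M \<le> M ^ leaves e"
    using Cell.prems leaves_pos[of e] by (intro self_le_power) auto
  ultimately show ?case by simp
next
  case (Add e f)
  then show ?case
    using sum_le_power_add[of M "leaves e" "leaves f"] leaves_pos[of e] leaves_pos[of f] by auto
next
  case (Sub e f)
  then show ?case
    using sum_le_power_add[of M "leaves e" "leaves f"] leaves_pos[of e] leaves_pos[of f] by auto
next
  case (Mul e f)
  then show ?case by (auto simp: abs_mult power_add intro!: mult_mono)
next
  case (Div e f)
  have "\<bar>ival s e div ival s f\<bar> \<le> \<bar>ival s e\<bar>" by (rule abs_div_le)
  also have "\<dots> \<le> M ^ leaves e" using Div by auto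
  also have "\<dots> \<le> M ^ leaves (Div e f)"
    using Div.prems by (intro power_increasing) auto
  finally show ?case by simp
qed auto

text \<open>If all cells and constants that an expression reads are at most \<open>M\<close>, its value is at most
  \<open>M\<close> to the number of its leaves. No expression below has more than 32 leaves.\<close>

definition fits :: "real \<Rightarrow> int \<Rightarrow> bool" where
  "fits B M \<longleftrightarrow> 2 \<le> M \<and> real_of_int M ^ 32 \<le> B"

lemma word_fits:
  assumes "fits B M" "\<bar>x\<bar> \<le> M ^ k" "k \<le> 32"
  shows "word B x = Some x"
proof -
  have "M ^ k \<le> M ^ 32"
    using assms by (intro power_increasing) (auto simp: fits_def)
  then have "\<bar>x\<bar> \<le> M ^ 32" using assms(2) by linarith
  then have "real_of_int \<bar>x\<bar> \<le> real_of_int (M ^ 32)" by (simp only: of_int_le_iff)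
  then show ?thesis using assms(1) by (simp add: word_def fits_def)
qed

lemma eval_safe:
  assumes "fits B M" "safe M s e" "leaves e \<le> 32"
  shows "eval B s e = Some (ival s e)"
  using assms
proof (induction e)
  case (Const k)
  then show ?case using word_fits[of B M k 1] by simp
next
  case (Cell a e)
  then obtain x where "s a (ival s e) = Some x" "\<bar>x\<bar> \<le> M" by auto
  then show ?case using Cell word_fits[of B M x 1] by simp
next
  case (Add e f)
  then show ?case using word_fits[OF _ safe_ival_bound[of M s "Add e f"]] by (simp add: fits_def)
next
  case (Sub e f)
  then show ?case using word_fits[OF _ safe_ival_bound[of M s "Sub e f"]] by (simp add: fits_def)
next
  case (Mul e f)
  then show ?case using word_fits[OF _ safe_ival_bound[of M s "Mul e f"]] by (simp add: fits_def)
next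
  case (Div e f)
  then show ?case using word_fits[OF _ safe_ival_bound[of M s "Div e f"]] by (simp add: fits_def)
qed

section \<open>Total correctness with time bounds\<close>

definition runs :: "real \<Rightarrow> com \<Rightarrow> nat \<Rightarrow> mem \<Rightarrow> (mem \<Rightarrow> bool) \<Rightarrow> bool" where
  "runs B c T s Q \<longleftrightarrow> (\<exists>t s'. exec B c s t s' \<and> t \<le> T \<and> Q s')"

text \<open>The frame property \<open>exec_frame\<close> is handed to the proof of the new
  postcondition, here and in \<open>runs_Seq\<close>. Postconditions and invariants therefore need
  not mention the arrays that a program leaves alone.\<close>

lemma runs_weaken:
  assumes "runs B c T s Q" "T \<le> T'" "\<And>s'. Q s' \<Longrightarrow> (\<And>a. a \<notin> writes c \<Longrightarrow> s' a = s a) \<Longrightarrow> Q' s'"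
  shows "runs B c T' s Q'"
  using assms exec_frame unfolding runs_def by (meson order_trans)

lemma runs_Seq:
  assumes "runs B c T s R" "\<And>s'. R s' \<Longrightarrow> (\<And>a. a \<notin> writes c \<Longrightarrow> s' a = s a) \<Longrightarrow> runs B d T' s' Q"
  shows "runs B (Seq c d) (1 + T + T') s Q"
proof -
  from assms(1) obtain t s' where 1: "exec B c s t s'" "t \<le> T" "R s'" unfolding runs_def by blast
  with assms(2) obtain t' s'' where 2: "exec B d s' t' s''" "t' \<le> T'" "Q s''"
    using exec_frame unfolding runs_def by blast
  have "1 + t + t' \<le> 1 + T + T'" using 1 2 by simp
  then show ?thesis using exec.Seq[OF 1(1) 2(1)] 2(3) unfolding runs_def by blast
qed

text \<open>Symbolic execution for loop-free code: simplification computes the final memory and the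
  side conditions at once. Loops give \<open>False\<close> and are handled by
  \<open>runs_While\<close> and \<open>runs_For\<close>.\<close>

fun wp :: "int \<Rightarrow> com \<Rightarrow> mem \<Rightarrow> (mem \<Rightarrow> bool) \<Rightarrow> bool" where
  "wp M Skip s Q \<longleftrightarrow> Q s"
| "wp M (Assign a e f) s Q \<longleftrightarrow> leaves e \<le> 32 \<and> leaves f \<le> 32 \<and> safe M s e \<and> safe M s f \<and>
     Q (s(a := (s a)(ival s e \<mapsto> ival s f)))"
| "wp M (Seq c d) s Q \<longleftrightarrow> wp M c s (\<lambda>s'. wp M d s' Q)"
| "wp M (If_Less e f c d) s Q \<longleftrightarrow> leaves e \<le> 32 \<and> leaves f \<le> 32 \<and> safe M s e \<and> safe M s f \<and>
     (if ival s e < ival s f then wp M c s Q else wp M d s Q)"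
| "wp M (While_Less e f c) s Q \<longleftrightarrow> False"

text \<open>Both branches of a conditional are added up, so this is an upper bound that depends on
  the text of the program only.\<close>

fun cost :: "com \<Rightarrow> nat" where
  "cost Skip = 1"
| "cost (Assign a e f) = 1 + ops e + ops f"
| "cost (Seq c d) = 1 + cost c + cost d"
| "cost (If_Less e f c d) = 1 + ops e + ops f + cost c + cost d"
| "cost (While_Less e f c) = 0"

lemma runs_wp:
  assumes "fits B M" "wp M c s Q"
  shows "runs B c (cost c) s Q"
  using assms(2)
proof (induction c arbitrary: s Q)
  case Skip
  then show ?case using exec.Skip unfolding runs_def by fastforce
next
  case (Assign a e f)
  then show ?case
    using exec.Assign[OF eval_safe[OF assms(1)] eval_safe[OF assms(1)], of s e f a]
    unfolding runs_def by fastforce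
next
  case (Seq c d)
  have "runs B c (cost c) s (\<lambda>s'. wp M d s' Q)" using Seq by simp
  then show ?case using runs_Seq Seq.IH(2) by fastforce
next
  case (If_Less e f c d)
  note ev = eval_safe[OF assms(1), of s e] eval_safe[OF assms(1), of s f]
  show ?case
  proof (cases "ival s e < ival s f")
    case True
    then obtain t s' where "exec B c s t s'" "t \<le> cost c" "Q s'"
      using If_Less unfolding runs_def by fastforce
    then show ?thesis using exec.If_True[OF ev True, of c t s' d] If_Less.prems
      unfolding runs_def by fastforce
  next
    case False
    then obtain t s' where "exec B d s t s'" "t \<le> cost d" "Q s'"
      using If_Less unfolding runs_def by fastforce
    then show ?thesis using exec.If_False[OF ev False, of d t s' c] If_Less.prems
      unfolding runs_def by fastforce
  qed
qed simp

lemma runs_wpI: "fits B M \<Longrightarrow> wp M c s Q \<Longrightarrow> cost c \<le> T \<Longrightarrow> runs B c T s Q"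
  by (rule runs_weaken[OF runs_wp])

text \<open>For conditionals with a loop in one of the branches, which are out of reach of
  \<open>wp\<close>.\<close>

lemma runs_If:
  assumes "fits B M" "leaves e \<le> 32" "leaves f \<le> 32" "safe M s e" "safe M s f"
    and "ival s e < ival s f \<Longrightarrow> runs B c T s Q"
    and "\<not> ival s e < ival s f \<Longrightarrow> runs B d T s Q"
  shows "runs B (If_Less e f c d) (1 + ops e + ops f + T) s Q"
proof -
  note ev = eval_safe[OF assms(1,4,2)] eval_safe[OF assms(1,5,3)]
  show ?thesis
  proof (cases "ival s e < ival s f")
    case True
    with assms(6) obtain t s' where "exec B c s t s'" "t \<le> T" "Q s'" unfolding runs_def by blast
    then show ?thesis using exec.If_True[OF ev True, of c t s' d] unfolding runs_def by fastforce
  next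
    case False
    with assms(7) obtain t s' where "exec B d s t s'" "t \<le> T" "Q s'" unfolding runs_def by blast
    then show ?thesis using exec.If_False[OF ev False, of d t s' c] unfolding runs_def by fastforce
  qed
qed

text \<open>The index of the invariant counts the iterations that are still allowed, which gives the
  time bound. The loop may stop early, so some \<open>j\<close> remains in the
  postcondition.\<close>

lemma runs_While:
  assumes "fits B M" "leaves e \<le> 32" "leaves f \<le> 32"
    and safe: "\<And>k s. I k s \<Longrightarrow> safe M s e \<and> safe M s f"
    and step: "\<And>k s. I k s \<Longrightarrow> ival s e < ival s f \<Longrightarrow> 0 < k \<and> runs B c T s (I (k - 1))"
    and "I (k :: nat) s"
  shows "runs B (While_Less e f c) (k * (1 + ops e + ops f + T) + (1 + ops e + ops f)) s
    (\<lambda>s'. (\<exists>j. I j s') \<and> \<not> ival s' e < ival s' f)"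
  using \<open>I k s\<close>
proof (induction k arbitrary: s rule: less_induct)
  case (less k)
  note ev = eval_safe[OF assms(1) conjunct1[OF safe[OF less.prems]] assms(2)]
    eval_safe[OF assms(1) conjunct2[OF safe[OF less.prems]] assms(3)]
  show ?case
  proof (cases "ival s e < ival s f")
    case True
    with step[OF less.prems] obtain t s' where k: "0 < k" and 1: "exec B c s t s'" "t \<le> T" "I (k - 1) s'"
      unfolding runs_def by blast
    with less.IH[of "k - 1" s'] obtain t' s'' where
      2: "exec B (While_Less e f c) s' t' s''" "t' \<le> (k - 1) * (1 + ops e + ops f + T) + (1 + ops e + ops f)"
        "(\<exists>j. I j s'') \<and> \<not> ival s'' e < ival s'' f"
      unfolding runs_def by auto
    have "k * (1 + ops e + ops f + T) = (k - 1) * (1 + ops e + ops f + T) + (1 + ops e + ops f + T)"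
      using k by (cases k) auto
    then have "1 + ops e + ops f + t + t' \<le> k * (1 + ops e + ops f + T) + (1 + ops e + ops f)"
      using 1 2 by linarith
    then show ?thesis using exec.While_True[OF ev True 1(1) 2(1)] 2(3) unfolding runs_def by blast
  next
    case False
    then show ?thesis using exec.While_False[OF ev False] less.prems unfolding runs_def by fastforce
  qed
qed

abbreviation Var :: "nat \<Rightarrow> exp" where "Var v \<equiv> Cell v (Const 0)"

abbreviation Set :: "nat \<Rightarrow> exp \<Rightarrow> com" where "Set v e \<equiv> Assign v (Const 0) e"

definition For :: "nat \<Rightarrow> nat \<Rightarrow> com \<Rightarrow> com" where
  "For v w c = Seq (Set v (Const 0))
     (While_Less (Var v) (Var w) (Seq c (Set v (Add (Var v) (Const 1)))))"

lemma writes_For [simp]: "writes (For v w c) = insert v (writes c)"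
  by (auto simp: For_def)

text \<open>\<open>Iv\<close> keeps the invariant independent of the loop variable, which is
  increased between the body and the next test. The frame in \<open>step\<close> refers to the
  memory \<open>s\<close> before the loop, so constants such as the dimension are available in every
  iteration.\<close>

lemma runs_For:
  assumes fits: "fits B M" and v: "v \<notin> writes c" and w: "w \<notin> writes c" "w \<noteq> v"
    and N: "s w 0 = Some (int N)" "int N \<le> M"
    and Iv: "\<And>i s' x. I i (s'(v := x)) = I i s'"
    and init: "I 0 s"
    and step: "\<And>i s'. i < N \<Longrightarrow> I i s' \<Longrightarrow> s' v 0 = Some (int i) \<Longrightarrow>
      (\<And>a. a \<notin> insert v (writes c) \<Longrightarrow> s' a = s a) \<Longrightarrow> runs B c T s' (I (Suc i))"
  shows "runs B (For v w c) (N * (T + 12) + 12) s (I N)"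
proof -
  \<comment> \<open>\<open>runs_While\<close> counts the iterations left, \<open>I\<close> those
    done.\<close>
  define J where "J k s' \<longleftrightarrow> k \<le> N \<and> I (N - k) s' \<and> s' v 0 = Some (int (N - k)) \<and>
    (\<forall>a. a \<notin> insert v (writes c) \<longrightarrow> s' a = s a)" for k s'
  have M: "2 \<le> M" using fits by (simp add: fits_def)
  have 1: "runs B (Set v (Const 0)) 3 s (J N)"
    using M init by (intro runs_wpI[OF fits]) (auto simp: J_def Iv)
  have 2: "runs B (While_Less (Var v) (Var w) (Seq c (Set v (Add (Var v) (Const 1)))))
      (N * (1 + ops (Var v) + ops (Var w) + (1 + T + 6)) + (1 + ops (Var v) + ops (Var w))) s'
      (\<lambda>s'. (\<exists>j. J j s') \<and> \<not> ival s' (Var v) < ival s' (Var w))" if "J N s'" for s'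
  proof (rule runs_While[OF fits])
    fix k s' assume J: "J k s'"
    then have sw: "s' w 0 = Some (int N)" using w N by (simp add: J_def)
    then show "safe M s' (Var v) \<and> safe M s' (Var w)"
      using J M N by (auto simp: J_def)
    assume "ival s' (Var v) < ival s' (Var w)"
    with J sw have k: "0 < k" "k \<le> N" by (auto simp: J_def)
    show "0 < k \<and> runs B (Seq c (Set v (Add (Var v) (Const 1)))) (1 + T + 6) s' (J (k - 1))"
    proof (intro conjI k runs_Seq)
      show "runs B c T s' (I (Suc (N - k)))" using J k by (intro step) (auto simp: J_def)
      fix s'' assume I: "I (Suc (N - k)) s''" and fr: "\<And>a. a \<notin> writes c \<Longrightarrow> s'' a = s' a"
      have eq: "Suc (N - k) = N - (k - 1)" using k by simp
      have eq': "int (N - k) + 1 = int (N - (k - 1))" using k by simp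
      have "s'' v 0 = Some (int (N - k))" using fr[OF v] J by (simp add: J_def)
      moreover have "int (N - k) \<le> M" using N by linarith
      ultimately show "runs B (Set v (Add (Var v) (Const 1))) 6 s'' (J (k - 1))"
        using M k J fr I N by (intro runs_wpI[OF fits]) (auto simp: J_def Iv eq' eq)
    qed
  qed (use that in auto)
  have "runs B (For v w c) (1 + 3 + (N * (1 + ops (Var v) + ops (Var w) + (1 + T + 6)) + (1 + ops (Var v) + ops (Var w)))) s
      (\<lambda>s'. (\<exists>j. J j s') \<and> \<not> ival s' (Var v) < ival s' (Var w))"
    unfolding For_def by (rule runs_Seq[OF 1 2])
  then show ?thesis
  proof (rule runs_weaken)
    fix s' assume "(\<exists>j. J j s') \<and> \<not> ival s' (Var v) < ival s' (Var w)"
    then obtain j where J: "J j s'" and *: "\<not> ival s' (Var v) < ival s' (Var w)" by blast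
    then have "s' w 0 = Some (int N)" using w N by (simp add: J_def)
    then have "j = 0" using J * by (auto simp: J_def)
    then show "I N s'" using J by (simp add: J_def)
  qed (simp add: algebra_simps)
qed

text \<open>To the callee the arrays from 50 on are its arrays from 0 on, and \<open>s\<close> is
  the overlay of itself with them.\<close>

lemma runs_shift:
  assumes "exec B' P (\<lambda>a. s (a + 50)) t s'" "B' \<le> B" "t \<le> T"
  shows "runs B (shift_com 50 P) T s (\<lambda>s''. (\<forall>a. s'' (a + 50) = s' a) \<and> (\<forall>a < 50. s'' a = s a))"
proof -
  have "overlay 50 s (\<lambda>a. s (a + 50)) = s" by (auto simp: overlay_def fun_eq_iff)
  then have "exec B (shift_com 50 P) s t (overlay 50 s s')"
    using exec_mono[OF exec_shift[OF assms(1), of 50 s] assms(2)] by simp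
  then show ?thesis using assms(3) unfolding runs_def overlay_def
    by (intro exI[of _ t] exI conjI) auto
qed

lemma wp_mono:
  "wp M c s Q \<Longrightarrow> (\<And>s'. Q s' \<Longrightarrow> (\<And>a. a \<notin> writes c \<Longrightarrow> s' a = s a) \<Longrightarrow> Q' s') \<Longrightarrow> wp M c s Q'"
proof (induction c arbitrary: s Q Q')
  case (Seq c d)
  from Seq.prems(1) have "wp M c s (\<lambda>s'. wp M d s' Q)" by simp
  then have "wp M c s (\<lambda>s'. wp M d s' Q')"
  proof (rule Seq.IH(1))
    fix s' assume *: "wp M d s' Q" "\<And>a. a \<notin> writes c \<Longrightarrow> s' a = s a"
    show "wp M d s' Q'"
      using *(1) by (rule Seq.IH(2)) (use * Seq.prems(2) in auto)
  qed
  then show ?case by simp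
next
  case (If_Less e f c d)
  have "wp M c s Q \<Longrightarrow> wp M c s Q'" "wp M d s Q \<Longrightarrow> wp M d s Q'"
    by (erule If_Less.IH, use If_Less.prems(2) in auto)+
  with If_Less.prems(1) show ?case by (auto split: if_splits)
qed auto

text \<open>The pattern of most loops below: iteration \<open>i\<close> changes only the
  \<open>d\<close> cells of entry \<open>i\<close> in array \<open>dst\<close>. By
  \<open>loc\<close>, \<open>R j\<close> reads no cells but those of entry \<open>j\<close>, so
  finished entries survive the later iterations.\<close>

lemma runs_map:
  assumes fits: "fits B M" and v: "v \<notin> writes c" and w: "w \<notin> writes c" "w \<noteq> v"
    and N: "s w 0 = Some (int N)" "int N \<le> M" and dst: "dst \<noteq> v"
    and loc: "\<And>i s1 s2. (\<And>x. int d * int i \<le> x \<Longrightarrow> x < int d * int i + int d \<Longrightarrow> s1 dst x = s2 dst x) \<Longrightarrow>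
      R i s1 \<Longrightarrow> R i s2"
    and step: "\<And>i s'. i < N \<Longrightarrow> s' v 0 = Some (int i) \<Longrightarrow>
      (\<And>a. a \<notin> insert v (writes c) \<Longrightarrow> s' a = s a) \<Longrightarrow>
      runs B c T s' (\<lambda>s''. R i s'' \<and>
        (\<forall>x. x < int d * int i \<or> int d * int i + int d \<le> x \<longrightarrow> s'' dst x = s' dst x))"
  shows "runs B (For v w c) (N * (T + 12) + 12) s (\<lambda>s'. \<forall>i<N. R i s')"
proof (rule runs_For[where I = "\<lambda>k s'. \<forall>i<k. R i s'" and s = s and w = w, OF fits v w N])
  show "(\<forall>i<k. R i (s'(v := x))) = (\<forall>i<k. R i s')" for k s' x
    using dst by (auto intro: loc[of _ "s'(v := x)" s'] loc[of _ s' "s'(v := x)"])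
  fix i s' assume i: "i < N" and R: "\<forall>j<i. R j s'" and "s' v 0 = Some (int i)"
    and "\<And>a. a \<notin> insert v (writes c) \<Longrightarrow> s' a = s a"
  with step have "runs B c T s' (\<lambda>s''. R i s'' \<and>
        (\<forall>x. x < int d * int i \<or> int d * int i + int d \<le> x \<longrightarrow> s'' dst x = s' dst x))" by blast
  then show "runs B c T s' (\<lambda>s''. \<forall>j<Suc i. R j s'')"
  proof (rule runs_weaken, simp)
    fix s'' assume *: "R i s'' \<and>
      (\<forall>x. x < int d * int i \<or> int d * int i + int d \<le> x \<longrightarrow> s'' dst x = s' dst x)"
    show "\<forall>j<Suc i. R j s''"
    proof (intro allI impI)
      fix j assume "j < Suc i"
      show "R j s''"
      proof (cases "j = i")
        case False
        with \<open>j < Suc i\<close> have "j < i" by simp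
        then have "int d * int j + int d \<le> int d * int i"
          by (metis Suc_leI distrib_left mult.right_neutral mult_left_mono of_nat_0_le_iff of_nat_Suc of_nat_mono add.commute)
        then show ?thesis using * \<open>j < i\<close> R
          by (intro loc[of j s' s'']) (auto simp: less_le_trans)
      qed (use * in simp)
    qed
  qed
qed simp

section \<open>Matrix products from graph problems on three layers\<close>

text \<open>What copying needs: the payload cells of an infinite entry may be undefined, those of a
  finite entry must be readable. Entries have \<open>d = 2\<close> words for integers and
  \<open>d = 3\<close> words for floating-point numbers.\<close>

definition entry_ok :: "nat \<Rightarrow> int \<Rightarrow> mem \<Rightarrow> nat \<Rightarrow> nat \<Rightarrow> bool" where
  "entry_ok d M s a i \<longleftrightarrow> (\<exists>f. s a (int d * int i) = Some f \<and> \<bar>f\<bar> \<le> 1 \<and>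
     (f = 0 \<longrightarrow> (\<forall>r \<in> {1..<int d}. \<exists>k. s a (int d * int i + r) = Some k \<and> \<bar>k\<bar> \<le> M)))"

definition same_entry :: "nat \<Rightarrow> mem \<Rightarrow> nat \<Rightarrow> nat \<Rightarrow> mem \<Rightarrow> nat \<Rightarrow> nat \<Rightarrow> bool" where
  "same_entry d s a i s' b j \<longleftrightarrow> (\<exists>f. s a (int d * int i) = Some f \<and> s' b (int d * int j) = Some f \<and>
     (f = 0 \<longrightarrow> (\<forall>r \<in> {1..<int d}. s' b (int d * int j + r) = s a (int d * int i + r))))"

lemma same_entry_cong:
  assumes "\<And>x. int d * int j \<le> x \<Longrightarrow> x < int d * int j + int d \<Longrightarrow> s1 b x = s2 b x" "0 < d"
    "same_entry d s a i s1 b j"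
  shows "same_entry d s a i s2 b j"
proof -
  have "s1 b (int d * int j) = s2 b (int d * int j)" using assms by auto
  moreover have "\<forall>r \<in> {1..<int d}. s1 b (int d * int j + r) = s2 b (int d * int j + r)"
    using assms by auto
  ultimately show ?thesis using assms(3) unfolding same_entry_def by auto
qed

lemma interval_1_2: "{1..<2 :: int} = {1}" and interval_1_3: "{1..<3 :: int} = {1, 2}"
  by auto

lemma same_entry_int: "holds_int s a i x \<Longrightarrow> same_entry 2 s a i s' b j \<Longrightarrow> holds_int s' b j x"
  by (auto simp: holds_int_def same_entry_def interval_1_2)

lemma same_entry_float: "holds_float M s a i x \<Longrightarrow> same_entry 3 s a i s' b j \<Longrightarrow> holds_float M s' b j x"
  by (auto simp: holds_float_def same_entry_def interval_1_3)

text \<open>Reading an undefined cell is an error, so the payload may be touched only after the flag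
  has been found to be 0. As conditions are strict comparisons, this takes two tests, against -1 and
  against 1.\<close>

definition copy_entry :: "nat \<Rightarrow> nat \<Rightarrow> nat \<Rightarrow> nat \<Rightarrow> nat \<Rightarrow> com" where
  "copy_entry d a p b q =
    Seq (Assign b (Mul (Const (int d)) (Var q)) (Cell a (Mul (Const (int d)) (Var p))))
      (If_Less (Const (-1)) (Cell a (Mul (Const (int d)) (Var p)))
        (If_Less (Cell a (Mul (Const (int d)) (Var p))) (Const 1)
          (Seq (Assign b (Add (Mul (Const (int d)) (Var q)) (Const 1))
                 (Cell a (Add (Mul (Const (int d)) (Var p)) (Const 1))))
             (if d = 3 then Assign b (Add (Mul (Const (int d)) (Var q)) (Const 2))
                 (Cell a (Add (Mul (Const (int d)) (Var p)) (Const 2))) else Skip))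
          Skip)
        Skip)"

lemma writes_copy_entry [simp]: "writes (copy_entry d a p b q) = {b}"
  by (simp add: copy_entry_def)

lemma wp_copy_entry:
  assumes "3 \<le> M" "d = 2 \<or> d = 3" "s p 0 = Some (int i)" "int i \<le> M" "s q 0 = Some (int j)" "int j \<le> M"
    "entry_ok d M s a i" "b \<noteq> a" "b \<noteq> p" "b \<noteq> q"
  shows "wp M (copy_entry d a p b q) s (\<lambda>s'. same_entry d s a i s' b j \<and>
    (\<forall>x. x < int d * int j \<or> int d * int j + int d \<le> x \<longrightarrow> s' b x = s b x))"
proof -
  from assms(7) obtain f where f: "s a (int d * int i) = Some f" "\<bar>f\<bar> \<le> 1"
    "f = 0 \<Longrightarrow> \<forall>r \<in> {1..<int d}. \<exists>k. s a (int d * int i + r) = Some k \<and> \<bar>k\<bar> \<le> M"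
    unfolding entry_ok_def by blast
  show ?thesis
  proof (cases "f = 0")
    case True
    from assms(2) show ?thesis
    proof
      assume "d = 2"
      then show ?thesis using True f assms
        by (auto simp: copy_entry_def same_entry_def interval_1_2)
    next
      assume "d = 3"
      then show ?thesis using True f assms
        by (auto simp: copy_entry_def same_entry_def interval_1_3)
    qed
  next
    case False
    then show ?thesis using f assms by (auto simp: copy_entry_def same_entry_def)
  qed
qed

text \<open>Array 51 is array 1 of the callee. Cell 0 of arrays 10 and 11 holds row and column in
  the matrix of dimension \<open>3 * n\<close>, cell 0 of array 12 the position to copy from.
  Outside the two copied blocks the flag 1 alone stands for \<infinity>.\<close>

definition embed_body :: "nat \<Rightarrow> com" where
  "embed_body d =
    Seq (Set 10 (Div (Var 7) (Var 5))) (Seq (Set 11 (Sub (Var 7) (Mul (Var 10) (Var 5))))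
     (If_Less (Var 10) (Var 0)
       (If_Less (Var 11) (Var 0) (Assign 51 (Mul (Const (int d)) (Var 7)) (Const 1))
         (If_Less (Var 11) (Mul (Const 2) (Var 0))
           (Seq (Set 12 (Add (Mul (Var 10) (Var 0)) (Sub (Var 11) (Var 0)))) (copy_entry d 1 12 51 7))
           (Assign 51 (Mul (Const (int d)) (Var 7)) (Const 1))))
       (If_Less (Var 10) (Mul (Const 2) (Var 0))
         (If_Less (Var 11) (Mul (Const 2) (Var 0)) (Assign 51 (Mul (Const (int d)) (Var 7)) (Const 1))
           (Seq (Set 12 (Add (Mul (Sub (Var 10) (Var 0)) (Var 0)) (Sub (Var 11) (Mul (Const 2) (Var 0)))))
             (copy_entry d 2 12 51 7)))
         (Assign 51 (Mul (Const (int d)) (Var 7)) (Const 1)))))"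

definition project_body :: "nat \<Rightarrow> com" where
  "project_body d =
    Seq (Set 10 (Div (Var 7) (Var 0))) (Seq (Set 11 (Sub (Var 7) (Mul (Var 10) (Var 0))))
     (Seq (Set 12 (Add (Mul (Var 10) (Var 5)) (Add (Mul (Const 2) (Var 0)) (Var 11))))
       (copy_entry d 52 12 3 7)))"

text \<open>With \<open>d = 3\<close> the problem is approximate, and the accuracy in cell 1 of
  array 0 is passed on to the callee.\<close>

definition embed_com :: "nat \<Rightarrow> com \<Rightarrow> com" where
  "embed_com d P =
    Seq (Seq (Set 5 (Mul (Const 3) (Var 0))) (Seq (Set 6 (Mul (Var 5) (Var 5)))
      (Seq (Set 9 (Mul (Var 0) (Var 0))) (Seq (Set 50 (Var 5))
        (if d = 3 then Assign 50 (Const 1) (Cell 0 (Const 1)) else Skip)))))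
    (Seq (For 7 6 (embed_body d)) (Seq (shift_com 50 P) (For 7 9 (project_body d))))"

definition embedded :: "nat \<Rightarrow> nat \<Rightarrow> mem \<Rightarrow> mem \<Rightarrow> bool" where
  "embedded d n s s1 \<longleftrightarrow> (\<forall>i<3*n. \<forall>j<3*n.
     if i < n \<and> n \<le> j \<and> j < 2*n then same_entry d s 1 (i*n + (j-n)) s1 1 (i*(3*n)+j)
     else if n \<le> i \<and> i < 2*n \<and> 2*n \<le> j then same_entry d s 2 ((i-n)*n + (j-2*n)) s1 1 (i*(3*n)+j)
     else s1 1 (int d * int (i*(3*n)+j)) = Some 1)"

lemma int_div_mod:
  "int x div int y = int (x div y)" "int x - int (x div y) * int y = int (x mod y)"
  by (simp_all add: zdiv_int) (metis minus_mult_div_eq_mod mult.commute of_nat_mod zdiv_int)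

lemma square_index_less: "i < n \<Longrightarrow> j < n \<Longrightarrow> i * n + j < n * (n::nat)"
  using mult_le_mono1[of "Suc i" n n] by simp

lemma less_int_le: "x < k \<Longrightarrow> int k \<le> M \<Longrightarrow> int x \<le> M"
  by linarith

text \<open>Stated in terms of flags and words, without any meaning of the entries, so that it
  serves integers and floating-point numbers. \<open>Q\<close> carries what is known about the
  callee's output, and \<open>entry_ok\<close> is demanded of the block that is copied back.\<close>

lemma runs_embed:
  assumes fits: "fits B M" and M: "9 * int n * int n \<le> M" and n: "1 \<le> n" and d: "d = 2 \<or> d = 3"
    and s: "s 0 0 = Some (int n)" "d = 3 \<Longrightarrow> s 0 1 = Some K \<and> \<bar>K\<bar> \<le> M"
      "\<And>i. i < n * n \<Longrightarrow> entry_ok d M s 1 i" "\<And>i. i < n * n \<Longrightarrow> entry_ok d M s 2 i"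
    and call: "\<And>s1. s1 0 0 = Some (int (3 * n)) \<Longrightarrow> (d = 3 \<Longrightarrow> s1 0 1 = Some K) \<Longrightarrow> embedded d n s s1 \<Longrightarrow>
       \<exists>t s2. exec B' P s1 t s2 \<and> t \<le> T \<and> Q s2 \<and>
         (\<forall>i<n. \<forall>j<n. entry_ok d M s2 2 (i * (3 * n) + 2 * n + j))"
    and B': "B' \<le> B"
  shows "runs B (embed_com d P) (100 + 9 * n * n * (cost (embed_body d) + cost (project_body d) + 50) + T) s
    (\<lambda>s'. \<exists>s2. Q s2 \<and> (\<forall>i<n. \<forall>j<n. same_entry d s2 2 (i * (3 * n) + 2 * n + j) s' 3 (i * n + j)))"
proof -
  have n1: "1 \<le> int n * int n" using n by (metis mult_le_mono nat_mult_1 of_nat_1 of_nat_le_iff of_nat_mult)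
  have n2: "int n \<le> int n * int n" using n by simp
  have M9: "9 \<le> M" "9 * int n \<le> M" using M n1 n2 by linarith+
  have NM: "int (9 * n * n) \<le> M" "int (n * n) \<le> M" using M n1 by (auto simp: mult.assoc)
  define s0 where "s0 = s(5 := (s 5)(0 \<mapsto> 3 * int n), 6 := (s 6)(0 \<mapsto> int (9 * n * n)),
    9 := (s 9)(0 \<mapsto> int (n * n)), 50 := (if d = 3 then (s 50)(0 \<mapsto> 3 * int n, 1 \<mapsto> K) else (s 50)(0 \<mapsto> 3 * int n)))"
  have r1: "runs B (Seq (Set 5 (Mul (Const 3) (Var 0))) (Seq (Set 6 (Mul (Var 5) (Var 5)))
      (Seq (Set 9 (Mul (Var 0) (Var 0))) (Seq (Set 50 (Var 5))
        (if d = 3 then Assign 50 (Const 1) (Cell 0 (Const 1)) else Skip))))) 40 s (\<lambda>s'. s' = s0)"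
    using d
  proof
    assume "d = 2"
    then show ?thesis using s M M9
      by (intro runs_wpI[OF fits]) (auto simp: s0_def fun_upd_twist fun_eq_iff)
  next
    assume "d = 3"
    then show ?thesis using s M M9
      by (intro runs_wpI[OF fits]) (auto simp: s0_def fun_upd_twist fun_eq_iff)
  qed
  have r2: "runs B (Seq (For 7 6 (embed_body d)) (Seq (shift_com 50 P) (For 7 9 (project_body d))))
     (1 + (9 * n * n * (cost (embed_body d) + 12) + 12) + (1 + T + (n * n * (cost (project_body d) + 12) + 12))) s0
    (\<lambda>s'. \<exists>s2. Q s2 \<and> (\<forall>i<n. \<forall>j<n. same_entry d s2 2 (i * (3 * n) + 2 * n + j) s' 3 (i * n + j)))"
  proof (rule runs_Seq)
    \<comment> \<open>The three cases of \<open>embedded\<close>, indexed by the linear position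
      \<open>x\<close> as in \<open>runs_map\<close>.\<close>
    define R where "R x s1 \<longleftrightarrow> (let i = x div (3*n); j = x mod (3*n) in
     if i < n \<and> n \<le> j \<and> j < 2*n then same_entry d s 1 (i*n + (j-n)) s1 51 x
     else if n \<le> i \<and> i < 2*n \<and> 2*n \<le> j then same_entry d s 2 ((i-n)*n + (j-2*n)) s1 51 x
     else s1 51 (int d * int x) = Some 1)" for x s1
    show "runs B (For 7 6 (embed_body d)) (9 * n * n * (cost (embed_body d) + 12) + 12) s0 (\<lambda>s1. \<forall>x<9*n*n. R x s1)"
    proof (rule runs_map[where dst = 51 and d = d, OF fits])
      show "s0 6 0 = Some (int (9 * n * n))" by (simp add: s0_def)
      show "int (9 * n * n) \<le> M" using M by simp
      show "R i s1 \<Longrightarrow> R i s2" if "\<And>x. int d * int i \<le> x \<Longrightarrow> x < int d * int i + int d \<Longrightarrow> s1 51 x = s2 51 x"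
        for i s1 s2
      proof -
        have eq1: "same_entry d s a k s1 51 i = same_entry d s a k s2 51 i" for a k
          using that d same_entry_cong[of d i s1 51 s2] same_entry_cong[of d i s2 51 s1] by auto
        have eq2: "s1 51 (int d * int i) = s2 51 (int d * int i)" using that d by auto
        show "R i s1 \<Longrightarrow> R i s2" unfolding R_def Let_def by (simp only: eq1 eq2)
      qed
      fix x s' assume x: "x < 9 * n * n" and s7: "s' 7 0 = Some (int x)"
        and fr: "\<And>a. a \<notin> insert 7 (writes (embed_body d)) \<Longrightarrow> s' a = s0 a"
      define i j where ij: "i = x div (3 * n)" "j = x mod (3 * n)"
      have ij_less: "i < 3 * n" "j < 3 * n" using x n by (auto simp: ij div_less_iff_less_mult)
      have sc: "s' 0 0 = Some (int n)" "s' 5 0 = Some (int (3 * n))" "s' 1 = s 1" "s' 2 = s 2"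
        using fr[of 0] fr[of 5] fr[of 1] fr[of 2] s by (auto simp: embed_body_def s0_def)
      have xM: "int x \<le> M" using x NM(1) by (rule less_int_le)
      have dm: "int x div (3 * int n) = int i" "int x - int i * (3 * int n) = int j"
        using int_div_mod[of x "3 * n"] by (auto simp: ij)
      have iM: "int i \<le> M" "int j \<le> M" using ij_less M9 by linarith+
      have ok1: "wp M (copy_entry d 1 12 51 7) (s'(10 := (s' 10)(0 \<mapsto> int i), 11 := (s' 11)(0 \<mapsto> int j), 12 := (s' 12)(0 \<mapsto> k)))
         (\<lambda>s''. R x s'' \<and> (\<forall>y. y < int d * int x \<or> int d * int x + int d \<le> y \<longrightarrow> s'' 51 y = s' 51 y))"
        if c: "i < n" "n \<le> j" "j < 2 * n" and k: "k = int i * int n + (int j - int n)" for k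
      proof -
        have *: "i * n + (j - n) < n * n" using c by (intro square_index_less) auto
        have kk: "k = int (i * n + (j - n))" using c k by (simp add: of_nat_diff)
        have **: "int (i * n + (j - n)) \<le> M" using * NM(2) by (rule less_int_le)
        show ?thesis
          apply (rule wp_mono)
           apply (rule wp_copy_entry[where i = "i * n + (j - n)" and j = x])
          using M9 d * ** s7 sc xM s(3)[OF *] c
          by (auto simp: kk R_def ij[symmetric] same_entry_def entry_ok_def)
      qed
      have ok2: "wp M (copy_entry d 2 12 51 7) (s'(10 := (s' 10)(0 \<mapsto> int i), 11 := (s' 11)(0 \<mapsto> int j), 12 := (s' 12)(0 \<mapsto> k)))
         (\<lambda>s''. R x s'' \<and> (\<forall>y. y < int d * int x \<or> int d * int x + int d \<le> y \<longrightarrow> s'' 51 y = s' 51 y))"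
        if c: "n \<le> i" "i < 2 * n" "2 * n \<le> j" and k: "k = (int i - int n) * int n + (int j - 2 * int n)" for k
      proof -
        have *: "(i - n) * n + (j - 2 * n) < n * n" using c ij_less by (intro square_index_less) auto
        have kk: "k = int ((i - n) * n + (j - 2 * n))" using c k by (simp add: of_nat_diff)
        have **: "int ((i - n) * n + (j - 2 * n)) \<le> M" using * NM(2) by (rule less_int_le)
        show ?thesis
          apply (rule wp_mono)
           apply (rule wp_copy_entry[where i = "(i - n) * n + (j - 2 * n)" and j = x])
          using M9 d * ** s7 sc xM s(4)[OF *] c
          by (auto simp: kk R_def ij[symmetric] same_entry_def entry_ok_def)
      qed
      show "runs B (embed_body d) (cost (embed_body d)) s' (\<lambda>s''. R x s'' \<and>
          (\<forall>y. y < int d * int x \<or> int d * int x + int d \<le> y \<longrightarrow> s'' 51 y = s' 51 y))"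
        unfolding embed_body_def
        apply (rule runs_wp[OF fits])
        using s7 sc xM M9 iM n d ok1 ok2
        by (auto simp: dm R_def ij[symmetric])
    qed (use d in \<open>auto simp: embed_body_def\<close>)
    fix s1 assume R: "\<forall>x<9*n*n. R x s1"
      and fr: "\<And>a. a \<notin> writes (For 7 6 (embed_body d)) \<Longrightarrow> s1 a = s0 a"
    have emb: "embedded d n s (\<lambda>a. s1 (a + 50))"
      unfolding embedded_def
    proof (intro allI impI)
      fix i j assume ij: "i < 3 * n" "j < 3 * n"
      have "i * (3 * n) + j < 9 * n * n" using square_index_less[OF ij] by simp
      then have "R (i * (3 * n) + j) s1" using R by blast
      moreover have dm: "(i * (3 * n) + j) div (3 * n) = i" "(i * (3 * n) + j) mod (3 * n) = j" using ij by auto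
      moreover have "same_entry d s a k (\<lambda>a. s1 (a + 50)) 1 x = same_entry d s a k s1 51 x" for a k x
        by (simp add: same_entry_def)
      moreover have "(1 + 50 :: nat) = 51" by simp
      ultimately show "if i < n \<and> n \<le> j \<and> j < 2*n then same_entry d s 1 (i*n + (j-n)) (\<lambda>a. s1 (a + 50)) 1 (i*(3*n)+j)
         else if n \<le> i \<and> i < 2*n \<and> 2*n \<le> j then same_entry d s 2 ((i-n)*n + (j-2*n)) (\<lambda>a. s1 (a + 50)) 1 (i*(3*n)+j)
         else s1 (1 + 50) (int d * int (i*(3*n)+j)) = Some 1"
        unfolding R_def Let_def by (simp only: )
    qed
    have "s1 50 = s0 50" using fr[of 50] by (auto simp: embed_body_def)
    then have "s1 50 0 = Some (int (3 * n))" "d = 3 \<Longrightarrow> s1 50 1 = Some K" by (auto simp: s0_def)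
    then obtain t s2 where P: "exec B' P (\<lambda>a. s1 (a + 50)) t s2" "t \<le> T" "Q s2"
         "\<forall>i<n. \<forall>j<n. entry_ok d M s2 2 (i * (3 * n) + 2 * n + j)"
      using call[OF _ _ emb] by auto
    show "runs B (Seq (shift_com 50 P) (For 7 9 (project_body d)))
      (1 + T + (n * n * (cost (project_body d) + 12) + 12)) s1
      (\<lambda>s'. \<exists>s2. Q s2 \<and> (\<forall>i<n. \<forall>j<n. same_entry d s2 2 (i * (3 * n) + 2 * n + j) s' 3 (i * n + j)))"
    proof (rule runs_Seq[OF runs_shift[OF P(1) B' P(2)]])
      fix s3 assume s3: "(\<forall>a. s3 (a + 50) = s2 a) \<and> (\<forall>a<50. s3 a = s1 a)"
      have s35: "s3 52 = s2 2" using spec[OF conjunct1[OF s3], of 2] by simp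
      define R' where "R' x s' \<longleftrightarrow> same_entry d s2 2 ((x div n) * (3 * n) + 2 * n + x mod n) s' 3 x" for x s'
      have "runs B (For 7 9 (project_body d)) (n * n * (cost (project_body d) + 12) + 12) s3 (\<lambda>s1. \<forall>x<n*n. R' x s1)"
      proof (rule runs_map[where dst = 3 and d = d, OF fits])
        show "s3 9 0 = Some (int (n * n))" using s3 fr[of 9] by (simp add: embed_body_def s0_def)
        show "int (n * n) \<le> M" using NM by simp
        show "R' i s1 \<Longrightarrow> R' i s2" if "\<And>x. int d * int i \<le> x \<Longrightarrow> x < int d * int i + int d \<Longrightarrow> s1 3 x = s2 3 x"
          for i s1 s2 unfolding R'_def by (rule same_entry_cong) (use that d in auto)
        fix x s' assume x: "x < n * n" and s7: "s' 7 0 = Some (int x)"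
          and fr': "\<And>a. a \<notin> insert 7 (writes (project_body d)) \<Longrightarrow> s' a = s3 a"
        define i j where ij: "i = x div n" "j = x mod n"
        have ij_less: "i < n" "j < n" using x n by (auto simp: ij div_less_iff_less_mult)
        have sc: "s' 0 0 = Some (int n)" "s' 5 0 = Some (int (3 * n))" "s' 52 = s2 2"
          using fr'[of 0] fr'[of 5] fr'[of 52] fr[of 0] fr[of 5] s s3 s35
          by (auto simp: project_body_def embed_body_def s0_def)
        have xM: "int x \<le> M" using x NM(2) by (rule less_int_le)
        have dm: "int x div int n = int i" "int x - int i * int n = int j"
          using int_div_mod[of x n] by (auto simp: ij)
        have iM: "int i \<le> M" "int j \<le> M" using ij_less M9 by linarith+
        have "i * (3 * n) + (2 * n + j) < (3 * n) * (3 * n)" using ij_less by (intro square_index_less) auto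
        then have "i * (3 * n) + 2 * n + j < 9 * n * n" by simp
        then have kM: "int (i * (3 * n) + 2 * n + j) \<le> M" using NM(1) by (rule less_int_le)
        have ok: "wp M (copy_entry d 52 12 3 7) (s'(10 := (s' 10)(0 \<mapsto> int i), 11 := (s' 11)(0 \<mapsto> int j),
             12 := (s' 12)(0 \<mapsto> int i * (3 * int n) + (2 * int n + int j))))
             (\<lambda>s''. R' x s'' \<and> (\<forall>y. y < int d * int x \<or> int d * int x + int d \<le> y \<longrightarrow> s'' 3 y = s' 3 y))"
          apply (rule wp_mono)
           apply (rule wp_copy_entry[where i = "i * (3 * n) + 2 * n + j" and j = x])
          using M9 d kM s7 sc xM P(4)[rule_format, OF ij_less]
          by (auto simp: R'_def ij[symmetric] same_entry_def entry_ok_def algebra_simps)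
        show "runs B (project_body d) (cost (project_body d)) s' (\<lambda>s''. R' x s'' \<and>
            (\<forall>y. y < int d * int x \<or> int d * int x + int d \<le> y \<longrightarrow> s'' 3 y = s' 3 y))"
          unfolding project_body_def
          apply (rule runs_wp[OF fits])
          using s7 sc xM M9 iM n d ok by (auto simp: dm)
      qed (use d in \<open>auto simp: project_body_def\<close>)
      then show "runs B (For 7 9 (project_body d)) (n * n * (cost (project_body d) + 12) + 12) s3
        (\<lambda>s'. \<exists>s2. Q s2 \<and> (\<forall>i<n. \<forall>j<n. same_entry d s2 2 (i * (3 * n) + 2 * n + j) s' 3 (i * n + j)))"
      proof (rule runs_weaken, simp, intro exI[of _ s2] conjI allI impI P(3))
        fix s' i j assume "\<forall>x<n * n. R' x s'" and ij: "i < n" "j < n"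
        then have "R' (i * n + j) s'" using square_index_less by blast
        then show "same_entry d s2 2 (i * (3 * n) + 2 * n + j) s' 3 (i * n + j)"
          using ij by (simp add: R'_def)
      qed
    qed
  qed
  have "runs B (embed_com d P) (1 + 40 + (1 + (9 * n * n * (cost (embed_body d) + 12) + 12) + (1 + T + (n * n * (cost (project_body d) + 12) + 12)))) s
    (\<lambda>s'. \<exists>s2. Q s2 \<and> (\<forall>i<n. \<forall>j<n. same_entry d s2 2 (i * (3 * n) + 2 * n + j) s' 3 (i * n + j)))"
    unfolding embed_com_def by (rule runs_Seq[OF r1]) (use r2 in simp)
  then show ?thesis
  proof (rule runs_weaken)
    have "1 + 40 + (1 + (9 * n * n * (cost (embed_body d) + 12) + 12) + (1 + T + (n * n * (cost (project_body d) + 12) + 12)))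
      \<le> 68 + 9 * (n * n) * cost (embed_body d) + 9 * (n * n) * cost (project_body d) + 120 * (n * n) + T"
      by (simp add: algebra_simps)
    also have "\<dots> \<le> 100 + 9 * n * n * (cost (embed_body d) + cost (project_body d) + 50) + T"
      by (simp add: algebra_simps)
    finally show "1 + 40 + (1 + (9 * n * n * (cost (embed_body d) + 12) + 12) + (1 + T + (n * n * (cost (project_body d) + 12) + 12)))
      \<le> 100 + 9 * n * n * (cost (embed_body d) + cost (project_body d) + 50) + T" .
  qed
qed

section \<open>Paths in the graph with three layers\<close>

abbreviation complete :: "nat \<Rightarrow> (nat, nat \<times> nat) pre_digraph" where
  "complete n \<equiv> graph_on n ({..<n} \<times> {..<n})"

lemma graph_on_simps [simp]:
  "verts (graph_on n E) = {..<n}" "arcs (graph_on n E) = E"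
  "tail (graph_on n E) = fst" "head (graph_on n E) = snd"
  by (simp_all add: graph_on_def)

lemma fin_digraph_graph_on: "E \<subseteq> {..<n} \<times> {..<n} \<Longrightarrow> fin_digraph (graph_on n E)"
  by unfold_locales (auto intro: finite_subset)

lemma wf_digraph_graph_on: "E \<subseteq> {..<n} \<times> {..<n} \<Longrightarrow> wf_digraph (graph_on n E)"
  by (rule fin_digraph.axioms(1)[OF fin_digraph_graph_on])

text \<open>Graphs are complete here, with \<infinity> for a missing arc, so that a matrix is the
  whole input. The empty path has the value -\<infinity>, the supremum of the empty set, which
  mirrors the convention in \<open>bottleneck\<close>.\<close>

definition minimax :: "nat \<Rightarrow> (nat \<Rightarrow> nat \<Rightarrow> ereal) \<Rightarrow> nat \<Rightarrow> nat \<Rightarrow> ereal" where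
  "minimax n X u v = (INF p\<in>{p. pre_digraph.apath (complete n) u p v}. SUP (i, j)\<in>set p. X i j)"

text \<open>The Min-Max square has the same type as \<open>minimax\<close>, one matrix in and one
  matrix out, so one interface can treat both.\<close>

definition self_product :: "nat \<Rightarrow> (nat \<Rightarrow> nat \<Rightarrow> ereal) \<Rightarrow> nat \<Rightarrow> nat \<Rightarrow> ereal" where
  "self_product n X = min_max n X X"

definition tripartite ::
  "nat \<Rightarrow> (nat \<Rightarrow> nat \<Rightarrow> ereal) \<Rightarrow> (nat \<Rightarrow> nat \<Rightarrow> ereal) \<Rightarrow> nat \<Rightarrow> nat \<Rightarrow> ereal" where
  "tripartite n A B i j = (if i < n \<and> n \<le> j \<and> j < 2 * n then A i (j - n)
     else if n \<le> i \<and> i < 2 * n \<and> 2 * n \<le> j then B (i - n) (j - 2 * n) else \<infinity>)"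

text \<open>Finite arcs lead from the first layer to the second and from the second to the third,
  and none leaves the third. A path free of infinite arcs therefore has exactly two arcs.\<close>

lemma tripartite_path_cases:
  assumes "i < n" "j < n" "pre_digraph.apath (complete (3 * n)) i p (2 * n + j)"
  shows "(\<exists>(x, y)\<in>set p. tripartite n A B x y = \<infinity>) \<or> (\<exists>k<n. p = [(i, n + k), (n + k, 2 * n + j)])"
proof -
  interpret wf_digraph "complete (3 * n)" by (rule wf_digraph_graph_on) simp
  have w: "awalk i p (2 * n + j)" using assms(3) by (rule awalkI_apath)
  then obtain x p1 where p: "p = (i, x) # p1" "awalk x p1 (2 * n + j)"
    using assms by (cases p) (auto simp: awalk_simps)
  show ?thesis
  proof (cases "n \<le> x \<and> x < 2 * n")
    case True
    then obtain y p2 where p1: "p1 = (x, y) # p2" "awalk y p2 (2 * n + j)"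
      using p(2) by (cases p1) (auto simp: awalk_simps)
    show ?thesis
    proof (cases "2 * n \<le> y")
      case y: True
      show ?thesis
      proof (cases p2)
        case Nil
        then have "y = 2 * n + j" using p1 by (auto simp: awalk_simps)
        then show ?thesis using True Nil p p1 by (intro disjI2 exI[of _ "x - n"]) auto
      next
        case (Cons e p3)
        then have "fst e = y" using p1 by (auto simp: awalk_simps)
        then have "tripartite n A B (fst e) (snd e) = \<infinity>" using y by (simp add: tripartite_def)
        then show ?thesis using Cons p p1 by auto
      qed
    next
      case False
      then have "tripartite n A B x y = \<infinity>" using True by (simp add: tripartite_def)
      then show ?thesis using p p1 by auto
    qed
  next
    case False
    then have "tripartite n A B i x = \<infinity>" using assms by (auto simp: tripartite_def)
    then show ?thesis using p by auto
  qed
qed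

lemma tripartite_path:
  assumes "i < n" "j < n" "k < n"
  shows "pre_digraph.apath (complete (3 * n)) i [(i, n + k), (n + k, 2 * n + j)] (2 * n + j)"
proof -
  interpret wf_digraph "complete (3 * n)" by (rule wf_digraph_graph_on) simp
  show ?thesis using assms by (auto simp: apath_simps)
qed

text \<open>Everything except the \<open>n\<close> candidates \<open>g k\<close> contributes
  \<infinity>. The candidates are the paths with two arcs, or the middle indices in
  \<open>self_product\<close>.\<close>

lemma INF_eq_MIN:
  fixes f :: "'a \<Rightarrow> ereal" and n :: nat
  assumes "1 \<le> n" "\<And>p. p \<in> S \<Longrightarrow> f p = \<infinity> \<or> (\<exists>k<n. p = g k)" "\<And>k. k < n \<Longrightarrow> g k \<in> S \<and> f (g k) = h k"
  shows "(INF p\<in>S. f p) = (MIN k\<in>{..<n}. h k)"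
proof -
  have ne: "h ` {..<n} \<noteq> {}" using assms(1) by (auto simp: lessThan_empty_iff)
  have "(MIN k\<in>{..<n}. h k) = (INF k\<in>{..<n}. h k)"
    using ne by (simp add: Min_Inf)
  moreover have "(INF p\<in>S. f p) = (INF k\<in>{..<n}. h k)"
  proof (rule antisym)
    show "(INF p\<in>S. f p) \<le> (INF k\<in>{..<n}. h k)"
      using assms(3) by (intro INF_greatest) (metis INF_lower lessThan_iff)
    show "(INF k\<in>{..<n}. h k) \<le> (INF p\<in>S. f p)"
    proof (rule INF_greatest)
      fix p assume "p \<in> S"
      then show "(INF k\<in>{..<n}. h k) \<le> f p"
        using assms(2,3) by (metis INF_lower ereal_less_eq(1) lessThan_iff)
    qed
  qed
  ultimately show ?thesis by simp
qed

lemma minimax_tripartite: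
  assumes "i < n" "j < n"
  shows "minimax (3 * n) (tripartite n A B) i (2 * n + j) = min_max n A B i j"
  unfolding minimax_def min_max_def
proof (rule INF_eq_MIN)
  show "1 \<le> n" using assms by simp
  fix p assume "p \<in> {p. pre_digraph.apath (complete (3 * n)) i p (2 * n + j)}"
  then have "(\<exists>(x, y)\<in>set p. tripartite n A B x y = \<infinity>) \<or> (\<exists>k<n. p = [(i, n + k), (n + k, 2 * n + j)])"
    using tripartite_path_cases[OF assms] by simp
  moreover have "(SUP (x, y)\<in>set p. tripartite n A B x y) = \<infinity>"
    if "\<exists>(x, y)\<in>set p. tripartite n A B x y = \<infinity>"
    using that SUP_upper[of _ "set p" "\<lambda>(x, y). tripartite n A B x y"] by fastforce
  ultimately show "(SUP (x, y)\<in>set p. tripartite n A B x y) = \<infinity> \<or> (\<exists>k<n. p = [(i, n + k), (n + k, 2 * n + j)])"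
    by blast
next
  fix k assume k: "k < n"
  show "[(i, n + k), (n + k, 2 * n + j)] \<in> {p. pre_digraph.apath (complete (3 * n)) i p (2 * n + j)} \<and>
     (SUP (x, y)\<in>set [(i, n + k), (n + k, 2 * n + j)]. tripartite n A B x y) = max (A i k) (B k j)"
    using tripartite_path[OF assms k] k assms by (simp add: tripartite_def sup_max)
qed

lemma self_product_tripartite:
  assumes "i < n" "j < n"
  shows "self_product (3 * n) (tripartite n A B) i (2 * n + j) = min_max n A B i j"
proof -
  have "self_product (3 * n) (tripartite n A B) i (2 * n + j) =
     (INF k\<in>{..<3*n}. max (tripartite n A B i k) (tripartite n A B k (2 * n + j)))"
    unfolding self_product_def min_max_def using assms by (subst Min_Inf) (auto simp: lessThan_empty_iff)
  also have "\<dots> = (MIN k\<in>{..<n}. max (A i k) (B k j))"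
  proof (rule INF_eq_MIN[where g = "\<lambda>k. n + k"])
    fix p assume "p \<in> {..<3 * n}"
    show "max (tripartite n A B i p) (tripartite n A B p (2 * n + j)) = \<infinity> \<or> (\<exists>k<n. p = n + k)"
    proof (cases "n \<le> p \<and> p < 2 * n")
      case True
      then show ?thesis by (intro disjI2 exI[of _ "p - n"]) auto
    next
      case False
      then have "tripartite n A B i p = \<infinity>" using assms by (auto simp: tripartite_def)
      then show ?thesis by (simp add: max_def)
    qed
  qed (use assms in \<open>auto simp: tripartite_def\<close>)
  finally show ?thesis by (simp add: min_max_def)
qed

lemma sum_list_infty:
  fixes f :: "'a \<Rightarrow> ereal"
  assumes "\<And>e. e \<in> set p \<Longrightarrow> 0 \<le> f e" "e \<in> set p" "f e = \<infinity>"
  shows "(\<Sum>e\<leftarrow>p. f e) = \<infinity>"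
  using assms
proof (induction p)
  case (Cons a p)
  have "0 \<le> (\<Sum>e\<leftarrow>p. f e)" using Cons.prems(1) by (auto intro!: sum_list_nonneg)
  then show ?case using Cons by auto
qed simp

text \<open>Nonnegative weights make a sum infinite as soon as one arc is, so only the paths with
  two arcs matter.\<close>

lemma distance_tripartite:
  assumes "i < n" "j < n" "\<And>i j. i < n \<Longrightarrow> j < n \<Longrightarrow> 0 \<le> A i j" "\<And>i j. i < n \<Longrightarrow> j < n \<Longrightarrow> 0 \<le> B i j"
  shows "distance (complete (3 * n)) (\<lambda>(i, j). tripartite n A B i j) i (2 * n + j) = min_plus n A B i j"
  unfolding distance_def min_plus_def
proof (rule INF_eq_MIN)
  interpret wf_digraph "complete (3 * n)" by (rule wf_digraph_graph_on) simp
  show "1 \<le> n" using assms by simp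
  fix p assume *: "p \<in> {p. pre_digraph.apath (complete (3 * n)) i p (2 * n + j)}"
  then have "(\<exists>(x, y)\<in>set p. tripartite n A B x y = \<infinity>) \<or> (\<exists>k<n. p = [(i, n + k), (n + k, 2 * n + j)])"
    using tripartite_path_cases[OF assms(1,2)] by simp
  moreover have "(\<Sum>(x, y)\<leftarrow>p. tripartite n A B x y) = \<infinity>"
    if "\<exists>(x, y)\<in>set p. tripartite n A B x y = \<infinity>"
  proof -
    from that obtain e where e: "e \<in> set p" "(\<lambda>(x, y). tripartite n A B x y) e = \<infinity>" by auto
    have "set p \<subseteq> {..<3 * n} \<times> {..<3 * n}" using * by (auto simp: apath_def awalk_def)
    then show ?thesis
      by (intro sum_list_infty[where f = "\<lambda>(x, y). tripartite n A B x y", OF _ e]) (fastforce simp: tripartite_def intro!: assms)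
  qed
  ultimately show "(\<Sum>(x, y)\<leftarrow>p. tripartite n A B x y) = \<infinity> \<or> (\<exists>k<n. p = [(i, n + k), (n + k, 2 * n + j)])"
    by blast
next
  fix k assume k: "k < n"
  show "[(i, n + k), (n + k, 2 * n + j)] \<in> {p. pre_digraph.apath (complete (3 * n)) i p (2 * n + j)} \<and>
     (\<Sum>(x, y)\<leftarrow>[(i, n + k), (n + k, 2 * n + j)]. tripartite n A B x y) = A i k + B k j"
    using tripartite_path[OF assms(1,2) k] k assms by (simp add: tripartite_def)
qed

text \<open>The common interface of \<open>minimax\<close> and \<open>self_product\<close>: input in
  array 1, output in array 2. Input entries may be \<infinity> but not -\<infinity>, while the
  output may contain both.\<close>

definition int_solvable :: "real \<Rightarrow> (nat \<Rightarrow> (nat \<Rightarrow> nat \<Rightarrow> ereal) \<Rightarrow> nat \<Rightarrow> nat \<Rightarrow> ereal) \<Rightarrow> bool" where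
  "int_solvable c G \<longleftrightarrow>
     (\<exists>P \<kappa> C l. \<forall>n W X s.
        1 \<le> n \<and> 0 \<le> W \<and>
        (\<forall>i<n. \<forall>j<n. X i j \<in> int_infty \<and> (X i j \<noteq> \<infinity> \<longrightarrow> \<bar>X i j\<bar> \<le> ereal W)) \<and>
        s 0 0 = Some (int n) \<and> holds_int_matrix s 1 n X
      \<longrightarrow> (\<exists>t s'.
        exec (exact_word \<kappa> n W) P s t s' \<and>
        real t \<le> exact_time C l c n \<and>
        holds_int_matrix s' 2 n (G n X)))"

text \<open>Links the word bound \<open>y ^ \<kappa>\<close> of a problem with a bound on cells:
  sizes up to \<open>y ^ q\<close> are affordable once \<open>\<kappa> \<ge> 32 * q\<close>, since
  expressions have at most 32 leaves.\<close>

lemma fits_floor: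
  assumes "3 \<le> y" "1 \<le> q" "32 * q \<le> \<kappa>"
  shows "fits (y ^ \<kappa>) \<lfloor>y ^ q\<rfloor>"
proof -
  have y: "2 \<le> y ^ q" using assms self_le_power[of y q] by linarith
  have "real_of_int \<lfloor>y ^ q\<rfloor> ^ 32 \<le> (y ^ q) ^ 32"
    using y by (intro power_mono) (auto simp: le_floor_iff)
  also have "\<dots> = y ^ (32 * q)" by (simp add: power_mult mult.commute)
  also have "\<dots> \<le> y ^ \<kappa>" using assms by (intro power_increasing) auto
  finally show ?thesis using y by (simp add: fits_def le_floor_iff)
qed

lemma n_square_le_powr: "1 \<le> n \<Longrightarrow> 2 \<le> c \<Longrightarrow> real n * real n \<le> real n powr c"
  using powr_mono[of 2 c "real n"] by (simp add: power2_eq_square)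

lemma one_le_log2: "2 \<le> x \<Longrightarrow> 1 \<le> log 2 x"
  by (subst le_log_iff) auto

text \<open>From \<open>2 + 3 * n \<le> (2 + n) ^ 2\<close> the logarithm at most doubles, which
  gives the factor \<open>2 ^ l\<close>. The quadratic cost of copying is absorbed because
  \<open>c \<ge> 2\<close>.\<close>

lemma exact_time_triple:
  assumes c: "2 \<le> c" and n: "1 \<le> n"
  shows "real k + real m * (real n * real n) + exact_time \<bar>C\<bar> l c (3 * n) \<le>
     exact_time (real k + real m + \<bar>C\<bar> * 3 powr c * 2 ^ l) l c n"
proof -
  let ?L = "log 2 (2 + real n)"
  have L: "1 \<le> ?L" using n by (intro one_le_log2) simp
  have nc: "real n * real n \<le> real n powr c" by (rule n_square_le_powr[OF n c])
  have n1: "1 \<le> real n powr c" using n c by (intro ge_one_powr_ge_zero) auto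
  have Ll: "1 \<le> ?L ^ l" using L by (rule one_le_power)
  have "log 2 (2 + real (3 * n)) \<le> log 2 ((2 + real n) ^ 2)"
    by (subst log_le_cancel_iff) (auto simp: power2_eq_square algebra_simps intro!: add_pos_nonneg)
  also have "\<dots> = 2 * ?L" by (subst log_nat_power) auto
  finally have "log 2 (2 + real (3 * n)) ^ l \<le> (2 * ?L) ^ l"
    by (intro power_mono) auto
  then have "exact_time \<bar>C\<bar> l c (3 * n) \<le> \<bar>C\<bar> * real (3 * n) powr c * (2 * ?L) ^ l"
    unfolding exact_time_def by (intro mult_left_mono) auto
  also have "\<dots> = \<bar>C\<bar> * 3 powr c * 2 ^ l * (real n powr c * ?L ^ l)"
    by (simp add: powr_mult power_mult_distrib)
  finally have 1: "exact_time \<bar>C\<bar> l c (3 * n) \<le> \<bar>C\<bar> * 3 powr c * 2 ^ l * (real n powr c * ?L ^ l)" .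
  have n2: "real n powr c \<le> real n powr c * ?L ^ l"
    using n1 Ll mult_left_mono[of 1 "?L ^ l" "real n powr c"] by simp
  have 2: "real k \<le> real k * (real n powr c * ?L ^ l)"
    using n1 n2 mult_left_mono[of 1 "real n powr c * ?L ^ l" "real k"] by simp
  have 3: "real m * (real n * real n) \<le> real m * (real n powr c * ?L ^ l)"
    using n2 nc by (intro mult_left_mono) auto
  show ?thesis using 1 2 3 unfolding exact_time_def[of _ l c n] by (simp add: algebra_simps)
qed

lemma abs_le_floor: "\<bar>real_of_int k\<bar> \<le> W \<Longrightarrow> \<bar>k\<bar> \<le> \<lfloor>W\<rfloor>"
  by (simp add: le_floor_iff)

lemma exact_time_abs: "exact_time C l c n \<le> exact_time \<bar>C\<bar> l c n"
proof -
  have "0 \<le> real n powr c * log 2 (2 + real n) ^ l" by simp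
  then show ?thesis unfolding exact_time_def using mult_right_mono[of C "\<bar>C\<bar>"]
    by (simp add: mult.assoc)
qed

lemma exact_time_nonneg: "0 \<le> C \<Longrightarrow> 0 \<le> exact_time C l c n"
  by (simp add: exact_time_def)

lemma holds_int_matrixD:
  "holds_int_matrix s a n X \<Longrightarrow> i < n \<Longrightarrow> j < n \<Longrightarrow> holds_int s a (i * n + j) (X i j)"
  by (simp add: holds_int_matrix_def)

lemma min_max_if_int_solvable:
  assumes c: "2 \<le> c" and G: "int_solvable c G"
    and tri: "\<And>n A B i j. i < n \<Longrightarrow> j < n \<Longrightarrow> G (3 * n) (tripartite n A B) i (2 * n + j) = min_max n A B i j"
  shows "min_max_solvable c"
proof -
  from G obtain P \<kappa> C l where P: "\<And>n W X s.
        1 \<le> n \<Longrightarrow> 0 \<le> W \<Longrightarrow>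
        (\<forall>i<n. \<forall>j<n. X i j \<in> int_infty \<and> (X i j \<noteq> \<infinity> \<longrightarrow> \<bar>X i j\<bar> \<le> ereal W)) \<Longrightarrow>
        s 0 0 = Some (int n) \<Longrightarrow> holds_int_matrix s 1 n X \<Longrightarrow> (\<exists>t s'.
        exec (exact_word \<kappa> n W) P s t s' \<and>
        real t \<le> exact_time C l c n \<and>
        holds_int_matrix s' 2 n (G n X))" unfolding int_solvable_def by blast
  define m where "m = 9 * (cost (embed_body 2) + cost (project_body 2) + 50)"
  show ?thesis unfolding min_max_solvable_def
  \<comment> \<open>160 is \<open>32 * 5\<close>, for cells up to \<open>y ^ 5\<close>, and
    \<open>2 * \<kappa>\<close> is for the callee, since \<open>2 + 3 * n + W \<le> y * y\<close>.
    The constant \<open>C\<close> of the callee may be negative, hence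
    \<open>\<bar>C\<bar>\<close>.\<close>
  proof (rule exI[of _ "embed_com 2 P"], rule exI[of _ "160 + 2 * \<kappa>"],
      rule exI[of _ "real 100 + real m + \<bar>C\<bar> * 3 powr c * 2 ^ l"], rule exI[of _ l], intro allI impI, elim conjE)
    fix n W A B s
    assume n: "1 \<le> n" and W: "0 \<le> W"
      and A: "\<forall>i<n. \<forall>j<n. A i j \<in> int_infty \<and> (A i j \<noteq> \<infinity> \<longrightarrow> \<bar>A i j\<bar> \<le> ereal W)"
      and B: "\<forall>i<n. \<forall>j<n. B i j \<in> int_infty \<and> (B i j \<noteq> \<infinity> \<longrightarrow> \<bar>B i j\<bar> \<le> ereal W)"
      and s0: "s 0 0 = Some (int n)" and sA: "holds_int_matrix s 1 n A" and sB: "holds_int_matrix s 2 n B"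
    define y where "y = 2 + real n + W"
    have y: "3 \<le> y" "real n \<le> y" "W \<le> y" using n W by (auto simp: y_def)
    define M where "M = \<lfloor>y ^ 5\<rfloor>"
    have fits: "fits (exact_word (160 + 2 * \<kappa>) n W) M"
      unfolding M_def exact_word_def y_def[symmetric] by (rule fits_floor) (use y in auto)
    have "9 * (real n * real n) \<le> y ^ 2 * (y * y)"
      using y power_mono[of 3 y 2] by (intro mult_mono) auto
    also have "\<dots> = y ^ 4" by (simp add: eval_nat_numeral)
    also have "\<dots> \<le> y ^ 5" using y by (intro power_increasing) auto
    finally have M9: "9 * int n * int n \<le> M" unfolding M_def by (simp add: le_floor_iff mult.assoc)
    have "W \<le> y ^ 5" using y self_le_power[of y 5] by linarith
    then have WM: "\<lfloor>W\<rfloor> \<le> M" unfolding M_def by (simp add: floor_mono)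
    have okAB: "entry_ok 2 M s a i" if "holds_int_matrix s a n Z"
      "\<forall>i<n. \<forall>j<n. Z i j \<in> int_infty \<and> (Z i j \<noteq> \<infinity> \<longrightarrow> \<bar>Z i j\<bar> \<le> ereal W)" "i < n * n" for a i Z
    proof -
      have ij: "i div n < n" "i mod n < n" "i = i div n * n + i mod n"
        using n that(3) by (auto simp: div_less_iff_less_mult)
      then have "holds_int s a i (Z (i div n) (i mod n))"
        using that(1) unfolding holds_int_matrix_def by metis
      moreover have "\<bar>real_of_int k\<bar> \<le> W \<Longrightarrow> \<bar>k\<bar> \<le> M" for k
        using WM abs_le_floor[of k W] by linarith
      ultimately show ?thesis
        using that(2)[rule_format, OF ij(1,2)]
        by (auto simp: holds_int_def entry_ok_def interval_1_2 int_infty_def)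
    qed
    have B': "exact_word \<kappa> (3 * n) W \<le> exact_word (160 + 2 * \<kappa>) n W"
    proof -
      have "2 + real (3 * n) + W \<le> 3 * y" using n W by (auto simp: y_def)
      also have "\<dots> \<le> y * y" using y by (intro mult_right_mono) auto
      finally have "exact_word \<kappa> (3 * n) W \<le> (y * y) ^ \<kappa>"
        unfolding exact_word_def using n W by (intro power_mono) auto
      also have "\<dots> = y ^ (2 * \<kappa>)" by (simp add: power_mult power2_eq_square)
      also have "\<dots> \<le> y ^ (160 + 2 * \<kappa>)" using y by (intro power_increasing) auto
      finally show ?thesis unfolding exact_word_def[of "160 + 2 * \<kappa>"] y_def[symmetric] .
    qed
    define X where "X = tripartite n A B"
    have X: "\<forall>i<3*n. \<forall>j<3*n. X i j \<in> int_infty \<and> (X i j \<noteq> \<infinity> \<longrightarrow> \<bar>X i j\<bar> \<le> ereal W)"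
      using A B by (auto simp: X_def tripartite_def) (auto simp: int_infty_def)
    define T where "T = nat \<lfloor>exact_time \<bar>C\<bar> l c (3 * n)\<rfloor>"
    have "runs (exact_word (160 + 2 * \<kappa>) n W) (embed_com 2 P)
      (100 + 9 * n * n * (cost (embed_body 2) + cost (project_body 2) + 50) + T) s
      (\<lambda>s'. \<exists>s2. holds_int_matrix s2 2 (3 * n) (G (3 * n) X) \<and>
        (\<forall>i<n. \<forall>j<n. same_entry 2 s2 2 (i * (3 * n) + 2 * n + j) s' 3 (i * n + j)))"
    proof (rule runs_embed[where s = s and K = 0, OF fits M9 n _ s0 _ _ _ _ B'])
      show "entry_ok 2 M s 1 i" if "i < n * n" for i using okAB[OF sA A that] .
      show "entry_ok 2 M s 2 i" if "i < n * n" for i using okAB[OF sB B that] .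
      fix s1 assume s10: "s1 0 0 = Some (int (3 * n))" and emb: "embedded 2 n s s1"
      have "holds_int_matrix s1 1 (3 * n) X"
        unfolding holds_int_matrix_def
      proof (intro allI impI)
        fix i j assume ij: "i < 3 * n" "j < 3 * n"
        note e = emb[unfolded embedded_def, rule_format, OF ij]
        consider "i < n \<and> n \<le> j \<and> j < 2*n" | "n \<le> i \<and> i < 2*n \<and> 2*n \<le> j"
          | "\<not> (i < n \<and> n \<le> j \<and> j < 2*n)" "\<not> (n \<le> i \<and> i < 2*n \<and> 2*n \<le> j)" by blast
        then show "holds_int s1 1 (i * (3 * n) + j) (X i j)"
        proof cases
          case 1
          moreover have "holds_int s 1 (i * n + (j - n)) (A i (j - n))"
            by (rule holds_int_matrixD[OF sA]) (use 1 in auto)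
          ultimately show ?thesis using e same_entry_int by (auto simp: X_def tripartite_def)
        next
          case 2
          moreover have "holds_int s 2 ((i - n) * n + (j - 2 * n)) (B (i - n) (j - 2 * n))"
            by (rule holds_int_matrixD[OF sB]) (use 2 ij in auto)
          ultimately show ?thesis using e same_entry_int by (auto simp: X_def tripartite_def)
        next
          case 3
          then show ?thesis using e by (auto simp: X_def tripartite_def holds_int_def)
        qed
      qed
      then obtain t s2 where t: "exec (exact_word \<kappa> (3 * n) W) P s1 t s2"
        "real t \<le> exact_time C l c (3 * n)" "holds_int_matrix s2 2 (3 * n) (G (3 * n) X)"
        using P[of "3 * n" W X s1] n W X s10 by auto
      have "t \<le> T" unfolding T_def using t(2) exact_time_abs[of C l c "3 * n"] by (intro le_nat_floor) linarith
      moreover have "entry_ok 2 M s2 2 (i * (3 * n) + 2 * n + j)" if ij: "i < n" "j < n" for i j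
      proof -
        have "i < 3 * n" "2 * n + j < 3 * n" using ij by auto
        then have h: "holds_int s2 2 (i * (3 * n) + 2 * n + j) (min_max n A B i j)"
          using holds_int_matrixD[OF t(3), of i "2 * n + j"] tri[OF ij, of A B] by (simp add: X_def add.assoc)
        \<comment> \<open>Copying back needs small words. A Min-Max value is one of the entries, so
          \<open>W\<close> bounds it too.\<close>
        have "min_max n A B i j \<in> (\<lambda>k. max (A i k) (B k j)) ` {..<n}"
          unfolding min_max_def using n by (intro Min_in) (auto simp: lessThan_empty_iff)
        then obtain k where k: "k < n" "min_max n A B i j = max (A i k) (B k j)" by auto
        have "min_max n A B i j = A i k \<or> min_max n A B i j = B k j" unfolding k(2) by (simp add: max_def)
        then have mm: "min_max n A B i j \<in> int_infty" "min_max n A B i j \<noteq> \<infinity> \<longrightarrow> \<bar>min_max n A B i j\<bar> \<le> ereal W"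
          using A B ij k(1) by auto
        have "\<bar>real_of_int k\<bar> \<le> W \<Longrightarrow> \<bar>k\<bar> \<le> M" for k
          using WM abs_le_floor[of k W] by linarith
        then show ?thesis using h mm
          by (auto simp: holds_int_def entry_ok_def interval_1_2 int_infty_def)
      qed
      ultimately show "\<exists>t s2. exec (exact_word \<kappa> (3 * n) W) P s1 t s2 \<and> t \<le> T \<and>
         holds_int_matrix s2 2 (3 * n) (G (3 * n) X) \<and>
         (\<forall>i<n. \<forall>j<n. entry_ok 2 M s2 2 (i * (3 * n) + 2 * n + j))" using t by blast
    qed auto
    then obtain t s' s2 where e: "exec (exact_word (160 + 2 * \<kappa>) n W) (embed_com 2 P) s t s'"
      and t: "t \<le> 100 + 9 * n * n * (cost (embed_body 2) + cost (project_body 2) + 50) + T"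
      and h: "holds_int_matrix s2 2 (3 * n) (G (3 * n) X)"
      and se: "\<forall>i<n. \<forall>j<n. same_entry 2 s2 2 (i * (3 * n) + 2 * n + j) s' 3 (i * n + j)"
      unfolding runs_def by blast
    have "t \<le> 100 + m * (n * n) + T" using t by (simp add: m_def algebra_simps)
    then have "real t \<le> real (100 + m * (n * n) + T)" by (simp only: of_nat_le_iff)
    also have "\<dots> \<le> real 100 + real m * (real n * real n) + exact_time \<bar>C\<bar> l c (3 * n)"
      using of_nat_floor[OF exact_time_nonneg[of "\<bar>C\<bar>" l c "3 * n"]] by (simp add: T_def)
    also have "\<dots> \<le> exact_time (real 100 + real m + \<bar>C\<bar> * 3 powr c * 2 ^ l) l c n"
      by (rule exact_time_triple[OF c n])
    finally have time: "real t \<le> exact_time (real 100 + real m + \<bar>C\<bar> * 3 powr c * 2 ^ l) l c n" .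
    have "holds_int_matrix s' 3 n (min_max n A B)"
      unfolding holds_int_matrix_def
    proof (intro allI impI)
      fix i j assume ij: "i < n" "j < n"
      then have "i < 3 * n" "2 * n + j < 3 * n" by auto
      then have "holds_int s2 2 (i * (3 * n) + (2 * n + j)) (min_max n A B i j)"
        using holds_int_matrixD[OF h, of i "2 * n + j"] tri[OF ij, of A B] by (simp add: X_def)
      then show "holds_int s' 3 (i * n + j) (min_max n A B i j)"
        by (rule same_entry_int) (use se ij in \<open>simp add: add.assoc\<close>)
    qed
    then show "\<exists>t s'. exec (exact_word (160 + 2 * \<kappa>) n W) (embed_com 2 P) s t s' \<and>
       real t \<le> exact_time (real 100 + real m + \<bar>C\<bar> * 3 powr c * 2 ^ l) l c n \<and>
       holds_int_matrix s' 3 n (min_max n A B)" using e time by blast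
  qed
qed

section \<open>Bottleneck paths and minimax paths\<close>

text \<open>There are finitely many paths, each with finitely many arcs, so infimum and supremum are
  attained unless they range over the empty set: no path at all gives \<infinity>, the empty path
  gives -\<infinity>.\<close>

lemma minimax_in:
  "minimax n X u v \<in> {\<infinity>, -\<infinity>} \<union> {X i j | i j. i < n \<and> j < n}"
proof -
  interpret fin_digraph "complete n" by (rule fin_digraph_graph_on) simp
  let ?S = "{p. apath u p v}"
  let ?f = "\<lambda>p. SUP (i, j)\<in>set p. X i j"
  have fin: "finite ?S" by (rule apaths_finite)
  show ?thesis
  proof (cases "?S = {}")
    case True
    then show ?thesis by (simp add: minimax_def top_ereal_def)
  next
    case False
    then have "minimax n X u v \<in> ?f ` ?S"
      unfolding minimax_def using Min_in[of "?f ` ?S"] fin by (simp add: Min_Inf)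
    then obtain p where p: "apath u p v" "minimax n X u v = ?f p" by auto
    then have sub: "set p \<subseteq> {..<n} \<times> {..<n}" by (auto simp: apath_def awalk_def)
    show ?thesis
    proof (cases "p = []")
      case True
      then show ?thesis using p by (simp add: bot_ereal_def)
    next
      case False
      then have "?f p \<in> (\<lambda>(i, j). X i j) ` set p"
        using Max_in[of "(\<lambda>(i, j). X i j) ` set p"] by (simp add: Max_Sup)
      then show ?thesis using p sub by auto
    qed
  qed
qed

lemma minimax_cong:
  assumes "\<And>i j. i < n \<Longrightarrow> j < n \<Longrightarrow> X i j = Y i j"
  shows "minimax n X u v = minimax n Y u v"
proof -
  interpret fin_digraph "complete n" by (rule fin_digraph_graph_on) simp
  have "(SUP (i, j)\<in>set p. X i j) = (SUP (i, j)\<in>set p. Y i j)" if "apath u p v" for p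
  proof (rule SUP_cong)
    fix e assume "e \<in> set p"
    moreover have "set p \<subseteq> {..<n} \<times> {..<n}" using that by (auto simp: apath_def awalk_def)
    ultimately show "(case e of (i, j) \<Rightarrow> X i j) = (case e of (i, j) \<Rightarrow> Y i j)" using assms by auto
  qed simp
  then show ?thesis unfolding minimax_def by (intro INF_cong) auto
qed

text \<open>The two graphs share nodes, tails and heads and differ only in their arcs, so the
  recursive notions \<open>awalk_verts\<close> and \<open>cas\<close> coincide.\<close>

lemma apath_graph_on:
  assumes "E \<subseteq> {..<n} \<times> {..<n}"
  shows "pre_digraph.apath (graph_on n E) u p v \<longleftrightarrow> pre_digraph.apath (complete n) u p v \<and> set p \<subseteq> E"
proof -
  interpret E: wf_digraph "graph_on n E" using assms by (rule wf_digraph_graph_on)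
  interpret K: wf_digraph "complete n" by (rule wf_digraph_graph_on) simp
  have verts: "E.awalk_verts u p = K.awalk_verts u p" for u p
    by (induction p arbitrary: u) auto
  have cas: "E.cas u p v = K.cas u p v" for u p v
    by (induction p arbitrary: u) auto
  show ?thesis
    using assms unfolding E.apath_def K.apath_def E.awalk_def K.awalk_def verts cas by auto
qed

text \<open>Negation exchanges suprema and infima. A path with an arc outside \<open>E\<close> has
  the value -\<infinity> after negation and cannot raise the supremum.\<close>

lemma bottleneck_eq_minimax:
  assumes "E \<subseteq> {..<n} \<times> {..<n}"
  shows "bottleneck (graph_on n E) w u v = - minimax n (\<lambda>u v. if (u, v) \<in> E then - w (u, v) else \<infinity>) u v"
proof -
  let ?S = "{p. pre_digraph.apath (complete n) u p v}"
  let ?x = "\<lambda>(i, j). if (i, j) \<in> E then - w (i, j) else \<infinity>"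
  have "- minimax n (\<lambda>u v. if (u, v) \<in> E then - w (u, v) else \<infinity>) u v = (SUP p\<in>?S. - (SUP e\<in>set p. ?x e))"
    unfolding minimax_def by (simp add: ereal_SUP_uminus_eq)
  also have "\<dots> = (SUP p\<in>?S. INF e\<in>set p. - ?x e)"
    by (simp add: ereal_INF_uminus_eq)
  also have "\<dots> = (SUP p\<in>{p. pre_digraph.apath (graph_on n E) u p v}. INF e\<in>set p. w e)"
  proof (rule antisym)
    show "(SUP p\<in>?S. INF e\<in>set p. - ?x e) \<le> (SUP p\<in>{p. pre_digraph.apath (graph_on n E) u p v}. INF e\<in>set p. w e)"
    proof (rule SUP_least)
      fix p assume p: "p \<in> ?S"
      show "(INF e\<in>set p. - ?x e) \<le> (SUP p\<in>{p. pre_digraph.apath (graph_on n E) u p v}. INF e\<in>set p. w e)"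
      proof (cases "set p \<subseteq> E")
        case True
        then have "(INF e\<in>set p. - ?x e) = (INF e\<in>set p. w e)" by (intro INF_cong) auto
        then show ?thesis using True p by (auto simp: apath_graph_on[OF assms] intro!: SUP_upper)
      next
        case False
        then obtain e where "e \<in> set p" "e \<notin> E" by blast
        then have "e \<in> set p" "- ?x e = - \<infinity>" by (auto split: prod.split)
        then have "(INF e\<in>set p. - ?x e) \<le> - \<infinity>" by (metis (no_types, lifting) INF_lower)
        then show ?thesis by simp
      qed
    qed
    show "(SUP p\<in>{p. pre_digraph.apath (graph_on n E) u p v}. INF e\<in>set p. w e) \<le> (SUP p\<in>?S. INF e\<in>set p. - ?x e)"
    proof (rule SUP_least)
      fix p assume "p \<in> {p. pre_digraph.apath (graph_on n E) u p v}"
      then have p: "p \<in> ?S" "set p \<subseteq> E" by (auto simp: apath_graph_on[OF assms])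
      then have "(INF e\<in>set p. w e) = (INF e\<in>set p. - ?x e)" by (intro INF_cong) auto
      then show "(INF e\<in>set p. w e) \<le> (SUP p\<in>?S. INF e\<in>set p. - ?x e)"
        using p by (auto intro!: SUP_upper)
    qed
  qed
  finally show ?thesis by (simp add: bottleneck_def)
qed

text \<open>Negating the flag exchanges the flags 1 and -1 of the two infinities and keeps 0; only
  in the last case is there a payload to negate.\<close>

definition negate_body :: "nat \<Rightarrow> nat \<Rightarrow> com" where
  "negate_body a b =
    Seq (Assign b (Mul (Const 2) (Var 7)) (Sub (Const 0) (Cell a (Mul (Const 2) (Var 7)))))
      (If_Less (Const (-1)) (Cell a (Mul (Const 2) (Var 7)))
        (If_Less (Cell a (Mul (Const 2) (Var 7))) (Const 1)
          (Assign b (Add (Mul (Const 2) (Var 7)) (Const 1))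
            (Sub (Const 0) (Cell a (Add (Mul (Const 2) (Var 7)) (Const 1)))))
          Skip)
        Skip)"

definition negate_com :: "com \<Rightarrow> com" where
  "negate_com P = Seq (Seq (Set 6 (Mul (Var 0) (Var 0))) (Set 50 (Var 0)))
     (Seq (For 7 6 (negate_body 1 51)) (Seq (shift_com 50 P) (For 7 6 (negate_body 52 2))))"

definition negated :: "mem \<Rightarrow> nat \<Rightarrow> mem \<Rightarrow> nat \<Rightarrow> nat \<Rightarrow> bool" where
  "negated s a s' b i \<longleftrightarrow> (\<exists>f. s a (2 * int i) = Some f \<and> s' b (2 * int i) = Some (- f) \<and>
     (f = 0 \<longrightarrow> (\<exists>k. s a (2 * int i + 1) = Some k \<and> s' b (2 * int i + 1) = Some (- k))))"

lemma negated_holds_int: "negated s a s' b i \<Longrightarrow> holds_int s a i x \<Longrightarrow> holds_int s' b i (- x)"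
  unfolding negated_def holds_int_def
  by (elim exE conjE disjE) (auto intro!: exI[of _ "- _ :: int"])

lemma runs_negate_pass:
  assumes fits: "fits B M" and M: "3 \<le> M" "int N \<le> M" and s: "s 6 0 = Some (int N)"
    and ab: "a \<noteq> b" "b \<notin> {6, 7}" "a \<notin> {7}"
    and ok: "\<And>i. i < N \<Longrightarrow> entry_ok 2 M s a i"
  shows "runs B (For 7 6 (negate_body a b)) (N * (cost (negate_body a b) + 12) + 12) s (\<lambda>s'. \<forall>i<N. negated s a s' b i)"
proof (rule runs_map[where dst = b and d = 2 and s = s, OF fits])
  show "negated s a s1 b i \<Longrightarrow> negated s a s2 b i"
    if "\<And>x. int 2 * int i \<le> x \<Longrightarrow> x < int 2 * int i + int 2 \<Longrightarrow> s1 b x = s2 b x" for i s1 s2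
    using that[of "2 * int i"] that[of "2 * int i + 1"] by (auto simp: negated_def)
  fix i s' assume i: "i < N" and s7: "s' 7 0 = Some (int i)"
    and fr: "\<And>a'. a' \<notin> insert 7 (writes (negate_body a b)) \<Longrightarrow> s' a' = s a'"
  have sa: "s' a = s a" using fr[of a] ab by (auto simp: negate_body_def)
  have iM: "int i \<le> M" using i M by linarith
  from ok[OF i] obtain f where f: "s a (2 * int i) = Some f" "\<bar>f\<bar> \<le> 1"
    "f = 0 \<Longrightarrow> \<exists>k. s a (2 * int i + 1) = Some k \<and> \<bar>k\<bar> \<le> M"
    by (auto simp: entry_ok_def interval_1_2)
  show "runs B (negate_body a b) (cost (negate_body a b)) s'
    (\<lambda>s''. negated s a s'' b i \<and> (\<forall>x. x < int 2 * int i \<or> int 2 * int i + int 2 \<le> x \<longrightarrow> s'' b x = s' b x))"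
    apply (rule runs_wp[OF fits])
    using f sa s7 M ab iM by (cases "f = 0") (auto simp: negate_body_def negated_def)
qed (use s M ab in \<open>auto simp: negate_body_def\<close>)

lemma runs_negate:
  assumes fits: "fits B M" and M: "3 \<le> M" "int (n * n) \<le> M" "int n \<le> M" and s0: "s 0 0 = Some (int n)"
    and ok: "\<And>i. i < n * n \<Longrightarrow> entry_ok 2 M s 1 i"
    and call: "\<And>s1. s1 0 0 = Some (int n) \<Longrightarrow> (\<forall>i<n*n. negated s 1 s1 1 i) \<Longrightarrow>
       \<exists>t s2. exec B' P s1 t s2 \<and> t \<le> T \<and> Q s2 \<and> (\<forall>i<n*n. entry_ok 2 M s2 2 i)"
    and B': "B' \<le> B"
  shows "runs B (negate_com P) (100 + n * n * (cost (negate_body 1 51) + cost (negate_body 52 2) + 24) + T) s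
    (\<lambda>s'. \<exists>s2. Q s2 \<and> (\<forall>i<n*n. negated s2 2 s' 2 i))"
proof -
  have "runs B (negate_com P)
     (1 + 20 + (1 + (n * n * (cost (negate_body 1 51) + 12) + 12) + (1 + T + (n * n * (cost (negate_body 52 2) + 12) + 12)))) s
    (\<lambda>s'. \<exists>s2. Q s2 \<and> (\<forall>i<n*n. negated s2 2 s' 2 i))"
    unfolding negate_com_def
  proof (rule runs_Seq)
    show "runs B (Seq (Set 6 (Mul (Var 0) (Var 0))) (Set 50 (Var 0))) 20 s
      (\<lambda>s'. s' 6 0 = Some (int (n * n)) \<and> s' 50 0 = Some (int n) \<and> s' 1 = s 1)"
      by (rule runs_wpI[OF fits]) (use s0 M in auto)
    fix s1 :: mem assume s1: "s1 6 0 = Some (int (n * n)) \<and> s1 50 0 = Some (int n) \<and> s1 1 = s 1"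
    show "runs B (Seq (For 7 6 (negate_body 1 51)) (Seq (shift_com 50 P) (For 7 6 (negate_body 52 2))))
      (1 + (n * n * (cost (negate_body 1 51) + 12) + 12) + (1 + T + (n * n * (cost (negate_body 52 2) + 12) + 12))) s1
      (\<lambda>s'. \<exists>s2. Q s2 \<and> (\<forall>i<n*n. negated s2 2 s' 2 i))"
    proof (rule runs_Seq[OF runs_negate_pass[OF fits M(1,2)]])
      show "entry_ok 2 M s1 1 i" if "i < n * n" for i using ok[OF that] s1 by (simp add: entry_ok_def)
      fix s2 assume neg: "\<forall>i<n * n. negated s1 1 s2 51 i"
        and fr: "\<And>a. a \<notin> writes (For 7 6 (negate_body 1 51)) \<Longrightarrow> s2 a = s1 a"
      have "(\<lambda>a. s2 (a + 50)) 0 0 = Some (int n)" using fr[of 50] s1 by (simp add: negate_body_def)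
      moreover have "\<forall>i<n * n. negated s 1 (\<lambda>a. s2 (a + 50)) 1 i"
        using neg s1 by (simp add: negated_def)
      ultimately obtain t s3 where P: "exec B' P (\<lambda>a. s2 (a + 50)) t s3" "t \<le> T" "Q s3"
        "\<forall>i<n*n. entry_ok 2 M s3 2 i" using call[of "\<lambda>a. s2 (a + 50)"] by blast
      show "runs B (Seq (shift_com 50 P) (For 7 6 (negate_body 52 2)))
        (1 + T + (n * n * (cost (negate_body 52 2) + 12) + 12)) s2
        (\<lambda>s'. \<exists>s2. Q s2 \<and> (\<forall>i<n*n. negated s2 2 s' 2 i))"
      proof (rule runs_Seq[OF runs_shift[OF P(1) B' P(2)]])
        fix s4 assume s4: "(\<forall>a. s4 (a + 50) = s3 a) \<and> (\<forall>a<50. s4 a = s2 a)"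
        have s452: "s4 52 = s3 2" using spec[OF conjunct1[OF s4], of 2] by simp
        have "runs B (For 7 6 (negate_body 52 2)) (n * n * (cost (negate_body 52 2) + 12) + 12) s4
          (\<lambda>s'. \<forall>i<n*n. negated s4 52 s' 2 i)"
        proof (rule runs_negate_pass[OF fits M(1,2)])
          show "s4 6 0 = Some (int (n * n))" using s4 s1 fr[of 6] by (simp add: negate_body_def)
          show "entry_ok 2 M s4 52 i" if "i < n * n" for i
            using P(4) that by (simp add: entry_ok_def s452)
        qed auto
        then show "runs B (For 7 6 (negate_body 52 2)) (n * n * (cost (negate_body 52 2) + 12) + 12) s4
          (\<lambda>s'. \<exists>s2. Q s2 \<and> (\<forall>i<n*n. negated s2 2 s' 2 i))"
          by (rule runs_weaken) (use P(3) in \<open>auto simp: negated_def s452\<close>)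
      qed
    qed (use s1 in auto)
  qed
  then show ?thesis by (rule runs_weaken) (simp_all add: algebra_simps)
qed

lemma exact_time_add:
  assumes c: "2 \<le> c" and n: "1 \<le> n"
  shows "real k + real m * (real n * real n) + exact_time \<bar>C\<bar> l c n \<le> exact_time (real k + real m + \<bar>C\<bar>) l c n"
proof -
  let ?L = "log 2 (2 + real n)"
  have L: "1 \<le> ?L" using n by (intro one_le_log2) simp
  have nc: "real n * real n \<le> real n powr c" by (rule n_square_le_powr[OF n c])
  have n1: "1 \<le> real n powr c" using n c by (intro ge_one_powr_ge_zero) auto
  have Ll: "1 \<le> ?L ^ l" using L by (rule one_le_power)
  have n2: "real n powr c \<le> real n powr c * ?L ^ l"
    using n1 Ll mult_left_mono[of 1 "?L ^ l" "real n powr c"] by simp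
  have 2: "real k \<le> real k * (real n powr c * ?L ^ l)"
    using n1 n2 mult_left_mono[of 1 "real n powr c * ?L ^ l" "real k"] by simp
  have 3: "real m * (real n * real n) \<le> real m * (real n powr c * ?L ^ l)"
    using n2 nc by (intro mult_left_mono) auto
  show ?thesis using 2 3 unfolding exact_time_def by (simp add: algebra_simps)
qed

lemma holds_int_matrix_index:
  assumes "holds_int_matrix s a n X" "1 \<le> n" "i < n * n"
  shows "holds_int s a i (X (i div n) (i mod n))" "i div n < n" "i mod n < n"
proof -
  show *: "i div n < n" "i mod n < n" using assms by (auto simp: div_less_iff_less_mult)
  show "holds_int s a i (X (i div n) (i mod n))"
    using holds_int_matrixD[OF assms(1) *] by simp
qed

lemma entry_ok_int:
  assumes "holds_int s a i x" "x \<in> {\<infinity>, -\<infinity>} \<or> \<bar>x\<bar> \<le> ereal W" "\<lfloor>W\<rfloor> \<le> M"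
  shows "entry_ok 2 M s a i"
proof -
  have "\<bar>k\<bar> \<le> M" if "\<bar>real_of_int k\<bar> \<le> W" for k
    using abs_le_floor[OF that] assms(3) by linarith
  then show ?thesis using assms(1,2) by (auto simp: holds_int_def entry_ok_def interval_1_2)
qed

text \<open>One statement for both directions between \<open>minimax\<close> and
  \<open>bottleneck\<close>, so input and output may contain both infinities. As before, 160 is
  \<open>32 * 5\<close>.\<close>

lemma negate_program_correct:
  assumes n: "1 \<le> n" and W: "0 \<le> W" and c: "2 \<le> c"
    and s0: "s 0 0 = Some (int n)" and X: "holds_int_matrix s 1 n X"
    and XW: "\<And>i j. i < n \<Longrightarrow> j < n \<Longrightarrow> X i j \<in> {\<infinity>, -\<infinity>} \<or> \<bar>X i j\<bar> \<le> ereal W"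
    and YW: "\<And>i j. i < n \<Longrightarrow> j < n \<Longrightarrow> Y i j \<in> {\<infinity>, -\<infinity>} \<or> \<bar>Y i j\<bar> \<le> ereal W"
    and call: "\<And>s1. s1 0 0 = Some (int n) \<Longrightarrow> holds_int_matrix s1 1 n (\<lambda>i j. - X i j) \<Longrightarrow>
      \<exists>t s2. exec (exact_word \<kappa> n W) P s1 t s2 \<and> real t \<le> exact_time C l c n \<and> holds_int_matrix s2 2 n Y"
  shows "\<exists>t s'. exec (exact_word (160 + \<kappa>) n W) (negate_com P) s t s' \<and>
    real t \<le> exact_time (real 100 + real (cost (negate_body 1 51) + cost (negate_body 52 2) + 24) + \<bar>C\<bar>) l c n \<and>
    holds_int_matrix s' 2 n (\<lambda>i j. - Y i j)"
proof -
  define y where "y = 2 + real n + W"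
  have y: "3 \<le> y" "real n \<le> y" "W \<le> y" using n W by (auto simp: y_def)
  define M where "M = \<lfloor>y ^ 5\<rfloor>"
  have fits: "fits (exact_word (160 + \<kappa>) n W) M"
    unfolding M_def exact_word_def y_def[symmetric] by (rule fits_floor) (use y in auto)
  have y5: "y \<le> y ^ 5" "y * y \<le> y ^ 5"
    using y self_le_power[of y 5] power_increasing[of 2 5 y] by (auto simp: power2_eq_square)
  have "real n * real n \<le> y * y" using y by (intro mult_mono) auto
  then have M: "3 \<le> M" "int (n * n) \<le> M" "int n \<le> M"
    using y y5 unfolding M_def by (auto simp: le_floor_iff)
  have "\<lfloor>W\<rfloor> \<le> M" unfolding M_def using y y5 by (intro floor_mono) linarith
  have ok: "entry_ok 2 M s a i" if "holds_int_matrix s a n Z" "i < n * n"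
    "\<And>i j. i < n \<Longrightarrow> j < n \<Longrightarrow> Z i j \<in> {\<infinity>, -\<infinity>} \<or> \<bar>Z i j\<bar> \<le> ereal W" for s a Z i
  proof -
    note h = holds_int_matrix_index[OF that(1) n that(2)]
    show ?thesis using entry_ok_int[OF h(1) that(3)[OF h(2,3)] \<open>\<lfloor>W\<rfloor> \<le> M\<close>] .
  qed
  define T where "T = nat \<lfloor>exact_time \<bar>C\<bar> l c n\<rfloor>"
  have B': "exact_word \<kappa> n W \<le> exact_word (160 + \<kappa>) n W"
    unfolding exact_word_def using y by (intro power_increasing) (auto simp: y_def)
  have "runs (exact_word (160 + \<kappa>) n W) (negate_com P)
    (100 + n * n * (cost (negate_body 1 51) + cost (negate_body 52 2) + 24) + T) s
    (\<lambda>s'. \<exists>s2. holds_int_matrix s2 2 n Y \<and> (\<forall>i<n*n. negated s2 2 s' 2 i))"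
  proof (rule runs_negate[where s = s, OF fits M s0 _ _ B'])
    show "entry_ok 2 M s 1 i" if "i < n * n" for i using ok[OF X that XW] by blast
    fix s1 assume s1: "s1 0 0 = Some (int n)" "\<forall>i<n*n. negated s 1 s1 1 i"
    have "holds_int_matrix s1 1 n (\<lambda>i j. - X i j)"
      unfolding holds_int_matrix_def
      by (intro allI impI negated_holds_int[OF s1(2)[rule_format] holds_int_matrixD[OF X]] square_index_less)
    then obtain t s2 where t: "exec (exact_word \<kappa> n W) P s1 t s2" "real t \<le> exact_time C l c n"
      "holds_int_matrix s2 2 n Y" using call s1(1) by blast
    have "t \<le> T" unfolding T_def using t(2) exact_time_abs[of C l c n] by (intro le_nat_floor) linarith
    then show "\<exists>t s2. exec (exact_word \<kappa> n W) P s1 t s2 \<and> t \<le> T \<and> holds_int_matrix s2 2 n Y \<and>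
      (\<forall>i<n*n. entry_ok 2 M s2 2 i)" using t ok[OF t(3) _ YW] by blast
  qed
  then obtain t s' s2 where e: "exec (exact_word (160 + \<kappa>) n W) (negate_com P) s t s'"
    and t: "t \<le> 100 + n * n * (cost (negate_body 1 51) + cost (negate_body 52 2) + 24) + T"
    and h: "holds_int_matrix s2 2 n Y" and neg: "\<forall>i<n*n. negated s2 2 s' 2 i"
    unfolding runs_def by blast
  have "real t \<le> real (100 + n * n * (cost (negate_body 1 51) + cost (negate_body 52 2) + 24) + T)"
    using t by (simp only: of_nat_le_iff)
  also have "\<dots> \<le> real 100 + real (cost (negate_body 1 51) + cost (negate_body 52 2) + 24) * (real n * real n)
      + exact_time \<bar>C\<bar> l c n"
    using of_nat_floor[OF exact_time_nonneg[of "\<bar>C\<bar>" l c n]] by (simp add: T_def)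
  also have "\<dots> \<le> exact_time (real 100 + real (cost (negate_body 1 51) + cost (negate_body 52 2) + 24) + \<bar>C\<bar>) l c n"
    by (rule exact_time_add[OF c n])
  finally have "real t \<le> exact_time (real 100 + real (cost (negate_body 1 51) + cost (negate_body 52 2) + 24) + \<bar>C\<bar>) l c n" .
  moreover have "holds_int_matrix s' 2 n (\<lambda>i j. - Y i j)"
    unfolding holds_int_matrix_def
    by (intro allI impI negated_holds_int[OF neg[rule_format] holds_int_matrixD[OF h]] square_index_less)
  ultimately show ?thesis using e by blast
qed

lemma minimax_bound:
  assumes "\<And>i j. i < n \<Longrightarrow> j < n \<Longrightarrow> X i j = \<infinity> \<or> \<bar>X i j\<bar> \<le> ereal W"
  shows "minimax n X u v \<in> {\<infinity>, -\<infinity>} \<or> \<bar>minimax n X u v\<bar> \<le> ereal W"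
  using minimax_in[of n X u v] assms by (auto simp del: ereal_infty_less_eq) blast

lemma int_solvable_minimax_if_bottleneck:
  assumes c: "2 \<le> c" and bn: "bottleneck_solvable c"
  shows "int_solvable c minimax"
proof -
  from bn obtain P \<kappa> C l where P: "\<And>n W E (w :: nat \<times> nat \<Rightarrow> int) s.
        1 \<le> n \<Longrightarrow> 0 \<le> W \<Longrightarrow> E \<subseteq> {..<n} \<times> {..<n} \<Longrightarrow>
        (\<forall>e\<in>E. \<bar>real_of_int (w e)\<bar> \<le> W) \<Longrightarrow>
        s 0 0 = Some (int n) \<Longrightarrow>
        holds_int_matrix s 1 n (\<lambda>u v. if (u, v) \<in> E then ereal (real_of_int (w (u, v))) else -\<infinity>)
      \<Longrightarrow> (\<exists>t s'.
        exec (exact_word \<kappa> n W) P s t s' \<and>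
        real t \<le> exact_time C l c n \<and>
        holds_int_matrix s' 2 n (bottleneck (graph_on n E) (\<lambda>e. ereal (real_of_int (w e)))))"
    unfolding bottleneck_solvable_def by (elim exE) (rule that, elim allE, erule mp, intro conjI; assumption)
  show ?thesis unfolding int_solvable_def
  proof (rule exI[of _ "negate_com P"], rule exI[of _ "160 + \<kappa>"],
      rule exI[of _ "real 100 + real (cost (negate_body 1 51) + cost (negate_body 52 2) + 24) + \<bar>C\<bar>"],
      rule exI[of _ l], intro allI impI, elim conjE)
    fix n W X s
    assume n: "1 \<le> n" and W: "0 \<le> W"
      and X: "\<forall>i<n. \<forall>j<n. X i j \<in> int_infty \<and> (X i j \<noteq> \<infinity> \<longrightarrow> \<bar>X i j\<bar> \<le> ereal W)"
      and s0: "s 0 0 = Some (int n)" and sX: "holds_int_matrix s 1 n X"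
    \<comment> \<open>The finite entries become the arcs. They lie in \<open>int_infty\<close>, so
      the floor in \<open>w\<close> merely reads off the integer.\<close>
    define E where "E = {(i, j). i < n \<and> j < n \<and> X i j \<noteq> \<infinity>}"
    define w where "w = (\<lambda>(i, j). - \<lfloor>real_of_ereal (X i j)\<rfloor>)"
    have E: "E \<subseteq> {..<n} \<times> {..<n}" by (auto simp: E_def)
    have XE: "X i j = (if (i, j) \<in> E then - ereal (real_of_int (w (i, j))) else \<infinity>)" if "i < n" "j < n" for i j
      using X[rule_format, OF that] that by (auto simp: E_def w_def int_infty_def)
    have wW: "\<forall>e\<in>E. \<bar>real_of_int (w e)\<bar> \<le> W"
    proof
      fix e assume e: "e \<in> E"
      obtain i j where ij: "e = (i, j)" by force
      have "\<bar>X i j\<bar> \<le> ereal W" using e X by (auto simp: ij E_def)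
      then show "\<bar>real_of_int (w e)\<bar> \<le> W" using XE[of i j] e by (auto simp: ij E_def)
    qed
    define Y where "Y u v = - minimax n X u v" for u v
    have Y: "bottleneck (graph_on n E) (\<lambda>e. ereal (real_of_int (w e))) = Y"
      unfolding Y_def by (intro ext, subst bottleneck_eq_minimax[OF E])
        (intro arg_cong[where f = uminus] minimax_cong, simp add: XE)
    have "\<exists>t s'. exec (exact_word (160 + \<kappa>) n W) (negate_com P) s t s' \<and>
      real t \<le> exact_time (real 100 + real (cost (negate_body 1 51) + cost (negate_body 52 2) + 24) + \<bar>C\<bar>) l c n \<and>
      holds_int_matrix s' 2 n (\<lambda>i j. - Y i j)"
    proof (rule negate_program_correct[where s = s, OF n W c s0 sX])
      show "X i j \<in> {\<infinity>, -\<infinity>} \<or> \<bar>X i j\<bar> \<le> ereal W" if "i < n" "j < n" for i j using X that by auto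
      show "Y i j \<in> {\<infinity>, -\<infinity>} \<or> \<bar>Y i j\<bar> \<le> ereal W" for i j
        using minimax_bound[of n X W i j] X unfolding Y_def by (auto simp: ereal_uminus_eq_reorder)
      fix s1 assume s1: "s1 0 0 = Some (int n)" "holds_int_matrix s1 1 n (\<lambda>i j. - X i j)"
      have "holds_int_matrix s1 1 n (\<lambda>u v. if (u, v) \<in> E then ereal (real_of_int (w (u, v))) else -\<infinity>)"
        unfolding holds_int_matrix_def
      proof (intro allI impI)
        fix i j assume ij: "i < n" "j < n"
        have "- X i j = (if (i, j) \<in> E then ereal (real_of_int (w (i, j))) else - \<infinity>)"
          using XE[OF ij] by auto
        then show "holds_int s1 1 (i * n + j) (if (i, j) \<in> E then ereal (real_of_int (w (i, j))) else - \<infinity>)"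
          using holds_int_matrixD[OF s1(2) ij] by simp
      qed
      then show "\<exists>t s2. exec (exact_word \<kappa> n W) P s1 t s2 \<and> real t \<le> exact_time C l c n \<and> holds_int_matrix s2 2 n Y"
        using P[where s = s1, OF n W E wW s1(1)] Y by simp
    qed
    then show "\<exists>t s'. exec (exact_word (160 + \<kappa>) n W) (negate_com P) s t s' \<and>
      real t \<le> exact_time (real 100 + real (cost (negate_body 1 51) + cost (negate_body 52 2) + 24) + \<bar>C\<bar>) l c n \<and>
      holds_int_matrix s' 2 n (minimax n X)" by (simp add: Y_def)
  qed
qed

lemma bottleneck_if_int_solvable_minimax:
  assumes c: "2 \<le> c" and mm: "int_solvable c minimax"
  shows "bottleneck_solvable c"
proof -
  from mm obtain P \<kappa> C l where P: "\<And>n W X s.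
        1 \<le> n \<Longrightarrow> 0 \<le> W \<Longrightarrow>
        (\<forall>i<n. \<forall>j<n. X i j \<in> int_infty \<and> (X i j \<noteq> \<infinity> \<longrightarrow> \<bar>X i j\<bar> \<le> ereal W)) \<Longrightarrow>
        s 0 0 = Some (int n) \<Longrightarrow> holds_int_matrix s 1 n X \<Longrightarrow> (\<exists>t s'.
        exec (exact_word \<kappa> n W) P s t s' \<and>
        real t \<le> exact_time C l c n \<and>
        holds_int_matrix s' 2 n (minimax n X))" unfolding int_solvable_def by blast
  show ?thesis unfolding bottleneck_solvable_def
  proof (rule exI[of _ "negate_com P"], rule exI[of _ "160 + \<kappa>"],
      rule exI[of _ "real 100 + real (cost (negate_body 1 51) + cost (negate_body 52 2) + 24) + \<bar>C\<bar>"],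
      rule exI[of _ l], intro allI impI, elim conjE)
    fix n W E and w :: "nat \<times> nat \<Rightarrow> int" and s
    assume n: "1 \<le> n" and W: "0 \<le> W" and E: "E \<subseteq> {..<n} \<times> {..<n}"
      and w: "\<forall>e\<in>E. \<bar>real_of_int (w e)\<bar> \<le> W" and s0: "s 0 0 = Some (int n)"
      and sX: "holds_int_matrix s 1 n (\<lambda>u v. if (u, v) \<in> E then ereal (real_of_int (w (u, v))) else -\<infinity>)"
    define X where "X u v = (if (u, v) \<in> E then - ereal (real_of_int (w (u, v))) else \<infinity>)" for u v
    have XI: "\<forall>i<n. \<forall>j<n. X i j \<in> int_infty \<and> (X i j \<noteq> \<infinity> \<longrightarrow> \<bar>X i j\<bar> \<le> ereal W)"
      using w by (auto simp: X_def int_infty_def intro!: exI[of _ "- _ :: int"])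
    have "\<exists>t s'. exec (exact_word (160 + \<kappa>) n W) (negate_com P) s t s' \<and>
      real t \<le> exact_time (real 100 + real (cost (negate_body 1 51) + cost (negate_body 52 2) + 24) + \<bar>C\<bar>) l c n \<and>
      holds_int_matrix s' 2 n (\<lambda>i j. - minimax n X i j)"
    proof (rule negate_program_correct[where s = s, OF n W c s0 sX])
      show "(if (i, j) \<in> E then ereal (real_of_int (w (i, j))) else - \<infinity>) \<in> {\<infinity>, - \<infinity>} \<or>
        \<bar>if (i, j) \<in> E then ereal (real_of_int (w (i, j))) else - \<infinity>\<bar> \<le> ereal W" for i j using w by auto
      show "minimax n X i j \<in> {\<infinity>, -\<infinity>} \<or> \<bar>minimax n X i j\<bar> \<le> ereal W" for i j
        using minimax_bound[of n X W i j] XI by auto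
      fix s1 assume s1: "s1 0 0 = Some (int n)"
        "holds_int_matrix s1 1 n (\<lambda>i j. - (if (i, j) \<in> E then ereal (real_of_int (w (i, j))) else - \<infinity>))"
      have "(\<lambda>i j. - (if (i, j) \<in> E then ereal (real_of_int (w (i, j))) else - \<infinity>)) = X"
        by (auto simp: X_def fun_eq_iff)
      then show "\<exists>t s2. exec (exact_word \<kappa> n W) P s1 t s2 \<and> real t \<le> exact_time C l c n \<and>
        holds_int_matrix s2 2 n (minimax n X)" using P[where s = s1, OF n W XI s1(1)] s1(2) by simp
    qed
    moreover have "(\<lambda>i j. - minimax n X i j) = bottleneck (graph_on n E) (\<lambda>e. ereal (real_of_int (w e)))"
      unfolding bottleneck_eq_minimax[OF E] X_def by simp
    ultimately show "\<exists>t s'. exec (exact_word (160 + \<kappa>) n W) (negate_com P) s t s' \<and>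
      real t \<le> exact_time (real 100 + real (cost (negate_body 1 51) + cost (negate_body 52 2) + 24) + \<bar>C\<bar>) l c n \<and>
      holds_int_matrix s' 2 n (bottleneck (graph_on n E) (\<lambda>e. ereal (real_of_int (w e))))" by simp
  qed
qed

section \<open>Min-Plus Product from APSP\<close>

text \<open>A value of at least 1 forces a positive integer mantissa. Then
  \<open>2 powr e \<le> w\<close> bounds \<open>e\<close> from above, and
  \<open>2 powr (- e) \<le> m\<close> with the crude \<open>log 2 m \<le> m\<close> bounds it from
  below. So input exponents are small although the format bounds mantissas only.\<close>

lemma float_exponent_bound:
  assumes "1 \<le> real_of_int m * 2 powr real_of_int e" "real_of_int m * 2 powr real_of_int e \<le> w"
    "\<bar>real_of_int m\<bar> \<le> M"
  shows "1 \<le> m" "\<bar>real_of_int e\<bar> \<le> M + log 2 w"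
proof -
  have m0: "0 < m"
  proof (rule ccontr)
    assume "\<not> 0 < m"
    then have "real_of_int m * 2 powr real_of_int e \<le> 0" by (intro mult_nonpos_nonneg) auto
    then show False using assms(1) by simp
  qed
  then show m: "1 \<le> m" by simp
  have w: "1 \<le> w" using assms by linarith
  have "2 powr real_of_int e \<le> real_of_int m * 2 powr real_of_int e"
    using m mult_right_mono[of 1 "real_of_int m" "2 powr real_of_int e"] by simp
  then have "2 powr real_of_int e \<le> w" using assms(2) by linarith
  then have 1: "real_of_int e \<le> log 2 w" using w by (subst le_log_iff) auto
  have "0 \<le> log 2 w" using w by simp
  have "2 powr (- real_of_int e) \<le> real_of_int m"
    using assms(1) by (simp add: powr_minus field_simps)
  then have "- real_of_int e \<le> log 2 (real_of_int m)" using m by (subst le_log_iff) auto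
  also have "\<dots> \<le> real_of_int m"
  proof -
    have "real (nat m) \<le> 2 ^ nat m"
      using of_nat_less_two_power[of "nat m", where 'a = real] by (rule less_imp_le)
    then have "real (nat m) \<le> 2 powr real (nat m)" by (simp only: powr_realpow[of 2, simplified])
    then have "real_of_int m \<le> 2 powr real_of_int m" using m by simp
    then show ?thesis using m by (subst log_le_iff) auto
  qed
  finally have "- real_of_int e \<le> M" using assms(3) by linarith
  then show "\<bar>real_of_int e\<bar> \<le> M + log 2 w" using 1 \<open>0 \<le> log 2 w\<close> assms(3) by linarith
qed

lemma entry_ok_float:
  assumes "holds_float M' s a i x" "x \<noteq> \<infinity> \<Longrightarrow> 1 \<le> x \<and> x \<le> ereal w" "\<lfloor>M' + log 2 w\<rfloor> \<le> M" "1 \<le> w"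
  shows "entry_ok 3 M s a i"
proof (cases "s a (3 * int i) = Some 1")
  case True
  then show ?thesis by (simp add: entry_ok_def)
next
  case False
  with assms(1) obtain m e where me: "s a (3 * int i) = Some 0" "s a (3 * int i + 1) = Some m"
    "s a (3 * int i + 2) = Some e" "\<bar>real_of_int m\<bar> \<le> M'" "x = ereal (real_of_int m * 2 powr real_of_int e)"
    unfolding holds_float_def by blast
  have x: "1 \<le> real_of_int m * 2 powr real_of_int e" "real_of_int m * 2 powr real_of_int e \<le> w"
    using assms(2) me(5) by auto
  have "0 \<le> log 2 w" using assms(4) by simp
  then have "\<bar>real_of_int m\<bar> \<le> M' + log 2 w" using me(4) by linarith
  then have "\<bar>m\<bar> \<le> M" using abs_le_floor assms(3) by fastforce
  moreover have "\<bar>e\<bar> \<le> M" using abs_le_floor[OF float_exponent_bound(2)[OF x me(4)]] assms(3) by linarith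
  ultimately show ?thesis using me by (simp add: entry_ok_def interval_1_3)
qed

lemma approx_time_abs: "0 < \<epsilon> \<Longrightarrow> approx_time C k l c n \<epsilon> \<le> approx_time \<bar>C\<bar> k l c n \<epsilon>"
proof -
  assume "0 < \<epsilon>"
  then have "0 \<le> log 2 (2 + real n + 1 / \<epsilon>)"
    using one_le_log2[of "2 + real n + 1 / \<epsilon>"] by auto
  then have "0 \<le> real n powr c * ((1 + 1 / \<epsilon>) ^ k * log 2 (2 + real n + 1 / \<epsilon>) ^ l)"
    using \<open>0 < \<epsilon>\<close> by simp
  then show ?thesis unfolding approx_time_def using mult_right_mono[of C "\<bar>C\<bar>"]
    by (simp add: mult.assoc)
qed

lemma approx_time_nonneg: "0 \<le> C \<Longrightarrow> 0 < \<epsilon> \<Longrightarrow> 0 \<le> approx_time C k l c n \<epsilon>"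
proof -
  assume "0 \<le> C" "0 < \<epsilon>"
  moreover from \<open>0 < \<epsilon>\<close> have "0 \<le> log 2 (2 + real n + 1 / \<epsilon>)"
    using one_le_log2[of "2 + real n + 1 / \<epsilon>"] by auto
  ultimately show ?thesis by (simp add: approx_time_def)
qed

text \<open>The callee works at accuracy \<open>1 / K\<close>. Since
  \<open>1 + K \<le> 2 * (1 + 1 / \<epsilon>)\<close> and the argument of the logarithm is at most
  squared, the change of parameters costs the factors \<open>2 ^ k\<close> and \<open>2 ^ l\<close>
  besides \<open>3 powr c\<close> for the dimension.\<close>

lemma approx_time_triple:
  assumes c: "2 \<le> c" and n: "1 \<le> n" and e: "0 < \<epsilon>" and K: "1 \<le> K" "K \<le> 1 / \<epsilon> + 1"
  shows "real k0 + real m * (real n * real n) + approx_time \<bar>C\<bar> k l c (3 * n) (1 / K) \<le>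
     approx_time (real k0 + real m + \<bar>C\<bar> * 3 powr c * 2 ^ k * 2 ^ l) k l c n \<epsilon>"
proof -
  let ?L = "log 2 (2 + real n + 1 / \<epsilon>)"
  let ?E = "1 + 1 / \<epsilon>"
  have L: "1 \<le> ?L" using n e by (intro one_le_log2) simp
  have nc: "real n * real n \<le> real n powr c" by (rule n_square_le_powr[OF n c])
  have n1: "1 \<le> real n powr c" using n c by (intro ge_one_powr_ge_zero) auto
  have Ll: "1 \<le> ?L ^ l" using L by (rule one_le_power)
  have Ek: "1 \<le> ?E ^ k" using e by (intro one_le_power) simp
  have x: "2 \<le> 2 + real n + 1 / \<epsilon>" "0 < 1 / \<epsilon>" using e by auto
  have "3 * (2 + real n + 1 / \<epsilon>) \<le> (2 + real n + 1 / \<epsilon>) * (2 + real n + 1 / \<epsilon>)"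
    using x n by (intro mult_right_mono) linarith+
  then have "2 + real (3 * n) + K \<le> (2 + real n + 1 / \<epsilon>) ^ 2"
    using K n x by (simp add: power2_eq_square)
  then have "log 2 (2 + real (3 * n) + K) \<le> log 2 ((2 + real n + 1 / \<epsilon>) ^ 2)"
    using K x by (subst log_le_cancel_iff) auto
  also have "\<dots> = 2 * ?L" using x by (subst log_nat_power) auto
  finally have Ll2: "log 2 (2 + real (3 * n) + K) ^ l \<le> (2 * ?L) ^ l"
    using K by (intro power_mono) auto
  have Kk: "(1 + K) ^ k \<le> (2 * ?E) ^ k" using K x by (intro power_mono) auto
  have "approx_time \<bar>C\<bar> k l c (3 * n) (1 / K) = \<bar>C\<bar> * real (3 * n) powr c * (1 + K) ^ k * log 2 (2 + real (3 * n) + K) ^ l"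
    by (simp add: approx_time_def)
  also have "\<dots> \<le> \<bar>C\<bar> * real (3 * n) powr c * (2 * ?E) ^ k * (2 * ?L) ^ l"
    using K Kk Ll2 by (intro mult_mono) auto
  also have "\<dots> = \<bar>C\<bar> * 3 powr c * 2 ^ k * 2 ^ l * (real n powr c * ?E ^ k * ?L ^ l)"
    unfolding power_mult_distrib by (simp add: powr_mult)
  finally have 1: "approx_time \<bar>C\<bar> k l c (3 * n) (1 / K) \<le> \<bar>C\<bar> * 3 powr c * 2 ^ k * 2 ^ l * (real n powr c * ?E ^ k * ?L ^ l)" .
  have "real n powr c \<le> real n powr c * ?E ^ k"
    using n1 Ek mult_left_mono[of 1 "?E ^ k" "real n powr c"] by simp
  also have "\<dots> \<le> real n powr c * ?E ^ k * ?L ^ l"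
    using n1 Ek Ll mult_left_mono[of 1 "?L ^ l" "real n powr c * ?E ^ k"] by simp
  finally have n2: "real n powr c \<le> real n powr c * ?E ^ k * ?L ^ l" .
  have 2: "real k0 \<le> real k0 * (real n powr c * ?E ^ k * ?L ^ l)"
    using n1 n2 mult_left_mono[of 1 "real n powr c * ?E ^ k * ?L ^ l" "real k0"] by simp
  have 3: "real m * (real n * real n) \<le> real m * (real n powr c * ?E ^ k * ?L ^ l)"
    using n2 nc by (intro mult_left_mono) auto
  show ?thesis using 1 2 3 unfolding approx_time_def[of _ k l c n] by (simp add: algebra_simps)
qed

lemma holds_float_matrixD:
  "holds_float_matrix M s a n X \<Longrightarrow> i < n \<Longrightarrow> j < n \<Longrightarrow> holds_float M s a (i * n + j) (X i j)"
  by (simp add: holds_float_matrix_def)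

lemma holds_float_mono: "holds_float M s a i x \<Longrightarrow> M \<le> M' \<Longrightarrow> holds_float M' s a i x"
  unfolding holds_float_def
  by (elim disjE conjE exE, rule disjI1, intro conjI exI, assumption+, linarith, assumption, simp)

lemma R_plus_nonneg: "x \<in> R_plus \<Longrightarrow> 0 \<le> x" and R_plus_ge_1: "x \<in> R_plus \<Longrightarrow> 1 \<le> x"
  by (auto simp: R_plus_def)

text \<open>Programs see \<open>\<epsilon>\<close> only through this integer. A callee may be run at
  accuracy \<open>1 / K\<close> by the last inequality, and it then finds the same integer in its
  input, because \<open>1 / (1 / K)\<close> is \<open>K\<close>.\<close>

lemma ceiling_inverse:
  assumes "0 < \<epsilon>"
  shows "1 \<le> \<lceil>1 / \<epsilon>\<rceil>" "real_of_int \<lceil>1 / \<epsilon>\<rceil> \<le> 1 / \<epsilon> + 1" "1 / real_of_int \<lceil>1 / \<epsilon>\<rceil> \<le> \<epsilon>"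
proof -
  show 1: "1 \<le> \<lceil>1 / \<epsilon>\<rceil>" using assms by (simp add: one_le_ceiling)
  show "real_of_int \<lceil>1 / \<epsilon>\<rceil> \<le> 1 / \<epsilon> + 1" by linarith
  have "1 / \<epsilon> \<le> real_of_int \<lceil>1 / \<epsilon>\<rceil>" by simp
  then have "1 / real_of_int \<lceil>1 / \<epsilon>\<rceil> \<le> 1 / (1 / \<epsilon>)"
    using assms by (intro divide_left_mono) auto
  then show "1 / real_of_int \<lceil>1 / \<epsilon>\<rceil> \<le> \<epsilon>" by simp
qed

lemma min_plus_if_APSP:
  assumes c: "2 \<le> c" and APSP: "approx_APSP_solvable c"
  shows "approx_min_plus_solvable c"
  unfolding approx_min_plus_solvable_def
proof
  fix b
  from APSP obtain P \<kappa> C k l where P: "\<forall>n \<epsilon> W E w s.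
        1 \<le> n \<and> 0 < \<epsilon> \<and> 1 \<le> W \<and>
        E \<subseteq> {..<n} \<times> {..<n} \<and>
        (\<forall>e\<in>E. w e \<in> R_plus \<and> (w e \<noteq> \<infinity> \<longrightarrow> w e \<le> ereal W)) \<and>
        s 0 0 = Some (int n) \<and> s 0 1 = Some \<lceil>1 / \<epsilon>\<rceil> \<and>
        holds_float_matrix ((real n + 1) ^ b) s 1 n
          (\<lambda>u v. if (u, v) \<in> E then w (u, v) else \<infinity>)
      \<longrightarrow> (\<exists>t s' D.
        exec (approx_word \<kappa> n \<epsilon> W) P s t s' \<and>
        real t \<le> approx_time C k l c n \<epsilon> \<and>
        holds_float_matrix (approx_word \<kappa> n \<epsilon> W) s' 2 n D \<and>
        (\<forall>u<n. \<forall>v<n. distance (graph_on n E) w u v \<le> D u v \<and>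
           D u v \<le> ereal (1 + \<epsilon>) * distance (graph_on n E) w u v))"
    unfolding approx_APSP_solvable_def
    by (drule_tac x = b in spec) (elim exE, rule that)
  define m where "m = 9 * (cost (embed_body 3) + cost (project_body 3) + 50)"
  \<comment> \<open>The cell bound \<open>y ^ q\<close> has to cover inputs of size about
    \<open>y ^ b\<close>, outputs of the callee of size about \<open>y ^ (2 * \<kappa>)\<close> and
    indices below \<open>y ^ 4\<close>; the 6 leaves room for the small summands.\<close>
  define q where "q = b + 2 * \<kappa> + 6"
  define \<kappa>' where "\<kappa>' = 32 * q"
  define C' where "C' = real 100 + real m + \<bar>C\<bar> * 3 powr c * 2 ^ k * 2 ^ l"
  show "\<exists>P \<kappa> C k l. \<forall>n \<epsilon> W A B s.
        1 \<le> n \<and> 0 < \<epsilon> \<and> 1 \<le> W \<and>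
        (\<forall>i<n. \<forall>j<n. A i j \<in> R_plus \<and> (A i j \<noteq> \<infinity> \<longrightarrow> A i j \<le> ereal W)) \<and>
        (\<forall>i<n. \<forall>j<n. B i j \<in> R_plus \<and> (B i j \<noteq> \<infinity> \<longrightarrow> B i j \<le> ereal W)) \<and>
        s 0 0 = Some (int n) \<and> s 0 1 = Some \<lceil>1 / \<epsilon>\<rceil> \<and>
        holds_float_matrix ((real n + 1) ^ b) s 1 n A \<and>
        holds_float_matrix ((real n + 1) ^ b) s 2 n B
      \<longrightarrow> (\<exists>t s' D.
        exec (approx_word \<kappa> n \<epsilon> W) P s t s' \<and>
        real t \<le> approx_time C k l c n \<epsilon> \<and>
        holds_float_matrix (approx_word \<kappa> n \<epsilon> W) s' 3 n D \<and>
        (\<forall>i<n. \<forall>j<n. min_plus n A B i j \<le> D i j \<and>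
           D i j \<le> ereal (1 + \<epsilon>) * min_plus n A B i j))"
  proof (rule exI[of _ "embed_com 3 P"], rule exI[of _ "\<kappa>'"],
      rule exI[of _ C'], rule exI[of _ k], rule exI[of _ l], intro allI impI, elim conjE)
    fix n and \<epsilon> W :: real and A B s
    assume n: "1 \<le> n" and \<epsilon>: "0 < \<epsilon>" and W: "1 \<le> W"
      and A: "\<forall>i<n. \<forall>j<n. A i j \<in> R_plus \<and> (A i j \<noteq> \<infinity> \<longrightarrow> A i j \<le> ereal W)"
      and B: "\<forall>i<n. \<forall>j<n. B i j \<in> R_plus \<and> (B i j \<noteq> \<infinity> \<longrightarrow> B i j \<le> ereal W)"
      and s0: "s 0 0 = Some (int n)" and s01: "s 0 1 = Some \<lceil>1 / \<epsilon>\<rceil>"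
      and sA: "holds_float_matrix ((real n + 1) ^ b) s 1 n A" and sB: "holds_float_matrix ((real n + 1) ^ b) s 2 n B"
    define K where "K = \<lceil>1 / \<epsilon>\<rceil>"
    note K = ceiling_inverse[OF \<epsilon>, folded K_def]
    have K1: "1 \<le> real_of_int K" using K(1) by simp
    define y where "y = 2 + real n + 1 / \<epsilon> + log 2 W"
    have lW: "0 \<le> log 2 W" using W by simp
    have e0: "0 < 1 / \<epsilon>" using \<epsilon> by simp
    have y: "3 \<le> y" "real n + 1 \<le> y" "log 2 W \<le> y" "real_of_int K \<le> y"
      using n lW e0 K(2) unfolding y_def by linarith+
    have ypow: "y ^ i \<le> y ^ j" if "i \<le> j" for i j using y that by (intro power_increasing) auto
    define M where "M = \<lfloor>y ^ q\<rfloor>"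
    have fits: "fits (approx_word \<kappa>' n \<epsilon> W) M"
      unfolding M_def approx_word_def y_def[symmetric] by (rule fits_floor) (use y in \<open>auto simp: q_def \<kappa>'_def\<close>)
    have "9 * (real n * real n) \<le> y ^ 2 * (y * y)"
      using y power_mono[of 3 y 2] by (intro mult_mono) auto
    also have "\<dots> = y ^ 4" by (simp add: eval_nat_numeral)
    also have "\<dots> \<le> y ^ q" by (rule ypow) (simp add: q_def)
    finally have M9: "9 * int n * int n \<le> M" unfolding M_def by (simp add: le_floor_iff mult.assoc)
    have "y ^ 1 \<le> y ^ q" by (rule ypow) (simp add: q_def)
    then have KM: "\<bar>K\<bar> \<le> M" unfolding M_def using y K(1) by (simp add: le_floor_iff)
    have w3: "approx_word \<kappa> (3 * n) (1 / K) W \<le> y ^ (2 * \<kappa>)"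
    proof -
      have "2 + real (3 * n) + real_of_int K + log 2 W \<le> 3 * y"
        using n lW e0 K(2) unfolding y_def of_nat_mult of_nat_numeral distrib_left by linarith
      also have "\<dots> \<le> y * y" using y by (intro mult_right_mono) auto
      finally have "approx_word \<kappa> (3 * n) (1 / K) W \<le> (y * y) ^ \<kappa>"
        unfolding approx_word_def using lW K1 by (intro power_mono) auto
      also have "\<dots> = y ^ (2 * \<kappa>)" by (simp add: power_mult power2_eq_square)
      finally show ?thesis .
    qed
    have small: "y ^ i + (y + 2) \<le> y ^ q" if "i \<le> b + 2 * \<kappa>" for i
    proof -
      have yi: "1 \<le> y ^ i" using y by (intro one_le_power) auto
      have "y + 2 \<le> (2 * y) * y ^ i" using y yi mult_mono[of "y + 2" "2 * y" 1 "y ^ i"] by simp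
      then have "y ^ i + (y + 2) \<le> (1 + 2 * y) * y ^ i" by (simp add: algebra_simps)
      also have "\<dots> \<le> (y * y) * y ^ i"
      proof (rule mult_right_mono)
        have "3 * y \<le> y * y" using y by (intro mult_right_mono) auto
        then show "1 + 2 * y \<le> y * y" using y by linarith
      qed (use yi in simp)
      also have "\<dots> = y ^ (i + 2)" by (simp add: power_add power2_eq_square)
      also have "\<dots> \<le> y ^ q" by (rule ypow) (use that in \<open>simp add: q_def\<close>)
      finally show ?thesis .
    qed
    have inM: "\<lfloor>(real n + 1) ^ b + log 2 W\<rfloor> \<le> M"
    proof -
      have "(real n + 1) ^ b \<le> y ^ b" using y by (intro power_mono) auto
      then show ?thesis unfolding M_def using small[of b] y by (intro floor_mono) auto
    qed
    \<comment> \<open>A sum of two finite entries is at most \<open>2 * W\<close>, and the factor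
      \<open>1 + 1 / K\<close> is at most 2, so finite outputs are at most
      \<open>4 * W\<close>.\<close>
    have outM: "\<lfloor>approx_word \<kappa> (3 * n) (1 / K) W + log 2 (4 * W)\<rfloor> \<le> M"
    proof -
      have "log 2 (4 * W) = 2 + log 2 W" using W log_nat_power[of 2 2 2]
        by (simp add: log_mult)
      then show ?thesis unfolding M_def using small[of "2 * \<kappa>"] y w3 by (intro floor_mono) auto
    qed
    have ok_in: "entry_ok 3 M s a i" if "holds_float_matrix ((real n + 1) ^ b) s a n Z"
      "\<forall>i<n. \<forall>j<n. Z i j \<in> R_plus \<and> (Z i j \<noteq> \<infinity> \<longrightarrow> Z i j \<le> ereal W)" "i < n * n" for a i Z
    proof -
      have ij: "i div n < n" "i mod n < n" using n that(3) by (auto simp: div_less_iff_less_mult)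
      have h: "holds_float ((real n + 1) ^ b) s a i (Z (i div n) (i mod n))"
        using holds_float_matrixD[OF that(1) ij] by simp
      show ?thesis
        by (rule entry_ok_float[OF h _ inM W]) (use that(2)[rule_format, OF ij] R_plus_ge_1 in auto)
    qed
    have B': "approx_word \<kappa> (3 * n) (1 / K) W \<le> approx_word \<kappa>' n \<epsilon> W"
    proof -
      have "y ^ (2 * \<kappa>) \<le> y ^ \<kappa>'" by (rule ypow) (simp add: \<kappa>'_def q_def)
      then show ?thesis using w3 unfolding approx_word_def[of \<kappa>'] y_def[symmetric] by linarith
    qed
    define X where "X = (\<lambda>(i, j). tripartite n A B i j)"
    have infty: "\<infinity> \<in> R_plus" by (simp add: R_plus_def)
    have X: "\<forall>e\<in>{..<3*n} \<times> {..<3*n}. X e \<in> R_plus \<and> (X e \<noteq> \<infinity> \<longrightarrow> X e \<le> ereal W)"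
      using A B infty by (auto simp: X_def tripartite_def split: if_splits)
    define C0 where "C0 = min_plus n A B"
    have C0: "distance (complete (3 * n)) X i (2 * n + j) = C0 i j" if "i < n" "j < n" for i j
      unfolding X_def C0_def using that A B by (intro distance_tripartite) (auto intro: R_plus_nonneg)
    have C0_cases: "C0 i j = \<infinity> \<or> (1 \<le> C0 i j \<and> C0 i j \<le> ereal (2 * W))" if ij: "i < n" "j < n" for i j
    proof -
      have "C0 i j \<in> (\<lambda>k. A i k + B k j) ` {..<n}"
        unfolding C0_def min_plus_def using n by (intro Min_in) (auto simp: lessThan_empty_iff)
      then obtain h where h: "h < n" "C0 i j = A i h + B h j" by auto
      have "A i h \<in> R_plus" "B h j \<in> R_plus" "A i h \<noteq> \<infinity> \<longrightarrow> A i h \<le> ereal W" "B h j \<noteq> \<infinity> \<longrightarrow> B h j \<le> ereal W"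
        using A B h ij by auto
      then show ?thesis unfolding h(2) by (auto simp: R_plus_def)
    qed
    define Q where "Q s2 \<longleftrightarrow> (\<exists>D. holds_float_matrix (approx_word \<kappa> (3 * n) (1 / K) W) s2 2 (3 * n) D \<and>
      (\<forall>u<3*n. \<forall>v<3*n. distance (complete (3 * n)) X u v \<le> D u v \<and>
           D u v \<le> ereal (1 + 1 / K) * distance (complete (3 * n)) X u v))" for s2
    define T where "T = nat \<lfloor>approx_time \<bar>C\<bar> k l c (3 * n) (1 / K)\<rfloor>"
    have runs: "runs (approx_word \<kappa>' n \<epsilon> W) (embed_com 3 P)
      (100 + 9 * n * n * (cost (embed_body 3) + cost (project_body 3) + 50) + T) s
      (\<lambda>s'. \<exists>s2. Q s2 \<and>
        (\<forall>i<n. \<forall>j<n. same_entry 3 s2 2 (i * (3 * n) + 2 * n + j) s' 3 (i * n + j)))"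
    proof (rule runs_embed[where s = s and K = K, OF fits M9 n _ s0 _ _ _ _ B'])
      show "s 0 1 = Some K \<and> \<bar>K\<bar> \<le> M" using s01 KM by (simp add: K_def)
      show "entry_ok 3 M s 1 i" if "i < n * n" for i using ok_in[OF sA A that] .
      show "entry_ok 3 M s 2 i" if "i < n * n" for i using ok_in[OF sB B that] .
      fix s1 assume s10: "s1 0 0 = Some (int (3 * n))" and "3 = (3::nat) \<Longrightarrow> s1 0 1 = Some K"
        and emb: "embedded 3 n s s1"
      then have s11: "s1 0 1 = Some K" by simp
      \<comment> \<open>The mantissa bound grows with the dimension, so the same \<open>b\<close>
        works for the larger matrix.\<close>
      have pw: "(real n + 1) ^ b \<le> (real (3 * n) + 1) ^ b" by (intro power_mono) auto
      have "holds_float_matrix ((real (3 * n) + 1) ^ b) s1 1 (3 * n)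
         (\<lambda>u v. if (u, v) \<in> {..<3*n} \<times> {..<3*n} then X (u, v) else \<infinity>)"
        unfolding holds_float_matrix_def
      proof (intro allI impI)
        fix i j assume ij: "i < 3 * n" "j < 3 * n"
        note e = emb[unfolded embedded_def, rule_format, OF ij]
        consider "i < n \<and> n \<le> j \<and> j < 2*n" | "n \<le> i \<and> i < 2*n \<and> 2*n \<le> j"
          | "\<not> (i < n \<and> n \<le> j \<and> j < 2*n)" "\<not> (n \<le> i \<and> i < 2*n \<and> 2*n \<le> j)" by blast
        then have "holds_float ((real n + 1) ^ b) s1 1 (i * (3 * n) + j) (X (i, j))"
        proof cases
          case 1
          moreover have "holds_float ((real n + 1) ^ b) s 1 (i * n + (j - n)) (A i (j - n))"
            by (rule holds_float_matrixD[OF sA]) (use 1 in auto)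
          ultimately show ?thesis using e same_entry_float by (auto simp: X_def tripartite_def)
        next
          case 2
          moreover have "holds_float ((real n + 1) ^ b) s 2 ((i - n) * n + (j - 2 * n)) (B (i - n) (j - 2 * n))"
            by (rule holds_float_matrixD[OF sB]) (use 2 ij in auto)
          ultimately show ?thesis using e same_entry_float by (auto simp: X_def tripartite_def)
        next
          case 3
          then show ?thesis using e by (auto simp: X_def tripartite_def holds_float_def)
        qed
        then show "holds_float ((real (3 * n) + 1) ^ b) s1 1 (i * (3 * n) + j)
          (if (i, j) \<in> {..<3*n} \<times> {..<3*n} then X (i, j) else \<infinity>)"
          using ij holds_float_mono[OF _ pw] by simp
      qed
      moreover have "s1 0 1 = Some \<lceil>1 / (1 / real_of_int K)\<rceil>" using s11 by simp
      moreover have "0 < 1 / real_of_int K" using K(1) by simp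
      moreover have "1 \<le> 3 * n" using n by simp
      ultimately obtain t s2 D where t: "exec (approx_word \<kappa> (3 * n) (1 / K) W) P s1 t s2"
        "real t \<le> approx_time C k l c (3 * n) (1 / K)"
        "holds_float_matrix (approx_word \<kappa> (3 * n) (1 / K) W) s2 2 (3 * n) D"
        "\<forall>u<3*n. \<forall>v<3*n. distance (complete (3 * n)) X u v \<le> D u v \<and>
           D u v \<le> ereal (1 + 1 / K) * distance (complete (3 * n)) X u v"
        using P[rule_format, of "3 * n" "1 / K" W "{..<3*n} \<times> {..<3*n}" X s1] W X s10 by auto
      have "t \<le> T" unfolding T_def using t(2) approx_time_abs[of "1 / K" C k l c "3 * n"] K(1)
        by (intro le_nat_floor) auto
      moreover have "Q s2" using t(3,4) unfolding Q_def by blast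
      moreover have "entry_ok 3 M s2 2 (i * (3 * n) + 2 * n + j)" if ij: "i < n" "j < n" for i j
      proof -
        have ij3: "i < 3 * n" "2 * n + j < 3 * n" using ij by auto
        have D: "C0 i j \<le> D i (2 * n + j)" "D i (2 * n + j) \<le> ereal (1 + 1 / K) * C0 i j"
          using t(4)[rule_format, OF ij3] C0[OF ij] by auto
        have h: "holds_float (approx_word \<kappa> (3 * n) (1 / K) W) s2 2 (i * (3 * n) + 2 * n + j) (D i (2 * n + j))"
          using holds_float_matrixD[OF t(3) ij3] by (simp add: add.assoc)
        have "1 \<le> D i (2 * n + j) \<and> D i (2 * n + j) \<le> ereal (4 * W)" if "D i (2 * n + j) \<noteq> \<infinity>"
        proof -
          have "C0 i j \<noteq> \<infinity>" using D(1) that by auto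
          then have C: "1 \<le> C0 i j" "C0 i j \<le> ereal (2 * W)" using C0_cases[OF ij] by auto
          have "D i (2 * n + j) \<le> ereal (1 + 1 / K) * C0 i j" by (rule D(2))
          also have "\<dots> \<le> ereal 2 * ereal (2 * W)"
            using C K1 order_trans[OF _ C(1), of 0] by (intro ereal_mult_mono) auto
          finally show ?thesis using order_trans[OF C(1) D(1)] by simp
        qed
        then show ?thesis using W by (intro entry_ok_float[OF h _ outM]) auto
      qed
      ultimately show "\<exists>t s2. exec (approx_word \<kappa> (3 * n) (1 / K) W) P s1 t s2 \<and> t \<le> T \<and> Q s2 \<and>
         (\<forall>i<n. \<forall>j<n. entry_ok 3 M s2 2 (i * (3 * n) + 2 * n + j))" using t(1) by blast
    qed auto
    then obtain t s' s2 where e: "exec (approx_word \<kappa>' n \<epsilon> W) (embed_com 3 P) s t s'"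
      and t: "t \<le> 100 + 9 * n * n * (cost (embed_body 3) + cost (project_body 3) + 50) + T"
      and Q: "Q s2"
      and se: "\<forall>i<n. \<forall>j<n. same_entry 3 s2 2 (i * (3 * n) + 2 * n + j) s' 3 (i * n + j)"
      unfolding runs_def by blast
    have "t \<le> 100 + m * (n * n) + T" using t by (simp add: m_def algebra_simps)
    then have "real t \<le> real (100 + m * (n * n) + T)" by (simp only: of_nat_le_iff)
    also have "\<dots> \<le> real 100 + real m * (real n * real n) + approx_time \<bar>C\<bar> k l c (3 * n) (1 / K)"
      using of_nat_floor[OF approx_time_nonneg[of "\<bar>C\<bar>" "1 / K" k l c "3 * n"]] K(1) by (simp add: T_def)
    also have "\<dots> \<le> approx_time C' k l c n \<epsilon>"
      unfolding C'_def by (rule approx_time_triple[OF c n \<epsilon> K1 K(2)])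
    finally have time: "real t \<le> approx_time C' k l c n \<epsilon>" .
    from Q obtain D where D: "holds_float_matrix (approx_word \<kappa> (3 * n) (1 / K) W) s2 2 (3 * n) D"
      "\<forall>u<3*n. \<forall>v<3*n. distance (complete (3 * n)) X u v \<le> D u v \<and>
           D u v \<le> ereal (1 + 1 / K) * distance (complete (3 * n)) X u v" unfolding Q_def by blast
    have "holds_float_matrix (approx_word \<kappa>' n \<epsilon> W) s' 3 n (\<lambda>i j. D i (2 * n + j))"
      unfolding holds_float_matrix_def
    proof (intro allI impI)
      fix i j assume ij: "i < n" "j < n"
      then have "i < 3 * n" "2 * n + j < 3 * n" by auto
      then have "holds_float (approx_word \<kappa> (3 * n) (1 / K) W) s2 2 (i * (3 * n) + (2 * n + j)) (D i (2 * n + j))"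
        using holds_float_matrixD[OF D(1), of i "2 * n + j"] by simp
      then have "holds_float (approx_word \<kappa>' n \<epsilon> W) s2 2 (i * (3 * n) + (2 * n + j)) (D i (2 * n + j))"
        by (rule holds_float_mono[OF _ B'])
      then show "holds_float (approx_word \<kappa>' n \<epsilon> W) s' 3 (i * n + j) (D i (2 * n + j))"
        by (rule same_entry_float) (use se ij in \<open>simp add: add.assoc\<close>)
    qed
    moreover have "C0 i j \<le> D i (2 * n + j) \<and> D i (2 * n + j) \<le> ereal (1 + \<epsilon>) * C0 i j" if ij: "i < n" "j < n" for i j
    proof -
      have ij3: "i < 3 * n" "2 * n + j < 3 * n" using ij by auto
      have D': "C0 i j \<le> D i (2 * n + j)" "D i (2 * n + j) \<le> ereal (1 + 1 / K) * C0 i j"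
        using D(2)[rule_format, OF ij3] C0[OF ij] by auto
      have "0 \<le> C0 i j" using C0_cases[OF ij] order_trans[of 0 1 "C0 i j"] by auto
      then have "ereal (1 + 1 / K) * C0 i j \<le> ereal (1 + \<epsilon>) * C0 i j"
        using K(3) by (intro ereal_mult_right_mono) auto
      then show ?thesis using D' by (metis order_trans)
    qed
    ultimately show "\<exists>t s' D. exec (approx_word \<kappa>' n \<epsilon> W) (embed_com 3 P) s t s' \<and>
        real t \<le> approx_time C' k l c n \<epsilon> \<and>
        holds_float_matrix (approx_word \<kappa>' n \<epsilon> W) s' 3 n D \<and>
        (\<forall>i<n. \<forall>j<n. min_plus n A B i j \<le> D i j \<and>
           D i j \<le> ereal (1 + \<epsilon>) * min_plus n A B i j)" using e time unfolding C0_def by blast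
  qed
qed

section \<open>Ranking by a tournament tree\<close>

text \<open>Node \<open>p\<close> of the tree in array 20 has the children \<open>2 p\<close> and \<open>2 p + 1\<close>, so the \<open>N\<close> leaves are the
  nodes from \<open>N\<close> on.\<close>

definition heap :: "nat \<Rightarrow> (nat \<Rightarrow> int) \<Rightarrow> bool" where
  "heap N f \<longleftrightarrow> (\<forall>p. 1 \<le> p \<longrightarrow> p < N \<longrightarrow> f p = min (f (2 * p)) (f (2 * p + 1)))"

text \<open>Along the parents \<open>q\<close>, \<open>q div 2\<close>, ... the values do not
  increase, and the walk ends at the root 1.\<close>

lemma heap_root_le:
  assumes "heap N f" "1 \<le> q" "q < 2 * N"
  shows "f 1 \<le> f q"
  using assms(2,3)
proof (induction q rule: less_induct)
  case (less q)
  show ?case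
  proof (cases "q = 1")
    case False
    then have q: "q div 2 < q" "1 \<le> q div 2" "q div 2 < N" using less.prems by auto
    have "f (q div 2) \<le> f q"
      using assms(1) q unfolding heap_def by (cases "even q") (auto elim!: oddE)
    then show ?thesis using less.IH[OF q(1,2)] q(3) by simp
  qed simp
qed

definition stored :: "nat \<Rightarrow> int \<Rightarrow> mem \<Rightarrow> (nat \<Rightarrow> int) \<Rightarrow> bool" where
  "stored N M s f \<longleftrightarrow> (\<forall>q. 1 \<le> q \<longrightarrow> q < 2 * N \<longrightarrow> s 20 (int q) = Some (f q) \<and> \<bar>f q\<bar> \<le> M)"

lemma storedD: "stored N M s f \<Longrightarrow> 1 \<le> q \<Longrightarrow> q < 2 * N \<Longrightarrow> s 20 (int q) = Some (f q) \<and> \<bar>f q\<bar> \<le> M"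
  by (simp add: stored_def)

definition sift_body :: com where
  "sift_body = Seq (Set 10 (Div (Var 10) (Const 2)))
     (If_Less (Cell 20 (Mul (Const 2) (Var 10))) (Cell 20 (Add (Mul (Const 2) (Var 10)) (Const 1)))
       (Assign 20 (Var 10) (Cell 20 (Mul (Const 2) (Var 10))))
       (Assign 20 (Var 10) (Cell 20 (Add (Mul (Const 2) (Var 10)) (Const 1)))))"

text \<open>Cell 0 of array 10 names a leaf and cell 0 of array 11 its new value. The loop
  recomputes the minima on the way from this leaf to the root.\<close>

definition update_com :: com where
  "update_com = Seq (Assign 20 (Var 10) (Var 11)) (While_Less (Const 1) (Var 10) sift_body)"

text \<open>A node has the value of one of its children, so a value below that of the left child
  comes from the right child. Following it from the root leads to a minimal leaf.\<close>

definition find_body :: com where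
  "find_body = If_Less (Cell 20 (Var 10)) (Cell 20 (Mul (Const 2) (Var 10)))
     (Set 10 (Add (Mul (Const 2) (Var 10)) (Const 1))) (Set 10 (Mul (Const 2) (Var 10)))"

definition find_com :: com where
  "find_com = Seq (Set 10 (Const 1)) (While_Less (Var 10) (Var 6) find_body)"

lemma writes_update_find [simp]: "writes update_com = {10, 20}" "writes find_com = {10}"
  by (auto simp: update_com_def sift_body_def find_com_def find_body_def)

text \<open>During the climb the parent of the current node is the only one whose equation may fail.
  The bound \<open>q < 2 ^ (k + 1)\<close> loses a factor 2 per step and limits the steps to
  \<open>L\<close>.\<close>

lemma runs_update:
  assumes fits: "fits B M" and M: "2 * int N \<le> M" "4 \<le> M" and L: "N \<le> 2 ^ L"
    and p: "s 10 0 = Some (int p)" "N \<le> p" "p < 2 * N" and x: "s 11 0 = Some x" "\<bar>x\<bar> \<le> M"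
    and f: "stored N M s f" "heap N f"
  shows "runs B update_com ((L + 1) * (cost sift_body + 20)) s
    (\<lambda>s'. \<exists>g. stored N M s' g \<and> heap N g \<and> (\<forall>q. N \<le> q \<longrightarrow> q < 2 * N \<longrightarrow> g q = (f(p := x)) q))"
proof -
  define I where "I k s' \<longleftrightarrow> (\<exists>q g. s' 10 0 = Some (int q) \<and> 1 \<le> q \<and> q < 2 * N \<and> q < 2 ^ (k + 1) \<and>
    stored N M s' g \<and> (\<forall>r. 1 \<le> r \<longrightarrow> r < N \<longrightarrow> r \<noteq> q div 2 \<longrightarrow> g r = min (g (2 * r)) (g (2 * r + 1))) \<and>
    (\<forall>q. N \<le> q \<longrightarrow> q < 2 * N \<longrightarrow> g q = (f(p := x)) q))" for k s'
  have N: "0 < N" using p by simp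
  have 1: "runs B (Assign 20 (Var 10) (Var 11)) 10 s (I L)"
  proof (rule runs_wpI[OF fits])
    have "I L (s(20 := (s 20)(int p \<mapsto> x)))"
      unfolding I_def
    proof (intro exI[of _ p] exI[of _ "f(p := x)"] conjI allI impI)
      show "p < 2 ^ (L + 1)" using p L by simp
      show "stored N M (s(20 := (s 20)(int p \<mapsto> x))) (f(p := x))"
        using f(1) x by (simp add: stored_def)
      fix r assume r: "1 \<le> r" "r < N" "r \<noteq> p div 2"
      then have "2 * r \<noteq> p" "2 * r + 1 \<noteq> p" "r \<noteq> p" using p by auto
      then show "(f(p := x)) r = min ((f(p := x)) (2 * r)) ((f(p := x)) (2 * r + 1))"
        using f(2) r by (simp add: heap_def)
    qed (use p N in simp_all)
    then show "wp M (Assign 20 (Var 10) (Var 11)) s (I L)"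
      using p x M by auto
  qed simp
  have 2: "runs B (While_Less (Const 1) (Var 10) sift_body)
     (L * (1 + ops (Const 1) + ops (Var 10) + cost sift_body) + (1 + ops (Const 1) + ops (Var 10))) s'
     (\<lambda>s''. (\<exists>j. I j s'') \<and> \<not> ival s'' (Const 1) < ival s'' (Var 10))" if "I L s'" for s'
  proof (rule runs_While[where I = I and k = L, OF fits _ _ _ _ that])
    fix k s' assume "I k s'"
    then obtain q g where q: "s' 10 0 = Some (int q)" "1 \<le> q" "q < 2 * N" "q < 2 ^ (k + 1)"
      and g: "stored N M s' g" "\<And>r. 1 \<le> r \<Longrightarrow> r < N \<Longrightarrow> r \<noteq> q div 2 \<Longrightarrow> g r = min (g (2 * r)) (g (2 * r + 1))"
      "\<And>q. N \<le> q \<Longrightarrow> q < 2 * N \<Longrightarrow> g q = (f(p := x)) q" unfolding I_def by blast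
    show "safe M s' (Const 1) \<and> safe M s' (Var 10)" using q M by auto
    assume "ival s' (Const 1) < ival s' (Var 10)"
    then have q2: "2 \<le> q" using q by simp
    have k: "0 < k" using q q2 by (cases k) auto
    define q' where "q' = q div 2"
    have q': "1 \<le> q'" "q' < N" "q' < 2 ^ (k - 1 + 1)" using q q2 k by (auto simp: q'_def)
    have iq': "int q div 2 = int q'" by (simp add: q'_def zdiv_int)
    note st = storedD[OF g(1), of "2 * q'"] storedD[OF g(1), of "2 * q' + 1"]
    have st': "s' 20 (2 * int q') = Some (g (2 * q'))" "s' 20 (2 * int q' + 1) = Some (g (2 * q' + 1))"
      "\<bar>g (2 * q')\<bar> \<le> M" "\<bar>g (2 * q' + 1)\<bar> \<le> M" using st q' by (auto simp: add.commute)
    have *: "I (k - 1) (s'(10 := (s' 10)(0 \<mapsto> int q'), 20 := (s' 20)(int q' \<mapsto> z)))"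
      if z: "z = min (g (2 * q')) (g (2 * q' + 1))" for z
      unfolding I_def
    proof (intro exI[of _ q'] exI[of _ "g(q' := z)"] conjI allI impI)
      show "stored N M (s'(10 := (s' 10)(0 \<mapsto> int q'), 20 := (s' 20)(int q' \<mapsto> z))) (g(q' := z))"
        using g(1) st' z by (auto simp: stored_def)
      fix r assume r: "1 \<le> r" "r < N" "r \<noteq> q' div 2"
      then have "2 * r \<noteq> q'" "2 * r + 1 \<noteq> q'" by auto
      then show "(g(q' := z)) r = min ((g(q' := z)) (2 * r)) ((g(q' := z)) (2 * r + 1))"
        using z g(2)[OF r(1,2)] q' by (cases "r = q'") (auto simp: q'_def)
    qed (use q' g(3) in auto)
    have qM: "int q \<le> M" "int q' \<le> M" using q(3) q'(2) M by linarith+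
    show "0 < k \<and> runs B sift_body (cost sift_body) s' (I (k - 1))"
    proof (intro conjI k)
      show "runs B sift_body (cost sift_body) s' (I (k - 1))"
        unfolding sift_body_def
        apply (rule runs_wp[OF fits])
        using q qM st' M *[of "g (2 * q')"] *[of "g (2 * q' + 1)"] by (auto simp: iq')
    qed
  qed auto
  have "runs B update_com (1 + 10 + (L * (1 + ops (Const 1) + ops (Var 10) + cost sift_body) + (1 + ops (Const 1) + ops (Var 10)))) s
    (\<lambda>s''. (\<exists>j. I j s'') \<and> \<not> ival s'' (Const 1) < ival s'' (Var 10))"
    unfolding update_com_def by (rule runs_Seq[OF 1 2])
  then show ?thesis
  proof (rule runs_weaken)
    fix s' assume *: "(\<exists>j. I j s') \<and> \<not> ival s' (Const 1) < ival s' (Var 10)"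
    then obtain q g where q: "s' 10 0 = Some (int q)" "1 \<le> q"
      and g: "stored N M s' g" "\<And>r. 1 \<le> r \<Longrightarrow> r < N \<Longrightarrow> r \<noteq> q div 2 \<Longrightarrow> g r = min (g (2 * r)) (g (2 * r + 1))"
      "\<And>q. N \<le> q \<Longrightarrow> q < 2 * N \<Longrightarrow> g q = (f(p := x)) q" unfolding I_def by blast
    then have "q = 1" using * by simp
    \<comment> \<open>At the root the exempted node is \<open>1 div 2 = 0\<close>, which is no node
      of the tree, so all equations hold.\<close>
    then have "heap N g" using g(2) by (simp add: heap_def)
    then show "\<exists>g. stored N M s' g \<and> heap N g \<and> (\<forall>q. N \<le> q \<longrightarrow> q < 2 * N \<longrightarrow> g q = (f(p := x)) q)"
      using g by blast
  qed (simp add: algebra_simps)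
qed

text \<open>The current node always carries the minimum \<open>f 1\<close>. By
  \<open>N \<le> q * 2 ^ k\<close> the leaves, which start at \<open>N\<close>, are reached after at
  most \<open>L\<close> steps.\<close>

lemma runs_find:
  assumes fits: "fits B M" and M: "2 * int N \<le> M" "4 \<le> M" and L: "N \<le> 2 ^ L" and N: "1 \<le> N" "s 6 0 = Some (int N)"
    and f: "stored N M s f" "heap N f"
  shows "runs B find_com ((L + 1) * (cost find_body + 20)) s
    (\<lambda>s'. \<exists>p. s' 10 0 = Some (int p) \<and> N \<le> p \<and> p < 2 * N \<and> f p = f 1)"
proof -
  define I where "I k s' \<longleftrightarrow> (\<exists>q. s' 10 0 = Some (int q) \<and> 1 \<le> q \<and> q < 2 * N \<and> N \<le> q * 2 ^ k \<and>
    f q = f 1 \<and> s' 20 = s 20 \<and> s' 6 = s 6)" for k and s' :: mem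
  have 1: "runs B (Set 10 (Const 1)) 5 s (I L)"
    by (rule runs_wpI[OF fits]) (use M N L in \<open>auto simp: I_def intro!: exI[of _ 1]\<close>)
  have 2: "runs B (While_Less (Var 10) (Var 6) find_body)
     (L * (1 + ops (Var 10) + ops (Var 6) + cost find_body) + (1 + ops (Var 10) + ops (Var 6))) s'
     (\<lambda>s''. (\<exists>j. I j s'') \<and> \<not> ival s'' (Var 10) < ival s'' (Var 6))" if "I L s'" for s'
  proof (rule runs_While[where I = I and k = L, OF fits _ _ _ _ that])
    fix k s' assume "I k s'"
    then obtain q where q: "s' 10 0 = Some (int q)" "1 \<le> q" "q < 2 * N" "N \<le> q * 2 ^ k" "f q = f 1" "s' 20 = s 20" "s' 6 = s 6"
      unfolding I_def by blast
    have qM: "int q \<le> M" using q M by linarith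
    show "safe M s' (Var 10) \<and> safe M s' (Var 6)" using q M N qM by auto
    assume "ival s' (Var 10) < ival s' (Var 6)"
    then have qN: "q < N" using q N by simp
    have k: "0 < k" using q qN by (cases k) auto
    have pw: "N \<le> (2 * q) * 2 ^ (k - 1)" "(2 * q) * 2 ^ (k - 1) \<le> (2 * q + 1) * 2 ^ (k - 1)"
      using q k by (cases k; simp add: algebra_simps)+
    have st: "s 20 (int q) = Some (f q)" "s 20 (2 * int q) = Some (f (2 * q))" "\<bar>f q\<bar> \<le> M" "\<bar>f (2 * q)\<bar> \<le> M"
      using storedD[OF f(1), of q] storedD[OF f(1), of "2 * q"] q qN by auto
    have h: "f q = min (f (2 * q)) (f (2 * q + 1))" using f(2) q qN by (simp add: heap_def)
    have A: "I (k - 1) (s'(10 := (s' 10)(0 \<mapsto> 2 * int q)))" if "\<not> f q < f (2 * q)"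
      unfolding I_def using q qN pw h that by (intro exI[of _ "2 * q"]) (auto simp: min_def split: if_splits)
    have B: "I (k - 1) (s'(10 := (s' 10)(0 \<mapsto> 2 * int q + 1)))" if "f q < f (2 * q)"
      unfolding I_def using q qN pw h that
      by (intro exI[of _ "2 * q + 1"] conjI) (auto simp: min_def split: if_splits)
    show "0 < k \<and> runs B find_body (cost find_body) s' (I (k - 1))"
    proof (intro conjI k)
      show "runs B find_body (cost find_body) s' (I (k - 1))"
        unfolding find_body_def
        apply (rule runs_wp[OF fits])
        using q qM st M A B by auto
    qed
  qed auto
  have "runs B find_com (1 + 5 + (L * (1 + ops (Var 10) + ops (Var 6) + cost find_body) + (1 + ops (Var 10) + ops (Var 6)))) s
    (\<lambda>s''. (\<exists>j. I j s'') \<and> \<not> ival s'' (Var 10) < ival s'' (Var 6))"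
    unfolding find_com_def by (rule runs_Seq[OF 1 2])
  then show ?thesis
    by (rule runs_weaken) (use N in \<open>auto simp: I_def algebra_simps\<close>)
qed

definition insert_body :: com where
  "insert_body = Seq (Seq (Set 10 (Add (Var 6) (Var 7))) (Set 11 (Cell 21 (Var 7)))) update_com"

text \<open>Array 22 receives the rank of each entry and array 23 the value of each rank.
  Overwriting the leaf with cell 0 of array 12 takes it out of the competition.\<close>

definition extract_body :: com where
  "extract_body = Seq find_com
     (Seq (Seq (Set 13 (Sub (Var 10) (Var 6))) (Seq (Assign 22 (Var 13) (Var 7))
       (Seq (Assign 23 (Var 7) (Cell 21 (Var 13))) (Set 11 (Var 12))))) update_com)"

text \<open>A tree filled with one constant satisfies all equations, so the values can then be
  inserted one by one with \<open>update_com\<close>.\<close>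

definition sort_com :: com where
  "sort_com = Seq (For 7 8 (Assign 20 (Var 7) (Var 12)))
     (Seq (For 7 6 insert_body) (For 7 6 extract_body))"

text \<open>Equal entries may receive different ranks. The decoding relies on \<open>vo\<close>
  being monotone and sending the rank of an entry back to the entry; the last clause transfers
  bounds from \<open>v\<close> to \<open>vo\<close>.\<close>

definition ranking :: "nat \<Rightarrow> (nat \<Rightarrow> int) \<Rightarrow> (nat \<Rightarrow> nat) \<Rightarrow> (nat \<Rightarrow> int) \<Rightarrow> bool" where
  "ranking N v rk vo \<longleftrightarrow> (\<forall>j<N. rk j < N \<and> vo (rk j) = v j) \<and>
     (\<forall>r r'. r \<le> r' \<longrightarrow> r' < N \<longrightarrow> vo r \<le> vo r') \<and> (\<forall>r<N. \<exists>j<N. vo r = v j)"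

lemma writes_sort [simp]: "writes sort_com = {7, 10, 11, 13, 20, 22, 23}"
  by (auto simp: sort_com_def insert_body_def extract_body_def)

text \<open>Selection of the minimum \<open>N\<close> times, each in \<open>O(L)\<close> steps with
  \<open>N \<le> 2 ^ L\<close>. All values lie strictly below \<open>big\<close>, so an extracted
  leaf never wins while another one is left.\<close>

lemma runs_sort:
  assumes fits: "fits B M" and M: "2 * int N \<le> M" "4 \<le> M" and L: "N \<le> 2 ^ L" and N: "1 \<le> N"
    and s: "s 6 0 = Some (int N)" "s 8 0 = Some (int (2 * N))" "s 12 0 = Some big" "\<bar>big\<bar> \<le> M"
    and v: "\<And>j. j < N \<Longrightarrow> s 21 (int j) = Some (v j) \<and> \<bar>v j\<bar> \<le> M \<and> v j < big"
  shows "runs B sort_com (100 + N * ((L + 1) * (2 * cost sift_body + cost find_body + 200))) s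
    (\<lambda>s'. \<exists>rk vo. ranking N v rk vo \<and>
      (\<forall>j<N. s' 22 (int j) = Some (int (rk j))) \<and> (\<forall>r<N. s' 23 (int r) = Some (vo r)))"
proof -
  have NM: "int N \<le> M" "int (2 * N) \<le> M" using M by simp_all
  define Ts where "Ts = (L + 1) * (cost sift_body + 20)"
  define Tf where "Tf = (L + 1) * (cost find_body + 20)"
  have r1: "runs B (For 7 8 (Assign 20 (Var 7) (Var 12))) (2 * N * (6 + 12) + 12) s
    (\<lambda>s'. \<forall>q<2 * N. s' 20 (int q) = Some big)"
  proof (rule runs_map[where dst = 20 and d = 1 and s = s, OF fits])
    fix i s' assume i: "i < 2 * N" and s7: "s' 7 0 = Some (int i)"
      and fr: "\<And>a. a \<notin> insert 7 (writes (Assign 20 (Var 7) (Var 12))) \<Longrightarrow> s' a = s a"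
    have "int i \<le> M" using i NM by linarith
    then show "runs B (Assign 20 (Var 7) (Var 12)) 6 s' (\<lambda>s''. s'' 20 (int i) = Some big \<and>
       (\<forall>x. x < int 1 * int i \<or> int 1 * int i + int 1 \<le> x \<longrightarrow> s'' 20 x = s' 20 x))"
      by (intro runs_wpI[OF fits]) (use s7 fr[of 12] s M in auto)
  qed (use s NM in auto)
  have r2: "runs B (For 7 6 insert_body) (N * (1 + 20 + Ts + 12) + 12) s1
    (\<lambda>s'. \<exists>f. stored N M s' f \<and> heap N f \<and> (\<forall>j<N. f (N + j) = v j))"
    if init: "\<forall>q<2 * N. s1 20 (int q) = Some big" and fr1: "s1 6 = s 6" "s1 21 = s 21" for s1
  proof -
    define I where "I i s' \<longleftrightarrow> (\<exists>f. stored N M s' f \<and> heap N f \<and> (\<forall>j<i. f (N + j) = v j))" for i s'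
    have "runs B (For 7 6 insert_body) (N * (1 + 20 + Ts + 12) + 12) s1 (I N)"
    proof (rule runs_For[where s = s1, OF fits])
      show "I 0 s1" unfolding I_def
        by (rule exI[of _ "\<lambda>_. big"]) (use init s in \<open>auto simp: stored_def heap_def\<close>)
      show "I i (s'(7 := x)) = I i s'" for i s' x by (simp add: I_def stored_def)
      fix i s' assume i: "i < N" and I: "I i s'" and s7: "s' 7 0 = Some (int i)"
        and fr: "\<And>a. a \<notin> insert 7 (writes insert_body) \<Longrightarrow> s' a = s1 a"
      from I obtain f where f: "stored N M s' f" "heap N f" "\<forall>j<i. f (N + j) = v j" unfolding I_def by blast
      have iM: "int i \<le> M" using i NM by linarith
      show "runs B insert_body (1 + 20 + Ts) s' (I (Suc i))"
        unfolding insert_body_def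
      proof (rule runs_Seq)
        show "runs B (Seq (Set 10 (Add (Var 6) (Var 7))) (Set 11 (Cell 21 (Var 7)))) 20 s'
          (\<lambda>s''. s'' 10 0 = Some (int (N + i)) \<and> s'' 11 0 = Some (v i) \<and> s'' 20 = s' 20)"
          by (rule runs_wpI[OF fits])
            (use s7 fr[of 6] fr[of 21] fr1 s v[OF i] iM NM M in \<open>auto simp: insert_body_def\<close>)
        fix s2 :: mem assume s2: "s2 10 0 = Some (int (N + i)) \<and> s2 11 0 = Some (v i) \<and> s2 20 = s' 20"
        have "runs B update_com Ts s2 (\<lambda>s'. \<exists>g. stored N M s' g \<and> heap N g \<and>
            (\<forall>q. N \<le> q \<longrightarrow> q < 2 * N \<longrightarrow> g q = (f(N + i := v i)) q))"
          unfolding Ts_def using s2 f i v[OF i] by (intro runs_update[OF fits M L]) (auto simp: stored_def)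
        then show "runs B update_com Ts s2 (I (Suc i))"
        proof (rule runs_weaken)
          fix s3 assume "\<exists>g. stored N M s3 g \<and> heap N g \<and> (\<forall>q. N \<le> q \<longrightarrow> q < 2 * N \<longrightarrow> g q = (f(N + i := v i)) q)"
          then obtain g where g: "stored N M s3 g" "heap N g" "\<And>q. N \<le> q \<Longrightarrow> q < 2 * N \<Longrightarrow> g q = (f(N + i := v i)) q"
            by blast
          show "I (Suc i) s3" unfolding I_def
          proof (intro exI[of _ g] conjI allI impI)
            fix j assume "j < Suc i"
            then show "g (N + j) = v j" using g(3)[of "N + j"] i f(3) by (auto simp: less_Suc_eq)
          qed (use g in auto)
        qed simp
      qed
    qed (use fr1 s NM in \<open>auto simp: insert_body_def\<close>)
    then show ?thesis by (rule runs_weaken) (simp_all add: I_def)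
  qed
  have r3: "runs B (For 7 6 extract_body) (N * (1 + Tf + (1 + 40 + Ts) + 12) + 12) s1
    (\<lambda>s'. \<exists>rk vo. ranking N v rk vo \<and>
      (\<forall>j<N. s' 22 (int j) = Some (int (rk j))) \<and> (\<forall>r<N. s' 23 (int r) = Some (vo r)))"
    if init: "\<exists>f. stored N M s1 f \<and> heap N f \<and> (\<forall>j<N. f (N + j) = v j)" and fr1: "s1 6 = s 6" "s1 21 = s 21" "s1 12 = s 12" for s1
  proof -
    \<comment> \<open>\<open>S\<close> is the set of extracted leaves. The last clause, that no
      remaining value is below an extracted one, keeps \<open>vo\<close> sorted when the next
      minimum is appended.\<close>
    define I where "I i s' \<longleftrightarrow> (\<exists>f S rk vo. stored N M s' f \<and> heap N f \<and> S \<subseteq> {..<N} \<and> card S = i \<and>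
      (\<forall>j<N. f (N + j) = (if j \<in> S then big else v j)) \<and>
      (\<forall>j\<in>S. s' 22 (int j) = Some (int (rk j)) \<and> rk j < i \<and> vo (rk j) = v j) \<and>
      (\<forall>r<i. s' 23 (int r) = Some (vo r) \<and> (\<exists>j<N. vo r = v j)) \<and>
      (\<forall>r r'. r \<le> r' \<longrightarrow> r' < i \<longrightarrow> vo r \<le> vo r') \<and>
      (\<forall>r<i. \<forall>j<N. j \<notin> S \<longrightarrow> vo r \<le> v j))" for i s'
    have "runs B (For 7 6 extract_body) (N * (1 + Tf + (1 + 40 + Ts) + 12) + 12) s1 (I N)"
    proof (rule runs_For[where s = s1, OF fits])
      from init obtain f where "stored N M s1 f" "heap N f" "\<forall>j<N. f (N + j) = v j" by blast
      then show "I 0 s1" unfolding I_def by (intro exI[of _ f] exI[of _ "{}"]) auto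
      show "I i (s'(7 := x)) = I i s'" for i s' x by (simp add: I_def stored_def)
      fix i s' assume i: "i < N" and I: "I i s'" and s7: "s' 7 0 = Some (int i)"
        and fr: "\<And>a. a \<notin> insert 7 (writes extract_body) \<Longrightarrow> s' a = s1 a"
      from I obtain f S rk vo where f: "stored N M s' f" "heap N f" and S: "S \<subseteq> {..<N}" "card S = i"
        and leaf: "\<forall>j<N. f (N + j) = (if j \<in> S then big else v j)"
        and rk: "\<forall>j\<in>S. s' 22 (int j) = Some (int (rk j)) \<and> rk j < i \<and> vo (rk j) = v j"
        and vo: "\<forall>r<i. s' 23 (int r) = Some (vo r) \<and> (\<exists>j<N. vo r = v j)"
        and srt: "\<forall>r r'. r \<le> r' \<longrightarrow> r' < i \<longrightarrow> vo r \<le> vo r'"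
        and low: "\<forall>r<i. \<forall>j<N. j \<notin> S \<longrightarrow> vo r \<le> v j"
        unfolding I_def by blast
      have sc: "s' 6 0 = Some (int N)" "s' 12 0 = Some big" "s' 21 = s 21"
        using fr[of 6] fr[of 12] fr[of 21] fr1 s by (auto simp: extract_body_def)
      have iM: "int i \<le> M" using i NM by linarith
      show "runs B extract_body (1 + Tf + (1 + 40 + Ts)) s' (I (Suc i))"
        unfolding extract_body_def
      proof (rule runs_Seq)
        show "runs B find_com Tf s' (\<lambda>s'. \<exists>p. s' 10 0 = Some (int p) \<and> N \<le> p \<and> p < 2 * N \<and> f p = f 1)"
          unfolding Tf_def by (rule runs_find[OF fits M L N sc(1) f])
        fix s2 assume "\<exists>p. s2 10 0 = Some (int p) \<and> N \<le> p \<and> p < 2 * N \<and> f p = f 1"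
          and fr2: "\<And>a. a \<notin> writes find_com \<Longrightarrow> s2 a = s' a"
        then obtain p where p: "s2 10 0 = Some (int p)" "N \<le> p" "p < 2 * N" "f p = f 1" by blast
        define j where "j = p - N"
        have j: "j < N" "p = N + j" using p by (auto simp: j_def)
        have pmin: "f p \<le> f (N + h)" if "h < N" for h
          using heap_root_le[OF f(2), of "N + h"] that p by simp
        \<comment> \<open>Some leaf is left and its value is below \<open>big\<close>, so the leaf
          found, being minimal, cannot be one that was extracted before.\<close>
        have "S \<noteq> {..<N}" using S i by auto
        then obtain h where h: "h < N" "h \<notin> S" using S by auto
        have "f p \<le> v h" using pmin[OF h(1)] leaf h by auto
        also have "v h < big" using v[OF h(1)] by simp
        finally have "j \<notin> S" using leaf j by auto
        then have fp: "f p = v j" using leaf j by auto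
        have jmin: "v j \<le> v h" if "h < N" "h \<notin> S" for h using pmin[OF that(1)] leaf that fp by auto
        have s2': "s2 6 0 = Some (int N)" "s2 12 0 = Some big" "s2 21 = s 21" "s2 7 0 = Some (int i)"
          "s2 20 = s' 20" "s2 22 = s' 22" "s2 23 = s' 23"
          using fr2 sc s7 by auto
        have pM: "int p \<le> M" "int j \<le> M" using p j NM by linarith+
        show "runs B (Seq (Seq (Set 13 (Sub (Var 10) (Var 6))) (Seq (Assign 22 (Var 13) (Var 7))
             (Seq (Assign 23 (Var 7) (Cell 21 (Var 13))) (Set 11 (Var 12))))) update_com) (1 + 40 + Ts) s2 (I (Suc i))"
        proof (rule runs_Seq)
          have pj: "int p - int N = int j" using j by simp
          show "runs B (Seq (Set 13 (Sub (Var 10) (Var 6))) (Seq (Assign 22 (Var 13) (Var 7))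
             (Seq (Assign 23 (Var 7) (Cell 21 (Var 13))) (Set 11 (Var 12))))) 40 s2
            (\<lambda>s3. s3 10 0 = Some (int p) \<and> s3 11 0 = Some big \<and> s3 20 = s' 20 \<and>
               s3 22 = (s' 22)(int j \<mapsto> int i) \<and> s3 23 = (s' 23)(int i \<mapsto> v j))"
            by (rule runs_wpI[OF fits]) (use s2' p pM iM NM v[OF j(1)] s M in \<open>auto simp: pj\<close>)
          fix s3 :: mem assume s3: "s3 10 0 = Some (int p) \<and> s3 11 0 = Some big \<and> s3 20 = s' 20 \<and>
               s3 22 = (s' 22)(int j \<mapsto> int i) \<and> s3 23 = (s' 23)(int i \<mapsto> v j)"
          have "runs B update_com Ts s3 (\<lambda>s'. \<exists>g. stored N M s' g \<and> heap N g \<and>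
            (\<forall>q. N \<le> q \<longrightarrow> q < 2 * N \<longrightarrow> g q = (f(p := big)) q))"
            unfolding Ts_def using s3 f p s by (intro runs_update[OF fits M L]) (auto simp: stored_def)
          then show "runs B update_com Ts s3 (I (Suc i))"
          proof (rule runs_weaken)
            fix s4 assume "\<exists>g. stored N M s4 g \<and> heap N g \<and> (\<forall>q. N \<le> q \<longrightarrow> q < 2 * N \<longrightarrow> g q = (f(p := big)) q)"
              and fr4: "\<And>a. a \<notin> writes update_com \<Longrightarrow> s4 a = s3 a"
            then obtain g where g: "stored N M s4 g" "heap N g" "\<And>q. N \<le> q \<Longrightarrow> q < 2 * N \<Longrightarrow> g q = (f(p := big)) q"
              by blast
            have s4: "s4 22 = (s' 22)(int j \<mapsto> int i)" "s4 23 = (s' 23)(int i \<mapsto> v j)" using s3 fr4 by auto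
            have finS: "finite S" using S finite_subset by blast
            show "I (Suc i) s4" unfolding I_def
            proof (rule exI[of _ g], rule exI[of _ "insert j S"], rule exI[of _ "rk(j := i)"],
                rule exI[of _ "vo(i := v j)"], intro conjI)
              show "card (insert j S) = Suc i" using S \<open>j \<notin> S\<close> finS by simp
              show "\<forall>h<N. g (N + h) = (if h \<in> insert j S then big else v h)"
                using g(3) leaf j by auto
              show "\<forall>h\<in>insert j S. s4 22 (int h) = Some (int ((rk(j := i)) h)) \<and> (rk(j := i)) h < Suc i \<and>
                (vo(i := v j)) ((rk(j := i)) h) = v h"
                using rk \<open>j \<notin> S\<close> by (auto simp: s4)
              show "\<forall>r<Suc i. s4 23 (int r) = Some ((vo(i := v j)) r) \<and> (\<exists>h<N. (vo(i := v j)) r = v h)"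
                using vo j by (auto simp: s4 less_Suc_eq)
              show "\<forall>r r'. r \<le> r' \<longrightarrow> r' < Suc i \<longrightarrow> (vo(i := v j)) r \<le> (vo(i := v j)) r'"
                using srt low j \<open>j \<notin> S\<close> by (auto simp: less_Suc_eq)
              show "\<forall>r<Suc i. \<forall>h<N. h \<notin> insert j S \<longrightarrow> (vo(i := v j)) r \<le> v h"
                using low jmin by (auto simp: less_Suc_eq)
            qed (use g S j in auto)
          qed simp
        qed
      qed
    qed (use fr1 s NM in \<open>auto simp: extract_body_def\<close>)
    then show ?thesis
    proof (rule runs_weaken, simp)
      fix s' assume "I N s'"
      then obtain f S rk vo where S: "S \<subseteq> {..<N}" "card S = N"
        and rk: "\<forall>j\<in>S. s' 22 (int j) = Some (int (rk j)) \<and> rk j < N \<and> vo (rk j) = v j"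
        and vo: "\<forall>r<N. s' 23 (int r) = Some (vo r) \<and> (\<exists>j<N. vo r = v j)"
        and srt: "\<forall>r r'. r \<le> r' \<longrightarrow> r' < N \<longrightarrow> vo r \<le> vo r'"
        unfolding I_def by blast
      have "S = {..<N}" using S by (intro card_subset_eq) auto
      then show "\<exists>rk vo. ranking N v rk vo \<and>
        (\<forall>j<N. s' 22 (int j) = Some (int (rk j))) \<and> (\<forall>r<N. s' 23 (int r) = Some (vo r))"
        using rk vo srt unfolding ranking_def by (intro exI[of _ rk] exI[of _ vo]) auto
    qed
  qed
  have "runs B sort_com (1 + (2 * N * (6 + 12) + 12) + (1 + (N * (1 + 20 + Ts + 12) + 12) + (N * (1 + Tf + (1 + 40 + Ts) + 12) + 12))) s
    (\<lambda>s'. \<exists>rk vo. ranking N v rk vo \<and>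
      (\<forall>j<N. s' 22 (int j) = Some (int (rk j))) \<and> (\<forall>r<N. s' 23 (int r) = Some (vo r)))"
    unfolding sort_com_def
  proof (rule runs_Seq[OF r1], rule runs_Seq[OF r2])
    fix s1 assume "\<And>a. a \<notin> writes (For 7 8 (Assign 20 (Var 7) (Var 12))) \<Longrightarrow> s1 a = s a"
    then show "s1 6 = s 6" "s1 21 = s 21" by auto
  next
    fix s1 s2 assume "\<And>a. a \<notin> writes (For 7 8 (Assign 20 (Var 7) (Var 12))) \<Longrightarrow> s1 a = s a"
      "\<exists>f. stored N M s2 f \<and> heap N f \<and> (\<forall>j<N. f (N + j) = v j)"
      "\<And>a. a \<notin> writes (For 7 6 insert_body) \<Longrightarrow> s2 a = s1 a"
    then show "runs B (For 7 6 extract_body) (N * (1 + Tf + (1 + 40 + Ts) + 12) + 12) s2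
      (\<lambda>s'. \<exists>rk vo. ranking N v rk vo \<and>
      (\<forall>j<N. s' 22 (int j) = Some (int (rk j))) \<and> (\<forall>r<N. s' 23 (int r) = Some (vo r)))"
      by (intro r3) (auto simp: insert_body_def)
  qed
  then show ?thesis
  proof (rule runs_weaken)
    have "1 + (2 * N * (6 + 12) + 12) + (1 + (N * (1 + 20 + Ts + 12) + 12) + (N * (1 + Tf + (1 + 40 + Ts) + 12) + 12))
      = 38 + N * (2 * Ts + Tf + 123)" by (simp add: algebra_simps)
    also have "2 * Ts + Tf + 123 \<le> (L + 1) * (2 * cost sift_body + cost find_body + 200)"
      by (simp add: Ts_def Tf_def algebra_simps)
    then have "38 + N * (2 * Ts + Tf + 123) \<le> 100 + N * ((L + 1) * (2 * cost sift_body + cost find_body + 200))"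
      by (intro add_mono mult_left_mono) auto
    finally show "1 + (2 * N * (6 + 12) + 12) + (1 + (N * (1 + 20 + Ts + 12) + 12) + (N * (1 + Tf + (1 + 40 + Ts) + 12) + 12))
      \<le> 100 + N * ((L + 1) * (2 * cost sift_body + cost find_body + 200))" .
  qed
qed

section \<open>Exact minimax values from approximate sums\<close>

text \<open>The entries of rank \<open>r\<close> become \<open>2 powr (L * r)\<close>, and a result is decoded by dividing its binary
  logarithm by \<open>L\<close>. Entries \<open>\<infinity>\<close> take part in the sorting as 0; their ranks are never used. Cell 0 of array 12
  receives a value above all entries, which marks the leaves already extracted from the tree.\<close>

definition load_body :: com where
  "load_body = Seq
     (If_Less (Cell 1 (Mul (Const 2) (Var 7))) (Const 1)
       (Assign 21 (Var 7) (Cell 1 (Add (Mul (Const 2) (Var 7)) (Const 1))))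
       (Assign 21 (Var 7) (Const 0)))
     (If_Less (Cell 21 (Var 7)) (Var 12) Skip (Set 12 (Add (Cell 21 (Var 7)) (Const 1))))"

definition float_body :: "nat \<Rightarrow> com" where
  "float_body a = If_Less (Cell 1 (Mul (Const 2) (Var 7))) (Const 1)
     (Seq (Assign a (Mul (Const 3) (Var 7)) (Const 0))
       (Seq (Assign a (Add (Mul (Const 3) (Var 7)) (Const 1)) (Const 1))
         (Assign a (Add (Mul (Const 3) (Var 7)) (Const 2)) (Mul (Var 9) (Cell 22 (Var 7))))))
     (Assign a (Mul (Const 3) (Var 7)) (Const 1))"

definition half_body :: com where
  "half_body = Seq (Set 10 (Div (Var 10) (Const 2))) (Set 11 (Add (Var 11) (Const 1)))"

text \<open>A finite result with a mantissa below 1 can only be 0, the length of the empty path; it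
  is decoded as -\<infinity>, the minimax value of that path. Otherwise halving the mantissa down to
  1 leaves the rounded down binary logarithm in cell 0 of array 11.\<close>

definition decode_body :: "nat \<Rightarrow> com" where
  "decode_body a = If_Less (Cell a (Mul (Const 3) (Var 7))) (Const 1)
     (If_Less (Cell a (Add (Mul (Const 3) (Var 7)) (Const 1))) (Const 1)
       (Assign 2 (Mul (Const 2) (Var 7)) (Const (-1)))
       (Seq (Seq (Set 10 (Cell a (Add (Mul (Const 3) (Var 7)) (Const 1))))
                 (Set 11 (Cell a (Add (Mul (Const 3) (Var 7)) (Const 2)))))
         (Seq (While_Less (Const 1) (Var 10) half_body)
           (Seq (Assign 2 (Mul (Const 2) (Var 7)) (Const 0))
             (Assign 2 (Add (Mul (Const 2) (Var 7)) (Const 1)) (Cell 23 (Div (Var 11) (Var 9))))))))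
     (Assign 2 (Mul (Const 2) (Var 7)) (Const 1))"

text \<open>The matrix goes to arrays 1 and 2 of the callee, so that one program drives both APSP,
  which takes its input from the first, and the Min-Plus Product, which takes both. \<open>a\<close>
  is the callee's output array as the caller sees it. The accuracy passed on is 1, that is, a factor
  2.\<close>

definition rank_com :: "nat \<Rightarrow> com \<Rightarrow> com" where
  "rank_com a P =
    Seq (Seq (Set 6 (Mul (Var 0) (Var 0))) (Seq (Set 8 (Mul (Const 2) (Var 6))) (Seq (Set 12 (Const 0))
      (Seq (Set 9 (Add (Var 0) (Const 2))) (Seq (Set 50 (Var 0)) (Assign 50 (Const 1) (Const 1)))))))
    (Seq (For 7 6 load_body) (Seq sort_com (Seq (For 7 6 (float_body 51)) (Seq (For 7 6 (float_body 52))
      (Seq (shift_com 50 P) (For 7 6 (decode_body a)))))))"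

definition int_entry :: "mem \<Rightarrow> nat \<Rightarrow> nat \<Rightarrow> int option \<Rightarrow> bool" where
  "int_entry s a i x \<longleftrightarrow> (case x of None \<Rightarrow> s a (2 * int i) = Some 1
     | Some k \<Rightarrow> s a (2 * int i) = Some 0 \<and> s a (2 * int i + 1) = Some k)"

definition exp_entry :: "mem \<Rightarrow> nat \<Rightarrow> nat \<Rightarrow> int option \<Rightarrow> int \<Rightarrow> bool" where
  "exp_entry s a i x e \<longleftrightarrow> (case x of None \<Rightarrow> s a (3 * int i) = Some 1
     | Some k \<Rightarrow> s a (3 * int i) = Some 0 \<and> s a (3 * int i + 1) = Some 1 \<and> s a (3 * int i + 2) = Some e)"

text \<open>The window between consecutive powers of \<open>2 powr L\<close> identifies the rank
  \<open>r\<close> although the stored number is only approximate. The bound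
  \<open>m < 2 ^ k\<close> limits the halvings in \<open>decode_body\<close>.\<close>

definition decodable :: "nat \<Rightarrow> int \<Rightarrow> int \<Rightarrow> nat \<Rightarrow> mem \<Rightarrow> nat \<Rightarrow> nat \<Rightarrow> ereal \<Rightarrow> bool" where
  "decodable k M L N s a i g \<longleftrightarrow>
     (s a (3 * int i) = Some 1 \<and> g = \<infinity>) \<or>
     (s a (3 * int i) = Some 0 \<and> s a (3 * int i + 1) = Some 0 \<and> g = -\<infinity>) \<or>
     (\<exists>m e r. s a (3 * int i) = Some 0 \<and> s a (3 * int i + 1) = Some m \<and> s a (3 * int i + 2) = Some e \<and>
        1 \<le> m \<and> m \<le> M \<and> m < 2 ^ k \<and> \<bar>e\<bar> \<le> M \<and> r < N \<and> g = ereal (real r) \<and>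
        2 powr (real_of_int L * real r) \<le> real_of_int m * 2 powr real_of_int e \<and>
        real_of_int m * 2 powr real_of_int e < 2 powr (real_of_int L * (real r + 1)))"

text \<open>Extends \<open>vo\<close> from ranks to all extended reals. Floor and clipping at
  \<open>N - 1\<close> make the extension a total monotone map that fixes both infinities, the kind
  of map with which minimax values commute.\<close>

definition lift_rank :: "nat \<Rightarrow> (nat \<Rightarrow> int) \<Rightarrow> ereal \<Rightarrow> ereal" where
  "lift_rank N vo x = (if x = \<infinity> then \<infinity> else if x = -\<infinity> then -\<infinity>
     else ereal (real_of_int (vo (min (N - 1) (nat \<lfloor>real_of_ereal x\<rfloor>)))))"

lemma lift_rank_simps [simp]:
  "lift_rank N vo \<infinity> = \<infinity>" "lift_rank N vo (-\<infinity>) = -\<infinity>"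
  "r < N \<Longrightarrow> lift_rank N vo (ereal (real r)) = ereal (real_of_int (vo r))"
  by (simp_all add: lift_rank_def min_absorb2)

lemma writes_decode [simp]: "writes (decode_body a) = {2, 10, 11}"
  by (auto simp: decode_body_def half_body_def)

text \<open>Halving with rounding down keeps
  \<open>m' * 2 powr e' \<le> d < (m' + 1) * 2 powr e'\<close>. At \<open>m' = 1\<close> this makes
  \<open>e'\<close> the rounded down binary logarithm of \<open>d\<close>, and division by
  \<open>L\<close> leaves \<open>r\<close>.\<close>

lemma runs_log:
  assumes fits: "fits B M" and M: "4 \<le> M" and L: "1 \<le> L" "L * int N \<le> M"
    and s: "s 10 0 = Some m" "s 11 0 = Some e"
    and m: "1 \<le> m" "m \<le> M" "m < 2 ^ k" "\<bar>e\<bar> \<le> M" and r: "r < N"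
    and D: "2 powr (real_of_int L * real r) \<le> real_of_int m * 2 powr real_of_int e"
        "real_of_int m * 2 powr real_of_int e < 2 powr (real_of_int L * (real r + 1))"
  shows "runs B (While_Less (Const 1) (Var 10) half_body) ((k + 1) * (cost half_body + 10)) s
    (\<lambda>s'. \<exists>e'. s' 11 0 = Some e' \<and> \<bar>e'\<bar> \<le> M \<and> e' div L = int r)"
proof -
  define d where "d = real_of_int m * 2 powr real_of_int e"
  define I where "I k s' \<longleftrightarrow> (\<exists>m' e'. s' 10 0 = Some m' \<and> s' 11 0 = Some e' \<and> 1 \<le> m' \<and> m' \<le> M \<and> m' < 2 ^ (k + 1) \<and>
    e \<le> e' \<and> real_of_int m' * 2 powr real_of_int e' \<le> d \<and> d < (real_of_int m' + 1) * 2 powr real_of_int e')"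
    for k and s' :: mem
  \<comment> \<open>Keeps the growing exponent within the cell bound throughout the loop.\<close>
  have bound: "e' < L * (int r + 1)" if "1 \<le> m'" "real_of_int m' * 2 powr real_of_int e' \<le> d" for m' e'
  proof -
    have "1 * 2 powr real_of_int e' \<le> real_of_int m' * 2 powr real_of_int e'"
      using that by (intro mult_right_mono) auto
    then have "2 powr real_of_int e' < 2 powr (real_of_int L * (real r + 1))"
      using that(2) D(2) unfolding d_def by linarith
    then have "real_of_int e' < real_of_int L * (real r + 1)" by simp
    also have "\<dots> = real_of_int (L * (int r + 1))" by simp
    finally show ?thesis by (simp only: of_int_less_iff)
  qed
  have Lr: "L * (int r + 1) \<le> M"
  proof -
    have "L * (int r + 1) \<le> L * int N" using r L by (intro mult_left_mono) auto
    then show ?thesis using L by linarith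
  qed
  have "runs B (While_Less (Const 1) (Var 10) half_body)
     (k * (1 + ops (Const 1) + ops (Var 10) + cost half_body) + (1 + ops (Const 1) + ops (Var 10))) s
     (\<lambda>s''. (\<exists>j. I j s'') \<and> \<not> ival s'' (Const 1) < ival s'' (Var 10))"
  proof (rule runs_While[where I = I and k = k, OF fits])
    have "m < 2 ^ (k + 1)" using m by simp
    then show "I k s" unfolding I_def using s m by (auto simp: d_def algebra_simps)
    fix k s' assume "I k s'"
    then obtain m' e' where me: "s' 10 0 = Some m'" "s' 11 0 = Some e'" "1 \<le> m'" "m' \<le> M" "m' < 2 ^ (k + 1)"
      "e \<le> e'" "real_of_int m' * 2 powr real_of_int e' \<le> d" "d < (real_of_int m' + 1) * 2 powr real_of_int e'"
      unfolding I_def by blast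
    have e'M: "\<bar>e'\<bar> \<le> M" using bound[OF me(3,7)] Lr me(6) m(4) by linarith
    show "safe M s' (Const 1) \<and> safe M s' (Var 10)" using me M by auto
    assume "ival s' (Const 1) < ival s' (Var 10)"
    then have m2: "2 \<le> m'" using me by simp
    have k: "0 < k" using me m2 by (cases k) auto
    have I: "I (k - 1) (s'(10 := (s' 10)(0 \<mapsto> m' div 2), 11 := (s' 11)(0 \<mapsto> e' + 1)))"
      unfolding I_def
    proof (rule exI[of _ "m' div 2"], rule exI[of _ "e' + 1"], intro conjI)
      have "(2::int) ^ (k + 1) = 2 * 2 ^ (k - 1 + 1)" using k by simp
      then show "m' div 2 < 2 ^ (k - 1 + 1)" using me(5) by linarith
      have "real_of_int (2 * (m' div 2)) \<le> real_of_int m'" unfolding of_int_le_iff by linarith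
      then have "real_of_int (m' div 2) * 2 \<le> real_of_int m'" by simp
      then have "(real_of_int (m' div 2) * 2) * 2 powr real_of_int e' \<le> real_of_int m' * 2 powr real_of_int e'"
        by (intro mult_right_mono) auto
      moreover have "real_of_int (m' div 2) * 2 powr real_of_int (e' + 1) =
        (real_of_int (m' div 2) * 2) * 2 powr real_of_int e'" by (simp add: powr_add)
      ultimately show "real_of_int (m' div 2) * 2 powr real_of_int (e' + 1) \<le> d"
        using me(7) by linarith
      have "real_of_int (m' + 1) \<le> real_of_int (2 * (m' div 2) + 2)" unfolding of_int_le_iff by linarith
      then have "real_of_int m' + 1 \<le> (real_of_int (m' div 2) + 1) * 2" by simp
      then have "(real_of_int m' + 1) * 2 powr real_of_int e' \<le> ((real_of_int (m' div 2) + 1) * 2) * 2 powr real_of_int e'"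
        by (intro mult_right_mono) auto
      moreover have "(real_of_int (m' div 2) + 1) * 2 powr real_of_int (e' + 1) =
        ((real_of_int (m' div 2) + 1) * 2) * 2 powr real_of_int e'" by (simp add: powr_add)
      ultimately show "d < (real_of_int (m' div 2) + 1) * 2 powr real_of_int (e' + 1)"
        using me(8) by linarith
      show "m' div 2 \<le> M" using me(4) m2 by linarith
    qed (use m2 me(6) in auto)
    show "0 < k \<and> runs B half_body (cost half_body) s' (I (k - 1))"
    proof (intro conjI k)
      show "runs B half_body (cost half_body) s' (I (k - 1))"
        unfolding half_body_def
        apply (rule runs_wp[OF fits])
        using me e'M M I by auto
    qed
  qed auto
  then show ?thesis
  proof (rule runs_weaken)
    fix s' assume *: "(\<exists>j. I j s') \<and> \<not> ival s' (Const 1) < ival s' (Var 10)"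
    then obtain m' e' where me: "s' 10 0 = Some m'" "s' 11 0 = Some e'" "1 \<le> m'"
      "e \<le> e'" "real_of_int m' * 2 powr real_of_int e' \<le> d" "d < (real_of_int m' + 1) * 2 powr real_of_int e'"
      unfolding I_def by blast
    then have m1: "m' = 1" using * by simp
    have up: "e' < L * (int r + 1)" by (rule bound[OF me(3,5)])
    have "2 powr (real_of_int L * real r) < 2 powr (real_of_int e' + 1)"
      using D(1) me(6) m1 by (simp add: d_def powr_add)
    then have "real_of_int (L * int r) < real_of_int (e' + 1)" by simp
    then have lo: "L * int r \<le> e'" unfolding of_int_less_iff by simp
    have "e' div L = int r"
    proof (rule int_div_pos_eq)
      show "e' = L * int r + (e' - L * int r)" by simp
      show "0 \<le> e' - L * int r" "e' - L * int r < L" using lo up by (auto simp: algebra_simps)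
    qed
    moreover have "\<bar>e'\<bar> \<le> M" using up Lr me(4) m(4) by linarith
    ultimately show "\<exists>e'. s' 11 0 = Some e' \<and> \<bar>e'\<bar> \<le> M \<and> e' div L = int r" using me by blast
  qed (simp add: algebra_simps)
qed

lemma runs_decode:
  assumes fits: "fits B M" and M: "4 \<le> M" and L: "1 \<le> L" "L * int N \<le> M" "s 9 0 = Some L" "L \<le> M"
    and a: "a \<notin> {2, 10, 11}" and i: "s 7 0 = Some (int i)" "int i \<le> M"
    and vo: "\<And>r. r < N \<Longrightarrow> s 23 (int r) = Some (vo r) \<and> \<bar>vo r\<bar> \<le> M"
    and dec: "decodable k M L N s a i g"
  shows "runs B (decode_body a) (100 + (k + 1) * (cost half_body + 10)) s
    (\<lambda>s'. holds_int s' 2 i (lift_rank N vo g) \<and>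
      (\<forall>x. x < int 2 * int i \<or> int 2 * int i + int 2 \<le> x \<longrightarrow> s' 2 x = s 2 x))"
    (is "runs _ _ _ _ ?Q")
proof -
  consider (inf) "s a (3 * int i) = Some 1" "g = \<infinity>"
    | (minf) "s a (3 * int i) = Some 0" "s a (3 * int i + 1) = Some 0" "g = -\<infinity>"
    | (fin) m e r where "s a (3 * int i) = Some 0" "s a (3 * int i + 1) = Some m" "s a (3 * int i + 2) = Some e"
        "1 \<le> m" "m \<le> M" "m < 2 ^ k" "\<bar>e\<bar> \<le> M" "r < N" "g = ereal (real r)"
        "2 powr (real_of_int L * real r) \<le> real_of_int m * 2 powr real_of_int e"
        "real_of_int m * 2 powr real_of_int e < 2 powr (real_of_int L * (real r + 1))"
    using dec unfolding decodable_def by blast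
  then show ?thesis
  proof cases
    case inf
    have "wp M (If_Less (Cell a (Mul (Const 3) (Var 7))) (Const 1) Skip (Assign 2 (Mul (Const 2) (Var 7)) (Const 1))) s ?Q"
      using inf i M by (auto simp: holds_int_def)
    then have "runs B (Assign 2 (Mul (Const 2) (Var 7)) (Const 1)) 10 s ?Q"
      using inf by (intro runs_wpI[OF fits]) (auto simp: i)
    then have "runs B (decode_body a) (1 + ops (Cell a (Mul (Const 3) (Var 7))) + ops (Const 1) + 10) s ?Q"
      unfolding decode_body_def using inf i M by (intro runs_If[OF fits]) auto
    then show ?thesis by (rule runs_weaken) auto
  next
    case minf
    have "runs B (Assign 2 (Mul (Const 2) (Var 7)) (Const (-1))) 10 s ?Q"
      using minf i M by (intro runs_wpI[OF fits]) (auto simp: holds_int_def)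
    then have "runs B (decode_body a) (1 + ops (Cell a (Mul (Const 3) (Var 7))) + ops (Const 1) +
       (1 + ops (Cell a (Add (Mul (Const 3) (Var 7)) (Const 1))) + ops (Const 1) + 10)) s ?Q"
      unfolding decode_body_def using minf i M by (intro runs_If[OF fits]) auto
    then show ?thesis by (rule runs_weaken) auto
  next
    case fin
    have "runs B (Seq (Seq (Set 10 (Cell a (Add (Mul (Const 3) (Var 7)) (Const 1))))
                 (Set 11 (Cell a (Add (Mul (Const 3) (Var 7)) (Const 2)))))
         (Seq (While_Less (Const 1) (Var 10) half_body)
           (Seq (Assign 2 (Mul (Const 2) (Var 7)) (Const 0))
             (Assign 2 (Add (Mul (Const 2) (Var 7)) (Const 1)) (Cell 23 (Div (Var 11) (Var 9)))))))
      (1 + 30 + (1 + (k + 1) * (cost half_body + 10) + 30)) s ?Q"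
    proof (rule runs_Seq)
      show "runs B (Seq (Set 10 (Cell a (Add (Mul (Const 3) (Var 7)) (Const 1))))
        (Set 11 (Cell a (Add (Mul (Const 3) (Var 7)) (Const 2))))) 30 s
        (\<lambda>s'. s' 10 0 = Some m \<and> s' 11 0 = Some e)"
        using fin i M a by (intro runs_wpI[OF fits]) auto
      fix s1 :: mem assume s1: "s1 10 0 = Some m \<and> s1 11 0 = Some e"
        and fr1: "\<And>b. b \<notin> writes (Seq (Set 10 (Cell a (Add (Mul (Const 3) (Var 7)) (Const 1))))
        (Set 11 (Cell a (Add (Mul (Const 3) (Var 7)) (Const 2))))) \<Longrightarrow> s1 b = s b"
      show "runs B (Seq (While_Less (Const 1) (Var 10) half_body)
           (Seq (Assign 2 (Mul (Const 2) (Var 7)) (Const 0))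
             (Assign 2 (Add (Mul (Const 2) (Var 7)) (Const 1)) (Cell 23 (Div (Var 11) (Var 9))))))
          (1 + (k + 1) * (cost half_body + 10) + 30) s1 ?Q"
      proof (rule runs_Seq)
        show "runs B (While_Less (Const 1) (Var 10) half_body) ((k + 1) * (cost half_body + 10)) s1
          (\<lambda>s'. \<exists>e'. s' 11 0 = Some e' \<and> \<bar>e'\<bar> \<le> M \<and> e' div L = int r)"
          by (rule runs_log[where s = s1, OF fits M L(1,2) conjunct1[OF s1] conjunct2[OF s1]]) (use fin in auto)
        fix s2 assume "\<exists>e'. s2 11 0 = Some e' \<and> \<bar>e'\<bar> \<le> M \<and> e' div L = int r"
          and fr2: "\<And>b. b \<notin> writes (While_Less (Const 1) (Var 10) half_body) \<Longrightarrow> s2 b = s1 b"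
        then obtain e' where e': "s2 11 0 = Some e'" "\<bar>e'\<bar> \<le> M" "e' div L = int r" by blast
        have fr: "s2 b = s b" if "b \<notin> {10, 11}" for b using that fr1[of b] fr2[of b] by (simp add: half_body_def)
        have sc: "s2 7 0 = Some (int i)" "s2 9 0 = Some L" "s2 23 (int r) = Some (vo r)" "\<bar>vo r\<bar> \<le> M" "s2 2 = s 2"
          using fr i L vo[OF \<open>r < N\<close>] by auto
        show "runs B (Seq (Assign 2 (Mul (Const 2) (Var 7)) (Const 0))
             (Assign 2 (Add (Mul (Const 2) (Var 7)) (Const 1)) (Cell 23 (Div (Var 11) (Var 9))))) 30 s2 ?Q"
          using sc e' i M L fin by (intro runs_wpI[OF fits]) (auto simp: holds_int_def)
      qed
    qed
    then have "runs B (decode_body a) (1 + ops (Cell a (Mul (Const 3) (Var 7))) + ops (Const 1) +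
       (1 + ops (Cell a (Add (Mul (Const 3) (Var 7)) (Const 1))) + ops (Const 1) +
         (1 + 30 + (1 + (k + 1) * (cost half_body + 10) + 30)))) s ?Q"
      unfolding decode_body_def using fin i M by (intro runs_If[OF fits]) auto
    then show ?thesis by (rule runs_weaken) auto
  qed
qed

lemma runs_float_pass:
  assumes fits: "fits B M" and M: "4 \<le> M" "int N \<le> M" and s: "s 6 0 = Some (int N)" "s 9 0 = Some L" "\<bar>L\<bar> \<le> M"
    and a: "a \<in> {51, 52}" and x: "\<And>i. i < N \<Longrightarrow> int_entry s 1 i (x i)"
    and rk: "\<And>i. i < N \<Longrightarrow> s 22 (int i) = Some (int (rk i)) \<and> rk i < N"
  shows "runs B (For 7 6 (float_body a)) (N * (cost (float_body a) + 12) + 12) s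
    (\<lambda>s'. \<forall>i<N. exp_entry s' a i (x i) (L * int (rk i)))"
proof (rule runs_map[where dst = a and d = 3 and s = s, OF fits])
  show "exp_entry s1 a i (x i) (L * int (rk i)) \<Longrightarrow> exp_entry s2 a i (x i) (L * int (rk i))"
    if "\<And>x. int 3 * int i \<le> x \<Longrightarrow> x < int 3 * int i + int 3 \<Longrightarrow> s1 a x = s2 a x" for i s1 s2
    using that[of "3 * int i"] that[of "3 * int i + 1"] that[of "3 * int i + 2"]
    by (auto simp: exp_entry_def split: option.splits)
  fix i s' assume i: "i < N" and s7: "s' 7 0 = Some (int i)"
    and fr: "\<And>b. b \<notin> insert 7 (writes (float_body a)) \<Longrightarrow> s' b = s b"
  have sc: "s' 1 = s 1" "s' 9 = s 9" "s' 22 = s 22" using fr a by (auto simp: float_body_def)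
  have iM: "int i \<le> M" "int (rk i) \<le> M" using i rk[OF i] M by linarith+
  show "runs B (float_body a) (cost (float_body a)) s' (\<lambda>s''. exp_entry s'' a i (x i) (L * int (rk i)) \<and>
      (\<forall>x. x < int 3 * int i \<or> int 3 * int i + int 3 \<le> x \<longrightarrow> s'' a x = s' a x))"
  proof (cases "x i")
    case None
    then show ?thesis unfolding float_body_def
      using x[OF i] s7 sc iM M a by (intro runs_wp[OF fits]) (auto simp: exp_entry_def int_entry_def)
  next
    case (Some k)
    then show ?thesis unfolding float_body_def
      using x[OF i] s7 sc iM M a rk[OF i] s by (intro runs_wp[OF fits]) (auto simp: exp_entry_def int_entry_def)
  qed
qed (use s M a in \<open>auto simp: float_body_def\<close>)

text \<open>The bound \<open>\<bar>k\<bar> < M\<close> is strict because \<open>big\<close> may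
  become \<open>k + 1\<close>.\<close>

lemma runs_load:
  assumes fits: "fits B M" and M: "4 \<le> M" "int N \<le> M" and s: "s 6 0 = Some (int N)" "s 12 0 = Some 0"
    and x: "\<And>i. i < N \<Longrightarrow> int_entry s 1 i (x i)" "\<And>i k. i < N \<Longrightarrow> x i = Some k \<Longrightarrow> \<bar>k\<bar> < M"
  shows "runs B (For 7 6 load_body) (N * (cost load_body + 12) + 12) s
    (\<lambda>s'. \<exists>big. s' 12 0 = Some big \<and> \<bar>big\<bar> \<le> M \<and>
      (\<forall>i<N. s' 21 (int i) = Some (case x i of None \<Rightarrow> 0 | Some k \<Rightarrow> k) \<and>
        (case x i of None \<Rightarrow> 0 | Some k \<Rightarrow> k) < big))"
proof -
  let ?v = "\<lambda>i. case x i of None \<Rightarrow> 0 | Some k \<Rightarrow> k"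
  define I where "I n s' \<longleftrightarrow> (\<exists>big. s' 12 0 = Some big \<and> 0 \<le> big \<and> big \<le> M \<and>
      (\<forall>i<n. s' 21 (int i) = Some (?v i) \<and> ?v i < big))" for n and s' :: mem
  have "runs B (For 7 6 load_body) (N * (cost load_body + 12) + 12) s (I N)"
  proof (rule runs_For[where s = s, OF fits])
    show "I 0 s" using s M by (auto simp: I_def)
    show "I i (s'(7 := x)) = I i s'" for i s' x by (simp add: I_def)
    fix i s' assume i: "i < N" and I: "I i s'" and s7: "s' 7 0 = Some (int i)"
      and fr: "\<And>a. a \<notin> insert 7 (writes load_body) \<Longrightarrow> s' a = s a"
    from I obtain big where big: "s' 12 0 = Some big" "0 \<le> big" "big \<le> M"
      "\<forall>j<i. s' 21 (int j) = Some (?v j) \<and> ?v j < big" unfolding I_def by blast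
    have sc: "s' 1 = s 1" using fr[of 1] by (simp add: load_body_def)
    have iM: "int i \<le> M" using i M by linarith
    have vM: "\<bar>?v i\<bar> < M" using x(2)[OF i] M by (cases "x i") auto
    have *: "I (Suc i) (s'(21 := (s' 21)(int i \<mapsto> ?v i)))" if "?v i < big"
      unfolding I_def using big that by (intro exI[of _ big]) (auto simp: less_Suc_eq)
    have **: "I (Suc i) (s'(21 := (s' 21)(int i \<mapsto> ?v i), 12 := (s' 12)(0 \<mapsto> ?v i + 1)))" if "\<not> ?v i < big"
      unfolding I_def
    proof (intro exI[of _ "?v i + 1"] conjI allI impI)
      fix j assume "j < Suc i"
      show "?v j < ?v i + 1"
      proof (cases "j = i")
        case False
        then have "?v j < big" using big(4) \<open>j < Suc i\<close> by simp
        then show ?thesis using that by linarith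
      qed simp
    qed (use big that vM in \<open>auto simp: less_Suc_eq\<close>)
    show "runs B load_body (cost load_body) s' (I (Suc i))"
    proof (cases "x i")
      case None
      then show ?thesis unfolding load_body_def
        using x(1)[OF i] s7 sc iM M big vM * ** by (intro runs_wp[OF fits]) (auto simp: int_entry_def)
    next
      case (Some k)
      then show ?thesis unfolding load_body_def
        using x(1)[OF i] s7 sc iM M big vM * ** by (intro runs_wp[OF fits]) (auto simp: int_entry_def)
    qed
  qed (use s M in \<open>auto simp: load_body_def\<close>)
  then show ?thesis by (rule runs_weaken) (auto simp: I_def)
qed

text \<open>The ranking is found at run time, so the contract of the callee is given for every
  ranking, and \<open>g rk\<close> is the exact result on the ranks \<open>rk\<close>.
  \<open>2 ^ lg\<close> bounds the number of entries and \<open>2 ^ k\<close> the mantissas of the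
  results, so \<open>lg\<close> and \<open>k\<close> bound the inner loops.\<close>

lemma runs_rank:
  assumes fits: "fits B M" and n: "1 \<le> n" and M: "4 \<le> M" "(int n + 2) * int (n * n) \<le> M"
    and lg: "n * n \<le> 2 ^ lg" and s0: "s 0 0 = Some (int n)"
    and x: "\<And>i. i < n * n \<Longrightarrow> int_entry s 1 i (x i)" "\<And>i k. i < n * n \<Longrightarrow> x i = Some k \<Longrightarrow> \<bar>k\<bar> < M"
    and v: "v = (\<lambda>i. case x i of None \<Rightarrow> 0 | Some k \<Rightarrow> k)"
    and a: "a \<in> {2, 3}"
    and call: "\<And>rk vo s1. ranking (n * n) v rk vo \<Longrightarrow> s1 0 0 = Some (int n) \<Longrightarrow> s1 0 1 = Some 1 \<Longrightarrow>
       (\<forall>i<n*n. exp_entry s1 1 i (x i) ((int n + 2) * int (rk i))) \<Longrightarrow>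
       (\<forall>i<n*n. exp_entry s1 2 i (x i) ((int n + 2) * int (rk i))) \<Longrightarrow>
       \<exists>t s2. exec B' P s1 t s2 \<and> t \<le> T \<and>
         (\<forall>i<n*n. decodable k M (int n + 2) (n * n) s2 a i (g rk i))"
    and B': "B' \<le> B"
  shows "runs B (rank_com (a + 50) P)
    (300 + n * n * ((lg + k + 1) * (2 * cost sift_body + cost find_body + cost load_body + cost (float_body 51)
      + cost (float_body 52) + cost half_body + 500)) + T) s
    (\<lambda>s'. \<exists>rk vo. ranking (n * n) v rk vo \<and> (\<forall>i<n*n. holds_int s' 2 i (lift_rank (n * n) vo (g rk i))))"
proof -
  define N where "N = n * n"
  define L where "L = int n + 2"
  have N1: "1 \<le> N" using n by (simp add: N_def)
  have nN: "n \<le> N" using n by (simp add: N_def)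
  have L: "1 \<le> L" "L * int N \<le> M" using M by (auto simp: L_def N_def)
  have "3 * int N \<le> L * int N" using n by (intro mult_right_mono) (auto simp: L_def)
  then have NM: "2 * int N \<le> M" "int N \<le> M" using L by linarith+
  have "L * 1 \<le> L * int N" using L N1 by (intro mult_left_mono) auto
  then have LM: "L \<le> M" using L by linarith
  have nM: "int n \<le> M" using nN NM by linarith
  have vM: "\<bar>v i\<bar> \<le> M" if "i < N" for i
    using x(2)[of i] that M unfolding v N_def by (cases "x i") fastforce+
  define T1 where "T1 = N * (cost load_body + 12) + 12"
  define T2 where "T2 = 100 + N * ((lg + 1) * (2 * cost sift_body + cost find_body + 200))"
  define T3 where "T3 = N * (cost (float_body 51) + 12) + 12"
  define T4 where "T4 = N * (cost (float_body 52) + 12) + 12"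
  define T5 where "T5 = N * (100 + (k + 1) * (cost half_body + 10) + 12) + 12"
  define Q where "Q s' \<longleftrightarrow> (\<exists>rk vo. ranking N v rk vo \<and> (\<forall>i<N. holds_int s' 2 i (lift_rank N vo (g rk i))))" for s'
  have "runs B (rank_com (a + 50) P) (1 + 60 + (1 + T1 + (1 + T2 + (1 + T3 + (1 + T4 + (1 + T + T5)))))) s Q"
    unfolding rank_com_def
  proof (rule runs_Seq)
    show "runs B (Seq (Set 6 (Mul (Var 0) (Var 0))) (Seq (Set 8 (Mul (Const 2) (Var 6))) (Seq (Set 12 (Const 0))
      (Seq (Set 9 (Add (Var 0) (Const 2))) (Seq (Set 50 (Var 0)) (Assign 50 (Const 1) (Const 1))))))) 60 s
      (\<lambda>s'. s' 6 0 = Some (int N) \<and> s' 8 0 = Some (int (2 * N)) \<and> s' 12 0 = Some 0 \<and> s' 9 0 = Some L \<and>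
        s' 50 0 = Some (int n) \<and> s' 50 1 = Some 1 \<and> s' 1 = s 1)"
      using s0 M nM NM by (intro runs_wpI[OF fits]) (auto simp: N_def L_def)
    fix s1 :: mem assume s1: "s1 6 0 = Some (int N) \<and> s1 8 0 = Some (int (2 * N)) \<and> s1 12 0 = Some 0 \<and> s1 9 0 = Some L \<and>
        s1 50 0 = Some (int n) \<and> s1 50 1 = Some 1 \<and> s1 1 = s 1"
    have x1: "int_entry s1 1 i (x i)" if "i < N" for i
      using x(1)[of i] that s1 by (auto simp: int_entry_def N_def split: option.splits)
    show "runs B (Seq (For 7 6 load_body) (Seq sort_com (Seq (For 7 6 (float_body 51)) (Seq (For 7 6 (float_body 52))
      (Seq (shift_com 50 P) (For 7 6 (decode_body (a + 50)))))))) (1 + T1 + (1 + T2 + (1 + T3 + (1 + T4 + (1 + T + T5))))) s1 Q"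
    proof (rule runs_Seq)
      show "runs B (For 7 6 load_body) T1 s1 (\<lambda>s'. \<exists>big. s' 12 0 = Some big \<and> \<bar>big\<bar> \<le> M \<and>
        (\<forall>i<N. s' 21 (int i) = Some (case x i of None \<Rightarrow> 0 | Some k \<Rightarrow> k) \<and>
          (case x i of None \<Rightarrow> 0 | Some k \<Rightarrow> k) < big))"
        unfolding T1_def using s1 x1 x(2) M NM by (intro runs_load[OF fits]) (auto simp: N_def)
      fix s2 assume "\<exists>big. s2 12 0 = Some big \<and> \<bar>big\<bar> \<le> M \<and>
        (\<forall>i<N. s2 21 (int i) = Some (case x i of None \<Rightarrow> 0 | Some k \<Rightarrow> k) \<and>
          (case x i of None \<Rightarrow> 0 | Some k \<Rightarrow> k) < big)"
        and fr2: "\<And>b. b \<notin> writes (For 7 6 load_body) \<Longrightarrow> s2 b = s1 b"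
      then obtain big where big: "s2 12 0 = Some big" "\<bar>big\<bar> \<le> M" "\<And>i. i < N \<Longrightarrow> s2 21 (int i) = Some (v i) \<and> v i < big"
        unfolding v by blast
      have f2: "s2 6 = s1 6" "s2 8 = s1 8" "s2 9 = s1 9" "s2 50 = s1 50" "s2 1 = s1 1"
        using fr2 by (auto simp: load_body_def)
      show "runs B (Seq sort_com (Seq (For 7 6 (float_body 51)) (Seq (For 7 6 (float_body 52))
        (Seq (shift_com 50 P) (For 7 6 (decode_body (a + 50))))))) (1 + T2 + (1 + T3 + (1 + T4 + (1 + T + T5)))) s2 Q"
      proof (rule runs_Seq)
        show "runs B sort_com T2 s2 (\<lambda>s'. \<exists>rk vo. ranking N v rk vo \<and>
          (\<forall>j<N. s' 22 (int j) = Some (int (rk j))) \<and> (\<forall>r<N. s' 23 (int r) = Some (vo r)))"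
          unfolding T2_def using s1 f2 big vM lg N1 M NM
          by (intro runs_sort[OF fits NM(1) M(1)]) (auto simp: N_def)
        fix s3 assume "\<exists>rk vo. ranking N v rk vo \<and>
          (\<forall>j<N. s3 22 (int j) = Some (int (rk j))) \<and> (\<forall>r<N. s3 23 (int r) = Some (vo r))"
          and fr3: "\<And>b. b \<notin> writes sort_com \<Longrightarrow> s3 b = s2 b"
        then obtain rk vo where rk: "ranking N v rk vo" "\<And>j. j < N \<Longrightarrow> s3 22 (int j) = Some (int (rk j))"
          "\<And>r. r < N \<Longrightarrow> s3 23 (int r) = Some (vo r)" by blast
        have rkN: "\<And>j. j < N \<Longrightarrow> rk j < N" using rk(1) by (simp add: ranking_def)
        have voM: "\<And>r. r < N \<Longrightarrow> \<bar>vo r\<bar> \<le> M" using rk(1) vM unfolding ranking_def by metis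
        have f3: "s3 6 = s1 6" "s3 9 = s1 9" "s3 50 = s1 50" "s3 1 = s1 1" using fr3 f2 by auto
        have x3: "int_entry s3 1 i (x i)" if "i < N" for i using x1[OF that] f3 by (auto simp: int_entry_def split: option.splits)
        show "runs B (Seq (For 7 6 (float_body 51)) (Seq (For 7 6 (float_body 52))
          (Seq (shift_com 50 P) (For 7 6 (decode_body (a + 50)))))) (1 + T3 + (1 + T4 + (1 + T + T5))) s3 Q"
        proof (rule runs_Seq)
          show "runs B (For 7 6 (float_body 51)) T3 s3 (\<lambda>s'. \<forall>i<N. exp_entry s' 51 i (x i) (L * int (rk i)))"
            unfolding T3_def using f3 s1 x3 rk rkN L LM M NM by (intro runs_float_pass[OF fits]) auto
          fix s4 assume e4: "\<forall>i<N. exp_entry s4 51 i (x i) (L * int (rk i))"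
            and fr4: "\<And>b. b \<notin> writes (For 7 6 (float_body 51)) \<Longrightarrow> s4 b = s3 b"
          have f4: "s4 6 = s1 6" "s4 9 = s1 9" "s4 50 = s1 50" "s4 1 = s1 1" "s4 22 = s3 22" "s4 23 = s3 23"
            using fr4 f3 by (auto simp: float_body_def)
          have x4: "int_entry s4 1 i (x i)" if "i < N" for i using x1[OF that] f4 by (auto simp: int_entry_def split: option.splits)
          show "runs B (Seq (For 7 6 (float_body 52))
            (Seq (shift_com 50 P) (For 7 6 (decode_body (a + 50))))) (1 + T4 + (1 + T + T5)) s4 Q"
          proof (rule runs_Seq)
            show "runs B (For 7 6 (float_body 52)) T4 s4 (\<lambda>s'. \<forall>i<N. exp_entry s' 52 i (x i) (L * int (rk i)))"
              unfolding T4_def using f4 s1 x4 rk rkN L LM M NM by (intro runs_float_pass[OF fits]) auto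
            fix s5 assume e5: "\<forall>i<N. exp_entry s5 52 i (x i) (L * int (rk i))"
              and fr5: "\<And>b. b \<notin> writes (For 7 6 (float_body 52)) \<Longrightarrow> s5 b = s4 b"
            have f5: "s5 6 = s1 6" "s5 9 = s1 9" "s5 50 = s1 50" "s5 23 = s3 23" "s5 51 = s4 51"
              using fr5 f4 by (auto simp: float_body_def)
            have ee: "exp_entry (\<lambda>a. s5 (a + 50)) 1 i y z = exp_entry s4 51 i y z"
              "exp_entry (\<lambda>a. s5 (a + 50)) 2 i y z = exp_entry s5 52 i y z" for i y z
              by (cases y; simp add: exp_entry_def f5)+
            obtain t s6 where P: "exec B' P (\<lambda>a. s5 (a + 50)) t s6" "t \<le> T"
              "\<forall>i<N. decodable k M L N s6 a i (g rk i)"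
              using call[of rk vo "\<lambda>a. s5 (a + 50)"] rk(1) e4 e5 s1 f5
              unfolding ee N_def L_def by auto
            show "runs B (Seq (shift_com 50 P) (For 7 6 (decode_body (a + 50)))) (1 + T + T5) s5 Q"
            proof (rule runs_Seq[OF runs_shift[OF P(1) B' P(2)]])
              fix s7 assume s7: "(\<forall>a. s7 (a + 50) = s6 a) \<and> (\<forall>a<50. s7 a = s5 a)"
              have f7: "s7 6 0 = Some (int N)" "s7 9 0 = Some L" "s7 23 = s3 23" "s7 (a + 50) = s6 a"
                using s7 f5 s1 by auto
              have "runs B (For 7 6 (decode_body (a + 50))) T5 s7
                 (\<lambda>s'. \<forall>i<N. holds_int s' 2 i (lift_rank N vo (g rk i)))"
                unfolding T5_def
              proof (rule runs_map[where dst = 2 and d = 2 and s = s7, OF fits])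
                show "holds_int t1 2 i z \<Longrightarrow> holds_int t2 2 i z"
                  if "\<And>x. int 2 * int i \<le> x \<Longrightarrow> x < int 2 * int i + int 2 \<Longrightarrow> t1 2 x = t2 2 x" for i t1 t2 z
                  using that[of "2 * int i"] that[of "2 * int i + 1"] by (auto simp: holds_int_def)
                fix i s' assume i: "i < N" and s'7: "s' 7 0 = Some (int i)"
                  and fr: "\<And>b. b \<notin> insert 7 (writes (decode_body (a + 50))) \<Longrightarrow> s' b = s7 b"
                have sc: "s' 9 0 = Some L" "s' 23 = s3 23" "s' (a + 50) = s6 a"
                  using fr[of 9] fr[of 23] fr[of "a + 50"] f7 a by auto
                have iM: "int i \<le> M" using i NM by linarith
                have "decodable k M L N s' (a + 50) i (g rk i)"
                  using P(3) i sc(3) by (simp add: decodable_def)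
                then show "runs B (decode_body (a + 50)) (100 + (k + 1) * (cost half_body + 10)) s'
                  (\<lambda>s''. holds_int s'' 2 i (lift_rank N vo (g rk i)) \<and>
                   (\<forall>x. x < int 2 * int i \<or> int 2 * int i + int 2 \<le> x \<longrightarrow> s'' 2 x = s' 2 x))"
                  using sc rk(3) voM s'7 iM L LM a by (intro runs_decode[OF fits M(1)]) auto
              qed (use f7 NM a in auto)
              then show "runs B (For 7 6 (decode_body (a + 50))) T5 s7 Q"
                by (rule runs_weaken) (use rk(1) in \<open>auto simp: Q_def\<close>)
            qed
          qed
        qed
      qed
    qed
  qed
  then have "runs B (rank_com (a + 50) P)
    (300 + N * ((lg + k + 1) * (2 * cost sift_body + cost find_body + cost load_body + cost (float_body 51)
      + cost (float_body 52) + cost half_body + 500)) + T) s Q"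
  proof (rule runs_weaken)
    define z where "z = lg + k + 1"
    define c1 c2 c3 c4 c5 c6 where cs: "c1 = 2 * cost sift_body + cost find_body" "c2 = cost load_body"
      "c3 = cost (float_body 51)" "c4 = cost (float_body 52)" "c5 = cost half_body" "c6 = (500::nat)"
    have z: "lg + 1 \<le> z" "k + 1 \<le> z" "1 \<le> z" by (auto simp: z_def)
    have zc: "c \<le> z * c" for c using z(3) by (metis mult_le_mono1 nat_mult_1)
    have "c2 + 12 + (lg + 1) * (c1 + 200) + (c3 + 12) + (c4 + 12) + (100 + (k + 1) * (c5 + 10) + 12)
      \<le> z * (c2 + 12) + z * (c1 + 200) + z * (c3 + 12) + z * (c4 + 12) + (z * 112 + z * (c5 + 10))"
      using zc[of "c2 + 12"] zc[of "c3 + 12"] zc[of "c4 + 12"] zc[of 112] z(1,2)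
        mult_le_mono1[OF z(1), of "c1 + 200"] mult_le_mono1[OF z(2), of "c5 + 10"] by linarith
    also have "\<dots> \<le> z * (c1 + c2 + c3 + c4 + c5 + 500)" by (simp add: algebra_simps)
    finally have "N * (c2 + 12 + (lg + 1) * (c1 + 200) + (c3 + 12) + (c4 + 12) + (100 + (k + 1) * (c5 + 10) + 12))
      \<le> N * (z * (c1 + c2 + c3 + c4 + c5 + 500))" by (rule mult_le_mono2)
    then show "1 + 60 + (1 + T1 + (1 + T2 + (1 + T3 + (1 + T4 + (1 + T + T5))))) \<le>
      300 + N * ((lg + k + 1) * (2 * cost sift_body + cost find_body + cost load_body + cost (float_body 51)
      + cost (float_body 52) + cost half_body + 500)) + T"
      unfolding T1_def T2_def T3_def T4_def T5_def z_def[symmetric] cs[symmetric]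
      by (simp add: distrib_left add.assoc)
  qed
  then show ?thesis by (rule runs_weaken) (auto simp: Q_def N_def)
qed

section \<open>Commutation of minimax values with monotone maps\<close>

lemma SUP_mono_commute:
  fixes f :: "'a \<Rightarrow> ereal" and h :: "ereal \<Rightarrow> ereal"
  assumes "finite S" "mono h" "h (-\<infinity>) = -\<infinity>"
  shows "(SUP x\<in>S. h (f x)) = h (SUP x\<in>S. f x)"
proof (cases "S = {}")
  case True
  then show ?thesis using assms(3) by (simp add: bot_ereal_def)
next
  case False
  then have "h (Max (f ` S)) = Max (h ` f ` S)" using assms by (intro mono_Max_commute) auto
  then show ?thesis using False assms(1) by (simp add: Max_Sup image_image)
qed

lemma INF_mono_commute:
  fixes f :: "'a \<Rightarrow> ereal" and h :: "ereal \<Rightarrow> ereal"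
  assumes "finite S" "mono h" "h \<infinity> = \<infinity>"
  shows "(INF x\<in>S. h (f x)) = h (INF x\<in>S. f x)"
proof (cases "S = {}")
  case True
  then show ?thesis using assms(3) by (simp add: top_ereal_def)
next
  case False
  then have "h (Min (f ` S)) = Min (h ` f ` S)" using assms by (intro mono_Min_commute) auto
  then show ?thesis using False assms(1) by (simp add: Min_Inf image_image)
qed

text \<open>Over finitely many paths a minimax value is composed of \<open>min\<close> and
  \<open>max\<close> only, so it commutes with every monotone map; fixing the two infinities covers
  the empty cases. This is what allows entries to be replaced by ranks.\<close>

lemma minimax_commute:
  assumes "mono h" "h \<infinity> = \<infinity>" "h (-\<infinity>) = -\<infinity>" "\<And>i j. i < n \<Longrightarrow> j < n \<Longrightarrow> Y i j = h (X i j)"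
  shows "minimax n Y u v = h (minimax n X u v)"
proof -
  interpret fin_digraph "complete n" by (rule fin_digraph_graph_on) simp
  have "minimax n Y u v = minimax n (\<lambda>i j. h (X i j)) u v" by (rule minimax_cong) (rule assms(4))
  also have "\<dots> = (INF p\<in>{p. apath u p v}. h (SUP (i, j)\<in>set p. X i j))"
    unfolding minimax_def using SUP_mono_commute[OF _ assms(1,3), where f = "\<lambda>(i, j). X i j"]
    by (intro INF_cong) (auto simp: case_prod_beta)
  also have "\<dots> = h (minimax n X u v)"
    unfolding minimax_def by (rule INF_mono_commute[OF _ assms(1,2)]) (rule apaths_finite)
  finally show ?thesis .
qed

lemma self_product_eq_INF: "1 \<le> n \<Longrightarrow> self_product n X u v = (INF k\<in>{..<n}. max (X u k) (X k v))"
  unfolding self_product_def min_max_def by (subst Min_Inf) (auto simp: lessThan_empty_iff)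

lemma self_product_commute:
  assumes "u < n" "v < n" "mono h" "h \<infinity> = \<infinity>" "\<And>i j. i < n \<Longrightarrow> j < n \<Longrightarrow> Y i j = h (X i j)"
  shows "self_product n Y u v = h (self_product n X u v)"
proof -
  have n: "1 \<le> n" using assms(1) by simp
  have "self_product n Y u v = (INF k\<in>{..<n}. h (max (X u k) (X k v)))"
    unfolding self_product_eq_INF[OF n] using assms
    by (intro INF_cong) (auto simp: max_of_mono)
  also have "\<dots> = h (self_product n X u v)"
    unfolding self_product_eq_INF[OF n] by (rule INF_mono_commute[OF _ assms(3,4)]) simp
  finally show ?thesis .
qed

lemma self_product_attained:
  assumes "1 \<le> n"
  shows "\<exists>k<n. self_product n X u v = max (X u k) (X k v)"
proof -
  have "self_product n X u v \<in> (\<lambda>k. max (X u k) (X k v)) ` {..<n}"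
    unfolding self_product_def min_max_def using assms by (intro Min_in) (auto simp: lessThan_empty_iff)
  then show ?thesis by auto
qed

lemma self_product_in:
  assumes "u < n" "v < n"
  shows "self_product n X u v \<in> {\<infinity>, -\<infinity>} \<union> {X i j | i j. i < n \<and> j < n}"
proof -
  obtain k where "k < n" "self_product n X u v = max (X u k) (X k v)"
    using self_product_attained[of n X u v] assms by auto
  then show ?thesis using assms by (auto simp: max_def)
qed

text \<open>The continuous extension of \<open>2 powr (L * x)\<close> for positive \<open>L\<close>.
  Its value 0 at -\<infinity> is the length of the empty path.\<close>

definition epow :: "real \<Rightarrow> ereal \<Rightarrow> ereal" where
  "epow L x = (if x = \<infinity> then \<infinity> else if x = -\<infinity> then 0 else ereal (2 powr (L * real_of_ereal x)))"

lemma epow_simps [simp]: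
  "epow L \<infinity> = \<infinity>" "epow L (-\<infinity>) = 0" "epow L (ereal r) = ereal (2 powr (L * r))"
  by (auto simp: epow_def)

lemma epow_nonneg: "0 \<le> epow L x"
  by (cases x) auto

lemma epow_mono: "0 \<le> L \<Longrightarrow> x \<le> y \<Longrightarrow> epow L x \<le> epow L y"
  by (cases x; cases y) (auto intro: mult_left_mono)

lemma sum_list_ge_member:
  fixes f :: "'a \<Rightarrow> ereal"
  assumes "\<And>e. 0 \<le> f e" "e \<in> set p"
  shows "f e \<le> (\<Sum>e\<leftarrow>p. f e)"
  using assms(2)
proof (induction p)
  case (Cons a p)
  have "0 \<le> (\<Sum>e\<leftarrow>p. f e)" using assms(1) by (intro sum_list_nonneg) auto
  then show ?case using Cons assms(1)[of a]
    by (auto intro: add_increasing add_increasing2)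
qed simp

lemma sum_list_le_length:
  fixes f :: "'a \<Rightarrow> ereal"
  assumes "\<And>e. e \<in> set p \<Longrightarrow> f e \<le> c" "0 \<le> c"
  shows "(\<Sum>e\<leftarrow>p. f e) \<le> ereal (real (length p)) * c"
  using assms(1)
proof (induction p)
  case Nil
  then show ?case by (simp add: zero_ereal_def[symmetric])
next
  case (Cons a p)
  have "ereal (real (length (a # p))) * c = (ereal 1 + ereal (real (length p))) * c" by simp
  also have "\<dots> = c + ereal (real (length p)) * c"
    using assms(2) by (subst ereal_left_distrib) (auto simp: one_ereal_def[symmetric])
  finally show ?case using Cons by (auto intro: add_mono)
qed

text \<open>A sum of nonnegative numbers lies between its largest summand and that summand times
  their number, and a simple path has fewer than \<open>n\<close> arcs. The factor
  \<open>n + 1\<close> is generous here; it matches the Min-Plus case, where two summands occur even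
  for \<open>n = 1\<close>.\<close>

lemma distance_epow_minimax:
  assumes n: "1 \<le> n" and L: "0 \<le> L"
  shows "epow L (minimax n X u v) \<le> distance (complete n) (\<lambda>(i, j). epow L (X i j)) u v"
    and "distance (complete n) (\<lambda>(i, j). epow L (X i j)) u v \<le> ereal (real n + 1) * epow L (minimax n X u v)"
proof -
  interpret fin_digraph "complete n" by (rule fin_digraph_graph_on) simp
  let ?S = "{p. apath u p v}"
  let ?f = "\<lambda>p. SUP (i, j)\<in>set p. X i j"
  let ?w = "\<lambda>(i, j). epow L (X i j)"
  have w0: "0 \<le> ?w e" for e by (cases e) (simp add: epow_nonneg)
  have lo: "epow L (?f p) \<le> (\<Sum>e\<leftarrow>p. ?w e)" for p
  proof (cases "p = []")
    case True
    then show ?thesis by (simp add: bot_ereal_def)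
  next
    case False
    then have "?f p \<in> (\<lambda>(i, j). X i j) ` set p"
      using Max_in[of "(\<lambda>(i, j). X i j) ` set p"] by (simp add: Max_Sup)
    then obtain e where e: "e \<in> set p" "?f p = (\<lambda>(i, j). X i j) e" by blast
    then have "epow L (?f p) = ?w e" unfolding e(2) by (simp add: case_prod_beta)
    then show ?thesis using sum_list_ge_member[of ?w, OF w0 e(1)] by simp
  qed
  have up: "(\<Sum>e\<leftarrow>p. ?w e) \<le> ereal (real n + 1) * epow L (?f p)" if "apath u p v" for p
  proof -
    have "?w e \<le> epow L (?f p)" if "e \<in> set p" for e
      using SUP_upper[OF that, of "\<lambda>(i, j). X i j"] L by (cases e) (auto intro!: epow_mono)
    then have "(\<Sum>e\<leftarrow>p. ?w e) \<le> ereal (real (length p)) * epow L (?f p)"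
      by (intro sum_list_le_length) (auto simp only: epow_nonneg)
    also have "\<dots> \<le> ereal (real n + 1) * epow L (?f p)"
      using length_apath_less[OF that] by (intro ereal_mult_right_mono epow_nonneg) simp
    finally show ?thesis .
  qed
  show "epow L (minimax n X u v) \<le> distance (complete n) ?w u v"
    unfolding distance_def
  proof (rule INF_greatest)
    fix p assume "p \<in> ?S"
    then have "minimax n X u v \<le> ?f p" unfolding minimax_def by (rule INF_lower)
    then show "epow L (minimax n X u v) \<le> (\<Sum>e\<leftarrow>p. ?w e)"
      using epow_mono[OF L] lo[of p] by (metis (no_types, lifting) order_trans)
  qed
  show "distance (complete n) ?w u v \<le> ereal (real n + 1) * epow L (minimax n X u v)"
  proof (cases "?S = {}")
    case True
    then have "minimax n X u v = \<infinity>" by (simp add: minimax_def top_ereal_def)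
    then show ?thesis by simp
  next
    case False
    then have "minimax n X u v \<in> ?f ` ?S"
      unfolding minimax_def using Min_in[of "?f ` ?S"] apaths_finite[of u v] by (simp add: Min_Inf)
    then obtain p where p: "apath u p v" "minimax n X u v = ?f p" by auto
    have "distance (complete n) ?w u v \<le> (\<Sum>e\<leftarrow>p. ?w e)"
      unfolding distance_def using p by (intro INF_lower) auto
    also have "\<dots> \<le> ereal (real n + 1) * epow L (minimax n X u v)" using up[OF p(1)] p(2) by simp
    finally show ?thesis .
  qed
qed

lemma min_plus_epow_self_product:
  assumes n: "1 \<le> n" and L: "0 \<le> L"
  shows "epow L (self_product n X u v) \<le> min_plus n (\<lambda>i j. epow L (X i j)) (\<lambda>i j. epow L (X i j)) u v"
    and "min_plus n (\<lambda>i j. epow L (X i j)) (\<lambda>i j. epow L (X i j)) u v \<le> ereal (real n + 1) * epow L (self_product n X u v)"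
proof -
  let ?m = "min_plus n (\<lambda>i j. epow L (X i j)) (\<lambda>i j. epow L (X i j)) u v"
  have "?m \<in> (\<lambda>k. epow L (X u k) + epow L (X k v)) ` {..<n}"
    unfolding min_plus_def using n by (intro Min_in) (auto simp: lessThan_empty_iff)
  then obtain k where k: "k < n" "?m = epow L (X u k) + epow L (X k v)" by auto
  have "self_product n X u v \<le> max (X u k) (X k v)"
    unfolding self_product_eq_INF[OF n] using k by (intro INF_lower) auto
  then have "epow L (self_product n X u v) \<le> epow L (max (X u k) (X k v))" by (rule epow_mono[OF L])
  also have "\<dots> \<le> epow L (X u k) + epow L (X k v)"
    by (cases "X u k \<le> X k v") (simp_all add: max_def add_increasing add_increasing2 epow_nonneg)
  finally show "epow L (self_product n X u v) \<le> ?m" using k by simp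
  obtain h where h: "h < n" "self_product n X u v = max (X u h) (X h v)"
    using self_product_attained[OF n] by blast
  have "?m \<le> epow L (X u h) + epow L (X h v)"
    unfolding min_plus_def using h by (intro Min_le) auto
  also have "\<dots> \<le> epow L (self_product n X u v) + epow L (self_product n X u v)"
    unfolding h(2) by (intro add_mono epow_mono[OF L]) auto
  also have "\<dots> = ereal 2 * epow L (self_product n X u v)"
    using epow_nonneg[of L "self_product n X u v"] by (cases "epow L (self_product n X u v)") auto
  also have "\<dots> \<le> ereal (real n + 1) * epow L (self_product n X u v)"
    using n by (intro ereal_mult_right_mono epow_nonneg) simp
  finally show "?m \<le> ereal (real n + 1) * epow L (self_product n X u v)" .
qed

text \<open>The common interface of the two approximate problems at \<open>\<epsilon> = 1\<close>.
  The mantissa bound 1 is the case \<open>b = 0\<close>; it suffices because the inputs will be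
  powers of two or \<infinity>.\<close>

definition two_approx_solvable ::
  "real \<Rightarrow> nat \<Rightarrow> (nat \<Rightarrow> (nat \<Rightarrow> nat \<Rightarrow> ereal) \<Rightarrow> nat \<Rightarrow> nat \<Rightarrow> ereal) \<Rightarrow> bool" where
  "two_approx_solvable c a F \<longleftrightarrow> (\<exists>P \<kappa> C k l. \<forall>n W X s.
     1 \<le> n \<longrightarrow> 1 \<le> W \<longrightarrow> (\<forall>i<n. \<forall>j<n. X i j \<in> R_plus \<and> (X i j \<noteq> \<infinity> \<longrightarrow> X i j \<le> ereal W)) \<longrightarrow>
     s 0 0 = Some (int n) \<longrightarrow> s 0 1 = Some 1 \<longrightarrow>
     holds_float_matrix 1 s 1 n X \<longrightarrow> holds_float_matrix 1 s 2 n X \<longrightarrow>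
     (\<exists>t s' D. exec (approx_word \<kappa> n 1 W) P s t s' \<and> real t \<le> approx_time C k l c n 1 \<and>
        holds_float_matrix (approx_word \<kappa> n 1 W) s' a n D \<and>
        (\<forall>i<n. \<forall>j<n. F n X i j \<le> D i j \<and> D i j \<le> 2 * F n X i j)))"

lemma two_approx_if_APSP:
  assumes "approx_APSP_solvable c"
  shows "two_approx_solvable c 2 (\<lambda>n X. distance (complete n) (\<lambda>(i, j). X i j))"
proof -
  from assms obtain P \<kappa> C k l where P: "\<forall>n \<epsilon> W E w s.
        1 \<le> n \<and> 0 < \<epsilon> \<and> 1 \<le> W \<and>
        E \<subseteq> {..<n} \<times> {..<n} \<and>
        (\<forall>e\<in>E. w e \<in> R_plus \<and> (w e \<noteq> \<infinity> \<longrightarrow> w e \<le> ereal W)) \<and>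
        s 0 0 = Some (int n) \<and> s 0 1 = Some \<lceil>1 / \<epsilon>\<rceil> \<and>
        holds_float_matrix ((real n + 1) ^ 0) s 1 n
          (\<lambda>u v. if (u, v) \<in> E then w (u, v) else \<infinity>)
      \<longrightarrow> (\<exists>t s' D.
        exec (approx_word \<kappa> n \<epsilon> W) P s t s' \<and>
        real t \<le> approx_time C k l c n \<epsilon> \<and>
        holds_float_matrix (approx_word \<kappa> n \<epsilon> W) s' 2 n D \<and>
        (\<forall>u<n. \<forall>v<n. distance (graph_on n E) w u v \<le> D u v \<and>
           D u v \<le> ereal (1 + \<epsilon>) * distance (graph_on n E) w u v))"
    unfolding approx_APSP_solvable_def by (drule_tac x = 0 in spec) (elim exE, rule that)
  show ?thesis unfolding two_approx_solvable_def
  proof (rule exI[of _ P], rule exI[of _ \<kappa>], rule exI[of _ C], rule exI[of _ k], rule exI[of _ l], intro allI impI)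
    fix n W X s
    assume a: "1 \<le> n" "1 \<le> W" "\<forall>i<n. \<forall>j<n. X i j \<in> R_plus \<and> (X i j \<noteq> \<infinity> \<longrightarrow> X i j \<le> ereal W)"
      "s 0 0 = Some (int n)" "s 0 1 = Some 1" "holds_float_matrix 1 s 1 n X"
    have m: "holds_float_matrix 1 s 1 n
      (\<lambda>u v. if (u, v) \<in> {..<n} \<times> {..<n} then (\<lambda>(i, j). X i j) (u, v) else \<infinity>)"
      using a(6) by (simp add: holds_float_matrix_def)
    show "\<exists>t s' D. exec (approx_word \<kappa> n 1 W) P s t s' \<and> real t \<le> approx_time C k l c n 1 \<and>
        holds_float_matrix (approx_word \<kappa> n 1 W) s' 2 n D \<and>
        (\<forall>i<n. \<forall>j<n. distance (complete n) (\<lambda>(i, j). X i j) i j \<le> D i j \<and>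
          D i j \<le> 2 * distance (complete n) (\<lambda>(i, j). X i j) i j)"
      using P[rule_format, of n 1 W "{..<n} \<times> {..<n}" "\<lambda>(i, j). X i j" s] a(1-5) m by auto
  qed
qed

lemma two_approx_if_min_plus:
  assumes "approx_min_plus_solvable c"
  shows "two_approx_solvable c 3 (\<lambda>n X. min_plus n X X)"
proof -
  from assms obtain P \<kappa> C k l where P: "\<forall>n \<epsilon> W A B s.
        1 \<le> n \<and> 0 < \<epsilon> \<and> 1 \<le> W \<and>
        (\<forall>i<n. \<forall>j<n. A i j \<in> R_plus \<and> (A i j \<noteq> \<infinity> \<longrightarrow> A i j \<le> ereal W)) \<and>
        (\<forall>i<n. \<forall>j<n. B i j \<in> R_plus \<and> (B i j \<noteq> \<infinity> \<longrightarrow> B i j \<le> ereal W)) \<and>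
        s 0 0 = Some (int n) \<and> s 0 1 = Some \<lceil>1 / \<epsilon>\<rceil> \<and>
        holds_float_matrix ((real n + 1) ^ 0) s 1 n A \<and>
        holds_float_matrix ((real n + 1) ^ 0) s 2 n B
      \<longrightarrow> (\<exists>t s' D.
        exec (approx_word \<kappa> n \<epsilon> W) P s t s' \<and>
        real t \<le> approx_time C k l c n \<epsilon> \<and>
        holds_float_matrix (approx_word \<kappa> n \<epsilon> W) s' 3 n D \<and>
        (\<forall>i<n. \<forall>j<n. min_plus n A B i j \<le> D i j \<and>
           D i j \<le> ereal (1 + \<epsilon>) * min_plus n A B i j))"
    unfolding approx_min_plus_solvable_def by (drule_tac x = 0 in spec) (elim exE, rule that)
  show ?thesis unfolding two_approx_solvable_def
  proof (rule exI[of _ P], rule exI[of _ \<kappa>], rule exI[of _ C], rule exI[of _ k], rule exI[of _ l], intro allI impI)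
    fix n W X s
    assume a: "1 \<le> n" "1 \<le> W" "\<forall>i<n. \<forall>j<n. X i j \<in> R_plus \<and> (X i j \<noteq> \<infinity> \<longrightarrow> X i j \<le> ereal W)"
      "s 0 0 = Some (int n)" "s 0 1 = Some 1" "holds_float_matrix 1 s 1 n X" "holds_float_matrix 1 s 2 n X"
    show "\<exists>t s' D. exec (approx_word \<kappa> n 1 W) P s t s' \<and> real t \<le> approx_time C k l c n 1 \<and>
        holds_float_matrix (approx_word \<kappa> n 1 W) s' 3 n D \<and>
        (\<forall>i<n. \<forall>j<n. min_plus n X X i j \<le> D i j \<and> D i j \<le> 2 * min_plus n X X i j)"
      using P[rule_format, of n 1 W X X s] a by auto
  qed
qed

lemma mono_lift_rank:
  assumes "ranking N v rk vo" "1 \<le> N"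
  shows "mono (lift_rank N vo)"
proof (rule monoI)
  fix x y :: ereal assume "x \<le> y"
  have "vo (min (N - 1) (nat \<lfloor>a\<rfloor>)) \<le> vo (min (N - 1) (nat \<lfloor>b\<rfloor>))" if "a \<le> b" for a b :: real
  proof -
    have "nat \<lfloor>a\<rfloor> \<le> nat \<lfloor>b\<rfloor>" using that by (intro nat_mono floor_mono)
    then have "min (N - 1) (nat \<lfloor>a\<rfloor>) \<le> min (N - 1) (nat \<lfloor>b\<rfloor>)" "min (N - 1) (nat \<lfloor>b\<rfloor>) < N" using assms(2) by auto
    then show ?thesis using assms(1) unfolding ranking_def by blast
  qed
  then show "lift_rank N vo x \<le> lift_rank N vo y"
    using \<open>x \<le> y\<close> by (cases x; cases y) (auto simp: lift_rank_def)
qed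

text \<open>The total error factor \<open>2 * c\<close> is below \<open>2 powr L\<close>, the ratio
  of consecutive powers, so the result cannot be mistaken for the next rank. For
  \<open>g = -\<infinity>\<close> the bounds force the result 0, for \<open>g = \<infinity>\<close>
  they force \<infinity>.\<close>

lemma decodable_if_approx:
  assumes h: "holds_float b s a i d" and g: "g = \<infinity> \<or> g = -\<infinity> \<or> (\<exists>r<N. g = ereal (real r))"
    and f: "epow L g \<le> f" "f \<le> ereal c * epow L g" "f \<le> d" "d \<le> 2 * f" and L: "real_of_int L' = L" "0 \<le> L"
    and c: "2 * c < 2 powr L" and b: "b \<le> 2 powr real k" "\<lfloor>b + L * real N\<rfloor> \<le> M"
  shows "decodable (Suc k) M L' N s a i g"
proof -
  have d0: "0 \<le> d" by (rule order_trans[OF epow_nonneg order_trans[OF f(1,3)]])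
  from g consider "g = \<infinity>" | "g = -\<infinity>" | r where "r < N" "g = ereal (real r)" by blast
  then show ?thesis
  proof cases
    case 1
    then have "d = \<infinity>" using f by auto
    then show ?thesis using h 1 by (auto simp: decodable_def holds_float_def)
  next
    case 2
    then have "f \<le> 0" using f(2) by (simp add: zero_ereal_def[symmetric])
    moreover have "0 \<le> f" using f(1) 2 by simp
    ultimately have "f = 0" by (rule order_antisym)
    then have "d \<le> 0" using f(4) by simp
    then have "d = 0" using d0 by simp
    then show ?thesis using h 2 by (auto simp: decodable_def holds_float_def)
  next
    case 3
    let ?p = "2 powr (L * real r)"
    have "epow L g \<le> d" using f(1,3) by (rule order_trans)
    then have lo: "ereal ?p \<le> d" using 3 by simp
    have fin: "f \<le> ereal (c * ?p)" using f(2) 3 by simp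
    have "2 * f \<le> 2 * ereal (c * ?p)" using fin by (rule ereal_mult_left_mono) simp
    also have "2 * ereal (c * ?p) = ereal (2 * c * ?p)"
      by (simp only: numeral_eq_ereal times_ereal.simps mult.assoc)
    finally have hi: "d \<le> ereal (2 * c * ?p)" using f(4) by (rule order_trans[rotated])
    have p: "2 * c * ?p < 2 powr (L * (real r + 1))"
    proof -
      have "2 * c * ?p < 2 powr L * ?p" using c by (intro mult_strict_right_mono) auto
      also have "\<dots> = 2 powr (L * (real r + 1))" by (simp add: powr_add[symmetric] algebra_simps)
      finally show ?thesis .
    qed
    have "d \<noteq> \<infinity>" using hi by auto
    then obtain m e where me: "s a (3 * int i) = Some 0" "s a (3 * int i + 1) = Some m" "s a (3 * int i + 2) = Some e"
      "\<bar>real_of_int m\<bar> \<le> b" "d = ereal (real_of_int m * 2 powr real_of_int e)"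
      using h unfolding holds_float_def by blast
    have D: "?p \<le> real_of_int m * 2 powr real_of_int e" "real_of_int m * 2 powr real_of_int e < 2 powr (L * (real r + 1))"
      using lo hi p me(5) by auto
    have p1: "1 \<le> ?p" using L(2) by (intro ge_one_powr_ge_zero) auto
    have eb: "1 \<le> m" "\<bar>real_of_int e\<bar> \<le> b + log 2 (2 powr (L * (real r + 1)))"
      using float_exponent_bound[of m e "2 powr (L * (real r + 1))" b] D p1 me(4) by auto
    have LN: "L * (real r + 1) \<le> L * real N" using 3(1) L(2) by (intro mult_left_mono) auto
    have "0 \<le> L * (real r + 1)" using L by simp
    have "\<bar>e\<bar> \<le> M" using abs_le_floor[of e "b + L * real N"] eb(2) LN b(2) by simp
    moreover have "m \<le> M"
      using abs_le_floor[of m "b + L * real N"] me(4) LN \<open>0 \<le> L * (real r + 1)\<close> b(2) by linarith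
    \<comment> \<open>The mantissa may equal \<open>2 ^ k\<close>, so the strict bound needs one
      more halving.\<close>
    moreover have "m < 2 ^ Suc k"
    proof -
      have "b \<le> 2 ^ k" using b(1) by (simp add: powr_realpow)
      then have "real_of_int m \<le> 2 ^ k" using me(4) by linarith
      then have "m \<le> 2 ^ k" by (metis of_int_le_iff of_int_numeral of_int_power)
      moreover have "(2::int) ^ k < 2 ^ Suc k" by simp
      ultimately show ?thesis by linarith
    qed
    ultimately show ?thesis unfolding decodable_def
      using me eb(1) 3 D L(1) by (intro disjI2 exI[of _ m] exI[of _ e] exI[of _ r]) auto
  qed
qed

lemma int_solvable_if_two_approx:
  assumes c: "2 \<le> c" and F: "two_approx_solvable c a F" and a: "a \<in> {2, 3}"
    and commute: "\<And>n X Y h u v. u < n \<Longrightarrow> v < n \<Longrightarrow> mono h \<Longrightarrow> h \<infinity> = \<infinity> \<Longrightarrow> h (-\<infinity>) = -\<infinity> \<Longrightarrow>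
      (\<And>i j. i < n \<Longrightarrow> j < n \<Longrightarrow> Y i j = h (X i j)) \<Longrightarrow> G n Y u v = h (G n X u v)"
    and G_in: "\<And>n X u v. u < n \<Longrightarrow> v < n \<Longrightarrow> G n X u v \<in> {\<infinity>, -\<infinity>} \<union> {X i j | i j. i < n \<and> j < n}"
    and FG: "\<And>n L X u v. 1 \<le> n \<Longrightarrow> 0 \<le> L \<Longrightarrow> epow L (G n X u v) \<le> F n (\<lambda>i j. epow L (X i j)) u v \<and>
      F n (\<lambda>i j. epow L (X i j)) u v \<le> ereal (real n + 1) * epow L (G n X u v)"
  shows "int_solvable c G"
proof -
  from F obtain P \<kappa> C k l where P: "\<forall>n W X s.
     1 \<le> n \<longrightarrow> 1 \<le> W \<longrightarrow> (\<forall>i<n. \<forall>j<n. X i j \<in> R_plus \<and> (X i j \<noteq> \<infinity> \<longrightarrow> X i j \<le> ereal W)) \<longrightarrow>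
     s 0 0 = Some (int n) \<longrightarrow> s 0 1 = Some 1 \<longrightarrow>
     holds_float_matrix 1 s 1 n X \<longrightarrow> holds_float_matrix 1 s 2 n X \<longrightarrow>
     (\<exists>t s' D. exec (approx_word \<kappa> n 1 W) P s t s' \<and> real t \<le> approx_time C k l c n 1 \<and>
        holds_float_matrix (approx_word \<kappa> n 1 W) s' a n D \<and>
        (\<forall>i<n. \<forall>j<n. F n X i j \<le> D i j \<and> D i j \<le> 2 * F n X i j))"
    unfolding two_approx_solvable_def by (elim exE) (rule that)
  \<comment> \<open>With \<open>z = 2 + n\<close> the callee's words are at most
    \<open>z ^ (4 * \<kappa>)\<close> and the exponents passed to it at most \<open>z ^ 3\<close>.
    The cell bound \<open>y ^ q\<close> covers their sum.\<close>
  define q where "q = 4 * \<kappa> + 6"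
  define m where "m = 2 * cost sift_body + cost find_body + cost load_body + cost (float_body 51)
      + cost (float_body 52) + cost half_body + 500"
  define C' where "C' = 300 + real m * (4 * real \<kappa> + 6) + \<bar>C\<bar> * 2 ^ k * 2 ^ l"
  show ?thesis unfolding int_solvable_def
  \<comment> \<open>The additional logarithm in \<open>l + 1\<close> pays for the sorting and for
    the halvings of the decoding.\<close>
  proof (rule exI[of _ "rank_com (a + 50) P"], rule exI[of _ "32 * q"], rule exI[of _ C'], rule exI[of _ "l + 1"],
      intro allI impI, elim conjE)
    fix n and W :: real and X s
    assume n: "1 \<le> n" and W: "0 \<le> W"
      and X: "\<forall>i<n. \<forall>j<n. X i j \<in> int_infty \<and> (X i j \<noteq> \<infinity> \<longrightarrow> \<bar>X i j\<bar> \<le> ereal W)"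
      and s0: "s 0 0 = Some (int n)" and sX: "holds_int_matrix s 1 n X"
    define N where "N = n * n"
    define L where "L = real n + 2"
    have N1: "1 \<le> N" using n by (simp add: N_def)
    define z where "z = 2 + real n"
    define y where "y = 2 + real n + W"
    have z: "3 \<le> z" and zy: "z \<le> y" and y: "3 \<le> y" "real n \<le> y" "W + 1 \<le> y"
      using n W by (auto simp: y_def z_def)
    have ypow: "y ^ i \<le> y ^ j" if "i \<le> j" for i j using y that by (intro power_increasing) auto
    define \<Lambda> where "\<Lambda> = log 2 z"
    have \<Lambda>: "1 \<le> \<Lambda>" unfolding \<Lambda>_def using z by (intro one_le_log2) simp
    have zpow: "z ^ i = 2 powr (real i * \<Lambda>)" for i
      using z by (simp add: \<Lambda>_def powr_powr[symmetric] powr_realpow mult.commute[of "real i"])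
    have LN: "L * real N \<le> z ^ 3"
    proof -
      have "L * (real n * real n) \<le> z * (z * z)" using n by (intro mult_mono) (auto simp: L_def z_def)
      then show ?thesis by (simp add: N_def eval_nat_numeral)
    qed
    \<comment> \<open>The largest weight passed on. Its logarithm \<open>L * N\<close> is polynomial
      in \<open>n\<close> and does not involve \<open>W\<close>, and so is the word bound
      \<open>b\<close> of the callee.\<close>
    define W' where "W' = 2 powr (L * real N)"
    have W': "1 \<le> W'" "log 2 W' = L * real N" unfolding W'_def
      by (auto simp: L_def intro!: ge_one_powr_ge_zero)
    define b where "b = approx_word \<kappa> n 1 W'"
    have bz: "b \<le> z ^ (4 * \<kappa>)"
    proof -
      have "2 + real n + 1 + L * real N \<le> 2 * z + z ^ 3" using LN z unfolding z_def[symmetric] by linarith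
      also have "\<dots> \<le> z * z ^ 3"
      proof -
        have "2 * z \<le> 2 * z ^ 3" using z self_le_power[of z 3] by simp
        moreover have "3 * z ^ 3 \<le> z * z ^ 3" using z by (intro mult_right_mono) auto
        ultimately show ?thesis by linarith
      qed
      finally have "2 + real n + 1 + L * real N \<le> z ^ 4" by (simp add: eval_nat_numeral)
      then have "b \<le> (z ^ 4) ^ \<kappa>"
        unfolding b_def approx_word_def W'(2) by (intro power_mono) (auto simp: L_def)
      then show ?thesis by (simp add: power_mult)
    qed
    define M where "M = \<lfloor>y ^ q\<rfloor>"
    have fits: "fits (exact_word (32 * q) n W) M"
      unfolding M_def exact_word_def y_def[symmetric] by (rule fits_floor) (use y in \<open>auto simp: q_def\<close>)
    have y1: "y ^ 1 \<le> y ^ q" "y ^ 3 \<le> y ^ q" by (rule ypow, simp add: q_def)+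
    have "z ^ 3 \<le> y ^ 3" using z zy by (intro power_mono) auto
    then have LNy: "L * real N \<le> y ^ q" using LN y1 by linarith
    have "y ^ 2 \<le> y ^ q" by (rule ypow) (simp add: q_def)
    moreover have "3 * 3 \<le> y * y" using y by (intro mult_mono) auto
    ultimately have y9: "9 \<le> y ^ q" by (simp add: power2_eq_square)
    have M4: "4 \<le> M" unfolding M_def using y9 by (simp add: le_floor_iff)
    have MLN: "(int n + 2) * int (n * n) \<le> M"
      unfolding M_def using LNy by (simp add: le_floor_iff L_def N_def)
    have MW: "\<bar>k\<bar> < M" if "\<bar>real_of_int k\<bar> \<le> W" for k
    proof -
      have "real_of_int (\<bar>k\<bar> + 1) \<le> y ^ q" using that y y1 by simp
      then have "\<bar>k\<bar> + 1 \<le> M" unfolding M_def by (simp only: le_floor_iff)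
      then show ?thesis by simp
    qed
    have bM: "\<lfloor>b + L * real N\<rfloor> \<le> M"
    proof -
      have 1: "1 \<le> y ^ (4 * \<kappa>)" using y by (intro one_le_power) auto
      have "b \<le> y ^ (4 * \<kappa>)" using bz power_mono[OF zy, of "4 * \<kappa>"] z by linarith
      then have "b + L * real N \<le> 1 * y ^ (4 * \<kappa>) + y ^ 3" using LN \<open>z ^ 3 \<le> y ^ 3\<close> by simp
      also have "\<dots> \<le> y ^ 3 * y ^ (4 * \<kappa>) + y ^ 3 * y ^ (4 * \<kappa>)"
        using y 1 one_le_power[of y 3] mult_left_mono[of 1 "y ^ (4 * \<kappa>)" "y ^ 3"]
        by (intro add_mono mult_right_mono) auto
      also have "\<dots> = 2 * y ^ (4 * \<kappa> + 3)" by (simp add: power_add)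
      also have "\<dots> \<le> y * y ^ (4 * \<kappa> + 3)" using y by (intro mult_right_mono) auto
      also have "\<dots> = y ^ Suc (4 * \<kappa> + 3)" by (rule power_Suc[symmetric])
      also have "\<dots> \<le> y ^ q" by (rule ypow) (simp add: q_def)
      finally show ?thesis unfolding M_def by (rule floor_mono)
    qed
    have B': "b \<le> exact_word (32 * q) n W"
    proof -
      have "b \<le> y ^ (4 * \<kappa>)" using bz power_mono[OF zy, of "4 * \<kappa>"] z by linarith
      also have "\<dots> \<le> y ^ (32 * q)" by (rule ypow) (simp add: q_def)
      finally show ?thesis by (simp add: exact_word_def y_def)
    qed
    define lg where "lg = nat \<lceil>2 * \<Lambda>\<rceil>"
    define km where "km = nat \<lceil>4 * real \<kappa> * \<Lambda>\<rceil>"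
    have lg: "n * n \<le> 2 ^ lg"
    proof -
      have "real (n * n) \<le> z ^ 2" unfolding power2_eq_square by (simp add: z_def mult_mono)
      also have "\<dots> = 2 powr (2 * \<Lambda>)" by (simp add: zpow)
      also have "\<dots> \<le> 2 powr real lg" using \<Lambda> unfolding lg_def by simp
      also have "\<dots> = real (2 ^ lg)" by (simp add: powr_realpow)
      finally show ?thesis by (simp only: of_nat_le_iff)
    qed
    have bk: "b \<le> 2 powr real km"
    proof -
      have "b \<le> 2 powr (real (4 * \<kappa>) * \<Lambda>)" using bz by (simp only: zpow)
      also have "\<dots> \<le> 2 powr real km" using \<Lambda> unfolding km_def by simp
      finally show ?thesis .
    qed
    define x where "x i = (if X (i div n) (i mod n) = \<infinity> then None else Some \<lfloor>real_of_ereal (X (i div n) (i mod n))\<rfloor>)" for i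
    define v where "v = (\<lambda>i. case x i of None \<Rightarrow> 0 | Some k \<Rightarrow> k)"
    have x_cases: "(X (i div n) (i mod n) = \<infinity> \<and> x i = None) \<or>
      (\<exists>k. X (i div n) (i mod n) = ereal (real_of_int k) \<and> x i = Some k \<and> \<bar>real_of_int k\<bar> \<le> W)" if "i < n * n" for i
    proof -
      have "i div n < n" "i mod n < n" using n that by (auto simp: div_less_iff_less_mult)
      then have "X (i div n) (i mod n) \<in> int_infty \<and>
        (X (i div n) (i mod n) \<noteq> \<infinity> \<longrightarrow> \<bar>X (i div n) (i mod n)\<bar> \<le> ereal W)" using X by blast
      then show ?thesis by (auto simp: int_infty_def x_def)
    qed
    have int_entry: "int_entry s 1 i (x i)" if "i < n * n" for i
      using holds_int_matrix_index(1)[OF sX n that] x_cases[OF that]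
      by (auto simp: int_entry_def holds_int_def)
    have xM: "\<bar>k\<bar> < M" if "i < n * n" "x i = Some k" for i k
      using x_cases[OF that(1)] that(2) MW by auto
    \<comment> \<open>The matrix of ranks; the callee's input is its image under
      \<open>epow L\<close>.\<close>
    define Rm where "Rm rk i j = (if x (i * n + j) = None then \<infinity> else ereal (real (rk (i * n + j) :: nat)))" for rk i j
    define g where "g rk i = G n (Rm rk) (i div n) (i mod n)" for rk i
    define T where "T = nat \<lfloor>approx_time \<bar>C\<bar> k l c n 1\<rfloor>"
    have idx: "i * n + j < N" "(i * n + j) div n = i" "(i * n + j) mod n = j" if "i < n" "j < n" for i j
      using that square_index_less[OF that] by (auto simp: N_def)
    have runs: "runs (exact_word (32 * q) n W) (rank_com (a + 50) P)
      (300 + n * n * ((lg + Suc km + 1) * (2 * cost sift_body + cost find_body + cost load_body + cost (float_body 51)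
      + cost (float_body 52) + cost half_body + 500)) + T) s
      (\<lambda>s'. \<exists>rk vo. ranking (n * n) v rk vo \<and> (\<forall>i<n*n. holds_int s' 2 i (lift_rank (n * n) vo (g rk i))))"
    proof (rule runs_rank[where s = s, OF fits n M4 MLN lg s0 int_entry xM v_def a _ B'])
      fix rk vo s1
      assume rk: "ranking (n * n) v rk vo" and s1: "s1 0 0 = Some (int n)" "s1 0 1 = Some 1"
        and e: "\<forall>i<n*n. exp_entry s1 1 i (x i) ((int n + 2) * int (rk i))"
          "\<forall>i<n*n. exp_entry s1 2 i (x i) ((int n + 2) * int (rk i))"
      define X' where "X' = (\<lambda>i j. epow L (Rm rk i j))"
      have rkN: "rk i < N" if "i < N" for i using rk that by (simp add: ranking_def N_def)
      have X': "\<forall>i<n. \<forall>j<n. X' i j \<in> R_plus \<and> (X' i j \<noteq> \<infinity> \<longrightarrow> X' i j \<le> ereal W')"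
      proof (intro allI impI)
        fix i j assume ij: "i < n" "j < n"
        have "0 \<le> L * real (rk (i * n + j))" "L * real (rk (i * n + j)) \<le> L * real N"
          using rkN[OF idx(1)[OF ij]] by (auto simp: L_def intro!: mult_left_mono)
        then show "X' i j \<in> R_plus \<and> (X' i j \<noteq> \<infinity> \<longrightarrow> X' i j \<le> ereal W')"
          by (auto simp: X'_def Rm_def R_plus_def W'_def intro!: ge_one_powr_ge_zero)
      qed
      have hX': "holds_float_matrix 1 s1 a' n X'"
        if ex: "\<forall>i<n*n. exp_entry s1 a' i (x i) ((int n + 2) * int (rk i))" for a'
        unfolding holds_float_matrix_def
      proof (intro allI impI)
        fix i j assume ij: "i < n" "j < n"
        have "exp_entry s1 a' (i * n + j) (x (i * n + j)) ((int n + 2) * int (rk (i * n + j)))"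
          using ex idx(1)[OF ij] by (simp add: N_def)
        then show "holds_float 1 s1 a' (i * n + j) (X' i j)"
          by (cases "x (i * n + j)") (auto simp: exp_entry_def holds_float_def X'_def Rm_def L_def)
      qed
      obtain t s2 D where t: "exec b P s1 t s2" "real t \<le> approx_time C k l c n 1"
        "holds_float_matrix b s2 a n D" "\<forall>i<n. \<forall>j<n. F n X' i j \<le> D i j \<and> D i j \<le> 2 * F n X' i j"
        using P[rule_format, OF n W'(1) _ s1 hX'[OF e(1)] hX'[OF e(2)]] X' unfolding b_def by blast
      have "t \<le> T" unfolding T_def using t(2) approx_time_abs[of 1 C k l c n]
        by (intro le_nat_floor) auto
      moreover have "decodable (Suc km) M (int n + 2) (n * n) s2 a i (g rk i)" if i: "i < n * n" for i
      proof (rule decodable_if_approx[where L = L and c = "real n + 1"])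
        define u w where uw: "u = i div n" "w = i mod n"
        have uw': "u < n" "w < n" "u * n + w = i" using n i by (auto simp: uw div_less_iff_less_mult)
        show "holds_float b s2 a i (D u w)" using holds_float_matrixD[OF t(3) uw'(1,2)] uw'(3) by simp
        show "g rk i = \<infinity> \<or> g rk i = - \<infinity> \<or> (\<exists>r<n * n. g rk i = ereal (real r))"
        proof -
          have "g rk i \<in> {\<infinity>, -\<infinity>} \<union> {Rm rk i j | i j. i < n \<and> j < n}"
            unfolding g_def uw[symmetric] by (rule G_in[OF uw'(1,2)])
          then consider "g rk i \<in> {\<infinity>, -\<infinity>}" | h j where "h < n" "j < n" "g rk i = Rm rk h j" by blast
          then show ?thesis
          proof cases
            case 2
            have "rk (h * n + j) < n * n" using rkN[OF idx(1)[OF 2(1,2)]] by (simp add: N_def)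
            then show ?thesis using 2(3) by (auto simp: Rm_def)
          qed auto
        qed
        have "0 \<le> L" by (simp add: L_def)
        note FG' = FG[OF n this, of "Rm rk" u w, folded X'_def]
        show "epow L (g rk i) \<le> F n X' u w" "F n X' u w \<le> ereal (real n + 1) * epow L (g rk i)"
          using FG' unfolding g_def uw[symmetric] by auto
        show "F n X' u w \<le> D u w" "D u w \<le> 2 * F n X' u w" using t(4) uw' by auto
        show "2 * (real n + 1) < 2 powr L"
        proof -
          have "real (n + 1) < 2 ^ (n + 1)" by (rule of_nat_less_two_power)
          moreover have "2 powr L = 2 * 2 ^ (n + 1)"
          proof -
            have "2 powr L = 2 powr real (n + 2)" by (simp add: L_def add.commute)
            also have "\<dots> = 2 ^ (n + 2)" by (simp only: powr_realpow)
            finally show ?thesis by simp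
          qed
          ultimately show ?thesis by simp
        qed
        show "\<lfloor>b + L * real (n * n)\<rfloor> \<le> M" using bM by (simp add: N_def)
      qed (use bk in \<open>auto simp: L_def\<close>)
      ultimately show "\<exists>t s2. exec b P s1 t s2 \<and> t \<le> T \<and>
         (\<forall>i<n*n. decodable (Suc km) M (int n + 2) (n * n) s2 a i (g rk i))" using t(1) by blast
    qed
    then obtain t s' rk vo where e: "exec (exact_word (32 * q) n W) (rank_com (a + 50) P) s t s'"
      and t: "t \<le> 300 + n * n * ((lg + Suc km + 1) * m) + T"
      and rk: "ranking N v rk vo" and h: "\<forall>i<N. holds_int s' 2 i (lift_rank N vo (g rk i))"
      unfolding runs_def m_def N_def by blast
    have "holds_int_matrix s' 2 n (G n X)"
      unfolding holds_int_matrix_def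
    proof (intro allI impI)
      fix u w assume uw: "u < n" "w < n"
      \<comment> \<open>The given matrix is the entrywise image of the rank matrix under the
        monotone \<open>lift_rank\<close>, so the results correspond in the same way.\<close>
      have "G n X u w = lift_rank N vo (G n (Rm rk) u w)"
      proof (rule commute[OF uw mono_lift_rank[OF rk N1]])
        fix i j assume ij: "i < n" "j < n"
        note xc = x_cases[of "i * n + j"] idx[OF ij]
        have rk': "rk (i * n + j) < N" "vo (rk (i * n + j)) = v (i * n + j)"
          using rk xc(2) by (auto simp: ranking_def)
        show "X i j = lift_rank N vo (Rm rk i j)"
          using xc rk' by (auto simp: Rm_def N_def v_def)
      qed auto
      then show "holds_int s' 2 (u * n + w) (G n X u w)"
        using h[rule_format, OF idx(1)[OF uw]] by (simp only: g_def idx(2,3)[OF uw])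
    qed
    moreover have "real t \<le> exact_time C' (l + 1) c n"
    proof -
      have "real t \<le> real (300 + n * n * ((lg + Suc km + 1) * m) + T)" using t by (simp only: of_nat_le_iff)
      also have "\<dots> = 300 + real n * real n * (real (lg + Suc km + 1) * real m) + real T"
        by (simp only: of_nat_add of_nat_mult of_nat_numeral)
      finally have 1: "real t \<le> 300 + real n * real n * (real (lg + Suc km + 1) * real m) + real T" .
      have L0: "0 \<le> 4 * real \<kappa> * \<Lambda>" using \<Lambda> by simp
      have "real lg \<le> 2 * \<Lambda> + 1" "real km \<le> 4 * real \<kappa> * \<Lambda> + 1"
        using \<Lambda> L0 unfolding lg_def km_def by linarith+
      then have "real (lg + Suc km + 1) \<le> 4 * real \<kappa> * \<Lambda> + 6 * \<Lambda>" using \<Lambda> by simp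
      then have lk: "real (lg + Suc km + 1) \<le> (4 * real \<kappa> + 6) * \<Lambda>" by (simp add: algebra_simps)
      have nc: "real n * real n \<le> real n powr c" by (rule n_square_le_powr[OF n c])
      have n1: "1 \<le> real n powr c" using n c by (intro ge_one_powr_ge_zero) auto
      have Ll: "1 \<le> \<Lambda> ^ l" "\<Lambda> ^ l \<le> \<Lambda> ^ (l + 1)" "\<Lambda> \<le> \<Lambda> ^ (l + 1)"
        using \<Lambda> one_le_power[OF \<Lambda>, of l] self_le_power[OF \<Lambda>, of "l + 1"] power_increasing[of l "l + 1" \<Lambda>] by auto
      have "real n * real n * (real (lg + Suc km + 1) * real m) \<le> real n powr c * (((4 * real \<kappa> + 6) * \<Lambda> ^ (l + 1)) * real m)"
      proof (intro mult_mono nc)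
        have "(4 * real \<kappa> + 6) * \<Lambda> \<le> (4 * real \<kappa> + 6) * \<Lambda> ^ (l + 1)" using Ll by (intro mult_left_mono) auto
        then show "real (lg + Suc km + 1) \<le> (4 * real \<kappa> + 6) * \<Lambda> ^ (l + 1)" using lk by linarith
      qed (use \<Lambda> in auto)
      then have 2: "real n * real n * (real (lg + Suc km + 1) * real m) \<le> real m * (4 * real \<kappa> + 6) * (real n powr c * \<Lambda> ^ (l + 1))"
        by (simp add: mult_ac)
      have 3: "300 \<le> 300 * (real n powr c * \<Lambda> ^ (l + 1))"
        using mult_mono[OF n1 one_le_power[OF \<Lambda>, of "l + 1"]] by simp
      have "real T \<le> approx_time \<bar>C\<bar> k l c n 1"
        unfolding T_def by (rule of_nat_floor[OF approx_time_nonneg]) auto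
      also have "\<dots> = \<bar>C\<bar> * real n powr c * 2 ^ k * log 2 (3 + real n) ^ l" by (simp add: approx_time_def)
      also have "\<dots> \<le> \<bar>C\<bar> * real n powr c * 2 ^ k * (2 * \<Lambda>) ^ l"
      proof (intro mult_left_mono power_mono)
        have "3 * z \<le> z * z" using z by (intro mult_right_mono) auto
        moreover have "3 + real n \<le> 3 * z" by (simp add: z_def)
        ultimately have "3 + real n \<le> z ^ 2" unfolding power2_eq_square by linarith
        then have "log 2 (3 + real n) \<le> log 2 (z ^ 2)" using z by (subst log_le_cancel_iff) auto
        also have "\<dots> = 2 * \<Lambda>" unfolding \<Lambda>_def using z by (subst log_nat_power) auto
        finally show "log 2 (3 + real n) \<le> 2 * \<Lambda>" .
        show "0 \<le> log 2 (3 + real n)" by simp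
      qed auto
      also have "\<dots> = \<bar>C\<bar> * 2 ^ k * 2 ^ l * (real n powr c * \<Lambda> ^ l)" by (simp add: power_mult_distrib)
      also have "\<dots> \<le> \<bar>C\<bar> * 2 ^ k * 2 ^ l * (real n powr c * \<Lambda> ^ (l + 1))"
        using Ll by (intro mult_left_mono) auto
      finally have 4: "real T \<le> \<bar>C\<bar> * 2 ^ k * 2 ^ l * (real n powr c * \<Lambda> ^ (l + 1))" .
      have "exact_time C' (l + 1) c n = C' * (real n powr c * \<Lambda> ^ (l + 1))"
        by (simp add: exact_time_def \<Lambda>_def z_def)
      also have "\<dots> = 300 * (real n powr c * \<Lambda> ^ (l + 1)) + real m * (4 * real \<kappa> + 6) * (real n powr c * \<Lambda> ^ (l + 1))
        + \<bar>C\<bar> * 2 ^ k * 2 ^ l * (real n powr c * \<Lambda> ^ (l + 1))" by (simp only: C'_def distrib_right)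
      finally show ?thesis using 1 2 3 4 by linarith
    qed
    ultimately show "\<exists>t s'. exec (exact_word (32 * q) n W) (rank_com (a + 50) P) s t s' \<and>
      real t \<le> exact_time C' (l + 1) c n \<and> holds_int_matrix s' 2 n (G n X)" using e by blast
  qed
qed

lemma bottleneck_if_APSP:
  assumes "2 \<le> c" "approx_APSP_solvable c"
  shows "bottleneck_solvable c"
proof (rule bottleneck_if_int_solvable_minimax[OF assms(1)],
    rule int_solvable_if_two_approx[OF assms(1) two_approx_if_APSP[OF assms(2)]])
  show "minimax n Y u v = h (minimax n X u v)"
    if "mono h" "h \<infinity> = \<infinity>" "h (-\<infinity>) = -\<infinity>" "\<And>i j. i < n \<Longrightarrow> j < n \<Longrightarrow> Y i j = h (X i j)" for n X Y h u v
    using that by (rule minimax_commute)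
qed (use minimax_in distance_epow_minimax in auto)

lemma min_max_if_min_plus:
  assumes "2 \<le> c" "approx_min_plus_solvable c"
  shows "min_max_solvable c"
proof (rule min_max_if_int_solvable[OF assms(1) _ self_product_tripartite],
    rule int_solvable_if_two_approx[OF assms(1) two_approx_if_min_plus[OF assms(2)]])
  show "self_product n Y u v = h (self_product n X u v)"
    if "u < n" "v < n" "mono h" "h \<infinity> = \<infinity>" "\<And>i j. i < n \<Longrightarrow> j < n \<Longrightarrow> Y i j = h (X i j)" for n X Y h u v
    using that by (rule self_product_commute)
  show "self_product n X u v \<in> {\<infinity>, -\<infinity>} \<union> {X i j | i j. i < n \<and> j < n}" if "u < n" "v < n" for n X u v
    using that by (rule self_product_in)
qed (use min_plus_epow_self_product in auto)

lemma min_max_if_bottleneck: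
  assumes "2 \<le> c" "bottleneck_solvable c"
  shows "min_max_solvable c"
  by (rule min_max_if_int_solvable[OF assms(1) int_solvable_minimax_if_bottleneck[OF assms] minimax_tripartite])

section \<open>Approximate squaring by one Min-Max Product\<close>

text \<open>\<open>distance\<close> ranges over simple paths. Cutting a cycle out of a walk does not
  increase its length, since weights are nonnegative.\<close>

lemma distance_le_awalk:
  assumes "wf_digraph G" "\<And>e. e \<in> arcs G \<Longrightarrow> 0 \<le> w e" "pre_digraph.awalk G u p v"
  shows "distance G w u v \<le> (\<Sum>e\<leftarrow>p. w e)"
proof -
  interpret wf_digraph G by fact
  show ?thesis using assms(3)
  proof (induction rule: awalk_to_apath_induct)
    case (path p)
    then have "apath u p v" by (simp add: apath_def)
    then show ?case unfolding distance_def by (intro INF_lower) auto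
  next
    case (decomp p q r s)
    from decomp(2,1,3) have p: "p = q @ r @ s" by (rule awalk_cyc_decompE)
    have "set r \<subseteq> arcs G" using decomp(1) p by (auto simp: awalk_def)
    then have r: "0 \<le> (\<Sum>e\<leftarrow>r. w e)" using assms(2) by (intro sum_list_nonneg) auto
    have "(\<Sum>e\<leftarrow>q @ s. w e) \<le> (\<Sum>e\<leftarrow>p. w e)"
      using add_mono[OF order_refl[of "\<Sum>e\<leftarrow>q. w e"] add_increasing[OF r order_refl[of "\<Sum>e\<leftarrow>s. w e"]]]
      by (simp add: p)
    then show ?case using decomp(4) by (rule order_trans[rotated])
  qed
qed

text \<open>There are finitely many simple paths, and a distance other than \<infinity> means that
  there is at least one.\<close>

lemma distance_attained:
  assumes "fin_digraph G" "distance G w u v \<noteq> \<infinity>"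
  shows "\<exists>p. pre_digraph.apath G u p v \<and> distance G w u v = (\<Sum>e\<leftarrow>p. w e)"
proof -
  interpret fin_digraph G by fact
  let ?S = "{p. apath u p v}" and ?f = "\<lambda>p. \<Sum>e\<leftarrow>p. w e"
  have "?S \<noteq> {}" using assms(2) unfolding distance_def by (intro notI) (simp add: top_ereal_def)
  then have "distance G w u v \<in> ?f ` ?S"
    unfolding distance_def using Min_in[of "?f ` ?S"] apaths_finite[of u v] by (simp add: Min_Inf)
  then show ?thesis by auto
qed

text \<open>Two shortest paths in a row form a walk that may repeat nodes, which is the occasion for
  \<open>distance_le_awalk\<close>.\<close>

lemma distance_triangle:
  assumes "fin_digraph G" "\<And>e. e \<in> arcs G \<Longrightarrow> 0 \<le> w e"
  shows "distance G w u v \<le> distance G w u x + distance G w x v"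
proof (cases "distance G w u x = \<infinity> \<or> distance G w x v = \<infinity>")
  case False
  interpret fin_digraph G by fact
  obtain p q where p: "apath u p x" "distance G w u x = (\<Sum>e\<leftarrow>p. w e)"
    and q: "apath x q v" "distance G w x v = (\<Sum>e\<leftarrow>q. w e)"
    using distance_attained[OF assms(1), of w u x] distance_attained[OF assms(1), of w x v] False by blast
  have "awalk u (p @ q) v" using awalk_appendI[OF awalkI_apath[OF p(1)] awalkI_apath[OF q(1)]] .
  from distance_le_awalk[OF wf_digraph_axioms assms(2) this] show ?thesis using p(2) q(2) by simp
qed auto

text \<open>The integer key \<open>x\<close> stands for the floating-point number with exponent \<open>x div T\<close> and mantissa
  \<open>T + x mod T\<close>. The mantissas in \<open>[T, 2 T)\<close> make this order preserving, so that an exact Min-Max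
  Product on keys is one on the numbers they stand for.\<close>

definition keyval :: "int \<Rightarrow> int \<Rightarrow> real" where
  "keyval T x = real_of_int (T + x mod T) * 2 powr real_of_int (x div T)"

text \<open>The case \<open>r = T\<close> is a mantissa that overflows to \<open>2 * T\<close>. It
  denotes the same number as mantissa \<open>T\<close> at the next exponent, so the carry happens by
  itself in the integer key.\<close>

lemma keyval_split:
  assumes "0 \<le> r" "r \<le> T" "0 < T"
  shows "keyval T (e * T + r) = real_of_int (T + r) * 2 powr real_of_int e"
proof (cases "r = T")
  case True
  have "(e * T + T) div T = e + 1" "(e * T + T) mod T = 0" using assms by auto
  then show ?thesis using True by (simp add: keyval_def powr_add)
next
  case False
  then have "(e * T + r) div T = e" "(e * T + r) mod T = r" using assms by auto
  then show ?thesis by (simp add: keyval_def)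
qed

lemma keyval_pos: "0 < T \<Longrightarrow> 0 < keyval T x"
  by (simp add: keyval_def add_pos_nonneg)

text \<open>Consecutive keys differ by one unit in the last place; as this is positive,
  \<open>keyval\<close> is strictly increasing.\<close>

lemma keyval_Suc: "0 < T \<Longrightarrow> keyval T (x + 1) = keyval T x + 2 powr real_of_int (x div T)"
proof -
  assume T: "0 < T"
  have r: "0 \<le> x mod T" "x mod T < T" using T by auto
  have x: "x + 1 = (x div T) * T + (x mod T + 1)" by simp
  have "keyval T (x + 1) = real_of_int (T + (x mod T + 1)) * 2 powr real_of_int (x div T)"
    unfolding x by (rule keyval_split) (use r T in linarith)+
  then show ?thesis by (simp add: keyval_def algebra_simps)
qed

lemma keyval_mono:
  assumes "0 < T" "x \<le> y"
  shows "keyval T x \<le> keyval T y"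
  using assms(2)
proof (induction rule: int_ge_induct)
  case (step i)
  then show ?case using keyval_Suc[OF assms(1), of i] by (simp add: add_increasing2)
qed simp

lemma keyval_le_iff: 
  assumes "0 < T"
  shows "keyval T x \<le> keyval T y \<longleftrightarrow> x \<le> y"
proof
  assume *: "keyval T x \<le> keyval T y"
  show "x \<le> y"
  proof (rule ccontr)
    assume "\<not> x \<le> y"
    then have "keyval T (y + 1) \<le> keyval T x" using assms by (intro keyval_mono) auto
    moreover have "0 < 2 powr real_of_int (y div T)" by simp
    ultimately show False using * keyval_Suc[OF assms, of y] by linarith
  qed
qed (rule keyval_mono[OF assms])

lemma keyval_shift: "0 < T \<Longrightarrow> keyval T (x + T * k) = keyval T x * 2 powr real_of_int k"
  by (simp add: keyval_def powr_add)

text \<open>Multiplication by \<open>p / q\<close> on the level of keys, with relative error at most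
  \<open>1 / T\<close> and always upwards, because results must never fall below the true
  distances.\<close>

definition scaled :: "int \<Rightarrow> int \<Rightarrow> int \<Rightarrow> int \<Rightarrow> int \<Rightarrow> bool" where
  "scaled T p q x x' \<longleftrightarrow> keyval T x * real_of_int p / real_of_int q \<le> keyval T x' \<and>
     keyval T x' \<le> (1 + 1 / real_of_int T) * (keyval T x * real_of_int p / real_of_int q)"

text \<open>Truncating the mantissa and taking the next larger key rounds up by a factor of at most
  \<open>1 + 1 / T\<close>, even when the mantissa overflows to \<open>2 T\<close>.\<close>

lemma scaledI:
  assumes T: "0 < T" and m: "T \<le> m" "m < 2 * T"
    and y: "real_of_int m * 2 powr real_of_int e \<le> keyval T x * real_of_int p / real_of_int q"
      "keyval T x * real_of_int p / real_of_int q < (real_of_int m + 1) * 2 powr real_of_int e"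
  shows "scaled T p q x (e * T + m - T + 1)"
proof -
  define Y where "Y = keyval T x * real_of_int p / real_of_int q"
  have "keyval T (e * T + (m - T + 1)) = real_of_int (T + (m - T + 1)) * 2 powr real_of_int e"
    using m T by (intro keyval_split) auto
  then have v: "keyval T (e * T + m - T + 1) = (real_of_int m + 1) * 2 powr real_of_int e"
    by (simp add: algebra_simps)
  have "1 \<le> real_of_int m / real_of_int T" using T m by simp
  then have "real_of_int m + 1 \<le> (1 + 1 / real_of_int T) * real_of_int m" by (simp add: algebra_simps)
  then have "(real_of_int m + 1) * 2 powr real_of_int e \<le> (1 + 1 / real_of_int T) * real_of_int m * 2 powr real_of_int e"
    by (intro mult_right_mono) auto
  also have "\<dots> \<le> (1 + 1 / real_of_int T) * Y"
    using y(1) T unfolding Y_def[symmetric] by (simp add: mult.assoc mult_left_mono)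
  finally show ?thesis using y(2) v unfolding scaled_def Y_def by simp
qed

text \<open>The value grows by a factor of at most \<open>2 * (J + 1) \<le> 2 powr (J + 2)\<close>,
  and doubling a value adds \<open>T\<close> to its key. So keys grow additively, which keeps them
  small over all rounds.\<close>

lemma scaled_key_bound:
  assumes T: "1 \<le> T" and J: "1 \<le> J" and p: "1 \<le> q" "q \<le> p" "p \<le> q * (J + 1)" and s: "scaled T p q x x'"
  shows "x \<le> x' \<and> x' \<le> x + T * (J + 2)"
proof -
  have T0: "0 < T" using T by simp
  have k0: "0 < keyval T x" by (rule keyval_pos[OF T0])
  define r where "r = real_of_int p / real_of_int q"
  have "real_of_int p \<le> real_of_int (q * (J + 1))" using p(3) by (simp only: of_int_le_iff)
  then have pq: "1 \<le> r" "r \<le> real_of_int J + 1"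
    using p(1,2) unfolding r_def by (auto simp: pos_divide_le_eq mult.commute)
  have s': "keyval T x * r \<le> keyval T x'" "keyval T x' \<le> (1 + 1 / real_of_int T) * (keyval T x * r)"
    using s by (simp_all add: scaled_def r_def)
  have "keyval T x * 1 \<le> keyval T x * r"
    using pq k0 by (intro mult_left_mono) auto
  then have "keyval T x \<le> keyval T x'" using s'(1) by linarith
  then have 1: "x \<le> x'" by (simp add: keyval_le_iff[OF T0])
  have "keyval T x' \<le> (1 + 1 / real_of_int T) * (keyval T x * r)" by (rule s'(2))
  also have "\<dots> \<le> 2 * (keyval T x * (real_of_int J + 1))"
    using pq k0 T by (intro mult_mono) auto
  also have "\<dots> \<le> keyval T x * 2 powr real_of_int (J + 2)"
  proof -
    have "real (nat (J + 1)) \<le> 2 ^ nat (J + 1)" by (rule less_imp_le[OF of_nat_less_two_power])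
    then have "real (nat (J + 1)) \<le> 2 powr real (nat (J + 1))" by (simp only: powr_realpow[of 2, simplified])
    then have "real_of_int J + 1 \<le> 2 powr (real_of_int J + 1)" using J by simp
    then have "2 * (real_of_int J + 1) \<le> 2 powr real_of_int (J + 2)" by (simp add: powr_add)
    then have "keyval T x * (2 * (real_of_int J + 1)) \<le> keyval T x * 2 powr real_of_int (J + 2)"
      using k0 by (intro mult_left_mono) auto
    then show ?thesis by (simp only: mult_ac)
  qed
  also have "\<dots> = keyval T (x + T * (J + 2))" by (rule keyval_shift[OF T0, symmetric])
  finally have "x' \<le> x + T * (J + 2)" by (simp add: keyval_le_iff[OF T0])
  with 1 show ?thesis by simp
qed

text \<open>A sum is a minimum of \<open>J\<^sup>2\<close> maxima up to the factor \<open>1 + 1 / J\<close>: the maximum for \<open>a\<close> is exact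
  when \<open>Y / X = a / J\<close>.\<close>

lemma sum_le_max_scaled:
  fixes X Y J a :: real
  assumes "0 < J" "0 < a" "X * (a + J) / J \<le> U" "Y * (a + J) / a \<le> U"
  shows "X + Y \<le> U"
proof -
  have "X \<le> U * (J / (a + J))" "Y \<le> U * (a / (a + J))"
    using assms by (auto simp: field_simps)
  then have "X + Y \<le> U * (J / (a + J) + a / (a + J))" by (simp add: distrib_left)
  also have "J / (a + J) + a / (a + J) = 1" using assms by (simp add: add_divide_distrib[symmetric] add.commute)
  finally show ?thesis by simp
qed

text \<open>If \<open>Y \<le> J * X\<close>, the ideal scale \<open>J * Y / X\<close> is rounded up
  to an integer, which costs at most \<open>X / J\<close>. Otherwise \<open>X\<close> is small
  compared with \<open>Y\<close>, and the largest scale \<open>J * J\<close> works.\<close>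

lemma exists_good_scale:
  fixes X Y :: real and J :: nat
  assumes "1 \<le> J" "0 < X" "0 < Y"
  shows "\<exists>a. 1 \<le> a \<and> a \<le> J * J \<and>
    X * (real a + real J) / real J \<le> (1 + 1 / real J) * (X + Y) \<and>
    Y * (real a + real J) / real a \<le> (1 + 1 / real J) * (X + Y)"
proof (cases "Y \<le> real J * X")
  case True
  define r where "r = real J * Y / X"
  define a where "a = nat \<lceil>r\<rceil>"
  have J: "0 < real J" using assms by simp
  have r: "0 < r" using assms J by (simp add: r_def)
  have ra: "r \<le> real a" "real a \<le> r + 1" using r unfolding a_def by linarith+
  have "r \<le> real (J * J)"
    using True assms J unfolding r_def by (simp add: divide_le_eq mult.assoc)
  then have "\<lceil>r\<rceil> \<le> int (J * J)" by (simp only: ceiling_le_iff of_int_of_nat_eq)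
  then have a2: "a \<le> J * J" unfolding a_def by (simp only: nat_le_iff)
  have a1: "1 \<le> a" using ra r by linarith
  have Xr: "X * r / real J = Y" using assms J by (simp add: r_def)
  have "X * (real a + real J) / real J = X + X * real a / real J"
    using J by (simp add: field_simps)
  also have "\<dots> \<le> X + X * (r + 1) / real J"
    using ra assms J by (intro add_left_mono divide_right_mono mult_left_mono) auto
  also have "\<dots> = X + Y + X / real J" using Xr by (simp add: distrib_left add_divide_distrib)
  also have "\<dots> \<le> (1 + 1 / real J) * (X + Y)" using assms J by (simp add: field_simps)
  finally have 1: "X * (real a + real J) / real J \<le> (1 + 1 / real J) * (X + Y)" .
  have "Y * real J / real a \<le> Y * real J / r" using ra r assms J by (intro divide_left_mono) auto
  also have "\<dots> = X" using assms J by (simp add: r_def)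
  finally have "Y * real J / real a \<le> X" .
  moreover have "Y * (real a + real J) / real a = Y + Y * real J / real a" using a1 by (simp add: field_simps)
  ultimately have "Y * (real a + real J) / real a \<le> 1 * (X + Y)" by simp
  also have "\<dots> \<le> (1 + 1 / real J) * (X + Y)" using assms J by (intro mult_right_mono) auto
  finally have "Y * (real a + real J) / real a \<le> (1 + 1 / real J) * (X + Y)" .
  with 1 a1 a2 show ?thesis by blast
next
  case False
  have J: "0 < real J" using assms by simp
  have c: "1 * (X + Y) \<le> (1 + 1 / real J) * (X + Y)" using assms J by (intro mult_right_mono) auto
  have "X * (real (J * J) + real J) / real J = X + real J * X" using J by (simp add: field_simps)
  then have "X * (real (J * J) + real J) / real J \<le> 1 * (X + Y)" using False by simp
  then have 1: "X * (real (J * J) + real J) / real J \<le> (1 + 1 / real J) * (X + Y)"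
    using c by (rule order_trans)
  have "Y * (real (J * J) + real J) / real (J * J) = (1 + 1 / real J) * Y" using J by (simp add: field_simps)
  also have "\<dots> \<le> (1 + 1 / real J) * (X + Y)" using assms J by (intro mult_left_mono) auto
  finally show ?thesis using 1 assms by (intro exI[of _ "J * J"]) auto
qed

text \<open>The first clause keeps results above actual sums, the second keeps them close to the
  smallest one. The 3 stems from \<open>(1 + 1 / T) * (1 + 1 / J) \<le> 1 + 3 / J\<close> for
  \<open>T \<ge> J\<close>, one factor for rounding mantissas and one for the grid of
  scales.\<close>

definition squared :: "int \<Rightarrow> nat \<Rightarrow> nat \<Rightarrow> (nat \<Rightarrow> nat \<Rightarrow> int option) \<Rightarrow> (nat \<Rightarrow> nat \<Rightarrow> int option) \<Rightarrow> bool" where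
  "squared T J n D D' \<longleftrightarrow> (\<forall>i<n. \<forall>j<n.
     (\<forall>z. D' i j = Some z \<longrightarrow> (\<exists>k<n. \<exists>x y. D i k = Some x \<and> D k j = Some y \<and> keyval T x + keyval T y \<le> keyval T z)) \<and>
     (\<forall>k<n. \<forall>x y. D i k = Some x \<longrightarrow> D k j = Some y \<longrightarrow>
        (\<exists>z. D' i j = Some z \<and> keyval T z \<le> (1 + 3 / real J) * (keyval T x + keyval T y))))"

definition key_ereal :: "int option \<Rightarrow> ereal" where
  "key_ereal x = (case x of None \<Rightarrow> \<infinity> | Some k \<Rightarrow> ereal (real_of_int k))"

lemma key_ereal_simps [simp]: "key_ereal None = \<infinity>" "key_ereal (Some k) = ereal (real_of_int k)"
  by (simp_all add: key_ereal_def)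

text \<open>The inner index \<open>a * n + k\<close> of the product runs through the pairs of a
  scale \<open>a + 1\<close> and a middle node \<open>k\<close>. Every scale gives a maximum of at
  least the sum, and some scale comes close to it.\<close>

lemma squared_if_min_max:
  fixes A B :: "nat \<Rightarrow> nat \<Rightarrow> int option"
  assumes T: "int J \<le> T" and J: "1 \<le> J" and n: "1 \<le> n"
    and A: "\<And>i a k. i < n \<Longrightarrow> a < J * J \<Longrightarrow> k < n \<Longrightarrow>
      rel_option (scaled T (int (a + 1 + J)) (int J)) (D i k) (A i (a * n + k))"
    and B: "\<And>j a k. j < n \<Longrightarrow> a < J * J \<Longrightarrow> k < n \<Longrightarrow>
      rel_option (scaled T (int (a + 1 + J)) (int (a + 1))) (D k j) (B (a * n + k) j)"
    and D': "\<And>i j. i < n \<Longrightarrow> j < n \<Longrightarrow>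
      key_ereal (D' i j) = min_max (n * (J * J)) (\<lambda>i j. key_ereal (A i j)) (\<lambda>i j. key_ereal (B i j)) i j"
  shows "squared T J n D D'"
  unfolding squared_def
proof (intro allI impI conjI)
  fix i j assume ij: "i < n" "j < n"
  let ?N = "n * (J * J)"
  let ?m = "\<lambda>h. max (key_ereal (A i h)) (key_ereal (B h j))"
  have T0: "0 < T" using T J by linarith
  have N: "1 \<le> ?N" using n J by simp
  have idx: "a * n + k < ?N" if "a < J * J" "k < n" for a k
  proof -
    have "a * n + k < (a + 1) * n" using that by simp
    also have "\<dots> \<le> (J * J) * n" using that by (intro mult_le_mono1) simp
    finally show ?thesis by (simp add: mult.commute)
  qed
  have eq: "key_ereal (D' i j) = (MIN h\<in>{..<?N}. ?m h)" using D'[OF ij] by (simp add: min_max_def)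
  {
    fix z assume z: "D' i j = Some z"
    have "(MIN h\<in>{..<?N}. ?m h) \<in> ?m ` {..<?N}" using N by (intro Min_in) (auto simp: lessThan_empty_iff)
    then obtain h where h: "h < ?N" "ereal (real_of_int z) = ?m h" using eq z by auto
    define a k where ak: "a = h div n" "k = h mod n"
    have ak': "a < J * J" "k < n" "h = a * n + k"
      using h n by (auto simp: ak div_less_iff_less_mult mult.commute)
    from h(2) obtain x' y' where A': "A i h = Some x'" and B': "B h j = Some y'"
      by (cases "A i h"; cases "B h j") (auto simp: max_def split: if_splits)
    obtain x y where x: "D i k = Some x" "scaled T (int (a + 1 + J)) (int J) x x'"
      and y: "D k j = Some y" "scaled T (int (a + 1 + J)) (int (a + 1)) y y'"
      using A[OF ij(1) ak'(1,2)] B[OF ij(2) ak'(1,2)] A' B' ak'(3) by (auto simp: option_rel_Some2)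
    have "x' \<le> z" "y' \<le> z" using h(2) A' B' by (auto simp: max_def split: if_splits)
    then have le: "keyval T x' \<le> keyval T z" "keyval T y' \<le> keyval T z" by (simp_all add: keyval_mono[OF T0])
    have "keyval T x + keyval T y \<le> keyval T z"
    proof (rule sum_le_max_scaled)
      show "keyval T x * (real (a + 1) + real J) / real J \<le> keyval T z"
        using x(2) le(1) by (simp add: scaled_def add_ac)
      show "keyval T y * (real (a + 1) + real J) / real (a + 1) \<le> keyval T z"
        using y(2) le(2) by (simp add: scaled_def add_ac)
    qed (use J in auto)
    then show "\<exists>k<n. \<exists>x y. D i k = Some x \<and> D k j = Some y \<and> keyval T x + keyval T y \<le> keyval T z"
      using x y ak' by blast
  }
  {
    fix k x y assume k: "k < n" and x: "D i k = Some x" and y: "D k j = Some y"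
    obtain a where a: "1 \<le> a" "a \<le> J * J"
      "keyval T x * (real a + real J) / real J \<le> (1 + 1 / real J) * (keyval T x + keyval T y)"
      "keyval T y * (real a + real J) / real a \<le> (1 + 1 / real J) * (keyval T x + keyval T y)"
      using exists_good_scale[OF J keyval_pos[OF T0] keyval_pos[OF T0], of x y] by blast
    define b where "b = a - 1"
    have b: "b < J * J" "b + 1 = a" using a by (auto simp: b_def)
    obtain x' where x': "A i (b * n + k) = Some x'" "scaled T (int (a + J)) (int J) x x'"
      using A[OF ij(1) b(1) k] x b(2) by (auto simp: option_rel_Some1 add_ac)
    obtain y' where y': "B (b * n + k) j = Some y'" "scaled T (int (a + J)) (int a) y y'"
      using B[OF ij(2) b(1) k] y b(2) by (auto simp: option_rel_Some1 add_ac)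
    have s0: "0 < keyval T x + keyval T y" using keyval_pos[OF T0, of x] keyval_pos[OF T0, of y] by simp
    have fac: "(1 + 1 / real_of_int T) * ((1 + 1 / real J) * (keyval T x + keyval T y)) \<le>
      (1 + 3 / real J) * (keyval T x + keyval T y)"
    proof -
      have J0: "0 < real J" using J by simp
      have "real J \<le> real_of_int T" using T by linarith
      then have "1 / real_of_int T \<le> 1 / real J" using J0 by (intro divide_left_mono) auto
      then have "(1 + 1 / real_of_int T) * (1 + 1 / real J) \<le> (1 + 1 / real J) * (1 + 1 / real J)"
        using J0 by (intro mult_right_mono) auto
      also have "\<dots> = 1 + 2 / real J + 1 / real J * (1 / real J)" by (simp add: algebra_simps)
      also have "\<dots> \<le> 1 + 2 / real J + 1 / real J * 1"
        using J by (intro add_left_mono mult_left_mono) auto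
      also have "\<dots> = 1 + 3 / real J" by (simp add: add_divide_distrib[symmetric])
      finally show ?thesis unfolding mult.assoc[symmetric] using s0 by (intro mult_right_mono) auto
    qed
    have up: "keyval T w' \<le> (1 + 3 / real J) * (keyval T x + keyval T y)"
      if "keyval T w' \<le> (1 + 1 / real_of_int T) * Z" "Z \<le> (1 + 1 / real J) * (keyval T x + keyval T y)" for w' Z
    proof -
      have "(1 + 1 / real_of_int T) * Z \<le> (1 + 1 / real_of_int T) * ((1 + 1 / real J) * (keyval T x + keyval T y))"
        using that(2) T0 by (intro mult_left_mono) auto
      then show ?thesis using that(1) fac by linarith
    qed
    have "keyval T x' \<le> (1 + 3 / real J) * (keyval T x + keyval T y)"
      by (rule up[OF _ a(3)]) (use x'(2) in \<open>simp add: scaled_def\<close>)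
    moreover have "keyval T y' \<le> (1 + 3 / real J) * (keyval T x + keyval T y)"
      by (rule up[OF _ a(4)]) (use y'(2) in \<open>simp add: scaled_def\<close>)
    moreover have "key_ereal (D' i j) \<le> ereal (real_of_int (max x' y'))"
    proof -
      have "(MIN h\<in>{..<?N}. ?m h) \<le> ?m (b * n + k)" using idx[OF b(1) k] by (intro Min_le) auto
      then show ?thesis using eq x' y' by (simp add: max_def split: if_splits)
    qed
    ultimately show "\<exists>z. D' i j = Some z \<and> keyval T z \<le> (1 + 3 / real J) * (keyval T x + keyval T y)"
    proof (cases "D' i j")
      case (Some z)
      assume "key_ereal (D' i j) \<le> ereal (real_of_int (max x' y'))"
      then have "z \<le> max x' y'" using Some by simp
      then have "keyval T z \<le> keyval T (max x' y')" by (rule keyval_mono[OF T0])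
      then show ?thesis using Some \<open>keyval T x' \<le> _\<close> \<open>keyval T y' \<le> _\<close> by (auto simp: max_def split: if_splits)
    qed simp
  }
qed

text \<open>The triangle inequality carries the lower bound through each squaring.\<close>

lemma squaring_sound:
  assumes G: "fin_digraph G" "verts G = {..<n}" "\<And>e. e \<in> arcs G \<Longrightarrow> 0 \<le> w e"
    and D0: "\<And>i j z. i < n \<Longrightarrow> j < n \<Longrightarrow> D 0 i j = Some z \<Longrightarrow> distance G w i j \<le> ereal (keyval T z)"
    and sq: "\<And>t. t < R \<Longrightarrow> squared T J n (D t) (D (Suc t))"
  shows "t \<le> R \<Longrightarrow> i < n \<Longrightarrow> j < n \<Longrightarrow> D t i j = Some z \<Longrightarrow> distance G w i j \<le> ereal (keyval T z)"
proof (induction t arbitrary: i j z)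
  case (Suc t)
  then obtain k x y where k: "k < n" "D t i k = Some x" "D t k j = Some y" "keyval T x + keyval T y \<le> keyval T z"
    using sq[of t] unfolding squared_def by (metis Suc_le_lessD)
  have "distance G w i j \<le> distance G w i k + distance G w k j" by (rule distance_triangle[OF G(1,3)])
  also have "\<dots> \<le> ereal (keyval T x) + ereal (keyval T y)"
    using Suc k by (intro add_mono Suc.IH) auto
  also have "\<dots> \<le> ereal (keyval T z)" using k by simp
  finally show ?case .
qed (use D0 in auto)

text \<open>A walk of at most \<open>2 ^ Suc t\<close> arcs is cut after \<open>2 ^ t\<close> arcs.
  \<open>\<eta>\<close> bounds the additive error of a starting key, in particular of the diagonal
  keys that stand in for an empty half; at most \<open>2 ^ t\<close> starting keys are
  combined.\<close>

lemma squaring_complete: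
  assumes G: "wf_digraph G" "verts G = {..<n}"
    and D0: "\<And>i. i < n \<Longrightarrow> \<exists>z. D 0 i i = Some z \<and> keyval T z \<le> \<eta>"
      "\<And>e. e \<in> arcs G \<Longrightarrow> w e \<noteq> \<infinity> \<Longrightarrow> \<exists>z. D 0 (tail G e) (head G e) = Some z \<and> ereal (keyval T z) \<le> w e + ereal \<eta>"
    and sq: "\<And>t. t < R \<Longrightarrow> squared T J n (D t) (D (Suc t))"
  shows "t \<le> R \<Longrightarrow> pre_digraph.awalk G i p j \<Longrightarrow> length p \<le> 2 ^ t \<Longrightarrow> (\<Sum>e\<leftarrow>p. w e) = ereal d \<Longrightarrow>
    (\<And>e. e \<in> set p \<Longrightarrow> 0 \<le> w e) \<Longrightarrow>
    \<exists>z. D t i j = Some z \<and> keyval T z \<le> (1 + 3 / real J) ^ t * (d + 2 ^ t * \<eta>)"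
proof (induction t arbitrary: i p j d)
  case 0
  interpret wf_digraph G by fact
  show ?case
  proof (cases p)
    case Nil
    then show ?thesis using 0 D0(1)[of i] G(2) by (auto simp: awalk_Nil_iff zero_ereal_def)
  next
    case (Cons e p')
    then have p: "p = [e]" using 0 by simp
    then have e: "e \<in> arcs G" "tail G e = i" "head G e = j" "w e = ereal d"
      using 0 by (auto simp: awalk_simps)
    then show ?thesis using D0(2)[of e] by auto
  qed
next
  case (Suc t)
  interpret wf_digraph G by fact
  define p1 p2 where p12: "p1 = take (2 ^ t) p" "p2 = drop (2 ^ t) p"
  have p: "p = p1 @ p2" by (simp add: p12)
  have len: "length p1 \<le> 2 ^ t" "length p2 \<le> 2 ^ t" using Suc.prems(3) by (auto simp: p12)
  obtain k where k: "awalk i p1 k" "awalk k p2 j" using Suc.prems(2) p by auto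
  have kn: "k < n" using k(2) G(2) awalk_hd_in_verts by auto
  have ij: "i < n" "j < n" using Suc.prems(2) G(2) awalk_hd_in_verts awalk_last_in_verts by auto
  have nn: "0 \<le> (\<Sum>e\<leftarrow>p1. w e)" "0 \<le> (\<Sum>e\<leftarrow>p2. w e)"
    using Suc.prems(5) p by (auto intro!: sum_list_nonneg)
  have "(\<Sum>e\<leftarrow>p1. w e) + (\<Sum>e\<leftarrow>p2. w e) = ereal d" using Suc.prems(4) p by simp
  then obtain d1 d2 where d: "(\<Sum>e\<leftarrow>p1. w e) = ereal d1" "(\<Sum>e\<leftarrow>p2. w e) = ereal d2" "d1 + d2 = d"
    using nn by (cases "\<Sum>e\<leftarrow>p1. w e"; cases "\<Sum>e\<leftarrow>p2. w e") auto
  obtain x where x: "D t i k = Some x" "keyval T x \<le> (1 + 3 / real J) ^ t * (d1 + 2 ^ t * \<eta>)"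
    using Suc.IH[OF _ k(1) len(1) d(1)] Suc.prems(1,5) p by auto
  obtain y where y: "D t k j = Some y" "keyval T y \<le> (1 + 3 / real J) ^ t * (d2 + 2 ^ t * \<eta>)"
    using Suc.IH[OF _ k(2) len(2) d(2)] Suc.prems(1,5) p by auto
  obtain z where z: "D (Suc t) i j = Some z" "keyval T z \<le> (1 + 3 / real J) * (keyval T x + keyval T y)"
    using sq[of t] Suc.prems(1) ij kn x(1) y(1) unfolding squared_def by (metis Suc_le_lessD)
  have "(1 + 3 / real J) * (keyval T x + keyval T y) \<le>
    (1 + 3 / real J) * ((1 + 3 / real J) ^ t * (d1 + 2 ^ t * \<eta>) + (1 + 3 / real J) ^ t * (d2 + 2 ^ t * \<eta>))"
    using x(2) y(2) by (intro mult_left_mono add_mono) auto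
  also have "\<dots> = (1 + 3 / real J) * (1 + 3 / real J) ^ t * ((d1 + d2) + (2 * 2 ^ t) * \<eta>)"
    by (simp only: distrib_left distrib_right mult.assoc) simp
  also have "\<dots> = (1 + 3 / real J) ^ Suc t * (d + 2 ^ Suc t * \<eta>)" using d(3) by simp
  finally have "keyval T z \<le> (1 + 3 / real J) ^ Suc t * (d + 2 ^ Suc t * \<eta>)" using z(2) by linarith
  then show ?case using z(1) by blast
qed

text \<open>Bernoulli's inequality bounds powers from below, so it is applied to
  \<open>1 / (1 + \<delta>) = 1 - \<delta> / (1 + \<delta>)\<close>. The conversion back uses
  \<open>(1 - x) * (1 + 2 * x) \<ge> 1\<close> for \<open>x = 1 / (2 * K)\<close>, which is at most
  \<open>1 / 2\<close>.\<close>

lemma power_one_plus_bound: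
  assumes "1 \<le> K" "0 \<le> \<delta>" "real R * \<delta> \<le> 1 / (2 * K)"
  shows "(1 + \<delta>) ^ R \<le> 1 + 1 / K"
proof -
  have h: "1 / (2 * K) \<le> 1 / 2" using assms(1) by (simp add: field_simps)
  have "1 + real R * (- \<delta> / (1 + \<delta>)) \<le> (1 + (- \<delta> / (1 + \<delta>))) ^ R"
    using assms(2) by (intro Bernoulli_inequality) (simp add: field_simps)
  moreover have "1 + (- \<delta> / (1 + \<delta>)) = 1 / (1 + \<delta>)" using assms(2) by (simp add: field_simps)
  moreover have "real R * (\<delta> / (1 + \<delta>)) \<le> real R * \<delta>"
    using assms(2) by (intro mult_left_mono) (auto simp: field_simps)
  ultimately have "1 - 1 / (2 * K) \<le> 1 / (1 + \<delta>) ^ R"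
    using assms(3) by (simp add: power_one_over)
  then have "(1 - 1 / (2 * K)) * (1 + \<delta>) ^ R \<le> 1"
    using assms(2) by (simp add: pos_le_divide_eq)
  moreover have "1 \<le> (1 - 1 / (2 * K)) * (1 + 1 / K)" using assms(1) by (simp add: field_simps)
  ultimately have "(1 - 1 / (2 * K)) * (1 + \<delta>) ^ R \<le> (1 - 1 / (2 * K)) * (1 + 1 / K)" by linarith
  then show ?thesis using h by (simp add: mult_le_cancel_left)
qed

section \<open>The squaring program\<close>

definition log_body :: com where
  "log_body = Seq (Set 10 (Mul (Const 2) (Var 10))) (Set 5 (Add (Var 5) (Const 1)))"

text \<open>The binary logarithm rounded up, which is the number of squarings. It is 0 for a single
  node.\<close>

definition ceil_log :: "nat \<Rightarrow> nat" where
  "ceil_log n = (LEAST r. n \<le> 2 ^ r)"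

lemma ceil_log: "n \<le> 2 ^ ceil_log n"
  unfolding ceil_log_def by (rule LeastI[of _ n]) (simp add: less_imp_le)

lemma less_ceil_log: "r < ceil_log n \<Longrightarrow> 2 ^ r < n"
  unfolding ceil_log_def using not_less_Least by fastforce

lemma ceil_log_le: "n \<le> 2 ^ r \<Longrightarrow> ceil_log n \<le> r"
  unfolding ceil_log_def by (rule Least_le)

lemma power_ceil_log_le: "1 \<le> n \<Longrightarrow> 2 ^ ceil_log n \<le> 2 * n"
  using less_ceil_log[of "ceil_log n - 1" n] by (cases "ceil_log n") auto

lemma runs_ceil_log:
  assumes fits: "fits B M" and M: "2 * int n \<le> M" "4 \<le> M" and n: "1 \<le> n"
    and s: "s 0 0 = Some (int n)" "s 5 0 = Some 0" "s 10 0 = Some 1"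
  shows "runs B (While_Less (Var 10) (Var 0) log_body) ((ceil_log n + 1) * (cost log_body + 10)) s
    (\<lambda>s'. s' 5 0 = Some (int (ceil_log n)))"
proof -
  let ?R = "ceil_log n"
  define I where "I k s' \<longleftrightarrow> (\<exists>r. s' 0 = s 0 \<and> r + k = ?R \<and> s' 10 0 = Some (2 ^ r) \<and> s' 5 0 = Some (int r))"
    for k and s' :: mem
  have RM: "(2::int) ^ ?R \<le> M"
  proof -
    have "int (2 ^ ?R) \<le> int (2 * n)" using power_ceil_log_le[OF n] by (simp only: of_nat_le_iff)
    then show ?thesis using M by simp
  qed
  have "runs B (While_Less (Var 10) (Var 0) log_body)
     (?R * (1 + ops (Var 10) + ops (Var 0) + cost log_body) + (1 + ops (Var 10) + ops (Var 0))) s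
     (\<lambda>s''. (\<exists>j. I j s'') \<and> \<not> ival s'' (Var 10) < ival s'' (Var 0))"
  proof (rule runs_While[where I = I and k = ?R, OF fits])
    show "I ?R s" using s by (auto simp: I_def)
    fix k s' assume "I k s'"
    then obtain r where r: "s' 0 = s 0" "r + k = ?R" "s' 10 0 = Some (2 ^ r)" "s' 5 0 = Some (int r)"
      unfolding I_def by blast
    have rM: "(2::int) ^ r \<le> M" using RM power_increasing[of r ?R "2::int"] r(2) by linarith
    have r5: "int r \<le> M"
    proof -
      have "int r < 2 ^ r" by (rule of_nat_less_two_power)
      then show ?thesis using rM by linarith
    qed
    show "safe M s' (Var 10) \<and> safe M s' (Var 0)" using r rM s M by auto
    assume "ival s' (Var 10) < ival s' (Var 0)"
    then have "int (2 ^ r) < int n" using r s by simp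
    then have "2 ^ r < n" by (simp only: of_nat_less_iff)
    then have "r \<noteq> ?R" using ceil_log[of n] by auto
    then have k: "0 < k" using r(2) by simp
    have "I (k - 1) (s'(10 := (s' 10)(0 \<mapsto> 2 * 2 ^ r), 5 := (s' 5)(0 \<mapsto> int r + 1)))"
      unfolding I_def using r k by (intro exI[of _ "Suc r"]) auto
    then show "0 < k \<and> runs B log_body (cost log_body) s' (I (k - 1))"
      unfolding log_body_def using k r rM r5 M by (intro conjI runs_wp[OF fits]) auto
  qed auto
  then show ?thesis
  proof (rule runs_weaken)
    fix s' assume *: "(\<exists>j. I j s') \<and> \<not> ival s' (Var 10) < ival s' (Var 0)"
    then obtain k r where r: "s' 0 = s 0" "r + k = ?R" "s' 10 0 = Some (2 ^ r)" "s' 5 0 = Some (int r)"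
      unfolding I_def by blast
    then have "int n \<le> int (2 ^ r)" using * s by simp
    then have "n \<le> 2 ^ r" by (simp only: of_nat_le_iff)
    then have "?R \<le> r" by (rule ceil_log_le)
    then show "s' 5 0 = Some (int ?R)" using r by simp
  qed (simp add: algebra_simps)
qed

definition double_body :: com where
  "double_body = Seq (Set 10 (Mul (Const 2) (Var 10))) (Set 11 (Sub (Var 11) (Const 1)))"

text \<open>Doubling is exact, so inputs enter without rounding error. This is the reason for a
  radix \<open>T\<close> that is at least as large as every input mantissa.\<close>

lemma runs_normalise_up:
  assumes fits: "fits B M" and M: "4 \<le> M" "2 * T \<le> M" and T: "1 \<le> T" "T \<le> 2 ^ h"
    and s: "s 16 0 = Some T" "s 10 0 = Some m" "s 11 0 = Some e"
    and m: "1 \<le> m" "m \<le> T" and e: "\<bar>e\<bar> + int h \<le> M"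
  shows "runs B (While_Less (Var 10) (Var 16) double_body) ((h + 1) * (cost double_body + 10)) s
    (\<lambda>s'. \<exists>m' e'. s' 10 0 = Some m' \<and> s' 11 0 = Some e' \<and> T \<le> m' \<and> m' < 2 * T \<and> \<bar>e'\<bar> \<le> \<bar>e\<bar> + int h \<and>
      real_of_int m' * 2 powr real_of_int e' = real_of_int m * 2 powr real_of_int e)"
proof -
  define I where "I k s' \<longleftrightarrow> (\<exists>m' e'. s' 16 = s 16 \<and> s' 10 0 = Some m' \<and> s' 11 0 = Some e' \<and> 1 \<le> m' \<and> m' < 2 * T \<and>
      T \<le> m' * 2 ^ k \<and> e' \<le> e \<and> e - e' + int k \<le> int h \<and>
      real_of_int m' * 2 powr real_of_int e' = real_of_int m * 2 powr real_of_int e)" for k and s' :: mem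
  have "runs B (While_Less (Var 10) (Var 16) double_body)
     (h * (1 + ops (Var 10) + ops (Var 16) + cost double_body) + (1 + ops (Var 10) + ops (Var 16))) s
     (\<lambda>s''. (\<exists>j. I j s'') \<and> \<not> ival s'' (Var 10) < ival s'' (Var 16))"
  proof (rule runs_While[where I = I and k = h, OF fits])
    have "1 * 2 ^ h \<le> m * 2 ^ h" using m by (intro mult_right_mono) auto
    then have "T \<le> m * 2 ^ h" using T by linarith
    then show "I h s" unfolding I_def using s m T by auto
    fix k s' assume "I k s'"
    then obtain m' e' where me: "s' 16 = s 16" "s' 10 0 = Some m'" "s' 11 0 = Some e'" "1 \<le> m'" "m' < 2 * T"
      "T \<le> m' * 2 ^ k" "e' \<le> e" "e - e' + int k \<le> int h"
      "real_of_int m' * 2 powr real_of_int e' = real_of_int m * 2 powr real_of_int e" unfolding I_def by blast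
    show "safe M s' (Var 10) \<and> safe M s' (Var 16)" using me s M T by auto
    assume "ival s' (Var 10) < ival s' (Var 16)"
    then have mT: "m' < T" using me s by simp
    have k: "0 < k" using me(6) mT by (cases k) auto
    have "T \<le> (2 * m') * 2 ^ (k - 1)" using me(6) k by (cases k) auto
    moreover have "2 powr real_of_int e' = 2 * 2 powr real_of_int (e' - 1)" by (simp add: powr_diff)
    ultimately have "I (k - 1) (s'(10 := (s' 10)(0 \<mapsto> 2 * m'), 11 := (s' 11)(0 \<mapsto> e' - 1)))"
      unfolding I_def using me mT k by (auto simp: powr_diff)
    moreover have "\<bar>e'\<bar> \<le> M" using me(7,8) e by linarith
    ultimately show "0 < k \<and> runs B double_body (cost double_body) s' (I (k - 1))"
      unfolding double_body_def using k me mT M by (intro conjI runs_wp[OF fits]) auto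
  qed auto
  then show ?thesis
  proof (rule runs_weaken)
    fix s' assume *: "(\<exists>j. I j s') \<and> \<not> ival s' (Var 10) < ival s' (Var 16)"
    then obtain k m' e' where me: "s' 16 = s 16" "s' 10 0 = Some m'" "s' 11 0 = Some e'" "m' < 2 * T"
      "e' \<le> e" "e - e' + int k \<le> int h"
      "real_of_int m' * 2 powr real_of_int e' = real_of_int m * 2 powr real_of_int e" unfolding I_def by blast
    moreover have "T \<le> m'" using * me s by simp
    moreover have "\<bar>e'\<bar> \<le> \<bar>e\<bar> + int h" using me(5,6) by linarith
    ultimately show "\<exists>m' e'. s' 10 0 = Some m' \<and> s' 11 0 = Some e' \<and> T \<le> m' \<and> m' < 2 * T \<and> \<bar>e'\<bar> \<le> \<bar>e\<bar> + int h \<and>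
      real_of_int m' * 2 powr real_of_int e' = real_of_int m * 2 powr real_of_int e" by blast
  qed (simp add: algebra_simps)
qed

text \<open>Halving truncates, but \<open>Y\<close> stays within one unit of the mantissa, which is
  all that \<open>scaledI\<close> asks for. The loop test is \<open>2 * T \<le> m\<close> in the
  form of a strict comparison.\<close>

lemma runs_normalise_down:
  assumes fits: "fits B M" and M: "4 \<le> M" "2 * T \<le> M" and T: "1 \<le> T"
    and s: "s 16 0 = Some T" "s 10 0 = Some m" "s 11 0 = Some e"
    and m: "T \<le> m" "m < 2 * T * 2 ^ h" "m \<le> M" and e: "\<bar>e\<bar> + int h \<le> M"
    and Y: "real_of_int m * 2 powr real_of_int e \<le> Y" "Y < (real_of_int m + 1) * 2 powr real_of_int e"
  shows "runs B (While_Less (Sub (Mul (Const 2) (Var 16)) (Const 1)) (Var 10) half_body) ((h + 1) * (cost half_body + 15)) s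
    (\<lambda>s'. \<exists>m' e'. s' 10 0 = Some m' \<and> s' 11 0 = Some e' \<and> T \<le> m' \<and> m' < 2 * T \<and> \<bar>e'\<bar> \<le> M \<and>
      real_of_int m' * 2 powr real_of_int e' \<le> Y \<and> Y < (real_of_int m' + 1) * 2 powr real_of_int e')"
proof -
  define I where "I k s' \<longleftrightarrow> (\<exists>m' e'. s' 16 = s 16 \<and> s' 10 0 = Some m' \<and> s' 11 0 = Some e' \<and> T \<le> m' \<and> m' \<le> M \<and>
      m' < 2 * T * 2 ^ k \<and> e \<le> e' \<and> e' - e + int k \<le> int h \<and>
      real_of_int m' * 2 powr real_of_int e' \<le> Y \<and> Y < (real_of_int m' + 1) * 2 powr real_of_int e')" for k and s' :: mem
  let ?e1 = "Sub (Mul (Const 2) (Var 16)) (Const 1)"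
  have "runs B (While_Less ?e1 (Var 10) half_body)
     (h * (1 + ops ?e1 + ops (Var 10) + cost half_body) + (1 + ops ?e1 + ops (Var 10))) s
     (\<lambda>s''. (\<exists>j. I j s'') \<and> \<not> ival s'' ?e1 < ival s'' (Var 10))"
  proof (rule runs_While[where I = I and k = h, OF fits])
    show "I h s" unfolding I_def using s m Y by auto
    fix k s' assume "I k s'"
    then obtain m' e' where me: "s' 16 = s 16" "s' 10 0 = Some m'" "s' 11 0 = Some e'" "T \<le> m'" "m' \<le> M"
      "m' < 2 * T * 2 ^ k" "e \<le> e'" "e' - e + int k \<le> int h"
      "real_of_int m' * 2 powr real_of_int e' \<le> Y" "Y < (real_of_int m' + 1) * 2 powr real_of_int e'" unfolding I_def by blast
    show "safe M s' ?e1 \<and> safe M s' (Var 10)" using me s M T by auto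
    assume "ival s' ?e1 < ival s' (Var 10)"
    then have mT: "2 * T \<le> m'" using me s by simp
    have k: "0 < k" using me(6) mT by (cases k) auto
    have I: "I (k - 1) (s'(10 := (s' 10)(0 \<mapsto> m' div 2), 11 := (s' 11)(0 \<mapsto> e' + 1)))"
      unfolding I_def
    proof (rule exI[of _ "m' div 2"], rule exI[of _ "e' + 1"], intro conjI)
      show "T \<le> m' div 2" using mT by linarith
      have "2 * T * 2 ^ k = 2 * (2 * T * 2 ^ (k - 1))" using k by (cases k) auto
      then show "m' div 2 < 2 * T * 2 ^ (k - 1)" using me(6) by linarith
      have "real_of_int (2 * (m' div 2)) \<le> real_of_int m'" unfolding of_int_le_iff by linarith
      then have "real_of_int (m' div 2) * 2 \<le> real_of_int m'" by simp
      then have "(real_of_int (m' div 2) * 2) * 2 powr real_of_int e' \<le> real_of_int m' * 2 powr real_of_int e'"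
        by (intro mult_right_mono) auto
      moreover have "real_of_int (m' div 2) * 2 powr real_of_int (e' + 1) =
        (real_of_int (m' div 2) * 2) * 2 powr real_of_int e'" by (simp add: powr_add)
      ultimately show "real_of_int (m' div 2) * 2 powr real_of_int (e' + 1) \<le> Y"
        using me(9) by linarith
      have "real_of_int (m' + 1) \<le> real_of_int (2 * (m' div 2) + 2)" unfolding of_int_le_iff by linarith
      then have "real_of_int m' + 1 \<le> (real_of_int (m' div 2) + 1) * 2" by simp
      then have "(real_of_int m' + 1) * 2 powr real_of_int e' \<le> ((real_of_int (m' div 2) + 1) * 2) * 2 powr real_of_int e'"
        by (intro mult_right_mono) auto
      moreover have "(real_of_int (m' div 2) + 1) * 2 powr real_of_int (e' + 1) =
        ((real_of_int (m' div 2) + 1) * 2) * 2 powr real_of_int e'" by (simp add: powr_add)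
      ultimately show "Y < (real_of_int (m' div 2) + 1) * 2 powr real_of_int (e' + 1)"
        using me(10) by linarith
      show "m' div 2 \<le> M" using me(5) mT T by linarith
      show "e' + 1 - e + int (k - 1) \<le> int h" using me(8) k by simp
    qed (use me k in auto)
    moreover have "\<bar>e'\<bar> \<le> M" using me(7,8) e by linarith
    ultimately show "0 < k \<and> runs B half_body (cost half_body) s' (I (k - 1))"
      unfolding half_body_def using k me mT M T by (intro conjI runs_wp[OF fits]) auto
  qed (use m in auto)
  then show ?thesis
  proof (rule runs_weaken)
    fix s' assume *: "(\<exists>j. I j s') \<and> \<not> ival s' ?e1 < ival s' (Var 10)"
    then obtain k m' e' where me: "s' 16 = s 16" "s' 10 0 = Some m'" "s' 11 0 = Some e'" "T \<le> m'"
      "e \<le> e'" "e' - e + int k \<le> int h"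
      "real_of_int m' * 2 powr real_of_int e' \<le> Y" "Y < (real_of_int m' + 1) * 2 powr real_of_int e'" unfolding I_def by blast
    moreover have "m' < 2 * T" using * me s by simp
    moreover have "\<bar>e'\<bar> \<le> M" using me(5,6) e by linarith
    ultimately show "\<exists>m' e'. s' 10 0 = Some m' \<and> s' 11 0 = Some e' \<and> T \<le> m' \<and> m' < 2 * T \<and> \<bar>e'\<bar> \<le> M \<and>
      real_of_int m' * 2 powr real_of_int e' \<le> Y \<and> Y < (real_of_int m' + 1) * 2 powr real_of_int e'" by blast
  qed (simp add: algebra_simps)
qed

text \<open>Splits a key into exponent and mantissa, multiplies the mantissa by the quotient of cell
  0 of arrays 21 and 22, renormalises it and reassembles the key. The last \<open>Const 1\<close> is
  the rounding up of \<open>scaledI\<close>.\<close>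

definition scale_com :: "nat \<Rightarrow> com" where
  "scale_com a = If_Less (Cell 30 (Mul (Const 2) (Var 20))) (Const 1)
     (Seq (Seq (Set 11 (Div (Cell 30 (Add (Mul (Const 2) (Var 20)) (Const 1))) (Var 16)))
        (Seq (Set 10 (Add (Var 16) (Sub (Cell 30 (Add (Mul (Const 2) (Var 20)) (Const 1))) (Mul (Var 11) (Var 16)))))
          (Set 10 (Div (Mul (Var 10) (Var 21)) (Var 22)))))
       (Seq (While_Less (Sub (Mul (Const 2) (Var 16)) (Const 1)) (Var 10) half_body)
         (Seq (Assign a (Mul (Const 2) (Var 7)) (Const 0))
           (Assign a (Add (Mul (Const 2) (Var 7)) (Const 1))
             (Add (Sub (Add (Mul (Var 11) (Var 16)) (Var 10)) (Var 16)) (Const 1))))))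
     (Assign a (Mul (Const 2) (Var 7)) (Const 1))"

lemma writes_scale [simp]: "writes (scale_com a) = {10, 11, a}"
  by (auto simp: scale_com_def half_body_def)

lemma runs_scale:
  assumes fits: "fits B M" and M: "4 \<le> M" "2 * T * (J + 1) \<le> M" and T: "1 \<le> T" and J: "1 \<le> J" "J + 1 \<le> 2 ^ h" "int h \<le> J + 1"
    and s: "s 16 0 = Some T" "s 7 0 = Some (int i)" "int i \<le> M" "s 20 0 = Some (int r)" "int r \<le> M"
      "s 21 0 = Some p" "s 22 0 = Some q" "p \<le> M" "q \<le> M"
    and p: "1 \<le> q" "q \<le> p" "p \<le> q * (J + 1)"
    and x: "int_entry s 30 r x" "\<And>k. x = Some k \<Longrightarrow> \<bar>k\<bar> + J + 1 \<le> M"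
    and a: "a \<in> {51, 52}"
  shows "runs B (scale_com a) (100 + (h + 1) * (cost half_body + 15)) s
    (\<lambda>s'. (\<exists>x'. int_entry s' a i x' \<and> rel_option (scaled T p q) x x') \<and>
      (\<forall>y. y < int 2 * int i \<or> int 2 * int i + int 2 \<le> y \<longrightarrow> s' a y = s a y))"
    (is "runs _ _ _ _ ?Q")
proof (cases x)
  case None
  have "runs B (Assign a (Mul (Const 2) (Var 7)) (Const 1)) 10 s ?Q"
    using None s M a by (intro runs_wpI[OF fits]) (auto simp: int_entry_def intro!: exI[of _ None])
  then have "runs B (scale_com a) (1 + ops (Cell 30 (Mul (Const 2) (Var 20))) + ops (Const 1) + 10) s ?Q"
    unfolding scale_com_def using None x s M by (intro runs_If[OF fits]) (auto simp: int_entry_def)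
  then show ?thesis by (rule runs_weaken) auto
next
  case (Some k)
  have k: "s 30 (2 * int r) = Some 0" "s 30 (2 * int r + 1) = Some k" "\<bar>k\<bar> + J + 1 \<le> M"
    using x Some by (auto simp: int_entry_def)
  define e where "e = k div T"
  define m0 where "m0 = T + k mod T"
  define m where "m = m0 * p div q"
  define Y where "Y = keyval T k * real_of_int p / real_of_int q"
  have T0: "0 < T" using T by simp
  have m0: "T \<le> m0" "m0 < 2 * T" using T0 by (auto simp: m0_def)
  have kv: "keyval T k = real_of_int m0 * 2 powr real_of_int e" by (simp add: keyval_def m0_def e_def)
  have eM: "\<bar>e\<bar> + int h \<le> M" using abs_div_le[of k T] k(3) J(3) unfolding e_def by linarith
  \<comment> \<open>By \<open>q \<le> p\<close> the mantissa does not drop below \<open>T\<close>,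
    so only halvings are needed; \<open>p \<le> q * (J + 1)\<close> limits their number to
    \<open>h\<close>.\<close>
  have mT: "T \<le> m"
  proof -
    have "T * q \<le> m0 * p" using m0 p T by (intro mult_mono) auto
    then have "T * q div q \<le> m0 * p div q" using p by (intro zdiv_mono1) auto
    then show ?thesis using p by (simp add: m_def)
  qed
  have mJ: "m < 2 * T * (J + 1)"
  proof -
    have "m0 * p \<le> m0 * (q * (J + 1))" using m0 p T by (intro mult_left_mono) auto
    then have "m \<le> m0 * (q * (J + 1)) div q" unfolding m_def using p by (intro zdiv_mono1) auto
    also have "m0 * (q * (J + 1)) = (m0 * (J + 1)) * q" by simp
    also have "(m0 * (J + 1)) * q div q = m0 * (J + 1)" using p by simp
    also have "\<dots> < 2 * T * (J + 1)" using m0 J by (intro mult_strict_right_mono) auto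
    finally show ?thesis .
  qed
  have m2: "m < 2 * T * 2 ^ h"
  proof -
    have "2 * T * (J + 1) \<le> 2 * T * 2 ^ h" using J T by (intro mult_left_mono) auto
    then show ?thesis using mJ by linarith
  qed
  have TM: "2 * T \<le> M"
  proof -
    have "2 * T * 1 \<le> 2 * T * (J + 1)" using J T by (intro mult_left_mono) auto
    then show ?thesis using M by linarith
  qed
  have mfl: "m = \<lfloor>real_of_int (m0 * p) / real_of_int q\<rfloor>" unfolding m_def by (rule floor_divide_of_int_eq[symmetric])
  have "real_of_int m \<le> real_of_int (m0 * p) / real_of_int q" "real_of_int (m0 * p) / real_of_int q < real_of_int m + 1"
    unfolding mfl by (rule of_int_floor_le, rule floor_correct[THEN conjunct2, simplified])
  then have "real_of_int m * 2 powr real_of_int e \<le> real_of_int (m0 * p) / real_of_int q * 2 powr real_of_int e"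
    "real_of_int (m0 * p) / real_of_int q * 2 powr real_of_int e < (real_of_int m + 1) * 2 powr real_of_int e"
    by (intro mult_right_mono mult_strict_right_mono; simp)+
  moreover have "real_of_int (m0 * p) / real_of_int q * 2 powr real_of_int e = Y"
    by (simp add: Y_def kv)
  ultimately have Y: "real_of_int m * 2 powr real_of_int e \<le> Y" "Y < (real_of_int m + 1) * 2 powr real_of_int e" by auto
  have e1: "k - e * T = k mod T" by (simp add: e_def minus_div_mult_eq_mod)
  have "runs B (Seq (Seq (Set 11 (Div (Cell 30 (Add (Mul (Const 2) (Var 20)) (Const 1))) (Var 16)))
        (Seq (Set 10 (Add (Var 16) (Sub (Cell 30 (Add (Mul (Const 2) (Var 20)) (Const 1))) (Mul (Var 11) (Var 16)))))
          (Set 10 (Div (Mul (Var 10) (Var 21)) (Var 22)))))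
       (Seq (While_Less (Sub (Mul (Const 2) (Var 16)) (Const 1)) (Var 10) half_body)
         (Seq (Assign a (Mul (Const 2) (Var 7)) (Const 0))
           (Assign a (Add (Mul (Const 2) (Var 7)) (Const 1))
             (Add (Sub (Add (Mul (Var 11) (Var 16)) (Var 10)) (Var 16)) (Const 1))))))
      (1 + 50 + (1 + (h + 1) * (cost half_body + 15) + 30)) s ?Q"
  proof (rule runs_Seq)
    show "runs B (Seq (Set 11 (Div (Cell 30 (Add (Mul (Const 2) (Var 20)) (Const 1))) (Var 16)))
        (Seq (Set 10 (Add (Var 16) (Sub (Cell 30 (Add (Mul (Const 2) (Var 20)) (Const 1))) (Mul (Var 11) (Var 16)))))
          (Set 10 (Div (Mul (Var 10) (Var 21)) (Var 22))))) 50 s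
        (\<lambda>s'. s' 10 0 = Some m \<and> s' 11 0 = Some e)"
    proof (rule runs_wpI[OF fits])
      have "\<bar>k\<bar> \<le> M" "\<bar>e\<bar> \<le> M" "\<bar>m0\<bar> \<le> M" "\<bar>p\<bar> \<le> M" "\<bar>q\<bar> \<le> M" "\<bar>T\<bar> \<le> M"
        using k(3) J eM m0 TM T p s by linarith+
      then show "wp M (Seq (Set 11 (Div (Cell 30 (Add (Mul (Const 2) (Var 20)) (Const 1))) (Var 16)))
        (Seq (Set 10 (Add (Var 16) (Sub (Cell 30 (Add (Mul (Const 2) (Var 20)) (Const 1))) (Mul (Var 11) (Var 16)))))
          (Set 10 (Div (Mul (Var 10) (Var 21)) (Var 22))))) s (\<lambda>s'. s' 10 0 = Some m \<and> s' 11 0 = Some e)"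
        using s k M p T by (auto simp: e_def[symmetric] e1 m0_def[symmetric] m_def)
    qed simp
    fix s1 :: mem assume s1: "s1 10 0 = Some m \<and> s1 11 0 = Some e"
      and fr1: "\<And>b. b \<notin> writes (Seq (Set 11 (Div (Cell 30 (Add (Mul (Const 2) (Var 20)) (Const 1))) (Var 16)))
        (Seq (Set 10 (Add (Var 16) (Sub (Cell 30 (Add (Mul (Const 2) (Var 20)) (Const 1))) (Mul (Var 11) (Var 16)))))
          (Set 10 (Div (Mul (Var 10) (Var 21)) (Var 22))))) \<Longrightarrow> s1 b = s b"
    show "runs B (Seq (While_Less (Sub (Mul (Const 2) (Var 16)) (Const 1)) (Var 10) half_body)
         (Seq (Assign a (Mul (Const 2) (Var 7)) (Const 0))
           (Assign a (Add (Mul (Const 2) (Var 7)) (Const 1))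
             (Add (Sub (Add (Mul (Var 11) (Var 16)) (Var 10)) (Var 16)) (Const 1)))))
         (1 + (h + 1) * (cost half_body + 15) + 30) s1 ?Q"
    proof (rule runs_Seq)
      show "runs B (While_Less (Sub (Mul (Const 2) (Var 16)) (Const 1)) (Var 10) half_body)
        ((h + 1) * (cost half_body + 15)) s1
        (\<lambda>s'. \<exists>m' e'. s' 10 0 = Some m' \<and> s' 11 0 = Some e' \<and> T \<le> m' \<and> m' < 2 * T \<and> \<bar>e'\<bar> \<le> M \<and>
          real_of_int m' * 2 powr real_of_int e' \<le> Y \<and> Y < (real_of_int m' + 1) * 2 powr real_of_int e')"
        by (rule runs_normalise_down[OF fits M(1) TM T, where m = m and e = e])
          (use s1 fr1[of 16] s mT m2 mJ M eM Y in auto)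
      fix s2 assume "\<exists>m' e'. s2 10 0 = Some m' \<and> s2 11 0 = Some e' \<and> T \<le> m' \<and> m' < 2 * T \<and> \<bar>e'\<bar> \<le> M \<and>
          real_of_int m' * 2 powr real_of_int e' \<le> Y \<and> Y < (real_of_int m' + 1) * 2 powr real_of_int e'"
        and fr2: "\<And>b. b \<notin> writes (While_Less (Sub (Mul (Const 2) (Var 16)) (Const 1)) (Var 10) half_body) \<Longrightarrow> s2 b = s1 b"
      then obtain m' e' where me: "s2 10 0 = Some m'" "s2 11 0 = Some e'" "T \<le> m'" "m' < 2 * T" "\<bar>e'\<bar> \<le> M"
        "real_of_int m' * 2 powr real_of_int e' \<le> Y" "Y < (real_of_int m' + 1) * 2 powr real_of_int e'" by blast
      have fr: "s2 b = s b" if "b \<notin> {10, 11}" for b using that fr1[of b] fr2[of b] by (simp add: half_body_def)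
      have sc: "scaled T p q k (e' * T + m' - T + 1)"
        by (rule scaledI[OF T0 me(3,4)]) (use me(6,7) in \<open>simp_all add: Y_def\<close>)
      have m'M: "\<bar>m'\<bar> \<le> M" "\<bar>T\<bar> \<le> M" using me TM T by linarith+
      show "runs B (Seq (Assign a (Mul (Const 2) (Var 7)) (Const 0))
           (Assign a (Add (Mul (Const 2) (Var 7)) (Const 1))
             (Add (Sub (Add (Mul (Var 11) (Var 16)) (Var 10)) (Var 16)) (Const 1)))) 30 s2 ?Q"
        using me m'M fr s M a Some sc
        by (intro runs_wpI[OF fits]) (auto simp: int_entry_def intro!: exI[of _ "Some (e' * T + m' - T + 1)"])
    qed
  qed
  then have "runs B (scale_com a) (1 + ops (Cell 30 (Mul (Const 2) (Var 20))) + ops (Const 1) +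
    (1 + 50 + (1 + (h + 1) * (cost half_body + 15) + 30))) s ?Q"
    unfolding scale_com_def using k s M by (intro runs_If[OF fits]) auto
  then show ?thesis by (rule runs_weaken) auto
qed

section \<open>One round: scaled factors, Min-Max Product, reading back\<close>

lemma writes_shift [simp]: "writes (shift_com d c) = (\<lambda>a. a + d) ` writes c"
  by (induction c) auto

lemma holds_int_key_ereal: "holds_int s a i (key_ereal x) \<longleftrightarrow> int_entry s a i x"
  by (cases x) (auto simp: holds_int_def int_entry_def)

text \<open>The Min-Max Product takes square matrices, here of dimension \<open>n * (J * J)\<close>,
  but only \<open>n\<close> rows of the left and \<open>n\<close> columns of the right factor carry
  keys. \<open>v\<close> is the array holding the restricted coordinate; beyond \<open>n\<close> the
  entry is \<infinity>.\<close>

definition table_body :: "nat \<Rightarrow> com \<Rightarrow> nat \<Rightarrow> com" where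
  "table_body v ix a = Seq (Seq (Set 13 (Div (Var 7) (Var 8))) (Set 15 (Sub (Var 7) (Mul (Var 13) (Var 8)))))
     (If_Less (Var v) (Var 0) (Seq ix (scale_com a)) (Assign a (Mul (Const 2) (Var 7)) (Const 1)))"

text \<open>Column \<open>a * n + k\<close> holds entry \<open>(i, k)\<close> scaled by
  \<open>(a + 1 + J) / J\<close>, with \<open>a\<close> in cell 0 of array 12. In
  \<open>right_body\<close>, row \<open>a * n + k\<close> holds entry \<open>(k, j)\<close> scaled
  by \<open>(a + 1 + J) / (a + 1)\<close>.\<close>

definition left_body :: com where
  "left_body = table_body 13 (Seq (Set 12 (Div (Var 15) (Var 0)))
     (Seq (Set 20 (Add (Mul (Var 13) (Var 0)) (Sub (Var 15) (Mul (Var 12) (Var 0)))))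
       (Seq (Set 21 (Add (Add (Var 12) (Const 1)) (Var 14))) (Set 22 (Var 14))))) 51"

definition right_body :: com where
  "right_body = table_body 15 (Seq (Set 12 (Div (Var 13) (Var 0)))
     (Seq (Set 20 (Add (Mul (Sub (Var 13) (Mul (Var 12) (Var 0))) (Var 0)) (Var 15)))
       (Seq (Set 21 (Add (Add (Var 12) (Const 1)) (Var 14))) (Set 22 (Add (Var 12) (Const 1)))))) 52"

definition back_body :: com where
  "back_body = Seq (Set 13 (Div (Var 7) (Var 0))) (Seq (Set 15 (Sub (Var 7) (Mul (Var 13) (Var 0))))
     (Seq (Set 12 (Add (Mul (Var 13) (Var 8)) (Var 15))) (copy_entry 2 53 12 30 7)))"

definition round_com :: "com \<Rightarrow> com" where
  "round_com P = Seq (Set 50 (Var 8)) (Seq (For 7 9 left_body) (Seq (For 7 9 right_body)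
     (Seq (shift_com 50 P) (For 7 6 back_body))))"

lemma writes_bodies [simp]:
  "writes left_body = {10, 11, 12, 13, 15, 20, 21, 22, 51}"
  "writes right_body = {10, 11, 12, 13, 15, 20, 21, 22, 52}"
  "writes back_body = {12, 13, 15, 30}"
  by (auto simp: left_body_def right_body_def table_body_def back_body_def)

lemma int_entry_cong:
  assumes "\<And>x. int 2 * int i \<le> x \<Longrightarrow> x < int 2 * int i + int 2 \<Longrightarrow> s1 a x = s2 a x"
  shows "int_entry s1 a i x \<longleftrightarrow> int_entry s2 a i x"
  using assms[of "2 * int i"] assms[of "2 * int i + 1"] by (cases x) (simp_all add: int_entry_def)

text \<open>\<open>M\<close> leaves room for the indices of matrices of dimension \<open>N\<close>
  and for a scaled mantissa before it is renormalised; \<open>h\<close> bounds the halvings of that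
  renormalisation.\<close>

locale squaring =
  fixes B :: real and M T :: int and n J N h :: nat
  assumes fits: "fits B M" and n: "1 \<le> n" and J: "1 \<le> J" "int J \<le> T" and N: "N = n * (J * J)"
    and M: "4 \<le> M" "int (N * N) \<le> M" "2 * T * (int J + 1) \<le> M"
    and h: "int J + 1 \<le> 2 ^ h" "h \<le> J + 1"
begin

definition env :: "mem \<Rightarrow> bool" where
  "env s \<longleftrightarrow> s 0 0 = Some (int n) \<and> s 6 0 = Some (int (n * n)) \<and> s 8 0 = Some (int N) \<and>
     s 9 0 = Some (int (N * N)) \<and> s 14 0 = Some (int J) \<and> s 16 0 = Some T"

definition keys :: "mem \<Rightarrow> (nat \<Rightarrow> nat \<Rightarrow> int option) \<Rightarrow> bool" where
  "keys s D \<longleftrightarrow> (\<forall>i<n. \<forall>j<n. int_entry s 30 (i * n + j) (D i j))"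

lemma keysD: "keys s D \<Longrightarrow> i < n \<Longrightarrow> j < n \<Longrightarrow> int_entry s 30 (i * n + j) (D i j)"
  by (simp add: keys_def)

definition bounded :: "int \<Rightarrow> (nat \<Rightarrow> nat \<Rightarrow> int option) \<Rightarrow> bool" where
  "bounded c D \<longleftrightarrow> (\<forall>i<n. \<forall>j<n. \<forall>k. D i j = Some k \<longrightarrow> \<bar>k\<bar> \<le> c)"

lemma T: "1 \<le> T" using J by linarith

lemma N_facts: "1 \<le> N" "n \<le> N" "int N \<le> M" "int n \<le> M" "int (n * n) \<le> M" "int J \<le> M" "N div n = J * J"
proof -
  have JJ: "1 \<le> J * J" using J by simp
  show N1: "1 \<le> N" using n JJ N by simp
  show nN: "n \<le> N" using JJ N by simp
  have "N \<le> N * N" using N1 by simp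
  then have "int N \<le> int (N * N)" by (simp only: of_nat_le_iff)
  then show NM: "int N \<le> M" using M by linarith
  then show "int n \<le> M" using nN by linarith
  have "n * n \<le> N * N" using nN by (intro mult_le_mono)
  then have "int (n * n) \<le> int (N * N)" by (simp only: of_nat_le_iff)
  then show "int (n * n) \<le> M" using M by linarith
  have "2 * T * 1 \<le> 2 * T * (int J + 1)" using T by (intro mult_left_mono) auto
  then show "int J \<le> M" using M J by linarith
  show "N div n = J * J" using n N by simp
qed

lemma scale_index:
  assumes "a < J * J"
  shows "int (a + 1 + J) \<le> M"
proof -
  have "a + 1 + J \<le> J * (J + 1)" using assms by simp
  then have "int (a + 1 + J) \<le> int J * (int J + 1)" by (metis of_nat_le_iff of_nat_mult of_nat_1 of_nat_add)
  also have "\<dots> \<le> (2 * T) * (int J + 1)" using J by (intro mult_right_mono) auto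
  finally show ?thesis using M by simp
qed

text \<open>Treats the left and the right factor at once: \<open>act\<close> is the coordinate
  restricted to \<open>n\<close>, \<open>row\<close> and \<open>col\<close> name the source entry,
  \<open>blk\<close> is the scale index counted from 0 and \<open>scl\<close> the
  denominator.\<close>

lemma runs_table:
  assumes s: "env s" "keys s D" "bounded c D" "c + int J + 1 \<le> M"
    and v: "v = 13 \<and> act = (\<lambda>i j. i) \<or> v = 15 \<and> act = (\<lambda>i j. j)" and d: "d \<in> {51, 52}" and wi: "writes ix = {12, 20, 21, 22}"
    and ix: "\<And>i j s'. i < N \<Longrightarrow> j < N \<Longrightarrow> act i j < n \<Longrightarrow> s' 0 0 = Some (int n) \<Longrightarrow> s' 14 0 = Some (int J) \<Longrightarrow>
      s' 13 0 = Some (int i) \<Longrightarrow> s' 15 0 = Some (int j) \<Longrightarrow>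
      row i j < n \<and> col i j < n \<and> blk i j < J * J \<and> (scl i j = J \<or> scl i j = blk i j + 1) \<and>
      runs B ix 80 s' (\<lambda>s'. s' 20 0 = Some (int (row i j * n + col i j)) \<and>
        s' 21 0 = Some (int (blk i j + 1 + J)) \<and> s' 22 0 = Some (int (scl i j)))"
  shows "runs B (For 7 9 (table_body v ix d)) (N * N * (250 + (h + 1) * (cost half_body + 15) + 12) + 12) s
      (\<lambda>s'. \<exists>A. \<forall>i<N. \<forall>j<N. int_entry s' d (i * N + j) (A i j) \<and>
        (if act i j < n then rel_option (scaled T (int (blk i j + 1 + J)) (int (scl i j))) (D (row i j) (col i j)) (A i j)
         else A i j = None))"
proof -
  let ?t = "100 + (h + 1) * (cost half_body + 15)"
  let ?head = "Seq (Set 13 (Div (Var 7) (Var 8))) (Set 15 (Sub (Var 7) (Mul (Var 13) (Var 8))))"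
  have hJ: "int h \<le> int J + 1" using h by simp
  have J1: "1 \<le> int J" using J by simp
  have Dk: "\<bar>k\<bar> + int J + 1 \<le> M" if "i < n" "j < n" "D i j = Some k" for i j k
  proof -
    have "\<bar>k\<bar> \<le> c" using s(3) that unfolding bounded_def by blast
    then show ?thesis using s(4) by linarith
  qed
  have wr: "writes (table_body v ix d) = {10, 11, 12, 13, 15, 20, 21, 22, d}"
    by (auto simp: table_body_def wi)
  define R where "R i j x \<longleftrightarrow> (if act i j < n then rel_option (scaled T (int (blk i j + 1 + J)) (int (scl i j)))
    (D (row i j) (col i j)) x else x = None)" for i j x
  define Q where "Q y s' \<longleftrightarrow> (\<exists>x. int_entry s' d y x \<and> R (y div N) (y mod N) x)" for y s'
  have finish: "\<exists>A. \<forall>i<N. \<forall>j<N. int_entry s' d (i * N + j) (A i j) \<and> R i j (A i j)" if "\<forall>y<N*N. Q y s'" for s'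
  proof -
    have "\<forall>i j. \<exists>x. i < N \<longrightarrow> j < N \<longrightarrow> int_entry s' d (i * N + j) x \<and> R i j x"
    proof (intro allI)
      fix i j
      show "\<exists>x. i < N \<longrightarrow> j < N \<longrightarrow> int_entry s' d (i * N + j) x \<and> R i j x"
      proof (cases "i < N \<and> j < N")
        case True
        then have "Q (i * N + j) s'" using that square_index_less by blast
        then show ?thesis using True unfolding Q_def by auto
      qed auto
    qed
    then show ?thesis by metis
  qed
  have "runs B (For 7 9 (table_body v ix d)) (N * N * (250 + (h + 1) * (cost half_body + 15) + 12) + 12) s (\<lambda>s'. \<forall>y<N*N. Q y s')"
  proof (rule runs_map[where dst = d and d = 2 and s = s, OF fits])
    show "Q i s2" if "\<And>x. int 2 * int i \<le> x \<Longrightarrow> x < int 2 * int i + int 2 \<Longrightarrow> s1 d x = s2 d x" "Q i s1" for i s1 s2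
      using int_entry_cong[of i s1 d s2] that unfolding Q_def by blast
    fix y s' assume y: "y < N * N" and s7: "s' 7 0 = Some (int y)"
      and fr: "\<And>a. a \<notin> insert 7 (writes (table_body v ix d)) \<Longrightarrow> s' a = s a"
    define i j where ij: "i = y div N" "j = y mod N"
    have ijN: "i < N" "j < N" using y N_facts(1) by (auto simp: ij div_less_iff_less_mult)
    have sc: "s' 0 0 = Some (int n)" "s' 8 0 = Some (int N)" "s' 14 0 = Some (int J)" "s' 16 0 = Some T" "s' 30 = s 30"
      using fr s(1) d unfolding wr by (auto simp: env_def)
    have yM: "int y \<le> M" using y M(2) by (rule less_int_le)
    have ijM: "int i \<le> M" "int j \<le> M" using ijN N_facts(3) by linarith+
    have "runs B (table_body v ix d) (1 + 30 + (1 + 4 + (1 + 80 + ?t))) s'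
      (\<lambda>s''. Q y s'' \<and> (\<forall>x. x < int 2 * int y \<or> int 2 * int y + int 2 \<le> x \<longrightarrow> s'' d x = s' d x))"
      (is "runs _ _ _ _ ?Q")
      unfolding table_body_def
    proof (rule runs_Seq)
      show "runs B ?head 30 s' (\<lambda>s'. s' 13 0 = Some (int i) \<and> s' 15 0 = Some (int j))"
        using s7 sc yM ijM N_facts M by (intro runs_wpI[OF fits]) (auto simp: int_div_mod ij)
      fix s1 :: mem assume s1: "s1 13 0 = Some (int i) \<and> s1 15 0 = Some (int j)"
        and fr1: "\<And>a. a \<notin> writes ?head \<Longrightarrow> s1 a = s' a"
      have f1: "s1 0 0 = Some (int n)" "s1 8 0 = Some (int N)" "s1 14 0 = Some (int J)" "s1 16 0 = Some T" "s1 30 = s 30"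
        "s1 7 0 = Some (int y)" "s1 d = s' d"
        using fr1 sc s7 d by auto
      have act: "ival s1 (Var v) < ival s1 (Var 0) \<longleftrightarrow> act i j < n" using s1 f1 v by auto
      have "runs B (If_Less (Var v) (Var 0) (Seq ix (scale_com d)) (Assign d (Mul (Const 2) (Var 7)) (Const 1)))
        (1 + ops (Var v) + ops (Var 0) + (1 + 80 + ?t)) s1 ?Q"
      proof (rule runs_If[OF fits])
        assume "ival s1 (Var v) < ival s1 (Var 0)"
        then have a: "act i j < n" using act by simp
        define r k p q where rk: "r = row i j" "k = col i j" "p = blk i j" "q = scl i j"
        have I: "r < n" "k < n" "p < J * J" "q = J \<or> q = p + 1"
          and run: "runs B ix 80 s1 (\<lambda>s'. s' 20 0 = Some (int (r * n + k)) \<and> s' 21 0 = Some (int (p + 1 + J)) \<and> s' 22 0 = Some (int q))"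
          using ix[where s' = s1, OF ijN a f1(1,3)] s1 by (auto simp: rk)
        have rM: "int (r * n + k) \<le> M" using square_index_less[OF I(1,2)] N_facts(5) by (rule less_int_le)
        have pM: "int (p + 1 + J) \<le> M" using scale_index[OF I(3)] by auto
        have qp: "1 \<le> int q" "int q \<le> int (p + 1 + J)" using I(4) J by auto
        have pq: "int (p + 1 + J) \<le> int q * (int J + 1)"
        proof -
          have "p + 1 + J \<le> J * (J + 1)" "p + 1 + J \<le> (p + 1) * (J + 1)" using I(3) J by simp_all
          then have "p + 1 + J \<le> q * (J + 1)" using I(4) by auto
          then show ?thesis by (metis of_nat_le_iff of_nat_mult of_nat_1 of_nat_add)
        qed
        show "runs B (Seq ix (scale_com d)) (1 + 80 + ?t) s1 ?Q"
        proof (rule runs_Seq[OF run])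
          fix s2 :: mem assume s2: "s2 20 0 = Some (int (r * n + k)) \<and> s2 21 0 = Some (int (p + 1 + J)) \<and> s2 22 0 = Some (int q)"
            and fr2: "\<And>b. b \<notin> writes ix \<Longrightarrow> s2 b = s1 b"
          have f2: "s2 16 0 = Some T" "s2 30 = s 30" "s2 7 0 = Some (int y)" "s2 d = s' d" using fr2 f1 d wi by auto
          have ent: "int_entry s2 30 (r * n + k) (D r k)"
            using keysD[OF s(2) I(1,2)] f2(2) by (simp only: int_entry_def)
          have "runs B (scale_com d) ?t s2
            (\<lambda>s'. (\<exists>x'. int_entry s' d y x' \<and> rel_option (scaled T (int (p + 1 + J)) (int q)) (D r k) x') \<and>
              (\<forall>z. z < int 2 * int y \<or> int 2 * int y + int 2 \<le> z \<longrightarrow> s' d z = s2 d z))"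
            by (rule runs_scale[where s = s2 and r = "r * n + k" and J = "int J", OF fits M(1,3) T J1 h(1) hJ])
              (use f2 s2 yM rM pM qp pq ent Dk[OF I(1,2)] d in auto)
          then show "runs B (scale_com d) ?t s2 ?Q"
            by (rule runs_weaken) (use a f2 in \<open>auto simp: Q_def R_def ij[symmetric] rk\<close>)
        qed
      next
        assume "\<not> ival s1 (Var v) < ival s1 (Var 0)"
        then have "\<not> act i j < n" using act by simp
        then have "runs B (Assign d (Mul (Const 2) (Var 7)) (Const 1)) 10 s1 ?Q"
          using f1 yM M by (intro runs_wpI[OF fits]) (auto simp: Q_def R_def ij[symmetric] int_entry_def)
        then show "runs B (Assign d (Mul (Const 2) (Var 7)) (Const 1)) (1 + 80 + ?t) s1 ?Q" by (rule runs_weaken) auto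
      qed (use s1 f1 ijM N_facts M v in auto)
      then show "runs B (If_Less (Var v) (Var 0) (Seq ix (scale_com d)) (Assign d (Mul (Const 2) (Var 7)) (Const 1)))
        (1 + 4 + (1 + 80 + ?t)) s1 ?Q" by (rule runs_weaken) auto
    qed
    then show "runs B (table_body v ix d) (250 + (h + 1) * (cost half_body + 15)) s' ?Q" by (rule runs_weaken) auto
  qed (use s(1) M d wr in \<open>auto simp: env_def\<close>)
  then show ?thesis by (rule runs_weaken) (use finish in \<open>auto simp: R_def\<close>)
qed

lemma runs_left_right:
  assumes s: "env s" "keys s D" "bounded c D" "c + int J + 1 \<le> M"
  shows runs_left: "runs B (For 7 9 left_body) (N * N * (250 + (h + 1) * (cost half_body + 15) + 12) + 12) s
      (\<lambda>s'. \<exists>A. (\<forall>i<N. \<forall>j<N. int_entry s' 51 (i * N + j) (A i j) \<and>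
        (if i < n then rel_option (scaled T (int (j div n + 1 + J)) (int J)) (D i (j mod n)) (A i j) else A i j = None)))"
    and runs_right: "runs B (For 7 9 right_body) (N * N * (250 + (h + 1) * (cost half_body + 15) + 12) + 12) s
      (\<lambda>s'. \<exists>A. (\<forall>i<N. \<forall>j<N. int_entry s' 52 (i * N + j) (A i j) \<and>
        (if j < n then rel_option (scaled T (int (i div n + 1 + J)) (int (i div n + 1))) (D (i mod n) j) (A i j) else A i j = None)))"
proof -
  have small: "j div n < J * J" "j mod n < n" "int (j div n) \<le> M" "int j \<le> M" "int (j div n + 1 + J) \<le> M" if "j < N" for j
  proof -
    show a: "j div n < J * J" "j mod n < n" using that n N by (auto simp: div_less_iff_less_mult mult.commute)
    show "int (j div n) \<le> M" "int (j div n + 1 + J) \<le> M" using scale_index[OF a(1)] by auto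
    show "int j \<le> M" using that N_facts(3) by linarith
  qed
  show "runs B (For 7 9 left_body) (N * N * (250 + (h + 1) * (cost half_body + 15) + 12) + 12) s
      (\<lambda>s'. \<exists>A. (\<forall>i<N. \<forall>j<N. int_entry s' 51 (i * N + j) (A i j) \<and>
        (if i < n then rel_option (scaled T (int (j div n + 1 + J)) (int J)) (D i (j mod n)) (A i j) else A i j = None)))"
    unfolding left_body_def
  proof (rule runs_table[where row = "\<lambda>i j. i" and col = "\<lambda>i j. j mod n" and blk = "\<lambda>i j. j div n" and scl = "\<lambda>i j. J"
        and act = "\<lambda>i j. i", OF s], goal_cases)
    case (4 i j s')
    then show ?case using small[OF 4(2)] small(4)[OF 4(1)] N_facts M n
      by (intro conjI runs_wpI[OF fits]) (auto simp: int_div_mod)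
  qed auto
  show "runs B (For 7 9 right_body) (N * N * (250 + (h + 1) * (cost half_body + 15) + 12) + 12) s
      (\<lambda>s'. \<exists>A. (\<forall>i<N. \<forall>j<N. int_entry s' 52 (i * N + j) (A i j) \<and>
        (if j < n then rel_option (scaled T (int (i div n + 1 + J)) (int (i div n + 1))) (D (i mod n) j) (A i j) else A i j = None)))"
    unfolding right_body_def
  proof (rule runs_table[where row = "\<lambda>i j. i mod n" and col = "\<lambda>i j. j" and blk = "\<lambda>i j. i div n" and scl = "\<lambda>i j. i div n + 1"
        and act = "\<lambda>i j. j", OF s], goal_cases)
    case (4 i j s')
    then show ?case using small[OF 4(1)] small(4)[OF 4(2)] N_facts M n
      by (intro conjI runs_wpI[OF fits]) (auto simp: int_div_mod)
  qed auto
qed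

end

lemma int_entry_array: "s' b = s a \<Longrightarrow> int_entry s' b i x \<longleftrightarrow> int_entry s a i x"
  by (simp only: int_entry_def)

context squaring
begin

lemma keys_array: "s' 30 = s 30 \<Longrightarrow> keys s' D \<longleftrightarrow> keys s D"
  unfolding keys_def using int_entry_array[of s' 30 s 30] by simp

definition round_time :: "nat \<Rightarrow> nat" where
  "round_time Tm = 100 + N * N * (600 + 2 * ((h + 1) * (cost half_body + 15)) + cost back_body) + Tm"

text \<open>Both denominators satisfy \<open>p \<le> q * (J + 1)\<close> for
  \<open>p = a + 1 + J\<close>, as \<open>scaled_key_bound\<close> demands: \<open>q = J\<close>
  because \<open>a < J * J\<close>, and \<open>q = a + 1\<close> because
  \<open>J \<ge> 1\<close>.\<close>

lemma scaled_bound: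
  assumes "a < J * J" "rel_option (scaled T (int (a + 1 + J)) q) x (Some z)" "q = int J \<or> q = int (a + 1)"
    "\<And>k. x = Some k \<Longrightarrow> \<bar>k\<bar> \<le> c"
  shows "\<bar>z\<bar> \<le> c + T * (int J + 2)"
proof -
  obtain k where k: "x = Some k" "scaled T (int (a + 1 + J)) q k z" using assms(2) by (auto simp: option_rel_Some2)
  have "int (a + 1 + J) \<le> q * (int J + 1)"
    using assms(3)
  proof
    assume q: "q = int J"
    have "a + 1 + J \<le> J * (J + 1)" using assms(1) by simp
    then show ?thesis unfolding q by (metis of_nat_le_iff of_nat_mult of_nat_1 of_nat_add)
  next
    assume "q = int (a + 1)"
    then show ?thesis using J by (simp add: algebra_simps)
  qed
  moreover have "1 \<le> q" "q \<le> int (a + 1 + J)" using assms(3) J by auto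
  ultimately have "k \<le> z \<and> z \<le> k + T * (int J + 2)" using k(2) J T by (intro scaled_key_bound) auto
  moreover have "\<bar>k\<bar> \<le> c" using assms(4) k(1) by blast
  moreover have "0 \<le> T * (int J + 2)" using T by simp
  ultimately show ?thesis by linarith
qed

text \<open>A round enlarges the key bound by the \<open>T * (J + 2)\<close> of
  \<open>scaled_key_bound\<close>. \<open>w\<close> is the bound on the entries with which the
  callee is invoked.\<close>

lemma runs_round:
  assumes s: "env s" "keys s D" "bounded c D" and c: "c + int J + 1 \<le> M" "c + T * (int J + 2) \<le> w" "w \<le> M"
    and call: "\<And>s1 A A'. s1 0 0 = Some (int N) \<Longrightarrow> holds_int_matrix s1 1 N (\<lambda>i j. key_ereal (A i j)) \<Longrightarrow>
      holds_int_matrix s1 2 N (\<lambda>i j. key_ereal (A' i j)) \<Longrightarrow>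
      (\<And>i j k. i < N \<Longrightarrow> j < N \<Longrightarrow> A i j = Some k \<or> A' i j = Some k \<Longrightarrow> \<bar>k\<bar> \<le> w) \<Longrightarrow>
      \<exists>t s2. exec B' P s1 t s2 \<and> t \<le> Tm \<and>
        holds_int_matrix s2 3 N (min_max N (\<lambda>i j. key_ereal (A i j)) (\<lambda>i j. key_ereal (A' i j)))"
    and B': "B' \<le> B"
  shows "runs B (round_com P) (round_time Tm) s
    (\<lambda>s'. \<exists>D'. squared T J n D D' \<and> keys s' D' \<and> bounded (c + T * (int J + 2)) D')"
    (is "runs _ _ _ _ ?Q")
proof -
  define TP where "TP = N * N * (250 + (h + 1) * (cost half_body + 15) + 12) + 12"
  have small: "j div n < J * J" "j mod n < n" if "j < N" for j
    using that n N by (auto simp: div_less_iff_less_mult mult.commute)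
  have Dc: "\<bar>k\<bar> \<le> c" if "i < n" "j < n" "D i j = Some k" for i j k
    using s(3) that unfolding bounded_def by blast
  have "runs B (round_com P) (1 + 5 + (1 + TP + (1 + TP + (1 + Tm + (n * n * (cost back_body + 12) + 12))))) s ?Q"
    unfolding round_com_def
  proof (rule runs_Seq)
    show "runs B (Set 50 (Var 8)) 5 s (\<lambda>s'. s' 50 0 = Some (int N))"
      using s(1) N_facts M by (intro runs_wpI[OF fits]) (auto simp: env_def)
    fix s1 :: mem assume s150: "s1 50 0 = Some (int N)" and fr1: "\<And>a. a \<notin> writes (Set 50 (Var 8)) \<Longrightarrow> s1 a = s a"
    have e1: "env s1" "keys s1 D"
      using s fr1 keys_array[of s1 s] by (auto simp: env_def)
    show "runs B (Seq (For 7 9 left_body) (Seq (For 7 9 right_body) (Seq (shift_com 50 P) (For 7 6 back_body))))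
      (1 + TP + (1 + TP + (1 + Tm + (n * n * (cost back_body + 12) + 12)))) s1 ?Q"
    proof (rule runs_Seq[OF runs_left[OF e1 s(3) c(1), folded TP_def]])
      fix s2 assume "\<exists>A. \<forall>i<N. \<forall>j<N. int_entry s2 51 (i * N + j) (A i j) \<and>
        (if i < n then rel_option (scaled T (int (j div n + 1 + J)) (int J)) (D i (j mod n)) (A i j) else A i j = None)"
        and fr2: "\<And>a. a \<notin> writes (For 7 9 left_body) \<Longrightarrow> s2 a = s1 a"
      then obtain A where A: "\<And>i j. i < N \<Longrightarrow> j < N \<Longrightarrow> int_entry s2 51 (i * N + j) (A i j) \<and>
        (if i < n then rel_option (scaled T (int (j div n + 1 + J)) (int J)) (D i (j mod n)) (A i j) else A i j = None)"
        by blast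
      have e2: "env s2" "keys s2 D"
        using e1 fr2 keys_array[of s2 s1] by (auto simp: env_def)
      show "runs B (Seq (For 7 9 right_body) (Seq (shift_com 50 P) (For 7 6 back_body)))
        (1 + TP + (1 + Tm + (n * n * (cost back_body + 12) + 12))) s2 ?Q"
      proof (rule runs_Seq[OF runs_right[OF e2 s(3) c(1), folded TP_def]])
        fix s3 assume "\<exists>A. \<forall>i<N. \<forall>j<N. int_entry s3 52 (i * N + j) (A i j) \<and>
          (if j < n then rel_option (scaled T (int (i div n + 1 + J)) (int (i div n + 1))) (D (i mod n) j) (A i j) else A i j = None)"
          and fr3: "\<And>a. a \<notin> writes (For 7 9 right_body) \<Longrightarrow> s3 a = s2 a"
        then obtain A' where A': "\<And>i j. i < N \<Longrightarrow> j < N \<Longrightarrow> int_entry s3 52 (i * N + j) (A' i j) \<and>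
          (if j < n then rel_option (scaled T (int (i div n + 1 + J)) (int (i div n + 1))) (D (i mod n) j) (A' i j) else A' i j = None)"
          by blast
        have e3: "env s3" using e2 fr3 unfolding env_def by auto
        have Ab: "\<bar>k\<bar> \<le> c + T * (int J + 2)" if ij: "i < N" "j < N" and k: "A i j = Some k" for i j k
        proof -
          have *: "i < n" "rel_option (scaled T (int (j div n + 1 + J)) (int J)) (D i (j mod n)) (Some k)"
            using A[OF ij] k by (auto split: if_splits)
          show ?thesis by (rule scaled_bound[OF small(1)[OF ij(2)] *(2) disjI1[OF refl] Dc[OF *(1) small(2)[OF ij(2)]]])
        qed
        have A'b: "\<bar>k\<bar> \<le> c + T * (int J + 2)" if ij: "i < N" "j < N" and k: "A' i j = Some k" for i j k
        proof -
          have *: "j < n" "rel_option (scaled T (int (i div n + 1 + J)) (int (i div n + 1))) (D (i mod n) j) (Some k)"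
            using A'[OF ij] k by (auto split: if_splits)
          show ?thesis by (rule scaled_bound[OF small(1)[OF ij(1)] *(2) disjI2[OF refl] Dc[OF small(2)[OF ij(1)] *(1)]])
        qed
        define mm where "mm = min_max N (\<lambda>i j. key_ereal (A i j)) (\<lambda>i j. key_ereal (A' i j))"
        have f3: "s3 51 = s2 51" "s3 50 = s1 50" using fr2 fr3 by auto
        have h1: "holds_int_matrix (\<lambda>a. s3 (a + 50)) 1 N (\<lambda>i j. key_ereal (A i j))"
          unfolding holds_int_matrix_def holds_int_key_ereal using A int_entry_array[of "\<lambda>a. s3 (a + 50)" 1 s2 51] f3(1) by simp
        have h2: "holds_int_matrix (\<lambda>a. s3 (a + 50)) 2 N (\<lambda>i j. key_ereal (A' i j))"
          unfolding holds_int_matrix_def holds_int_key_ereal using A' int_entry_array[of "\<lambda>a. s3 (a + 50)" 2 s3 52] by simp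
        have bound_w: "\<bar>k\<bar> \<le> w" if "i < N" "j < N" "A i j = Some k \<or> A' i j = Some k" for i j k
          using Ab[of i j k] A'b[of i j k] that c(2) by auto
        obtain t s4 where P: "exec B' P (\<lambda>a. s3 (a + 50)) t s4" "t \<le> Tm" "holds_int_matrix s4 3 N mm"
        proof -
          have "(\<lambda>a. s3 (a + 50)) 0 0 = Some (int N)" using s150 f3(2) by simp
          then have "\<exists>t s4. exec B' P (\<lambda>a. s3 (a + 50)) t s4 \<and> t \<le> Tm \<and> holds_int_matrix s4 3 N mm"
            unfolding mm_def by (rule call[OF _ h1 h2]) (rule bound_w)
          then show ?thesis using that by blast
        qed
        \<comment> \<open>A Min-Max value is an entry of one of the factors, hence again a bounded
          key or \<infinity>.\<close>
        have "\<exists>x. mm i j = key_ereal x \<and> (\<forall>k. x = Some k \<longrightarrow> \<bar>k\<bar> \<le> c + T * (int J + 2))" if ij: "i < n" "j < n" for i j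
        proof -
          have ijN: "i < N" "j < N" using ij N_facts(2) by auto
          have "mm i j \<in> (\<lambda>k. max (key_ereal (A i k)) (key_ereal (A' k j))) ` {..<N}"
            unfolding mm_def min_max_def using N_facts(1) by (intro Min_in) (auto simp: lessThan_empty_iff)
          then obtain k where k: "k < N" "mm i j = max (key_ereal (A i k)) (key_ereal (A' k j))" by auto
          then have "mm i j = key_ereal (A i k) \<or> mm i j = key_ereal (A' k j)" by (auto simp: max_def)
          then show ?thesis using Ab[OF ijN(1) k(1)] A'b[OF k(1) ijN(2)] by blast
        qed
        then obtain D' where D': "\<And>i j. i < n \<Longrightarrow> j < n \<Longrightarrow> mm i j = key_ereal (D' i j) \<and>
          (\<forall>k. D' i j = Some k \<longrightarrow> \<bar>k\<bar> \<le> c + T * (int J + 2))" by metis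
        have bD': "bounded (c + T * (int J + 2)) D'" unfolding bounded_def using D' by blast
        have sq: "squared T J n D D'"
        proof (rule squared_if_min_max[OF J(2,1) n])
          have idx: "a * n + k < N" "(a * n + k) div n = a" "(a * n + k) mod n = k" if "a < J * J" "k < n" for a k
          proof -
            have "a * n + k < (a + 1) * n" using that by simp
            also have "\<dots> \<le> (J * J) * n" using that by (intro mult_le_mono1) simp
            finally show "a * n + k < N" by (simp add: N mult.commute)
          qed (use that in auto)
          show "rel_option (scaled T (int (a + 1 + J)) (int J)) (D i k) (A i (a * n + k))"
            if "i < n" "a < J * J" "k < n" for i a k
            using A[of i "a * n + k"] that idx[OF that(2,3)] N_facts(2) by simp
          show "rel_option (scaled T (int (a + 1 + J)) (int (a + 1))) (D k j) (A' (a * n + k) j)"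
            if "j < n" "a < J * J" "k < n" for j a k
            using A'[of "a * n + k" j] that idx[OF that(2,3)] N_facts(2) by simp
          show "key_ereal (D' i j) = min_max (n * (J * J)) (\<lambda>i j. key_ereal (A i j)) (\<lambda>i j. key_ereal (A' i j)) i j"
            if "i < n" "j < n" for i j using D'[OF that] by (simp add: mm_def N)
        qed
        show "runs B (Seq (shift_com 50 P) (For 7 6 back_body)) (1 + Tm + (n * n * (cost back_body + 12) + 12)) s3 ?Q"
        proof (rule runs_Seq[OF runs_shift[OF P(1) B' P(2)]])
          fix s5 assume s5: "(\<forall>a. s5 (a + 50) = s4 a) \<and> (\<forall>a<50. s5 a = s3 a)"
          have s553: "s5 53 = s4 3" using spec[OF conjunct1[OF s5], of 3] by simp
          have e5: "env s5" using e3 s5 unfolding env_def by auto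
          have ent: "int_entry s5 53 (i * N + j) (D' i j)" if "i < n" "j < n" for i j
          proof -
            have "holds_int s4 3 (i * N + j) (mm i j)"
              using holds_int_matrixD[OF P(3), of i j] that N_facts(2) by simp
            then have "int_entry s4 3 (i * N + j) (D' i j)"
              using D'[OF that] by (simp add: holds_int_key_ereal)
            then show ?thesis using int_entry_array[of s5 53 s4 3] s553 by simp
          qed
          have "runs B (For 7 6 back_body) (n * n * (cost back_body + 12) + 12) s5
            (\<lambda>s'. \<forall>y<n*n. int_entry s' 30 y (D' (y div n) (y mod n)))"
          proof (rule runs_map[where dst = 30 and d = 2 and s = s5, OF fits])
            show "int_entry t2 30 i (D' (i div n) (i mod n))"
              if "\<And>x. int 2 * int i \<le> x \<Longrightarrow> x < int 2 * int i + int 2 \<Longrightarrow> t1 30 x = t2 30 x"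
                "int_entry t1 30 i (D' (i div n) (i mod n))" for i t1 t2
              using int_entry_cong[of i t1 30 t2] that by blast
            fix y s' assume y: "y < n * n" and s7: "s' 7 0 = Some (int y)"
              and fr: "\<And>a. a \<notin> insert 7 (writes back_body) \<Longrightarrow> s' a = s5 a"
            define i j where ij: "i = y div n" "j = y mod n"
            have ij': "i < n" "j < n" using y n by (auto simp: ij div_less_iff_less_mult)
            have sc: "s' 0 0 = Some (int n)" "s' 8 0 = Some (int N)" "s' 53 = s4 3"
              using fr[of 0] fr[of 8] fr[of 53] e5 s553 by (auto simp: env_def)
            have yM: "int y \<le> M" using y N_facts(5) by (rule less_int_le)
            have dm: "int y div int n = int i" "int y - int i * int n = int j"
              using int_div_mod[of y n] by (auto simp: ij)
            have ijM: "int i \<le> M" "int j \<le> M" using ij' N_facts(4) by linarith+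
            have "i * N + j < N * N" using ij' N_facts(2) by (intro square_index_less) auto
            then have kM: "int (i * N + j) \<le> M" using M(2) by (rule less_int_le)
            have ent': "int_entry s4 3 (i * N + j) (D' i j)" using ent[OF ij'] int_entry_array[of s5 53 s4 3] s553 by simp
            have ok: "entry_ok 2 M s4 3 (i * N + j)"
            proof -
              have "\<bar>k\<bar> \<le> M" if "D' i j = Some k" for k using D'[OF ij'] that c by force
              then show ?thesis using ent' by (cases "D' i j") (auto simp: entry_ok_def int_entry_def interval_1_2)
            qed
            have cp: "wp M (copy_entry 2 53 12 30 7) (s'(13 := (s' 13)(0 \<mapsto> int i), 15 := (s' 15)(0 \<mapsto> int j),
               12 := (s' 12)(0 \<mapsto> int i * int N + int j)))
              (\<lambda>s''. int_entry s'' 30 y (D' (y div n) (y mod n)) \<and>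
               (\<forall>x. x < int 2 * int y \<or> int 2 * int y + int 2 \<le> x \<longrightarrow> s'' 30 x = s' 30 x))"
            proof (rule wp_mono, rule wp_copy_entry[where i = "i * N + j" and j = y])
              show "entry_ok 2 M (s'(13 := (s' 13)(0 \<mapsto> int i), 15 := (s' 15)(0 \<mapsto> int j),
                12 := (s' 12)(0 \<mapsto> int i * int N + int j))) 53 (i * N + j)"
                using ok sc(3) by (simp add: entry_ok_def)
              fix s'' assume se: "same_entry 2 (s'(13 := (s' 13)(0 \<mapsto> int i), 15 := (s' 15)(0 \<mapsto> int j),
                12 := (s' 12)(0 \<mapsto> int i * int N + int j))) 53 (i * N + j) s'' 30 y \<and>
                (\<forall>x. x < int 2 * int y \<or> int 2 * int y + int 2 \<le> x \<longrightarrow> s'' 30 x = (s'(13 := (s' 13)(0 \<mapsto> int i), 15 := (s' 15)(0 \<mapsto> int j),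
                12 := (s' 12)(0 \<mapsto> int i * int N + int j))) 30 x)"
              have "holds_int (s'(13 := (s' 13)(0 \<mapsto> int i), 15 := (s' 15)(0 \<mapsto> int j),
                12 := (s' 12)(0 \<mapsto> int i * int N + int j))) 53 (i * N + j) (key_ereal (D' i j))"
                unfolding holds_int_key_ereal using ent' sc(3)
                by (subst int_entry_array[where s = s4 and a = 3]) simp_all
              then have "holds_int s'' 30 y (key_ereal (D' i j))" using se same_entry_int by blast
              then show "int_entry s'' 30 y (D' (y div n) (y mod n)) \<and>
               (\<forall>x. x < int 2 * int y \<or> int 2 * int y + int 2 \<le> x \<longrightarrow> s'' 30 x = s' 30 x)"
                using se by (simp add: holds_int_key_ereal ij)
            qed (use M s7 yM kM in auto)
            show "runs B back_body (cost back_body) s' (\<lambda>s''. int_entry s'' 30 y (D' (y div n) (y mod n)) \<and>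
               (\<forall>x. x < int 2 * int y \<or> int 2 * int y + int 2 \<le> x \<longrightarrow> s'' 30 x = s' 30 x))"
              unfolding back_body_def
              apply (rule runs_wp[OF fits])
              using s7 sc yM ijM N_facts M n cp by (auto simp: dm)
          qed (use e5 N_facts in \<open>auto simp: env_def\<close>)
          then show "runs B (For 7 6 back_body) (n * n * (cost back_body + 12) + 12) s5 ?Q"
          proof (rule runs_weaken, simp)
            fix s' assume *: "\<forall>y<n*n. int_entry s' 30 y (D' (y div n) (y mod n))"
            have "keys s' D'" unfolding keys_def
            proof (intro allI impI)
              fix i j assume ij: "i < n" "j < n"
              then show "int_entry s' 30 (i * n + j) (D' i j)"
                using *[rule_format, OF square_index_less[OF ij]] by simp
            qed
            then show "\<exists>D'. squared T J n D D' \<and> keys s' D' \<and> bounded (c + T * (int J + 2)) D'" using sq bD' by blast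
          qed
        qed
      qed
    qed
  qed
  then show ?thesis
  proof (rule runs_weaken)
    have "n * n * (cost back_body + 12) \<le> N * N * (cost back_body + 12)"
      using N_facts(2) by (intro mult_le_mono1 mult_le_mono)
    moreover have "1 \<le> N * N" using N_facts(1) by simp
    moreover define g where "g = (h + 1) * (cost half_body + 15)"
    moreover have "N * N * (600 + 2 * g + cost back_body) = 2 * (N * N * (250 + g + 12)) + N * N * (cost back_body + 12) + 64 * (N * N)"
      by (simp add: algebra_simps)
    ultimately show "1 + 5 + (1 + TP + (1 + TP + (1 + Tm + (n * n * (cost back_body + 12) + 12)))) \<le> round_time Tm"
      unfolding round_time_def TP_def g_def[symmetric] by linarith
  qed
qed

text \<open>The growth is additive, so after \<open>R\<close> rounds the bound has risen by
  \<open>R * (T * (J + 2))\<close> only, and a single \<open>w\<close> serves all calls.\<close>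

lemma runs_rounds:
  assumes s: "env s" "keys s D0" "bounded c D0" "s 5 0 = Some (int R)" "int R \<le> M"
    and c: "c + int R * (T * (int J + 2)) \<le> w" "w + int J + 1 \<le> M" "0 \<le> c"
    and call: "\<And>s1 A A'. s1 0 0 = Some (int N) \<Longrightarrow> holds_int_matrix s1 1 N (\<lambda>i j. key_ereal (A i j)) \<Longrightarrow>
      holds_int_matrix s1 2 N (\<lambda>i j. key_ereal (A' i j)) \<Longrightarrow>
      (\<And>i j k. i < N \<Longrightarrow> j < N \<Longrightarrow> A i j = Some k \<or> A' i j = Some k \<Longrightarrow> \<bar>k\<bar> \<le> w) \<Longrightarrow>
      \<exists>t s2. exec B' P s1 t s2 \<and> t \<le> Tm \<and>
        holds_int_matrix s2 3 N (min_max N (\<lambda>i j. key_ereal (A i j)) (\<lambda>i j. key_ereal (A' i j)))"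
    and B': "B' \<le> B"
  shows "runs B (For 19 5 (round_com P)) (R * (round_time Tm + 12) + 12) s
    (\<lambda>s'. \<exists>D. D 0 = D0 \<and> (\<forall>t<R. squared T J n (D t) (D (Suc t))) \<and> keys s' (D R) \<and> bounded w (D R))"
proof -
  have TJ: "0 \<le> T * (int J + 2)" using T by simp
  define b where "b t = c + int t * (T * (int J + 2))" for t
  have bmono: "b t \<le> b t'" if "t \<le> t'" for t t'
    unfolding b_def using that TJ by (intro add_left_mono mult_right_mono) auto
  have bR: "b R \<le> w" using c unfolding b_def by simp
  define I where "I t s' \<longleftrightarrow> (\<exists>D. D 0 = D0 \<and> (\<forall>u<t. squared T J n (D u) (D (Suc u))) \<and> keys s' (D t) \<and> bounded (b t) (D t))"
    for t s'
  have "runs B (For 19 5 (round_com P)) (R * (round_time Tm + 12) + 12) s (I R)"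
  proof (rule runs_For[where s = s, OF fits])
    show "I 0 s" unfolding I_def b_def using s by (intro exI[of _ "\<lambda>_. D0"]) auto
    show "I i (s'(19 := x)) = I i s'" for i s' x unfolding I_def using keys_array[of "s'(19 := x)" s'] by simp
    fix t s' assume t: "t < R" and I: "I t s'"
      and fr: "\<And>a. a \<notin> insert 19 (writes (round_com P)) \<Longrightarrow> s' a = s a"
    from I obtain D where D: "D 0 = D0" "\<forall>u<t. squared T J n (D u) (D (Suc u))" "keys s' (D t)" "bounded (b t) (D t)"
      unfolding I_def by blast
    \<comment> \<open>The callee works on arrays from 50 on, so the constants in \<open>env\<close>
      survive a round.\<close>
    have "s' a = s a" if "a \<in> {0, 6, 8, 9, 14, 16}" for a
    proof -
      have "a \<notin> (\<lambda>a. a + 50) ` writes P" using that by auto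
      then show ?thesis using fr[of a] that by (auto simp: round_com_def)
    qed
    then have e: "env s'" using s(1) by (simp add: env_def)
    have bt: "b t + T * (int J + 2) = b (Suc t)" unfolding b_def by (simp add: algebra_simps)
    have b1: "b t + int J + 1 \<le> M" using bmono[of t R] t bR c by linarith
    have b2: "b t + T * (int J + 2) \<le> w" unfolding bt using bmono[of "Suc t" R] t bR by linarith
    have wM: "w \<le> M" using c by linarith
    have "runs B (round_com P) (round_time Tm) s'
      (\<lambda>s''. \<exists>D'. squared T J n (D t) D' \<and> keys s'' D' \<and> bounded (b t + T * (int J + 2)) D')"
      by (rule runs_round[OF e D(3,4) b1 b2 wM _ B']) (rule call)
    then show "runs B (round_com P) (round_time Tm) s' (I (Suc t))"
    proof (rule runs_weaken, simp)
      fix s'' assume "\<exists>D'. squared T J n (D t) D' \<and> keys s'' D' \<and> bounded (b t + T * (int J + 2)) D'"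
      then obtain D' where D': "squared T J n (D t) D'" "keys s'' D'" "bounded (b (Suc t)) D'" unfolding bt by blast
      show "I (Suc t) s''" unfolding I_def
        using D D' by (intro exI[of _ "D(Suc t := D')"]) (auto simp: less_Suc_eq)
    qed
  qed (use s in \<open>auto simp: round_com_def\<close>)
  then show ?thesis
  proof (rule runs_weaken, simp)
    fix s' assume "I R s'"
    then obtain D where D: "D 0 = D0" "\<forall>u<R. squared T J n (D u) (D (Suc u))" "keys s' (D R)" "bounded (b R) (D R)"
      unfolding I_def by blast
    moreover have "bounded w (D R)" using D(4) bR unfolding bounded_def by (meson order_trans)
    ultimately show "\<exists>D. D 0 = D0 \<and> (\<forall>t<R. squared T J n (D t) (D (Suc t))) \<and> keys s' (D R) \<and> bounded w (D R)" by blast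
  qed
qed

end

section \<open>Constants, input and output of the complete program\<close>

definition const_com :: "nat \<Rightarrow> com" where
  "const_com b = Seq (Set 14 (Mul (Mul (Const 6) (Cell 0 (Const 1))) (Add (Var 5) (Const 1))))
     (Seq (Set 8 (Mul (Var 0) (Mul (Var 14) (Var 14)))) (Seq (Set 9 (Mul (Var 8) (Var 8)))
       (Seq (Set 6 (Mul (Var 0) (Var 0))) (Seq (Set 16 (Var 14)) (Set 17 (Const (int b)))))))"

definition setup_com :: "nat \<Rightarrow> com" where
  "setup_com b = Seq (Seq (Set 5 (Const 0)) (Set 10 (Const 1)))
     (Seq (While_Less (Var 10) (Var 0) log_body) (Seq (const_com b)
       (Seq (For 7 17 (Set 16 (Mul (Var 16) (Add (Var 0) (Const 1)))))
         (Set 18 (Mul (Sub (Const 0) (Add (Add (Mul (Const 2) (Var 0)) (Var 16)) (Var 14))) (Var 16))))))"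

definition load_float :: com where
  "load_float = If_Less (Cell 1 (Mul (Const 3) (Var 7))) (Const 1)
     (Seq (Seq (Set 10 (Cell 1 (Add (Mul (Const 3) (Var 7)) (Const 1))))
               (Set 11 (Cell 1 (Add (Mul (Const 3) (Var 7)) (Const 2)))))
       (Seq (While_Less (Var 10) (Var 16) double_body)
         (Seq (Assign 30 (Mul (Const 2) (Var 7)) (Const 0))
           (Assign 30 (Add (Mul (Const 2) (Var 7)) (Const 1)) (Add (Mul (Var 11) (Var 16)) (Sub (Var 10) (Var 16)))))))
     (Assign 30 (Mul (Const 2) (Var 7)) (Const 1))"

text \<open>Two strict comparisons single out the diagonal, which receives the key in cell 0 of
  array 18 whatever the input says there: a loop lies on no simple path.\<close>

definition init_body :: com where
  "init_body = Seq (Seq (Set 13 (Div (Var 7) (Var 0))) (Set 15 (Sub (Var 7) (Mul (Var 13) (Var 0)))))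
     (If_Less (Var 13) (Var 15) load_float (If_Less (Var 15) (Var 13) load_float
       (Seq (Assign 30 (Mul (Const 2) (Var 7)) (Const 0))
         (Assign 30 (Add (Mul (Const 2) (Var 7)) (Const 1)) (Var 18)))))"

definition store_float :: com where
  "store_float = If_Less (Cell 30 (Mul (Const 2) (Var 7))) (Const 1)
     (Seq (Set 11 (Div (Cell 30 (Add (Mul (Const 2) (Var 7)) (Const 1))) (Var 16)))
       (Seq (Assign 2 (Mul (Const 3) (Var 7)) (Const 0))
         (Seq (Assign 2 (Add (Mul (Const 3) (Var 7)) (Const 1))
             (Add (Var 16) (Sub (Cell 30 (Add (Mul (Const 2) (Var 7)) (Const 1))) (Mul (Var 11) (Var 16)))))
           (Assign 2 (Add (Mul (Const 3) (Var 7)) (Const 2)) (Var 11)))))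
     (Assign 2 (Mul (Const 3) (Var 7)) (Const 1))"

definition zero_float :: com where
  "zero_float = Seq (Assign 2 (Mul (Const 3) (Var 7)) (Const 0))
     (Seq (Assign 2 (Add (Mul (Const 3) (Var 7)) (Const 1)) (Const 0))
       (Assign 2 (Add (Mul (Const 3) (Var 7)) (Const 2)) (Const 0)))"

definition final_body :: com where
  "final_body = Seq (Seq (Set 13 (Div (Var 7) (Var 0))) (Set 15 (Sub (Var 7) (Mul (Var 13) (Var 0)))))
     (If_Less (Var 13) (Var 15) store_float (If_Less (Var 15) (Var 13) store_float zero_float))"

definition APSP_com :: "nat \<Rightarrow> com \<Rightarrow> com" where
  "APSP_com b P = Seq (setup_com b) (Seq (For 7 6 init_body) (Seq (For 19 5 (round_com P)) (For 7 6 final_body)))"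

lemma writes_APSP_parts [simp]:
  "writes load_float = {10, 11, 30}" "writes init_body = {10, 11, 13, 15, 30}"
  "writes store_float = {2, 11}" "writes zero_float = {2}" "writes final_body = {2, 11, 13, 15}"
  "writes (const_com b) = {6, 8, 9, 14, 16, 17}"
  by (auto simp: load_float_def init_body_def store_float_def zero_float_def final_body_def double_body_def const_com_def)

text \<open>\<open>J\<close> is chosen for
  \<open>(1 + 3 / J) ^ (ceil_log n + 1) \<le> 1 + 1 / K\<close>, where
  \<open>power_one_plus_bound\<close> asks for
  \<open>(ceil_log n + 1) * (3 / J) \<le> 1 / (2 * K)\<close>. \<open>T\<close> is at least
  \<open>J\<close>, as the rounding error requires, and at least every input mantissa, so that
  loading is exact.\<close>

locale APSP_machine = squaring +
  fixes K b :: nat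
  assumes K: "1 \<le> K" and J_def: "J = 6 * K * (ceil_log n + 1)" and T_def: "T = int (J * (n + 1) ^ b)"
    and bM: "int b \<le> M" "6 \<le> M"
begin

text \<open>Distance 0 has no key. The diagonal starts with a key so small that its contribution
  to \<open>2 ^ ceil_log n\<close> arcs vanishes in the approximation; the final pass writes 0 there.\<close>

definition zero_key :: int where
  "zero_key = - (2 * int n + T + int J) * T"

lemma J_ge: "6 * K \<le> J" "ceil_log n + 1 \<le> J"
proof -
  show "6 * K \<le> J" unfolding J_def by simp
  have "1 * (ceil_log n + 1) \<le> 6 * K * (ceil_log n + 1)" using K by (intro mult_le_mono1) simp
  then show "ceil_log n + 1 \<le> J" unfolding J_def by simp
qed

lemma runs_setup:
  assumes s: "s 0 0 = Some (int n)" "s 0 1 = Some (int K)"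
  shows "runs B (setup_com b) (300 + (ceil_log n + 1) * (cost log_body + 10) + b * 30) s
    (\<lambda>s'. env s' \<and> s' 5 0 = Some (int (ceil_log n)) \<and> s' 18 0 = Some zero_key \<and> s' 1 = s 1)"
proof -
  let ?R = "ceil_log n"
  note J6 = J_ge
  have KM: "int K \<le> M" "int ?R \<le> M" using J6 N_facts(6) by linarith+
  have "2 * n \<le> N"
  proof -
    have "2 \<le> J * J" using J6 K mult_le_mono[of 2 J 2 J] by simp
    then have "n * 2 \<le> n * (J * J)" by (rule mult_le_mono2)
    then show ?thesis using N by simp
  qed
  then have nM: "2 * int n \<le> M" using N_facts(3) by linarith
  have TM: "T \<le> M"
  proof -
    have "2 * T * 1 \<le> 2 * T * (int J + 1)" using T by (intro mult_left_mono) auto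
    then show ?thesis using M T by linarith
  qed
  have TM': "int (J * (n + 1) ^ i) \<le> M" if "i \<le> b" for i
  proof -
    have "(n + 1) ^ i \<le> (n + 1) ^ b" using that by (intro power_increasing) auto
    then have "J * (n + 1) ^ i \<le> J * (n + 1) ^ b" by (rule mult_le_mono2)
    then have "int (J * (n + 1) ^ i) \<le> T" unfolding T_def by (simp only: of_nat_le_iff)
    then show ?thesis using TM by linarith
  qed
  have "runs B (setup_com b) (1 + 10 + (1 + (?R + 1) * (cost log_body + 10) + (1 + 80 + (1 + (b * (10 + 12) + 12) + 40)))) s
    (\<lambda>s'. env s' \<and> s' 5 0 = Some (int ?R) \<and> s' 18 0 = Some zero_key \<and> s' 1 = s 1)"
    (is "runs _ _ _ _ ?Q")
    unfolding setup_com_def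
  proof (rule runs_Seq)
    show "runs B (Seq (Set 5 (Const 0)) (Set 10 (Const 1))) 10 s (\<lambda>s'. s' 5 0 = Some 0 \<and> s' 10 0 = Some 1)"
      using M by (intro runs_wpI[OF fits]) auto
    fix s1 :: mem assume s1: "s1 5 0 = Some 0 \<and> s1 10 0 = Some 1"
      and fr1: "\<And>a. a \<notin> writes (Seq (Set 5 (Const 0)) (Set 10 (Const 1))) \<Longrightarrow> s1 a = s a"
    have f1: "s1 0 = s 0" "s1 1 = s 1" using fr1 by auto
    show "runs B (Seq (While_Less (Var 10) (Var 0) log_body) (Seq (const_com b)
       (Seq (For 7 17 (Set 16 (Mul (Var 16) (Add (Var 0) (Const 1)))))
         (Set 18 (Mul (Sub (Const 0) (Add (Add (Mul (Const 2) (Var 0)) (Var 16)) (Var 14))) (Var 16))))))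
       (1 + (?R + 1) * (cost log_body + 10) + (1 + 80 + (1 + (b * (10 + 12) + 12) + 40))) s1 ?Q"
    proof (rule runs_Seq)
      show "runs B (While_Less (Var 10) (Var 0) log_body) ((?R + 1) * (cost log_body + 10)) s1
        (\<lambda>s'. s' 5 0 = Some (int ?R))"
        by (rule runs_ceil_log[OF fits nM M(1) n]) (use s f1 s1 in auto)
      fix s2 assume s2: "s2 5 0 = Some (int ?R)"
        and fr2: "\<And>a. a \<notin> writes (While_Less (Var 10) (Var 0) log_body) \<Longrightarrow> s2 a = s1 a"
      have f2: "s2 0 = s 0" "s2 1 = s 1" using fr2 f1 by (auto simp: log_body_def)
      show "runs B (Seq (const_com b)
         (Seq (For 7 17 (Set 16 (Mul (Var 16) (Add (Var 0) (Const 1)))))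
           (Set 18 (Mul (Sub (Const 0) (Add (Add (Mul (Const 2) (Var 0)) (Var 16)) (Var 14))) (Var 16)))))
         (1 + 80 + (1 + (b * (10 + 12) + 12) + 40)) s2 ?Q"
      proof (rule runs_Seq)
        show "runs B (const_com b) 80 s2 (\<lambda>s'. s' 14 0 = Some (int J) \<and> s' 8 0 = Some (int N) \<and> s' 9 0 = Some (int (N * N)) \<and>
          s' 6 0 = Some (int (n * n)) \<and> s' 16 0 = Some (int J) \<and> s' 17 0 = Some (int b))"
          unfolding const_com_def
        proof (rule runs_wpI[OF fits])
          have Ji: "6 * int K * (int ?R + 1) = int J" unfolding J_def by (simp add: algebra_simps)
          have Ni: "int n * (int J * int J) = int N" unfolding N by simp
          show "wp M (Seq (Set 14 (Mul (Mul (Const 6) (Cell 0 (Const 1))) (Add (Var 5) (Const 1))))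
            (Seq (Set 8 (Mul (Var 0) (Mul (Var 14) (Var 14)))) (Seq (Set 9 (Mul (Var 8) (Var 8)))
            (Seq (Set 6 (Mul (Var 0) (Var 0))) (Seq (Set 16 (Var 14)) (Set 17 (Const (int b)))))))) s2
            (\<lambda>s'. s' 14 0 = Some (int J) \<and> s' 8 0 = Some (int N) \<and> s' 9 0 = Some (int (N * N)) \<and>
            s' 6 0 = Some (int (n * n)) \<and> s' 16 0 = Some (int J) \<and> s' 17 0 = Some (int b))"
            using s f2 s2 KM N_facts M bM by (simp add: Ji Ni)
        qed simp
        fix s3 :: mem assume s3: "s3 14 0 = Some (int J) \<and> s3 8 0 = Some (int N) \<and> s3 9 0 = Some (int (N * N)) \<and>
          s3 6 0 = Some (int (n * n)) \<and> s3 16 0 = Some (int J) \<and> s3 17 0 = Some (int b)"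
          and fr3: "\<And>a. a \<notin> writes (const_com b) \<Longrightarrow> s3 a = s2 a"
        have f3: "s3 0 = s 0" "s3 1 = s 1" "s3 5 = s2 5" using fr3 f2 by auto
        show "runs B (Seq (For 7 17 (Set 16 (Mul (Var 16) (Add (Var 0) (Const 1)))))
           (Set 18 (Mul (Sub (Const 0) (Add (Add (Mul (Const 2) (Var 0)) (Var 16)) (Var 14))) (Var 16))))
           (1 + (b * (10 + 12) + 12) + 40) s3 ?Q"
        proof (rule runs_Seq)
          show "runs B (For 7 17 (Set 16 (Mul (Var 16) (Add (Var 0) (Const 1))))) (b * (10 + 12) + 12) s3
            (\<lambda>s'. s' 16 0 = Some (int (J * (n + 1) ^ b)))"
          proof (rule runs_For[where s = s3 and I = "\<lambda>i s'. s' 16 0 = Some (int (J * (n + 1) ^ i))", OF fits])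
            fix i s' assume i: "i < b" and I: "s' 16 0 = Some (int (J * (n + 1) ^ i))"
              and fr: "\<And>a. a \<notin> insert 7 (writes (Set 16 (Mul (Var 16) (Add (Var 0) (Const 1))))) \<Longrightarrow> s' a = s3 a"
            have "s' 0 0 = Some (int n)" using fr[of 0] f3 s by simp
            moreover have "int (J * (n + 1) ^ i) * (int n + 1) = int (J * (n + 1) ^ Suc i)"
              by (simp add: algebra_simps)
            ultimately show "runs B (Set 16 (Mul (Var 16) (Add (Var 0) (Const 1)))) 10 s'
              (\<lambda>s'. s' 16 0 = Some (int (J * (n + 1) ^ Suc i)))"
              using I TM'[of i] i N_facts M by (intro runs_wpI[OF fits]) (simp_all del: of_nat_mult of_nat_power power_Suc)
          qed (use s3 bM in auto)
          fix s4 assume s4: "s4 16 0 = Some (int (J * (n + 1) ^ b))"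
            and fr4: "\<And>a. a \<notin> writes (For 7 17 (Set 16 (Mul (Var 16) (Add (Var 0) (Const 1))))) \<Longrightarrow> s4 a = s3 a"
          have f4: "s4 0 0 = Some (int n)" "s4 1 = s 1" "s4 5 0 = Some (int ?R)" "s4 14 0 = Some (int J)" "s4 8 0 = Some (int N)"
            "s4 9 0 = Some (int (N * N))" "s4 6 0 = Some (int (n * n))" "s4 16 0 = Some T"
            using fr4 f3 s2 s3 s s4 by (auto simp: T_def)
          show "runs B (Set 18 (Mul (Sub (Const 0) (Add (Add (Mul (Const 2) (Var 0)) (Var 16)) (Var 14))) (Var 16))) 40 s4 ?Q"
            using f4 N_facts M TM T by (intro runs_wpI[OF fits]) (auto simp: env_def zero_key_def)
        qed
      qed
    qed
  qed
  then show ?thesis by (rule runs_weaken) (simp_all add: algebra_simps)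
qed

lemma diag_index:
  assumes "y < n * n" "s 7 0 = Some (int y)" "s 0 0 = Some (int n)"
  shows "runs B (Seq (Set 13 (Div (Var 7) (Var 0))) (Set 15 (Sub (Var 7) (Mul (Var 13) (Var 0))))) 30 s
    (\<lambda>s'. s' 13 0 = Some (int (y div n)) \<and> s' 15 0 = Some (int (y mod n)))"
proof (rule runs_wpI[OF fits])
  have yM: "int y \<le> M" using assms(1) N_facts(5) by (rule less_int_le)
  have "y div n < n" using assms(1) n by (simp add: div_less_iff_less_mult)
  then have dM: "int (y div n) \<le> M" using N_facts(4) by linarith
  show "wp M (Seq (Set 13 (Div (Var 7) (Var 0))) (Set 15 (Sub (Var 7) (Mul (Var 13) (Var 0))))) s
      (\<lambda>s'. s' 13 0 = Some (int (y div n)) \<and> s' 15 0 = Some (int (y mod n)))"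
    using assms(2,3) yM dM n N_facts M by (auto simp: int_div_mod)
qed simp

text \<open>Off the diagonal a key represents its weight exactly; \<open>c\<close> bounds these keys
  only.\<close>

definition start_key :: "int \<Rightarrow> (nat \<Rightarrow> nat \<Rightarrow> ereal) \<Rightarrow> nat \<Rightarrow> nat \<Rightarrow> int option \<Rightarrow> bool" where
  "start_key c X i j x \<longleftrightarrow> (if i = j then x = Some zero_key
     else (X i j = \<infinity> \<and> x = None) \<or> (\<exists>z. x = Some z \<and> X i j = ereal (keyval T z) \<and> \<bar>z\<bar> \<le> c))"

text \<open>\<open>E\<close> bounds the input exponents, and normalising changes them by at most
  \<open>g\<close> because \<open>T \<le> 2 ^ g\<close>. The mantissa adds at most one more
  \<open>T\<close> to the key.\<close>

lemma runs_init:
  assumes s: "env s" "s 18 0 = Some zero_key" "\<bar>zero_key\<bar> \<le> M"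
    and X: "holds_float_matrix ((real n + 1) ^ b) s 1 n X"
      "\<And>i j. i < n \<Longrightarrow> j < n \<Longrightarrow> X i j \<noteq> \<infinity> \<Longrightarrow> 1 \<le> X i j \<and> X i j \<le> ereal W" "1 \<le> W"
    and E: "\<lfloor>(real n + 1) ^ b + log 2 W\<rfloor> \<le> E" "E + int g \<le> M" and g: "T \<le> 2 ^ g"
  shows "runs B (For 7 6 init_body) (n * n * (250 + (g + 1) * (cost double_body + 10) + 12) + 12) s
    (\<lambda>s'. \<exists>D. keys s' D \<and> (\<forall>i<n. \<forall>j<n. start_key ((E + int g + 1) * T) X i j (D i j)))"
proof -
  let ?c = "(E + int g + 1) * T"
  define Q where "Q y s' \<longleftrightarrow> (\<exists>x. int_entry s' 30 y x \<and> start_key ?c X (y div n) (y mod n) x)" for y s'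
  have TM: "2 * T \<le> M"
  proof -
    have "2 * T * 1 \<le> 2 * T * (int J + 1)" using T by (intro mult_left_mono) auto
    then show ?thesis using M by linarith
  qed
  have "runs B (For 7 6 init_body) (n * n * (250 + (g + 1) * (cost double_body + 10) + 12) + 12) s (\<lambda>s'. \<forall>y<n*n. Q y s')"
  proof (rule runs_map[where dst = 30 and d = 2 and s = s, OF fits])
    show "Q i s2" if "\<And>x. int 2 * int i \<le> x \<Longrightarrow> x < int 2 * int i + int 2 \<Longrightarrow> s1 30 x = s2 30 x" "Q i s1" for i s1 s2
      using int_entry_cong[of i s1 30 s2] that unfolding Q_def by blast
    fix y s' assume y: "y < n * n" and s7: "s' 7 0 = Some (int y)"
      and fr: "\<And>a. a \<notin> insert 7 (writes init_body) \<Longrightarrow> s' a = s a"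
    define i j where ij: "i = y div n" "j = y mod n"
    have ij': "i < n" "j < n" "i * n + j = y" using y n by (auto simp: ij div_less_iff_less_mult)
    have sc: "s' 0 0 = Some (int n)" "s' 16 0 = Some T" "s' 18 0 = Some zero_key" "s' 1 = s 1"
      using fr s by (auto simp: env_def)
    have yM: "int y \<le> M" using y N_facts(5) by (rule less_int_le)
    have ijM: "int i \<le> M" "int j \<le> M" using ij' N_facts(4) by linarith+
    let ?Q = "\<lambda>s''. Q y s'' \<and> (\<forall>x. x < int 2 * int y \<or> int 2 * int y + int 2 \<le> x \<longrightarrow> s'' 30 x = s' 30 x)"
    have hf: "holds_float ((real n + 1) ^ b) s 1 y (X i j)" using holds_float_matrixD[OF X(1) ij'(1,2)] ij'(3) by simp
    have load: "runs B load_float (100 + (g + 1) * (cost double_body + 10)) s1 ?Q"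
      if ne: "i \<noteq> j" and f1: "s1 16 0 = Some T" "s1 1 = s 1" "s1 7 0 = Some (int y)" "s1 30 = s' 30" for s1
    proof (cases "s 1 (3 * int y) = Some 1")
      case True
      then have "X i j = \<infinity>" using hf by (auto simp: holds_float_def)
      then have "runs B (Assign 30 (Mul (Const 2) (Var 7)) (Const 1)) 10 s1 ?Q"
        using f1 yM M ne by (intro runs_wpI[OF fits])
          (auto simp: Q_def int_entry_def start_key_def ij[symmetric] intro!: exI[of _ None])
      then have "runs B load_float (1 + ops (Cell 1 (Mul (Const 3) (Var 7))) + ops (Const 1) + 10) s1 ?Q"
        unfolding load_float_def using True f1 yM M by (intro runs_If[OF fits]) auto
      then show ?thesis by (rule runs_weaken) auto
    next
      case False
      with hf obtain m e where me: "s 1 (3 * int y) = Some 0" "s 1 (3 * int y + 1) = Some m" "s 1 (3 * int y + 2) = Some e"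
        "\<bar>real_of_int m\<bar> \<le> (real n + 1) ^ b" "X i j = ereal (real_of_int m * 2 powr real_of_int e)"
        unfolding holds_float_def by blast
      have x1: "1 \<le> real_of_int m * 2 powr real_of_int e" "real_of_int m * 2 powr real_of_int e \<le> W"
        using X(2)[OF ij'(1,2)] me(5) by auto
      note fb = float_exponent_bound[OF x1 me(4)]
      have eE: "\<bar>e\<bar> \<le> E" using abs_le_floor[OF fb(2)] E by linarith
      have mT: "m \<le> T"
      proof -
        have "real_of_int m \<le> real_of_int (int ((n + 1) ^ b))" using me(4) by (simp add: add.commute)
        then have "m \<le> int ((n + 1) ^ b)" by (simp only: of_int_le_iff)
        also have "\<dots> \<le> int (J * (n + 1) ^ b)" using J by (simp only: of_nat_le_iff) simp
        finally show ?thesis unfolding T_def .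
      qed
      have "runs B (Seq (Seq (Set 10 (Cell 1 (Add (Mul (Const 3) (Var 7)) (Const 1))))
               (Set 11 (Cell 1 (Add (Mul (Const 3) (Var 7)) (Const 2)))))
       (Seq (While_Less (Var 10) (Var 16) double_body)
         (Seq (Assign 30 (Mul (Const 2) (Var 7)) (Const 0))
           (Assign 30 (Add (Mul (Const 2) (Var 7)) (Const 1)) (Add (Mul (Var 11) (Var 16)) (Sub (Var 10) (Var 16)))))))
        (1 + 30 + (1 + (g + 1) * (cost double_body + 10) + 30)) s1 ?Q"
      proof (rule runs_Seq)
        show "runs B (Seq (Set 10 (Cell 1 (Add (Mul (Const 3) (Var 7)) (Const 1))))
               (Set 11 (Cell 1 (Add (Mul (Const 3) (Var 7)) (Const 2))))) 30 s1
          (\<lambda>s'. s' 10 0 = Some m \<and> s' 11 0 = Some e)"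
        proof (rule runs_wpI[OF fits])
          have "\<bar>m\<bar> \<le> M" "\<bar>e\<bar> \<le> M" using fb(1) mT TM T eE E by linarith+
          then show "wp M (Seq (Set 10 (Cell 1 (Add (Mul (Const 3) (Var 7)) (Const 1))))
               (Set 11 (Cell 1 (Add (Mul (Const 3) (Var 7)) (Const 2))))) s1
            (\<lambda>s'. s' 10 0 = Some m \<and> s' 11 0 = Some e)" using me f1 yM M by auto
        qed simp
        fix s2 :: mem assume s2: "s2 10 0 = Some m \<and> s2 11 0 = Some e"
          and fr2: "\<And>a. a \<notin> writes (Seq (Set 10 (Cell 1 (Add (Mul (Const 3) (Var 7)) (Const 1))))
               (Set 11 (Cell 1 (Add (Mul (Const 3) (Var 7)) (Const 2))))) \<Longrightarrow> s2 a = s1 a"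
        show "runs B (Seq (While_Less (Var 10) (Var 16) double_body)
         (Seq (Assign 30 (Mul (Const 2) (Var 7)) (Const 0))
           (Assign 30 (Add (Mul (Const 2) (Var 7)) (Const 1)) (Add (Mul (Var 11) (Var 16)) (Sub (Var 10) (Var 16))))))
          (1 + (g + 1) * (cost double_body + 10) + 30) s2 ?Q"
        proof (rule runs_Seq)
          show "runs B (While_Less (Var 10) (Var 16) double_body) ((g + 1) * (cost double_body + 10)) s2
            (\<lambda>s'. \<exists>m' e'. s' 10 0 = Some m' \<and> s' 11 0 = Some e' \<and> T \<le> m' \<and> m' < 2 * T \<and> \<bar>e'\<bar> \<le> \<bar>e\<bar> + int g \<and>
              real_of_int m' * 2 powr real_of_int e' = real_of_int m * 2 powr real_of_int e)"
            by (rule runs_normalise_up[OF fits M(1) TM T g]) (use s2 fr2[of 16] f1 fb(1) mT eE E in auto)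
          fix s3 assume "\<exists>m' e'. s3 10 0 = Some m' \<and> s3 11 0 = Some e' \<and> T \<le> m' \<and> m' < 2 * T \<and> \<bar>e'\<bar> \<le> \<bar>e\<bar> + int g \<and>
              real_of_int m' * 2 powr real_of_int e' = real_of_int m * 2 powr real_of_int e"
            and fr3: "\<And>a. a \<notin> writes (While_Less (Var 10) (Var 16) double_body) \<Longrightarrow> s3 a = s2 a"
          then obtain m' e' where me': "s3 10 0 = Some m'" "s3 11 0 = Some e'" "T \<le> m'" "m' < 2 * T" "\<bar>e'\<bar> \<le> \<bar>e\<bar> + int g"
            "real_of_int m' * 2 powr real_of_int e' = real_of_int m * 2 powr real_of_int e" by blast
          have f3: "s3 16 0 = Some T" "s3 7 0 = Some (int y)" "s3 30 = s' 30"
            using fr3 fr2 f1 by (auto simp: double_body_def)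
          define z where "z = e' * T + (m' - T)"
          have "keyval T z = real_of_int (T + (m' - T)) * 2 powr real_of_int e'"
            unfolding z_def using me' T by (intro keyval_split) auto
          then have Xz: "X i j = ereal (keyval T z)" using me(5) me'(6) by simp
          have e'b: "\<bar>e'\<bar> \<le> E + int g" using me'(5) eE by linarith
          have zc: "\<bar>z\<bar> \<le> ?c"
          proof -
            have "\<bar>e' * T\<bar> \<le> (E + int g) * T" using e'b T by (simp add: abs_mult mult_right_mono)
            moreover have "\<bar>m' - T\<bar> \<le> T" using me'(3,4) by linarith
            ultimately have "\<bar>z\<bar> \<le> (E + int g) * T + T" unfolding z_def by linarith
            then show ?thesis by (simp add: algebra_simps)
          qed
          have Mb: "\<bar>m'\<bar> \<le> M" "\<bar>e'\<bar> \<le> M" "\<bar>T\<bar> \<le> M" using me' TM T e'b E by linarith+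
          have sk: "start_key ?c X i j (Some z)" using ne Xz zc by (auto simp: start_key_def)
          show "runs B (Seq (Assign 30 (Mul (Const 2) (Var 7)) (Const 0))
           (Assign 30 (Add (Mul (Const 2) (Var 7)) (Const 1)) (Add (Mul (Var 11) (Var 16)) (Sub (Var 10) (Var 16))))) 30 s3 ?Q"
            using me' f3 Mb yM M sk by (intro runs_wpI[OF fits])
              (auto simp: Q_def int_entry_def ij[symmetric] z_def[symmetric] intro!: exI[of _ "Some z"])
        qed
      qed
      then have "runs B load_float (1 + ops (Cell 1 (Mul (Const 3) (Var 7))) + ops (Const 1) +
        (1 + 30 + (1 + (g + 1) * (cost double_body + 10) + 30))) s1 ?Q"
        unfolding load_float_def using me f1 yM M by (intro runs_If[OF fits]) auto
      then show ?thesis by (rule runs_weaken) auto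
    qed
    define TL where "TL = 100 + (g + 1) * (cost double_body + 10)"
    have "runs B init_body (1 + 30 + (1 + ops (Var 13) + ops (Var 15) + (1 + ops (Var 15) + ops (Var 13) + TL))) s' ?Q"
      unfolding init_body_def
    proof (rule runs_Seq[OF diag_index[of y s', OF y s7 sc(1)]], fold ij)
      fix s1 assume s1: "s1 13 0 = Some (int i) \<and> s1 15 0 = Some (int j)"
        and fr1: "\<And>a. a \<notin> writes (Seq (Set 13 (Div (Var 7) (Var 0))) (Set 15 (Sub (Var 7) (Mul (Var 13) (Var 0))))) \<Longrightarrow> s1 a = s' a"
      have f1: "s1 16 0 = Some T" "s1 1 = s 1" "s1 7 0 = Some (int y)" "s1 30 = s' 30" "s1 18 0 = Some zero_key"
        using fr1 sc s7 by auto
      show "runs B (If_Less (Var 13) (Var 15) load_float (If_Less (Var 15) (Var 13) load_float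
        (Seq (Assign 30 (Mul (Const 2) (Var 7)) (Const 0))
         (Assign 30 (Add (Mul (Const 2) (Var 7)) (Const 1)) (Var 18)))))
        (1 + ops (Var 13) + ops (Var 15) + (1 + ops (Var 15) + ops (Var 13) + TL)) s1 ?Q"
      proof (rule runs_If[OF fits])
        assume "ival s1 (Var 13) < ival s1 (Var 15)"
        then have "i \<noteq> j" using s1 by auto
        then have "runs B load_float TL s1 ?Q" unfolding TL_def using f1 by (intro load) auto
        then show "runs B load_float (1 + ops (Var 15) + ops (Var 13) + TL) s1 ?Q" by (rule runs_weaken) auto
      next
        assume a1: "\<not> ival s1 (Var 13) < ival s1 (Var 15)"
        show "runs B (If_Less (Var 15) (Var 13) load_float
          (Seq (Assign 30 (Mul (Const 2) (Var 7)) (Const 0))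
          (Assign 30 (Add (Mul (Const 2) (Var 7)) (Const 1)) (Var 18)))) (1 + ops (Var 15) + ops (Var 13) + TL) s1 ?Q"
        proof (rule runs_If[OF fits])
          assume "ival s1 (Var 15) < ival s1 (Var 13)"
          then have "i \<noteq> j" using s1 by auto
          then show "runs B load_float TL s1 ?Q" unfolding TL_def using f1 by (intro load) auto
        next
          assume "\<not> ival s1 (Var 15) < ival s1 (Var 13)"
          then have "i = j" using s1 a1 by simp
          then show "runs B (Seq (Assign 30 (Mul (Const 2) (Var 7)) (Const 0))
            (Assign 30 (Add (Mul (Const 2) (Var 7)) (Const 1)) (Var 18))) TL s1 ?Q"
            using f1 yM M s(3) by (intro runs_wpI[OF fits])
              (auto simp: TL_def Q_def int_entry_def start_key_def ij[symmetric] intro!: exI[of _ "Some zero_key"])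
        qed (use s1 ijM M in auto)
      qed (use s1 ijM M in auto)
    qed
    then show "runs B init_body (250 + (g + 1) * (cost double_body + 10)) s' ?Q"
      by (rule runs_weaken) (auto simp: TL_def)
  qed (use s N_facts in \<open>auto simp: env_def\<close>)
  then show ?thesis
  proof (rule runs_weaken, simp)
    fix s' assume *: "\<forall>y<n*n. Q y s'"
    have "\<forall>i j. \<exists>x. i < n \<longrightarrow> j < n \<longrightarrow> int_entry s' 30 (i * n + j) x \<and> start_key ?c X i j x"
    proof (intro allI)
      fix i j
      show "\<exists>x. i < n \<longrightarrow> j < n \<longrightarrow> int_entry s' 30 (i * n + j) x \<and> start_key ?c X i j x"
      proof (cases "i < n \<and> j < n")
        case True
        then have "Q (i * n + j) s'" using * square_index_less by blast
        then show ?thesis using True unfolding Q_def by auto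
      qed auto
    qed
    then obtain D where "\<And>i j. i < n \<Longrightarrow> j < n \<Longrightarrow> int_entry s' 30 (i * n + j) (D i j) \<and> start_key ?c X i j (D i j)" by metis
    then show "\<exists>D. keys s' D \<and> (\<forall>i<n. \<forall>j<n. start_key ?c X i j (D i j))" unfolding keys_def by blast
  qed
qed

definition result :: "(nat \<Rightarrow> nat \<Rightarrow> int option) \<Rightarrow> nat \<Rightarrow> nat \<Rightarrow> ereal" where
  "result D i j = (if i = j then 0 else case D i j of None \<Rightarrow> \<infinity> | Some k \<Rightarrow> ereal (keyval T k))"

lemma runs_final:
  assumes s: "env s" "keys s D" "bounded c D" "c \<le> M"
  shows "runs B (For 7 6 final_body) (n * n * (cost final_body + 12) + 12) s
    (\<lambda>s'. holds_float_matrix (real_of_int (2 * T)) s' 2 n (result D))"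
proof -
  have TM: "\<bar>T\<bar> \<le> M"
  proof -
    have "2 * T * 1 \<le> 2 * T * (int J + 1)" using T by (intro mult_left_mono) auto
    then show ?thesis using M T by linarith
  qed
  have "runs B (For 7 6 final_body) (n * n * (cost final_body + 12) + 12) s
    (\<lambda>s'. \<forall>y<n*n. holds_float (real_of_int (2 * T)) s' 2 y (result D (y div n) (y mod n)))"
  proof (rule runs_map[where dst = 2 and d = 3 and s = s, OF fits])
    show "holds_float m t2 2 i z"
      if "\<And>x. int 3 * int i \<le> x \<Longrightarrow> x < int 3 * int i + int 3 \<Longrightarrow> t1 2 x = t2 2 x" "holds_float m t1 2 i z" for i t1 t2 z m
      using that(1)[of "3 * int i"] that(1)[of "3 * int i + 1"] that(1)[of "3 * int i + 2"] that(2)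
      by (simp add: holds_float_def)
    fix y s' assume y: "y < n * n" and s7: "s' 7 0 = Some (int y)"
      and fr: "\<And>a. a \<notin> insert 7 (writes final_body) \<Longrightarrow> s' a = s a"
    define i j where ij: "i = y div n" "j = y mod n"
    have ij': "i < n" "j < n" "i * n + j = y" using y n by (auto simp: ij div_less_iff_less_mult)
    have sc: "s' 0 0 = Some (int n)" "s' 16 0 = Some T" "s' 30 = s 30"
      using fr s by (auto simp: env_def)
    have yM: "int y \<le> M" using y N_facts(5) by (rule less_int_le)
    have ijM: "int i \<le> M" "int j \<le> M" using ij' N_facts(4) by linarith+
    have dm: "int y div int n = int i" "int y - int i * int n = int j"
      using int_div_mod[of y n] by (auto simp: ij)
    let ?Q = "\<lambda>s''. holds_float (real_of_int (2 * T)) s'' 2 y (result D i j) \<and>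
      (\<forall>x. x < int 3 * int y \<or> int 3 * int y + int 3 \<le> x \<longrightarrow> s'' 2 x = s' 2 x)"
    define s1 where "s1 = s'(13 := (s' 13)(0 \<mapsto> int i), 15 := (s' 15)(0 \<mapsto> int j))"
    have f1: "s1 16 0 = Some T" "s1 7 0 = Some (int y)" "s1 2 = s' 2" "s1 30 = s 30" "s1 13 0 = Some (int i)" "s1 15 0 = Some (int j)"
      using sc s7 by (auto simp: s1_def)
    have ent: "int_entry s1 30 y (D i j)" using keysD[OF s(2) ij'(1,2)] ij'(3) int_entry_array[of s1 30 s 30] f1 by simp
    have store: "wp M store_float s1 ?Q" if ne: "i \<noteq> j"
    proof (cases "D i j")
      case None
      then show ?thesis using ent f1 yM M ne
        by (auto simp: store_float_def int_entry_def holds_float_def result_def)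
    next
      case (Some k)
      have kM: "\<bar>k\<bar> \<le> M" using s(3,4) ij' Some unfolding bounded_def by force
      have e1: "k - k div T * T = k mod T" by (simp add: minus_div_mult_eq_mod)
      have kd: "\<bar>k div T\<bar> \<le> M" using abs_div_le[of k T] kM by linarith
      have "\<bar>real_of_int (T + k mod T)\<bar> \<le> real_of_int (2 * T)"
      proof -
        have "0 \<le> k mod T" "k mod T < T" using T by auto
        then have "\<bar>T + k mod T\<bar> \<le> 2 * T" using T by linarith
        then have "real_of_int \<bar>T + k mod T\<bar> \<le> real_of_int (2 * T)" by (simp only: of_int_le_iff)
        then show ?thesis by simp
      qed
      then show ?thesis using ent f1 yM M TM T ne Some kM kd
        by (auto simp: store_float_def int_entry_def holds_float_def result_def keyval_def e1)
    qed
    have zero: "wp M zero_float s1 ?Q" if "i = j"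
      using f1 yM M T that by (auto simp: zero_float_def holds_float_def result_def)
    have "wp M final_body s' ?Q"
      unfolding final_body_def using s7 sc yM ijM n N_facts M store zero f1
      by (auto simp: dm s1_def[symmetric])
    then show "runs B final_body (cost final_body) s' (\<lambda>s''. holds_float (real_of_int (2 * T)) s'' 2 y (result D (y div n) (y mod n)) \<and>
      (\<forall>x. x < int 3 * int y \<or> int 3 * int y + int 3 \<le> x \<longrightarrow> s'' 2 x = s' 2 x))"
      unfolding ij by (rule runs_wp[OF fits])
  qed (use s N_facts in \<open>auto simp: env_def\<close>)
  then show ?thesis
  proof (rule runs_weaken, simp)
    fix s' assume *: "\<forall>y<n*n. holds_float (real_of_int (2 * T)) s' 2 y (result D (y div n) (y mod n))"
    show "holds_float_matrix (real_of_int (2 * T)) s' 2 n (result D)"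
      unfolding holds_float_matrix_def
    proof (intro allI impI)
      fix i j assume ij: "i < n" "j < n"
      then show "holds_float (real_of_int (2 * T)) s' 2 (i * n + j) (result D i j)"
        using *[rule_format, OF square_index_less[OF ij]] by simp
    qed
  qed
qed

text \<open>The summands below \<open>w\<close> are the largest input key, the diagonal key and the
  growth over all rounds. The postcondition exposes the sequence \<open>D\<close> of key matrices,
  from which correctness follows without further reference to memory.\<close>

lemma runs_APSP:
  assumes s: "s 0 0 = Some (int n)" "s 0 1 = Some (int K)"
    and X: "holds_float_matrix ((real n + 1) ^ b) s 1 n X"
      "\<And>i j. i < n \<Longrightarrow> j < n \<Longrightarrow> X i j \<noteq> \<infinity> \<Longrightarrow> 1 \<le> X i j \<and> X i j \<le> ereal W" "1 \<le> W"
    and E: "\<lfloor>(real n + 1) ^ b + log 2 W\<rfloor> \<le> E" "E + int g \<le> M" and g: "T \<le> 2 ^ g"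
    and w: "(E + int g + 1) * T + \<bar>zero_key\<bar> + int (ceil_log n) * (T * (int J + 2)) \<le> w" "w + int J + 1 \<le> M"
    and call: "\<And>s1 A A'. s1 0 0 = Some (int N) \<Longrightarrow> holds_int_matrix s1 1 N (\<lambda>i j. key_ereal (A i j)) \<Longrightarrow>
      holds_int_matrix s1 2 N (\<lambda>i j. key_ereal (A' i j)) \<Longrightarrow>
      (\<And>i j k. i < N \<Longrightarrow> j < N \<Longrightarrow> A i j = Some k \<or> A' i j = Some k \<Longrightarrow> \<bar>k\<bar> \<le> w) \<Longrightarrow>
      \<exists>t s2. exec B' P s1 t s2 \<and> t \<le> Tm \<and>
        holds_int_matrix s2 3 N (min_max N (\<lambda>i j. key_ereal (A i j)) (\<lambda>i j. key_ereal (A' i j)))"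
    and B': "B' \<le> B"
  shows "runs B (APSP_com b P)
    (400 + (ceil_log n + 1) * (cost log_body + 10) + b * 30 + n * n * (300 + (g + 1) * (cost double_body + 10) + cost final_body)
      + ceil_log n * (round_time Tm + 12)) s
    (\<lambda>s'. \<exists>D. (\<forall>i<n. \<forall>j<n. start_key ((E + int g + 1) * T) X i j (D 0 i j)) \<and>
      (\<forall>t<ceil_log n. squared T J n (D t) (D (Suc t))) \<and>
      holds_float_matrix (real_of_int (2 * T)) s' 2 n (result (D (ceil_log n))))"
    (is "runs _ _ _ _ ?Q")
proof -
  let ?R = "ceil_log n"
  let ?c = "(E + int g + 1) * T + \<bar>zero_key\<bar>"
  have "0 \<le> (real n + 1) ^ b + log 2 W" using X(3) by simp
  then have E0: "0 \<le> E" using E(1) by linarith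
  then have c1: "0 \<le> (E + int g + 1) * T" using T by simp
  have TJ: "0 \<le> int ?R * (T * (int J + 2))" using T by simp
  have zM: "\<bar>zero_key\<bar> \<le> M" using w c1 TJ by linarith
  have RM: "int ?R \<le> M"
    using J_ge(2) N_facts(6) by linarith
  have wM: "w \<le> M" using w by linarith
  have "runs B (APSP_com b P) (1 + (300 + (?R + 1) * (cost log_body + 10) + b * 30) +
    (1 + (n * n * (250 + (g + 1) * (cost double_body + 10) + 12) + 12) +
    (1 + (?R * (round_time Tm + 12) + 12) + (n * n * (cost final_body + 12) + 12)))) s ?Q"
    unfolding APSP_com_def
  proof (rule runs_Seq[OF runs_setup[of s, OF s]])
    fix s1 assume s1: "env s1 \<and> s1 5 0 = Some (int ?R) \<and> s1 18 0 = Some zero_key \<and> s1 1 = s 1"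
    have X1: "holds_float_matrix ((real n + 1) ^ b) s1 1 n X"
      using X(1) s1 by (simp add: holds_float_matrix_def holds_float_def)
    show "runs B (Seq (For 7 6 init_body) (Seq (For 19 5 (round_com P)) (For 7 6 final_body)))
      (1 + (n * n * (250 + (g + 1) * (cost double_body + 10) + 12) + 12) +
      (1 + (?R * (round_time Tm + 12) + 12) + (n * n * (cost final_body + 12) + 12))) s1 ?Q"
    proof (rule runs_Seq[OF runs_init[OF _ _ zM X1 X(2,3) E g]])
      fix s2 assume "\<exists>D. keys s2 D \<and> (\<forall>i<n. \<forall>j<n. start_key ((E + int g + 1) * T) X i j (D i j))"
        and fr2: "\<And>a. a \<notin> writes (For 7 6 init_body) \<Longrightarrow> s2 a = s1 a"
      then obtain D0 where D0: "keys s2 D0" "\<forall>i<n. \<forall>j<n. start_key ((E + int g + 1) * T) X i j (D0 i j)" by blast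
      have e2: "env s2" "s2 5 0 = Some (int ?R)" using s1 fr2 by (auto simp: env_def)
      have bD: "bounded ?c D0" unfolding bounded_def
      proof (intro allI impI)
        fix i j k assume ij: "i < n" "j < n" and k: "D0 i j = Some k"
        have "start_key ((E + int g + 1) * T) X i j (Some k)" using D0(2) ij k by metis
        then show "\<bar>k\<bar> \<le> ?c" using c1 by (auto simp: start_key_def split: if_splits)
      qed
      show "runs B (Seq (For 19 5 (round_com P)) (For 7 6 final_body))
        (1 + (?R * (round_time Tm + 12) + 12) + (n * n * (cost final_body + 12) + 12)) s2 ?Q"
      proof (rule runs_Seq)
        show "runs B (For 19 5 (round_com P)) (?R * (round_time Tm + 12) + 12) s2
          (\<lambda>s'. \<exists>D. D 0 = D0 \<and> (\<forall>t<?R. squared T J n (D t) (D (Suc t))) \<and> keys s' (D ?R) \<and> bounded w (D ?R))"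
          by (rule runs_rounds[OF e2(1) D0(1) bD e2(2) RM w _ _ B']) (use c1 in simp, rule call)
        fix s3 assume "\<exists>D. D 0 = D0 \<and> (\<forall>t<?R. squared T J n (D t) (D (Suc t))) \<and> keys s3 (D ?R) \<and> bounded w (D ?R)"
          and fr3: "\<And>a. a \<notin> writes (For 19 5 (round_com P)) \<Longrightarrow> s3 a = s2 a"
        then obtain D where D: "D 0 = D0" "\<forall>t<?R. squared T J n (D t) (D (Suc t))" "keys s3 (D ?R)" "bounded w (D ?R)" by blast
        have "s3 a = s2 a" if "a \<in> {0, 6, 8, 9, 14, 16}" for a
        proof -
          have "a \<notin> (\<lambda>a. a + 50) ` writes P" using that by auto
          then show ?thesis using fr3[of a] that by (auto simp: round_com_def)
        qed
        then have e3: "env s3" using e2(1) by (simp add: env_def)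
        show "runs B (For 7 6 final_body) (n * n * (cost final_body + 12) + 12) s3 ?Q"
          by (rule runs_weaken[OF runs_final[OF e3 D(3,4) wM]]) (use D D0 in auto)
      qed
    qed (use s1 in auto)
  qed
  then show ?thesis by (rule runs_weaken) (simp_all add: algebra_simps)
qed

end

section \<open>Correctness of the approximate distances\<close>

lemma ceil_log_le_self: "ceil_log n \<le> n"
  by (rule ceil_log_le) (simp add: less_imp_le)

lemma nat_le_two_powr: "real n \<le> 2 powr real n"
proof -
  have "real n \<le> 2 ^ n" by (rule less_imp_le[OF of_nat_less_two_power])
  then show ?thesis by (simp only: powr_realpow[of 2, simplified])
qed

context APSP_machine
begin

text \<open>\<open>zero_key\<close> stands for \<open>T * 2 powr (- (2 * n + T + J))\<close>. The
  three summands of the exponent pay for the factors \<open>2 ^ ceil_log n \<le> 2 * n\<close>,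
  \<open>T\<close> and \<open>J\<close>, each by \<open>x \<le> 2 powr x\<close>.\<close>

lemma keyval_zero_key: "2 ^ ceil_log n * keyval T zero_key \<le> 3 / real J"
proof -
  let ?e = "2 * int n + T + int J"
  have J0: "0 < real J" using J by simp
  have Tn: "T = int (nat T)" using T by simp
  have "keyval T (- ?e * T + 0) = real_of_int (T + 0) * 2 powr real_of_int (- ?e)"
    by (rule keyval_split) (use T in auto)
  then have kv: "keyval T zero_key = real_of_int T * 2 powr (- real_of_int ?e)" by (simp add: zero_key_def)
  have "2 ^ ceil_log n * real_of_int T * real J \<le> 2 powr real (2 * n) * 2 powr real_of_int T * 2 powr real J"
  proof (intro mult_mono)
    have "real (2 ^ ceil_log n) \<le> real (2 * n)" using power_ceil_log_le[OF n] by (simp only: of_nat_le_iff)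
    also have "\<dots> \<le> 2 powr real (2 * n)" by (rule nat_le_two_powr)
    finally show "2 ^ ceil_log n \<le> 2 powr real (2 * n)" by simp
    show "real_of_int T \<le> 2 powr real_of_int T" using nat_le_two_powr[of "nat T"] T by simp
  qed (use T nat_le_two_powr in auto)
  also have "\<dots> = 2 powr real_of_int ?e" by (simp add: powr_add[symmetric])
  finally have *: "2 ^ ceil_log n * real_of_int T * real J \<le> 2 powr real_of_int ?e" .
  have "2 ^ ceil_log n * keyval T zero_key * real J =
    2 ^ ceil_log n * real_of_int T * real J / 2 powr real_of_int ?e"
    unfolding kv powr_minus by (simp add: divide_inverse mult_ac)
  also have "\<dots> \<le> 1" using * by (simp add: pos_divide_le_eq)
  finally have "2 ^ ceil_log n * keyval T zero_key \<le> 1 / real J" using J0 by (simp add: pos_le_divide_eq)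
  also have "\<dots> \<le> 3 / real J" using J0 by (simp add: divide_right_mono)
  finally show ?thesis .
qed

lemma result_correct:
  assumes A: "A \<subseteq> {..<n} \<times> {..<n}" and w: "\<forall>e\<in>A. w e \<in> R_plus"
    and D0: "\<forall>i<n. \<forall>j<n. start_key c (\<lambda>u v. if (u, v) \<in> A then w (u, v) else \<infinity>) i j (D 0 i j)"
    and sq: "\<forall>t<ceil_log n. squared T J n (D t) (D (Suc t))" and uv: "u < n" "v < n"
  shows "distance (graph_on n A) w u v \<le> result (D (ceil_log n)) u v"
    and "result (D (ceil_log n)) u v \<le> ereal (1 + 1 / real K) * distance (graph_on n A) w u v"
proof -
  let ?G = "graph_on n A" and ?R = "ceil_log n" and ?d = "distance (graph_on n A) w"
  have fin: "fin_digraph ?G" by (rule fin_digraph_graph_on[OF A])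
  interpret fin_digraph ?G by (rule fin)
  have w0: "0 \<le> w e" if "e \<in> arcs ?G" for e using w that by (auto intro: R_plus_nonneg)
  have self: "?d i i = 0" if "i < n" for i
  proof (rule antisym)
    have "awalk i [] i" using that by (simp add: awalk_Nil_iff)
    from distance_le_awalk[OF wf_digraph_axioms w0 this] show "?d i i \<le> 0" by simp
    show "0 \<le> ?d i i" unfolding distance_def
      using w0 by (intro INF_greatest sum_list_nonneg) (auto simp: apath_def awalk_def)
  qed
  have start: "(i = j \<and> D 0 i j = Some zero_key) \<or>
    (i \<noteq> j \<and> ((i, j) \<notin> A \<or> w (i, j) = \<infinity>) \<and> D 0 i j = None) \<or>
    (i \<noteq> j \<and> (i, j) \<in> A \<and> (\<exists>z. D 0 i j = Some z \<and> w (i, j) = ereal (keyval T z)))" if "i < n" "j < n" for i j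
  proof -
    have "start_key c (\<lambda>u v. if (u, v) \<in> A then w (u, v) else \<infinity>) i j (D 0 i j)" using D0 that by blast
    then show ?thesis unfolding start_key_def by (auto split: if_splits)
  qed
  have sound: "?d i j \<le> ereal (keyval T z)" if "i < n" "j < n" "D ?R i j = Some z" for i j z
  proof (rule squaring_sound[OF fin _ w0, where D = D and R = ?R and t = ?R])
    show "?d i j \<le> ereal (keyval T z)" if ij: "i < n" "j < n" "D 0 i j = Some z" for i j z
      using start[OF ij(1,2)]
    proof (elim disjE conjE)
      assume "i = j"
      moreover have "0 < keyval T z" using T by (intro keyval_pos) simp
      ultimately show ?thesis using self[OF ij(1)] by simp
    next
      assume "(i, j) \<in> A" and ex: "\<exists>z. D 0 i j = Some z \<and> w (i, j) = ereal (keyval T z)"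
      then have "awalk i [(i, j)] j" using ij by (auto simp: awalk_simps)
      then have "?d i j \<le> (\<Sum>e\<leftarrow>[(i, j)]. w e)" using w0 by (intro distance_le_awalk[OF wf_digraph_axioms])
      then show ?thesis using ex ij by auto
    qed (use ij in simp_all)
  qed (use that sq in auto)
  have complete: "\<exists>z. D ?R u v = Some z \<and> keyval T z \<le> (1 + 1 / real K) * d"
    if ne: "u \<noteq> v" and d: "?d u v = ereal d" for d
  proof -
    obtain p where p: "apath u p v" "?d u v = (\<Sum>e\<leftarrow>p. w e)" using distance_attained[OF fin, of w u v] d by auto
    have aw: "awalk u p v" using p(1) by (rule awalkI_apath)
    have pA: "set p \<subseteq> A" using aw by (auto simp: awalk_def)
    \<comment> \<open>Simple paths have fewer than \<open>n\<close> arcs, so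
      \<open>ceil_log n\<close> squarings reach them all.\<close>
    have len: "length p \<le> 2 ^ ?R" using length_apath_less[OF p(1)] ceil_log[of n] by simp
    have "\<exists>z. D ?R u v = Some z \<and> keyval T z \<le> (1 + 3 / real J) ^ ?R * (d + 2 ^ ?R * keyval T zero_key)"
    proof (rule squaring_complete[OF wf_digraph_axioms, where R = ?R and p = p])
      show "\<exists>z. D 0 i i = Some z \<and> keyval T z \<le> keyval T zero_key" if "i < n" for i
        using start[OF that that] by auto
      show "\<exists>z. D 0 (tail ?G e) (head ?G e) = Some z \<and> ereal (keyval T z) \<le> w e + ereal (keyval T zero_key)"
        if e: "e \<in> arcs ?G" "w e \<noteq> \<infinity>" for e
      proof -
        obtain i j where ij: "e = (i, j)" "i < n" "j < n" using e A by auto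
        have kz: "0 < keyval T zero_key" using T by (intro keyval_pos) simp
        show ?thesis using start[OF ij(2,3)]
        proof (elim disjE conjE)
          assume "D 0 i j = Some zero_key"
          then show ?thesis using w0[OF e(1)] ij(1) add_increasing[of "w e" "ereal (keyval T zero_key)"] by auto
        next
          assume "\<exists>z. D 0 i j = Some z \<and> w (i, j) = ereal (keyval T z)"
          then show ?thesis using ij(1) kz by auto
        qed (use e ij in auto)
      qed
      show "(\<Sum>e\<leftarrow>p. w e) = ereal d" using p(2) d by simp
    qed (use sq aw len pA w0 in auto)
    then obtain z where z: "D ?R u v = Some z" "keyval T z \<le> (1 + 3 / real J) ^ ?R * (d + 2 ^ ?R * keyval T zero_key)" by blast
    \<comment> \<open>Different nodes have distance at least 1, so the absolute error caused by the
      diagonal is also a relative error of at most \<open>3 / J\<close>. It counts like one more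
      squaring, hence the \<open>+ 1\<close> in the choice of \<open>J\<close>.\<close>
    have d1: "1 \<le> d"
    proof -
      obtain e p' where ep: "p = e # p'" using aw ne by (cases p) (auto simp: awalk_simps)
      have "1 \<le> w e" using ep pA w by (auto intro: R_plus_ge_1)
      moreover have "0 \<le> (\<Sum>e\<leftarrow>p'. w e)" using ep pA w0 by (intro sum_list_nonneg) auto
      ultimately have "1 + 0 \<le> w e + (\<Sum>e\<leftarrow>p'. w e)" by (rule add_mono)
      then have "1 \<le> ?d u v" using p(2) ep by simp
      then show ?thesis using d by simp
    qed
    have J0: "0 < real J" using J by simp
    have "3 / real J * 1 \<le> 3 / real J * d" using d1 J0 by (intro mult_left_mono) auto
    then have "2 ^ ?R * keyval T zero_key \<le> 3 / real J * d" using keyval_zero_key by linarith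
    then have "d + 2 ^ ?R * keyval T zero_key \<le> (1 + 3 / real J) * d" by (simp add: algebra_simps)
    then have "(1 + 3 / real J) ^ ?R * (d + 2 ^ ?R * keyval T zero_key) \<le> (1 + 3 / real J) ^ ?R * ((1 + 3 / real J) * d)"
      by (intro mult_left_mono) auto
    also have "\<dots> = (1 + 3 / real J) ^ (?R + 1) * d" by simp
    also have "\<dots> \<le> (1 + 1 / real K) * d"
    proof (intro mult_right_mono power_one_plus_bound)
      have "real J = 6 * real K * real (?R + 1)" unfolding J_def by (simp add: algebra_simps)
      then show "real (?R + 1) * (3 / real J) \<le> 1 / (2 * real K)" using K J0 by (simp add: field_simps)
    qed (use K d1 in auto)
    finally show ?thesis using z by auto
  qed
  have "?d u v \<le> result (D ?R) u v \<and> result (D ?R) u v \<le> ereal (1 + 1 / real K) * ?d u v"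
  proof (cases "u = v")
    case True
    then show ?thesis using self[OF uv(1)] by (simp add: result_def zero_ereal_def[symmetric])
  next
    case ne: False
    show ?thesis
    proof (cases "D ?R u v")
      case None
      have "?d u v = \<infinity>"
      proof (rule ccontr)
        assume inf: "?d u v \<noteq> \<infinity>"
        have "0 \<le> ?d u v" unfolding distance_def
          using w0 by (intro INF_greatest sum_list_nonneg) (auto simp: apath_def awalk_def)
        then obtain d where "?d u v = ereal d" using inf by (cases "?d u v") auto
        then show False using complete[OF ne] None by auto
      qed
      moreover have "0 < 1 + 1 / real K" by (intro add_pos_nonneg) auto
      ultimately show ?thesis using None ne by (simp add: result_def)
    next
      case (Some z)
      have le: "?d u v \<le> ereal (keyval T z)" by (rule sound[OF uv Some])
      have "0 \<le> ?d u v" unfolding distance_def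
        using w0 by (intro INF_greatest sum_list_nonneg) (auto simp: apath_def awalk_def)
      then obtain d where d: "?d u v = ereal d" using le by (cases "?d u v") auto
      then show ?thesis using complete[OF ne d] le Some ne by (auto simp: result_def)
    qed
  qed
  then show "?d u v \<le> result (D ?R) u v" "result (D ?R) u v \<le> ereal (1 + 1 / real K) * ?d u v" by auto
qed

end

section \<open>Word size and running time of the squaring program\<close>

definition poly_bounded :: "real \<Rightarrow> nat \<Rightarrow> real \<Rightarrow> bool" where
  "poly_bounded y k x \<longleftrightarrow> 0 \<le> x \<and> x \<le> y ^ k"

lemma poly_bounded_mono: "3 \<le> y \<Longrightarrow> poly_bounded y i x \<Longrightarrow> i \<le> j \<Longrightarrow> poly_bounded y j x"
  unfolding poly_bounded_def by (auto intro: order_trans[OF _ power_increasing[of i j y]])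

lemma poly_bounded_mult:
  assumes "3 \<le> y" "poly_bounded y i a" "poly_bounded y j b" "i + j \<le> k"
  shows "poly_bounded y k (a * b)"
proof (rule poly_bounded_mono[OF assms(1) _ assms(4)])
  show "poly_bounded y (i + j) (a * b)"
    using assms unfolding poly_bounded_def by (auto simp: power_add intro!: mult_mono)
qed

text \<open>\<open>2 * y ^ m \<le> y ^ Suc m\<close> for \<open>y \<ge> 2\<close>: a sum costs one
  degree. This is crude, but degrees can then be computed mechanically.\<close>

lemma poly_bounded_add:
  assumes "3 \<le> y" "poly_bounded y i a" "poly_bounded y j b" "i < k" "j < k"
  shows "poly_bounded y k (a + b)"
proof -
  obtain m where m: "k = Suc m" using assms(4) by (cases k) auto
  have "a \<le> y ^ m" "b \<le> y ^ m"
    using assms m poly_bounded_mono[of y i a m] poly_bounded_mono[of y j b m] by (auto simp: poly_bounded_def)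
  then have "a + b \<le> 2 * y ^ m" by simp
  also have "\<dots> \<le> y * y ^ m" using assms(1) by (intro mult_right_mono) auto
  finally show ?thesis using assms m by (simp add: poly_bounded_def)
qed

lemma poly_bounded_power: "poly_bounded y i a \<Longrightarrow> poly_bounded y (i * k) (a ^ k)"
  unfolding poly_bounded_def by (auto simp: power_mult intro!: power_mono)

lemma ceil_log_le_log:
  assumes "1 \<le> n"
  shows "real (ceil_log n) \<le> 1 + log 2 (real n)"
proof -
  have "real (2 ^ ceil_log n) \<le> real (2 * n)" using power_ceil_log_le[OF assms] by (simp only: of_nat_le_iff)
  then have "log 2 (2 ^ ceil_log n) \<le> log 2 (2 * real n)" using assms by (subst log_le_cancel_iff) auto
  also have "log 2 (2 * real n) = 1 + log 2 (real n)" using assms by (simp add: log_mult)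
  finally show ?thesis by (simp add: log_nat_power)
qed

text \<open>The quantities of the squaring algorithm, measured by \<open>\<xi> = 1 + 1 / \<epsilon>\<close> and the logarithm
  \<open>\<Lambda> = log 2 (2 + n + 1 / \<epsilon>)\<close>.\<close>

lemma squaring_sizes:
  fixes n K b J N :: nat and \<xi> \<Lambda> v :: real
  assumes n: "1 \<le> n" and K: "1 \<le> K" "real K \<le> \<xi>" and v: "real n + 1 \<le> v" "\<xi> \<le> v" "3 \<le> v" and \<Lambda>: "\<Lambda> = log 2 v"
    and J: "J = 6 * K * (ceil_log n + 1)" and N: "N = n * (J * J)"
  shows "real (ceil_log n + 1) \<le> 3 * \<Lambda>" "real N \<le> 324 * (real n * (\<xi> * \<Lambda>) ^ 2)"
    "real (ceil_log (J + 1) + 1) \<le> 9 * \<Lambda>" "real (ceil_log (J * (n + 1) ^ b) + 1) \<le> (9 + real b) * \<Lambda>"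
    "log 2 (2 + real N) \<le> 14 * \<Lambda>"
proof -
  have \<Lambda>1: "1 \<le> \<Lambda>" unfolding \<Lambda> using v by (intro one_le_log2) simp
  have \<xi>1: "1 \<le> \<xi>" using K by linarith
  have \<Lambda>v: "\<Lambda> \<le> v"
  proof -
    have "v \<le> 2 powr v"
    proof -
      have "1 + real (nat \<lfloor>v\<rfloor>) \<le> 2 ^ nat \<lfloor>v\<rfloor>"
        using Bernoulli_inequality[of 1 "nat \<lfloor>v\<rfloor>"] by simp
      also have "\<dots> = 2 powr real (nat \<lfloor>v\<rfloor>)" by (simp add: powr_realpow)
      also have "\<dots> \<le> 2 powr v" using v by simp
      finally show ?thesis using v by linarith
    qed
    then show ?thesis unfolding \<Lambda> using v by (subst log_le_iff) auto
  qed
  have "log 2 (real n) \<le> \<Lambda>" unfolding \<Lambda> using n v by (subst log_le_cancel_iff) auto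
  then show R: "real (ceil_log n + 1) \<le> 3 * \<Lambda>" using ceil_log_le_log[OF n] \<Lambda>1 by simp
  \<comment> \<open>18 is the 6 in the definition of \<open>J\<close> times the 3 of the preceding
    estimate; the 324 below is its square.\<close>
  have J1: "real J \<le> 18 * (\<xi> * \<Lambda>)"
  proof -
    have "real J = 6 * (real K * real (ceil_log n + 1))" unfolding J by (simp add: algebra_simps)
    also have "\<dots> \<le> 6 * (\<xi> * (3 * \<Lambda>))" using K R \<xi>1 by (intro mult_left_mono mult_mono) auto
    finally show ?thesis by simp
  qed
  have x1: "1 \<le> \<xi> * \<Lambda>" using \<xi>1 \<Lambda>1 mult_mono[of 1 \<xi> 1 \<Lambda>] by simp
  have xv: "\<xi> * \<Lambda> \<le> v ^ 2" unfolding power2_eq_square using v \<Lambda>v \<xi>1 \<Lambda>1 by (intro mult_mono) auto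
  show N1: "real N \<le> 324 * (real n * (\<xi> * \<Lambda>) ^ 2)"
  proof -
    have "real N = real n * (real J * real J)" unfolding N by simp
    also have "\<dots> \<le> real n * ((18 * (\<xi> * \<Lambda>)) * (18 * (\<xi> * \<Lambda>)))" using J1 x1 by (intro mult_left_mono mult_mono) auto
    finally show ?thesis by (simp add: power2_eq_square mult_ac)
  qed
  have logv: "log 2 (a * v ^ k) = log 2 a + real k * \<Lambda>" if "0 < a" for a k
    using that v by (simp add: log_mult log_nat_power \<Lambda>)
  have lg: "log 2 x \<le> real i + real k * \<Lambda>" if "0 < x" "x \<le> a * v ^ k" "a \<le> 2 ^ i" "0 < a" for x a i k
  proof -
    have "log 2 x \<le> log 2 (a * v ^ k)" using that v by (subst log_le_cancel_iff) auto
    also have "\<dots> = log 2 a + real k * \<Lambda>" by (rule logv[OF that(4)])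
    also have "log 2 a \<le> log 2 (2 ^ i)" using that by (subst log_le_cancel_iff) auto
    finally show ?thesis by (simp add: log_nat_power)
  qed
  have v2: "1 \<le> v ^ 2" using v by (intro one_le_power) simp
  have "real (J + 1) \<le> 19 * v ^ 2" using J1 xv v2 by simp
  \<comment> \<open>\<open>19 \<le> 2 ^ 5\<close>. The same 5 serves the constant 18 below, and the
    9 at the end comes from \<open>326 \<le> 2 ^ 9\<close>.\<close>
  then have "log 2 (real (J + 1)) \<le> real 5 + real 2 * \<Lambda>" by (intro lg) auto
  then show "real (ceil_log (J + 1) + 1) \<le> 9 * \<Lambda>" using ceil_log_le_log[of "J + 1"] \<Lambda>1 by simp
  have J0: "1 \<le> J" using K unfolding J by simp
  have "real (J * (n + 1) ^ b) \<le> 18 * v ^ (2 + b)"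
  proof -
    have "real J * (real n + 1) ^ b \<le> (18 * v ^ 2) * v ^ b"
      using J1 xv v by (intro mult_mono power_mono) auto
    then show ?thesis by (simp only: power_add mult.assoc of_nat_mult of_nat_power of_nat_add of_nat_1)
  qed
  then have "log 2 (real (J * (n + 1) ^ b)) \<le> real 5 + real (2 + b) * \<Lambda>" using J0 by (intro lg) auto
  moreover have "1 \<le> J * (n + 1) ^ b" using J0 by simp
  ultimately have "real (ceil_log (J * (n + 1) ^ b)) \<le> 1 + (5 + (2 + real b) * \<Lambda>)"
    using ceil_log_le_log[of "J * (n + 1) ^ b"] by simp
  then show "real (ceil_log (J * (n + 1) ^ b) + 1) \<le> (9 + real b) * \<Lambda>" using \<Lambda>1 by (simp add: algebra_simps)
  have "2 + real N \<le> 326 * v ^ 5"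
  proof -
    have "real n * (\<xi> * \<Lambda>) ^ 2 \<le> v * (v ^ 2) ^ 2" using v xv x1 by (intro mult_mono power_mono) auto
    also have "v * (v ^ 2) ^ 2 = v ^ 5" by (simp add: eval_nat_numeral)
    finally have "real N \<le> 324 * v ^ 5" using N1 by linarith
    moreover have "1 \<le> v ^ 5" using v by (intro one_le_power) simp
    ultimately show ?thesis by simp
  qed
  then have "log 2 (2 + real N) \<le> real 9 + real 5 * \<Lambda>" by (intro lg) (auto intro: add_pos_nonneg)
  then show "log 2 (2 + real N) \<le> 14 * \<Lambda>" using \<Lambda>1 by simp
qed

text \<open>\<open>z\<close> is the size of \<open>zero_key\<close>, \<open>w\<close> bounds all
  keys, and the last sum is the cell bound of the whole program. The degrees in \<open>y\<close>
  depend on \<open>b\<close> only; \<open>y\<close> will contain \<open>log 2 W\<close> in place of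
  \<open>W\<close>.\<close>

lemma squaring_words:
  fixes n K b J N :: nat and E z y :: real
  assumes y: "3 \<le> y" and n: "real n + 1 \<le> y" and K: "real K \<le> y"
    and J: "J = 6 * K * (ceil_log n + 1)" and N: "N = n * (J * J)"
    and T: "T = real (J * (n + 1) ^ b)" and g: "g = ceil_log (J * (n + 1) ^ b)"
    and E: "0 \<le> E" "E \<le> (real n + 1) ^ b + y"
    and z: "z = (2 * real n + T + real J) * T"
    and w: "w = (E + real g + 1) * T + z + real (ceil_log n) * (T * (real J + 2))"
  shows "poly_bounded y (12 + 2 * b) w" "poly_bounded y 9 (real N)"
    "poly_bounded y (25 + 2 * b) (w + real J + 1 + real (N * N) + 2 * T * (real J + 1) + 6 + real b + E + real g)"
proof -
  note add = poly_bounded_add[OF y] and mult = poly_bounded_mult[OF y]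
  have c1: "poly_bounded y 0 1" and c2: "poly_bounded y 1 2" using y by (auto simp: poly_bounded_def)
  have "3 ^ 2 \<le> y ^ 2" using y by (intro power_mono) auto
  then have c6: "poly_bounded y 2 6" by (simp add: poly_bounded_def)
  have pn: "poly_bounded y 1 (real n)" and pn1: "poly_bounded y 1 (real n + 1)" and pK: "poly_bounded y 1 (real K)"
    using n K by (auto simp: poly_bounded_def)
  have pR: "poly_bounded y 1 (real (ceil_log n))" and pR1: "poly_bounded y 1 (real (ceil_log n) + 1)"
    using n ceil_log_le_self[of n] by (auto simp: poly_bounded_def)
  have "poly_bounded y 4 (6 * real K * (real (ceil_log n) + 1))"
    by (rule mult[OF mult[OF c6 pK order_refl] pR1]) simp
  then have pJ: "poly_bounded y 4 (real J)" unfolding J by (simp add: algebra_simps)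
  have "poly_bounded y 9 (real n * (real J * real J))" by (rule mult[OF pn mult[OF pJ pJ order_refl]]) simp
  then show pN: "poly_bounded y 9 (real N)" unfolding N by simp
  have pNN: "poly_bounded y 18 (real (N * N))" unfolding of_nat_mult by (rule mult[OF pN pN]) simp
  have "poly_bounded y (4 + b) (real J * (real n + 1) ^ b)"
    by (rule mult[OF pJ poly_bounded_power[OF pn1]]) simp
  then have pT: "poly_bounded y (4 + b) T" unfolding T by (simp add: add.commute)
  have pg: "poly_bounded y (4 + b) (real g)"
    using pT ceil_log_le_self[of "J * (n + 1) ^ b"] unfolding poly_bounded_def T g
    by (metis of_nat_0_le_iff of_nat_le_iff order_trans)
  have "poly_bounded y (b + 2) ((real n + 1) ^ b + y)"
    by (rule add[OF poly_bounded_power[OF pn1, of b], where j = 1]) (use y in \<open>auto simp: poly_bounded_def\<close>)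
  then have pE: "poly_bounded y (b + 2) E" using E unfolding poly_bounded_def by linarith
  have "poly_bounded y (6 + b) (2 * real n + T + real J)"
    by (rule add[OF add[OF mult[OF c2 pn order_refl] pT, where k = "5 + b"] pJ]) simp_all
  then have pz: "poly_bounded y (10 + 2 * b) z" unfolding z by (rule mult[OF _ pT]) simp
  have pJ2: "poly_bounded y 5 (real J + 2)" and pJ1: "poly_bounded y 5 (real J + 1)"
    by (rule add[OF pJ c2] add[OF pJ c1]; simp)+
  have "poly_bounded y (6 + b) (E + real g + 1)"
    by (rule add[OF add[OF pE pg, where k = "5 + b"] c1]) simp_all
  then have "poly_bounded y (10 + 2 * b) ((E + real g + 1) * T)" by (rule mult[OF _ pT]) simp
  then have 1: "poly_bounded y (11 + 2 * b) ((E + real g + 1) * T + z)" by (rule add[OF _ pz]) simp_all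
  have "poly_bounded y (10 + b) (real (ceil_log n) * (T * (real J + 2)))"
    by (rule mult[OF pR mult[OF pT pJ2 order_refl]]) simp
  with 1 show pw: "poly_bounded y (12 + 2 * b) w" unfolding w by (rule add) simp_all
  have pTJ: "poly_bounded y (10 + b) (2 * T * (real J + 1))"
    by (rule mult[OF mult[OF c2 pT order_refl] pJ1]) simp
  have pb: "poly_bounded y b (real b)"
  proof -
    have "real b \<le> 2 ^ b" by (rule less_imp_le[OF of_nat_less_two_power])
    also have "\<dots> \<le> y ^ b" using y by (intro power_mono) auto
    finally show ?thesis by (simp add: poly_bounded_def)
  qed
  have "poly_bounded y (14 + 2 * b) (w + real J + 1)"
    by (rule add[OF add[OF pw pJ, where k = "13 + 2 * b"] c1]) simp_all
  then have "poly_bounded y (20 + 2 * b) (w + real J + 1 + real (N * N))" by (rule add[OF _ pNN]) simp_all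
  then have "poly_bounded y (21 + 2 * b) (w + real J + 1 + real (N * N) + 2 * T * (real J + 1))"
    by (rule add[OF _ pTJ]) simp_all
  then have "poly_bounded y (22 + 2 * b) (w + real J + 1 + real (N * N) + 2 * T * (real J + 1) + 6)"
    by (rule add[OF _ c6]) simp_all
  then have "poly_bounded y (23 + 2 * b) (w + real J + 1 + real (N * N) + 2 * T * (real J + 1) + 6 + real b)"
    by (rule add[OF _ pb]) simp_all
  then have "poly_bounded y (24 + 2 * b) (w + real J + 1 + real (N * N) + 2 * T * (real J + 1) + 6 + real b + E)"
    by (rule add[OF _ pE]) simp_all
  then show "poly_bounded y (25 + 2 * b) (w + real J + 1 + real (N * N) + 2 * T * (real J + 1) + 6 + real b + E + real g)"
    by (rule add[OF _ pg]) simp_all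
qed

text \<open>The Min-Max Product of dimension \<open>N = n * (J * J)\<close> dictates the bound:
  \<open>N powr c\<close> is at most a constant times
  \<open>n powr c * (\<xi> * \<Lambda>) powr (2 * c)\<close>. So \<open>k \<ge> 2 * c\<close>
  becomes the degree in \<open>1 + 1 / \<epsilon>\<close>. The exponent of the logarithm collects
  \<open>k\<close> from \<open>J\<close>, \<open>l\<close> from the callee and 3 for rounds and
  inner loops.\<close>

lemma squaring_time:
  fixes n K b J N h g Tm k l c\<^sub>1 c\<^sub>2 c\<^sub>3 c\<^sub>4 c\<^sub>5 :: nat and c C \<epsilon> :: real
  assumes n: "1 \<le> n" and \<epsilon>: "0 < \<epsilon>" and K: "1 \<le> K" "real K \<le> 1 / \<epsilon> + 1" and c: "2 \<le> c" "2 * c \<le> real k"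
    and J: "J = 6 * K * (ceil_log n + 1)" and N: "N = n * (J * J)"
    and h: "h = ceil_log (J + 1)" and g: "g = ceil_log (J * (n + 1) ^ b)"
    and Tm: "real Tm \<le> exact_time \<bar>C\<bar> l c N"
  shows "real (400 + (ceil_log n + 1) * (c\<^sub>1 + 10) + b * 30 + n * n * (300 + (g + 1) * (c\<^sub>2 + 10) + c\<^sub>3) +
      ceil_log n * (100 + N * N * (600 + 2 * ((h + 1) * (c\<^sub>4 + 15)) + c\<^sub>5) + Tm + 12)) \<le>
    approx_time (400 + 3 * (real c\<^sub>1 + 10) + 30 * real b + (300 + (9 + real b) * (real c\<^sub>2 + 10) + real c\<^sub>3) +
      3 * (112 + 324 powr c * (600 + 18 * (real c\<^sub>4 + 15) + real c\<^sub>5) + \<bar>C\<bar> * 324 powr c * 14 ^ l)) k (k + l + 3) c n \<epsilon>"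
proof -
  define \<xi> v \<Lambda> where "\<xi> = 1 + 1 / \<epsilon>" and "v = 2 + real n + 1 / \<epsilon>" and "\<Lambda> = log 2 v"
  have e0: "0 < 1 / \<epsilon>" using \<epsilon> by simp
  have v3: "3 \<le> v" using e0 n unfolding v_def by linarith
  have \<Lambda>1: "1 \<le> \<Lambda>" unfolding \<Lambda>_def using v3 by (intro one_le_log2) simp
  have \<xi>1: "1 \<le> \<xi>" using e0 unfolding \<xi>_def by simp
  have v1: "real n + 1 \<le> v" "\<xi> \<le> v" using e0 unfolding v_def \<xi>_def by simp_all
  have K': "real K \<le> \<xi>" using K unfolding \<xi>_def by simp
  note sizes = squaring_sizes[OF n K(1) K' v1 v3 \<Lambda>_def J N]
  have J1: "1 \<le> J" using K J by simp
  have N1: "1 \<le> N" using n J1 N by simp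
  define P where "P = real n powr c"
  define Z where "Z = P * (\<xi> * \<Lambda>) ^ k"
  define U where "U = Z * \<Lambda> ^ (l + 3)"
  define q where "q = (324 :: real) powr c"
  have q0: "0 \<le> q" by (simp add: q_def)
  have P1: "1 \<le> P" unfolding P_def using n c by (intro ge_one_powr_ge_zero) auto
  have nP: "real n * real n \<le> P" unfolding P_def by (rule n_square_le_powr[OF n c(1)])
  have x1: "1 \<le> \<xi> * \<Lambda>" using \<xi>1 \<Lambda>1 mult_mono[of 1 \<xi> 1 \<Lambda>] by simp
  have PZ: "P \<le> Z" unfolding Z_def using P1 x1 mult_left_mono[of 1 "(\<xi> * \<Lambda>) ^ k" P] by (simp add: one_le_power)
  have Nc: "real N powr c \<le> q * Z"
  proof -
    have "real N powr c \<le> (324 * (real n * (\<xi> * \<Lambda>) ^ 2)) powr c"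
      using sizes(2) c by (intro powr_mono2) auto
    also have "\<dots> = q * (P * ((\<xi> * \<Lambda>) ^ 2) powr c)" using x1 by (simp add: powr_mult q_def P_def)
    also have "((\<xi> * \<Lambda>) ^ 2) powr c = (\<xi> * \<Lambda>) powr (2 * c)"
    proof -
      have "(\<xi> * \<Lambda>) ^ 2 = (\<xi> * \<Lambda>) powr 2" using x1 by simp
      then show ?thesis by (simp only: powr_powr)
    qed
    also have "q * (P * (\<xi> * \<Lambda>) powr (2 * c)) \<le> q * (P * (\<xi> * \<Lambda>) powr real k)"
      using x1 c P1 q0 by (intro mult_left_mono powr_mono) auto
    also have "\<dots> = q * Z" using x1 by (simp only: powr_realpow Z_def)
    finally show ?thesis .
  qed
  have NN: "real N * real N \<le> q * Z" using n_square_le_powr[OF N1 c(1)] Nc by linarith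
  have Z1: "1 \<le> Z" using P1 PZ by linarith
  have pow: "Z * \<Lambda> ^ i \<le> U" if "i \<le> l + 3" for i
    unfolding U_def using that \<Lambda>1 Z1 by (intro mult_left_mono power_increasing) auto
  have Z\<Lambda>: "Z * \<Lambda> \<le> U" using pow[of 1] by simp
  have "1 * \<Lambda> \<le> Z * \<Lambda>" "P * \<Lambda> \<le> Z * \<Lambda>" "1 * 1 \<le> Z * \<Lambda>" using Z1 PZ \<Lambda>1 by (intro mult_mono; simp)+
  then have U: "\<Lambda> \<le> U" "P * \<Lambda> \<le> U" "1 \<le> U" using Z\<Lambda> by linarith+
  have 2: "real (ceil_log n + 1) * (real c\<^sub>1 + 10) \<le> 3 * (real c\<^sub>1 + 10) * U"
  proof -
    have "real (ceil_log n + 1) * (real c\<^sub>1 + 10) \<le> (3 * U) * (real c\<^sub>1 + 10)"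
      using sizes(1) U by (intro mult_right_mono) auto
    then show ?thesis by (simp add: mult_ac)
  qed
  have 3: "30 * real b * 1 \<le> 30 * real b * U" using U by (intro mult_left_mono) auto
  have 4: "real n * real n * (300 + real (g + 1) * (real c\<^sub>2 + 10) + real c\<^sub>3) \<le>
    (300 + (9 + real b) * (real c\<^sub>2 + 10) + real c\<^sub>3) * U"
  proof -
    have "real (g + 1) * (real c\<^sub>2 + 10) \<le> ((9 + real b) * \<Lambda>) * (real c\<^sub>2 + 10)"
      unfolding g using sizes(4) by (intro mult_right_mono) auto
    moreover have "300 * 1 \<le> 300 * \<Lambda>" "real c\<^sub>3 * 1 \<le> real c\<^sub>3 * \<Lambda>" using \<Lambda>1 by (intro mult_left_mono; simp)+
    ultimately have "300 + real (g + 1) * (real c\<^sub>2 + 10) + real c\<^sub>3 \<le>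
        300 * \<Lambda> + ((9 + real b) * \<Lambda>) * (real c\<^sub>2 + 10) + real c\<^sub>3 * \<Lambda>" by linarith
    also have "\<dots> = (300 + (9 + real b) * (real c\<^sub>2 + 10) + real c\<^sub>3) * \<Lambda>" by (simp add: algebra_simps)
    finally have "real n * real n * (300 + real (g + 1) * (real c\<^sub>2 + 10) + real c\<^sub>3) \<le>
      P * ((300 + (9 + real b) * (real c\<^sub>2 + 10) + real c\<^sub>3) * \<Lambda>)"
      using nP P1 by (intro mult_mono) auto
    also have "\<dots> = (300 + (9 + real b) * (real c\<^sub>2 + 10) + real c\<^sub>3) * (P * \<Lambda>)" by (simp only: mult_ac)
    also have "\<dots> \<le> (300 + (9 + real b) * (real c\<^sub>2 + 10) + real c\<^sub>3) * U" using U by (intro mult_left_mono) auto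
    finally show ?thesis .
  qed
  let ?V = "Z * \<Lambda> ^ (l + 1)"
  have V: "Z * \<Lambda> \<le> ?V" "1 \<le> ?V" "Z * \<Lambda> ^ l \<le> ?V"
  proof -
    have "\<Lambda> ^ 1 \<le> \<Lambda> ^ (l + 1)" "\<Lambda> ^ l \<le> \<Lambda> ^ (l + 1)" using \<Lambda>1 by (intro power_increasing; simp)+
    then show "Z * \<Lambda> \<le> ?V" "Z * \<Lambda> ^ l \<le> ?V" using Z1 by (auto intro!: mult_left_mono simp del: power_Suc)
    then show "1 \<le> ?V" using \<open>1 * 1 \<le> Z * \<Lambda>\<close> by linarith
  qed
  have 5: "real N * real N * (600 + 2 * (real (h + 1) * (real c\<^sub>4 + 15)) + real c\<^sub>5) \<le>
    q * (600 + 18 * (real c\<^sub>4 + 15) + real c\<^sub>5) * ?V"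
  proof -
    have "real (h + 1) * (real c\<^sub>4 + 15) \<le> (9 * \<Lambda>) * (real c\<^sub>4 + 15)"
      unfolding h using sizes(3) by (intro mult_right_mono) auto
    moreover have "600 * 1 \<le> 600 * \<Lambda>" "real c\<^sub>5 * 1 \<le> real c\<^sub>5 * \<Lambda>" using \<Lambda>1 by (intro mult_left_mono; simp)+
    ultimately have "600 + 2 * (real (h + 1) * (real c\<^sub>4 + 15)) + real c\<^sub>5 \<le>
        600 * \<Lambda> + 2 * ((9 * \<Lambda>) * (real c\<^sub>4 + 15)) + real c\<^sub>5 * \<Lambda>" by linarith
    also have "\<dots> = (600 + 18 * (real c\<^sub>4 + 15) + real c\<^sub>5) * \<Lambda>" by (simp add: algebra_simps)
    finally have "real N * real N * (600 + 2 * (real (h + 1) * (real c\<^sub>4 + 15)) + real c\<^sub>5) \<le>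
      (q * Z) * ((600 + 18 * (real c\<^sub>4 + 15) + real c\<^sub>5) * \<Lambda>)"
      by (rule mult_mono[OF NN]) (use q0 Z1 in auto)
    also have "\<dots> = q * (600 + 18 * (real c\<^sub>4 + 15) + real c\<^sub>5) * (Z * \<Lambda>)" by (simp only: mult_ac)
    also have "\<dots> \<le> q * (600 + 18 * (real c\<^sub>4 + 15) + real c\<^sub>5) * ?V" by (rule mult_left_mono[OF V(1)]) (use q0 in auto)
    finally show ?thesis .
  qed
  have 6: "real Tm \<le> \<bar>C\<bar> * q * 14 ^ l * ?V"
  proof -
    have "real Tm \<le> \<bar>C\<bar> * real N powr c * log 2 (2 + real N) ^ l" using Tm by (simp add: exact_time_def)
    also have "\<dots> \<le> \<bar>C\<bar> * (q * Z) * (14 * \<Lambda>) ^ l"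
      using Nc sizes(5) q0 Z1 by (intro mult_mono power_mono mult_left_mono) auto
    also have "\<dots> = \<bar>C\<bar> * q * 14 ^ l * (Z * \<Lambda> ^ l)" by (simp only: power_mult_distrib mult_ac)
    also have "\<dots> \<le> \<bar>C\<bar> * q * 14 ^ l * ?V" by (rule mult_left_mono[OF V(3)]) (use q0 in auto)
    finally show ?thesis .
  qed
  let ?r = "112 + q * (600 + 18 * (real c\<^sub>4 + 15) + real c\<^sub>5) + \<bar>C\<bar> * q * 14 ^ l"
  have r0: "0 \<le> ?r" using q0 by simp
  have "100 + real N * real N * (600 + 2 * (real (h + 1) * (real c\<^sub>4 + 15)) + real c\<^sub>5) + real Tm + 12 \<le> ?r * ?V"
  proof -
    have "?r * ?V = 112 * ?V + q * (600 + 18 * (real c\<^sub>4 + 15) + real c\<^sub>5) * ?V + \<bar>C\<bar> * q * 14 ^ l * ?V"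
      by (simp only: distrib_right)
    then show ?thesis using 5 6 V(2) by linarith
  qed
  then have "real (ceil_log n) * (100 + real N * real N * (600 + 2 * (real (h + 1) * (real c\<^sub>4 + 15)) + real c\<^sub>5) + real Tm + 12)
      \<le> (3 * \<Lambda>) * (?r * ?V)"
    using sizes(1) \<Lambda>1 by (intro mult_mono) auto
  also have "\<dots> = 3 * ?r * (Z * \<Lambda> ^ (l + 2))" by (simp add: mult_ac)
  also have "\<dots> \<le> 3 * ?r * U" using r0 by (intro mult_left_mono pow) auto
  finally have 7: "real (ceil_log n) * (100 + real N * real N * (600 + 2 * (real (h + 1) * (real c\<^sub>4 + 15)) + real c\<^sub>5) + real Tm + 12)
      \<le> 3 * ?r * U" .
  have "real (400 + (ceil_log n + 1) * (c\<^sub>1 + 10) + b * 30 + n * n * (300 + (g + 1) * (c\<^sub>2 + 10) + c\<^sub>3) +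
      ceil_log n * (100 + N * N * (600 + 2 * ((h + 1) * (c\<^sub>4 + 15)) + c\<^sub>5) + Tm + 12)) =
    400 + real (ceil_log n + 1) * (real c\<^sub>1 + 10) + 30 * real b * 1 +
      real n * real n * (300 + real (g + 1) * (real c\<^sub>2 + 10) + real c\<^sub>3) +
      real (ceil_log n) * (100 + real N * real N * (600 + 2 * (real (h + 1) * (real c\<^sub>4 + 15)) + real c\<^sub>5) + real Tm + 12)"
    by (simp only: of_nat_add of_nat_mult of_nat_numeral of_nat_1 mult_1_right mult.commute[of "real b"])
  also have "\<dots> \<le> 400 * U + 3 * (real c\<^sub>1 + 10) * U + 30 * real b * U +
      (300 + (9 + real b) * (real c\<^sub>2 + 10) + real c\<^sub>3) * U + 3 * ?r * U"
    using 2 3 4 7 U(3) by linarith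
  also have "\<dots> = (400 + 3 * (real c\<^sub>1 + 10) + 30 * real b + (300 + (9 + real b) * (real c\<^sub>2 + 10) + real c\<^sub>3) + 3 * ?r) * U"
    by (simp only: distrib_right)
  also have "U = P * \<xi> ^ k * \<Lambda> ^ (k + l + 3)"
    unfolding U_def Z_def by (simp only: power_mult_distrib power_add mult_ac)
  finally show ?thesis
    unfolding approx_time_def P_def \<xi>_def v_def \<Lambda>_def q_def by (simp only: mult.assoc)
qed

lemma APSP_if_min_max:
  fixes c :: real
  assumes c: "2 \<le> c" and mm: "min_max_solvable c"
  shows "approx_APSP_solvable c"
proof -
  obtain P \<kappa> C l where solve: "\<forall>n W A B s.
        1 \<le> n \<and> 0 \<le> W \<and>
        (\<forall>i<n. \<forall>j<n. A i j \<in> int_infty \<and> (A i j \<noteq> \<infinity> \<longrightarrow> \<bar>A i j\<bar> \<le> ereal W)) \<and>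
        (\<forall>i<n. \<forall>j<n. B i j \<in> int_infty \<and> (B i j \<noteq> \<infinity> \<longrightarrow> \<bar>B i j\<bar> \<le> ereal W)) \<and>
        s 0 0 = Some (int n) \<and>
        holds_int_matrix s 1 n A \<and> holds_int_matrix s 2 n B
      \<longrightarrow> (\<exists>t s'.
        exec (exact_word \<kappa> n W) P s t s' \<and>
        real t \<le> exact_time C l c n \<and>
        holds_int_matrix s' 3 n (min_max n A B))"
    using mm unfolding min_max_solvable_def by (elim exE) (rule that)
  show ?thesis unfolding approx_APSP_solvable_def
  proof (rule allI)
    fix b :: nat
    \<comment> \<open>The degree of the cell bound in \<open>squaring_words\<close>. In
      \<open>\<kappa>'\<close>, the part \<open>32 * q\<close> is for expressions over such cells
      and \<open>q * \<kappa>\<close> for the callee's words, since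
      \<open>2 + N + m \<le> y ^ q\<close>.\<close>
    define q where "q = 25 + 2 * b"
    define \<kappa>' where "\<kappa>' = 32 * q + q * \<kappa>"
    define k where "k = nat \<lceil>2 * c\<rceil>"
    define C' where "C' = 400 + 3 * (real (cost log_body) + 10) + 30 * real b +
      (300 + (9 + real b) * (real (cost double_body) + 10) + real (cost final_body)) +
      3 * (112 + 324 powr c * (600 + 18 * (real (cost half_body) + 15) + real (cost back_body)) + \<bar>C\<bar> * 324 powr c * 14 ^ l)"
    have k: "2 * c \<le> real k" unfolding k_def by linarith
    show "\<exists>P \<kappa> C k l. \<forall>n \<epsilon> W E w s.
        1 \<le> n \<and> 0 < \<epsilon> \<and> 1 \<le> W \<and>
        E \<subseteq> {..<n} \<times> {..<n} \<and>
        (\<forall>e\<in>E. w e \<in> R_plus \<and> (w e \<noteq> \<infinity> \<longrightarrow> w e \<le> ereal W)) \<and>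
        s 0 0 = Some (int n) \<and> s 0 1 = Some \<lceil>1 / \<epsilon>\<rceil> \<and>
        holds_float_matrix ((real n + 1) ^ b) s 1 n
          (\<lambda>u v. if (u, v) \<in> E then w (u, v) else \<infinity>)
      \<longrightarrow> (\<exists>t s' D.
        exec (approx_word \<kappa> n \<epsilon> W) P s t s' \<and>
        real t \<le> approx_time C k l c n \<epsilon> \<and>
        holds_float_matrix (approx_word \<kappa> n \<epsilon> W) s' 2 n D \<and>
        (\<forall>u<n. \<forall>v<n. distance (graph_on n E) w u v \<le> D u v \<and>
           D u v \<le> ereal (1 + \<epsilon>) * distance (graph_on n E) w u v))"
    proof (rule exI[of _ "APSP_com b P"], rule exI[of _ \<kappa>'], rule exI[of _ C'], rule exI[of _ k],
        rule exI[of _ "k + l + 3"], intro allI impI, elim conjE)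
      fix n :: nat and \<epsilon> W :: real and A :: "(nat \<times> nat) set" and w :: "nat \<times> nat \<Rightarrow> ereal" and s :: mem
      let ?X = "\<lambda>u v. if (u, v) \<in> A then w (u, v) else \<infinity>"
      assume n: "1 \<le> n" and \<epsilon>: "0 < \<epsilon>" and W: "1 \<le> W" and A: "A \<subseteq> {..<n} \<times> {..<n}"
        and w: "\<forall>e\<in>A. w e \<in> R_plus \<and> (w e \<noteq> \<infinity> \<longrightarrow> w e \<le> ereal W)"
        and s: "s 0 0 = Some (int n)" "s 0 1 = Some \<lceil>1 / \<epsilon>\<rceil>"
        and X: "holds_float_matrix ((real n + 1) ^ b) s 1 n ?X"
      define K where "K = nat \<lceil>1 / \<epsilon>\<rceil>"
      have Ki: "\<lceil>1 / \<epsilon>\<rceil> = int K" using ceiling_inverse(1)[OF \<epsilon>] unfolding K_def by linarith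
      have K: "1 \<le> K" "real K \<le> 1 / \<epsilon> + 1" "1 / real K \<le> \<epsilon>"
        using ceiling_inverse[OF \<epsilon>] unfolding Ki by simp_all
      define J where "J = 6 * K * (ceil_log n + 1)"
      define N where "N = n * (J * J)"
      define T where "T = int (J * (n + 1) ^ b)"
      define h where "h = ceil_log (J + 1)"
      define g where "g = ceil_log (J * (n + 1) ^ b)"
      define E where "E = \<lfloor>(real n + 1) ^ b + log 2 W\<rfloor>"
      define z where "z = (2 * int n + T + int J) * T"
      define m where "m = (E + int g + 1) * T + z + int (ceil_log n) * (T * (int J + 2))"
      \<comment> \<open>The sum of all quantities that have to fit, so that each requirement follows
        by dropping nonnegative summands.\<close>
      define M where "M = m + int J + 1 + int (N * N) + 2 * T * (int J + 1) + 6 + int b + E + int g"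
      define y where "y = 2 + real n + 1 / \<epsilon> + log 2 W"
      have e0: "0 < 1 / \<epsilon>" using \<epsilon> by simp
      have lW: "0 \<le> log 2 W" using W by simp
      have y3: "3 \<le> y" unfolding y_def using e0 lW n by linarith
      have E0: "0 \<le> E" unfolding E_def using lW by simp
      have J1: "1 \<le> J" using K by (simp add: J_def)
      have JT: "int J \<le> T"
      proof -
        have "J * 1 \<le> J * (n + 1) ^ b" by (intro mult_le_mono2) simp
        then show ?thesis unfolding T_def by (simp only: of_nat_le_iff mult_1_right)
      qed
      have T1: "1 \<le> T" using J1 JT by linarith
      have z0: "0 \<le> z" unfolding z_def using T1 by simp
      have Tg: "T \<le> 2 ^ g"
      proof -
        have "int (J * (n + 1) ^ b) \<le> int (2 ^ g)" unfolding g_def of_nat_le_iff by (rule ceil_log)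
        then show ?thesis by (simp add: T_def)
      qed
      have terms: "0 \<le> (E + int g + 1) * T" "0 \<le> int (ceil_log n) * (T * (int J + 2))" "0 \<le> 2 * T * (int J + 1)"
        "0 \<le> int (N * N)" using E0 T1 by simp_all
      have m0: "0 \<le> m" unfolding m_def using terms z0 by linarith
      have Mge: "6 \<le> M" "int (N * N) \<le> M" "2 * T * (int J + 1) \<le> M" "int b \<le> M" "E + int g \<le> M" "m + int J + 1 \<le> M"
        unfolding M_def using m0 terms E0 by linarith+
      have N1: "1 \<le> N" using n J1 by (simp add: N_def)
      have Elog: "real_of_int E \<le> (real n + 1) ^ b + y"
      proof -
        have "real_of_int E \<le> (real n + 1) ^ b + log 2 W" unfolding E_def by (rule of_int_floor_le)
        moreover have "log 2 W \<le> y" unfolding y_def using e0 by simp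
        ultimately show ?thesis by linarith
      qed
      have words: "poly_bounded y (12 + 2 * b) (real_of_int m)" "poly_bounded y 9 (real N)"
        "poly_bounded y (25 + 2 * b) (real_of_int m + real J + 1 + real (N * N) + 2 * real_of_int T * (real J + 1) +
          6 + real b + real_of_int E + real g)"
        by (rule squaring_words[where z = "real_of_int z" and E = "real_of_int E" and K = K and T = "real_of_int T" and b = b and n = n
              and J = J and N = N and g = g and w = "real_of_int m", OF y3 _ _ J_def N_def _ g_def _ Elog];
            use e0 lW E0 K(2) in \<open>simp add: y_def T_def z_def m_def\<close>)+
      have My: "poly_bounded y q (real_of_int M)" using words(3) by (simp add: M_def q_def)
      define B where "B = approx_word \<kappa>' n \<epsilon> W"
      have B: "B = y ^ \<kappa>'" by (simp add: B_def approx_word_def y_def)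
      have y1: "1 \<le> y" using y3 by simp
      have fits: "fits B M"
      proof -
        have "real_of_int M ^ 32 \<le> (y ^ q) ^ 32" using My by (intro power_mono) (auto simp: poly_bounded_def)
        also have "\<dots> = y ^ (32 * q)" by (simp only: power_mult[symmetric] mult.commute)
        also have "\<dots> \<le> B" unfolding B \<kappa>'_def using y1 by (intro power_increasing) auto
        finally show ?thesis using Mge by (simp add: fits_def)
      qed
      \<comment> \<open>The callee sees entries bounded by the key bound \<open>m\<close>, not by
        \<open>W\<close>. Its words are polynomial in \<open>m\<close>, hence polynomial in
        \<open>log 2 W\<close>, as the word bound of APSP demands.\<close>
      have inner: "exact_word \<kappa> N (real_of_int m) \<le> B"
      proof -
        have "poly_bounded y 1 2" using y3 by (simp add: poly_bounded_def)
        from poly_bounded_add[OF y3 this words(2), of 10] have "poly_bounded y 10 (2 + real N)" by simp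
        from poly_bounded_add[OF y3 this words(1), of q] have "poly_bounded y q (2 + real N + real_of_int m)"
          by (simp add: q_def)
        from poly_bounded_power[OF this, of \<kappa>] have "exact_word \<kappa> N (real_of_int m) \<le> y ^ (q * \<kappa>)"
          by (simp add: poly_bounded_def exact_word_def)
        also have "\<dots> \<le> B" unfolding B \<kappa>'_def using y1 by (intro power_increasing) auto
        finally show ?thesis .
      qed
      interpret apsp: APSP_machine B M T n J N h K b
      proof
        show "int J + 1 \<le> 2 ^ h"
        proof -
          have "int (J + 1) \<le> int (2 ^ h)" unfolding h_def of_nat_le_iff by (rule ceil_log)
          then show ?thesis by simp
        qed
        show "h \<le> J + 1" unfolding h_def by (rule ceil_log_le_self)
      qed (use fits n J1 JT N_def Mge K J_def T_def in auto)
      have "apsp.zero_key = - z" unfolding apsp.zero_key_def z_def by (rule mult_minus_left)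
      then have zk: "\<bar>apsp.zero_key\<bar> = z" using z0 by simp
      define Tm where "Tm = nat \<lfloor>exact_time \<bar>C\<bar> l c N\<rfloor>"
      have Tm: "real Tm \<le> exact_time \<bar>C\<bar> l c N" unfolding Tm_def by (simp add: of_nat_floor exact_time_nonneg)
      have call: "\<exists>t s2. exec (exact_word \<kappa> N (real_of_int m)) P s1 t s2 \<and> t \<le> Tm \<and>
          holds_int_matrix s2 3 N (min_max N (\<lambda>i j. key_ereal (Y i j)) (\<lambda>i j. key_ereal (Y' i j)))"
        if s1: "s1 0 0 = Some (int N)" "holds_int_matrix s1 1 N (\<lambda>i j. key_ereal (Y i j))"
          "holds_int_matrix s1 2 N (\<lambda>i j. key_ereal (Y' i j))"
          and bd: "\<And>i j k. i < N \<Longrightarrow> j < N \<Longrightarrow> Y i j = Some k \<or> Y' i j = Some k \<Longrightarrow> \<bar>k\<bar> \<le> m" for s1 Y Y'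
      proof -
        have key: "key_ereal x \<in> int_infty \<and> (key_ereal x \<noteq> \<infinity> \<longrightarrow> \<bar>key_ereal x\<bar> \<le> ereal (real_of_int m))"
          if "\<And>k. x = Some k \<Longrightarrow> \<bar>k\<bar> \<le> m" for x
        proof (cases x)
          case (Some k)
          then have "real_of_int \<bar>k\<bar> \<le> real_of_int m" using that by (simp only: of_int_le_iff)
          then show ?thesis using Some by (auto simp: key_ereal_def int_infty_def)
        qed (simp add: key_ereal_def int_infty_def)
        have "\<exists>t s2. exec (exact_word \<kappa> N (real_of_int m)) P s1 t s2 \<and> real t \<le> exact_time C l c N \<and>
          holds_int_matrix s2 3 N (min_max N (\<lambda>i j. key_ereal (Y i j)) (\<lambda>i j. key_ereal (Y' i j)))"
          by (rule solve[rule_format]) (use s1 bd key N1 m0 in auto)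
        then obtain t s2 where ts: "exec (exact_word \<kappa> N (real_of_int m)) P s1 t s2" "real t \<le> exact_time C l c N"
          "holds_int_matrix s2 3 N (min_max N (\<lambda>i j. key_ereal (Y i j)) (\<lambda>i j. key_ereal (Y' i j)))" by blast
        have "real t \<le> exact_time \<bar>C\<bar> l c N" using ts(2) exact_time_abs[of C l c N] by linarith
        then have "t \<le> Tm" unfolding Tm_def by (rule le_nat_floor)
        with ts show ?thesis by blast
      qed
      have s1: "s 0 1 = Some (int K)" using s(2) Ki by simp
      have Xb: "1 \<le> ?X i j \<and> ?X i j \<le> ereal W" if "?X i j \<noteq> \<infinity>" for i j
        using that w by (auto split: if_splits intro: R_plus_ge_1)
      have "runs B (APSP_com b P)
        (400 + (ceil_log n + 1) * (cost log_body + 10) + b * 30 + n * n * (300 + (g + 1) * (cost double_body + 10) + cost final_body)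
          + ceil_log n * (apsp.round_time Tm + 12)) s
        (\<lambda>s'. \<exists>D. (\<forall>i<n. \<forall>j<n. apsp.start_key ((E + int g + 1) * T) ?X i j (D 0 i j)) \<and>
          (\<forall>t<ceil_log n. squared T J n (D t) (D (Suc t))) \<and>
          holds_float_matrix (real_of_int (2 * T)) s' 2 n (apsp.result (D (ceil_log n))))"
      proof (rule apsp.runs_APSP[where w = m and B' = "exact_word \<kappa> N (real_of_int m)" and W = W, OF s(1) s1 X Xb W _ _ Tg _ _ call inner])
        show "\<lfloor>(real n + 1) ^ b + log 2 W\<rfloor> \<le> E" by (simp add: E_def)
        show "(E + int g + 1) * T + \<bar>apsp.zero_key\<bar> + int (ceil_log n) * (T * (int J + 2)) \<le> m" by (simp add: zk m_def)
      qed (use Mge in simp_all)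
      then obtain t s' D where t: "exec B (APSP_com b P) s t s'"
          "t \<le> 400 + (ceil_log n + 1) * (cost log_body + 10) + b * 30 + n * n * (300 + (g + 1) * (cost double_body + 10) + cost final_body)
          + ceil_log n * (apsp.round_time Tm + 12)"
        and D: "\<forall>i<n. \<forall>j<n. apsp.start_key ((E + int g + 1) * T) ?X i j (D 0 i j)"
          "\<forall>t<ceil_log n. squared T J n (D t) (D (Suc t))"
        and out: "holds_float_matrix (real_of_int (2 * T)) s' 2 n (apsp.result (D (ceil_log n)))"
        unfolding runs_def by blast
      let ?D = "apsp.result (D (ceil_log n))"
      have "real t \<le> approx_time C' k (k + l + 3) c n \<epsilon>"
      proof -
        note t(2)
        also have "400 + (ceil_log n + 1) * (cost log_body + 10) + b * 30 + n * n * (300 + (g + 1) * (cost double_body + 10) + cost final_body)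
          + ceil_log n * (apsp.round_time Tm + 12) =
          400 + (ceil_log n + 1) * (cost log_body + 10) + b * 30 + n * n * (300 + (g + 1) * (cost double_body + 10) + cost final_body)
          + ceil_log n * (100 + N * N * (600 + 2 * ((h + 1) * (cost half_body + 15)) + cost back_body) + Tm + 12)"
          by (simp only: apsp.round_time_def)
        finally show ?thesis
          using squaring_time[OF n \<epsilon> K(1,2) c k J_def N_def h_def g_def Tm,
              of "cost log_body" "cost double_body" "cost final_body" "cost half_body" "cost back_body"]
          unfolding C'_def by (meson of_nat_mono order_trans)
      qed
      moreover have "holds_float_matrix B s' 2 n ?D"
      proof -
        have "2 * T * 1 \<le> 2 * T * (int J + 1)" using T1 by (intro mult_left_mono) auto
        then have "2 * T \<le> M" using Mge(3) by linarith
        then have "real_of_int (2 * T) \<le> real_of_int M" by (simp only: of_int_le_iff)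
        also have "\<dots> \<le> real_of_int M ^ 32" using Mge(1) by (intro self_le_power) auto
        also have "\<dots> \<le> B" using fits by (simp add: fits_def)
        finally show ?thesis using out by (auto simp: holds_float_matrix_def intro: holds_float_mono)
      qed
      moreover have "distance (graph_on n A) w u v \<le> ?D u v \<and> ?D u v \<le> ereal (1 + \<epsilon>) * distance (graph_on n A) w u v"
        if uv: "u < n" "v < n" for u v
      proof -
        have wA: "\<forall>e\<in>A. w e \<in> R_plus" using w by blast
        note r = apsp.result_correct[OF A wA D uv]
        have "0 \<le> distance (graph_on n A) w u v"
          unfolding distance_def
          using w A by (intro INF_greatest sum_list_nonneg)
            (auto simp: pre_digraph.apath_def pre_digraph.awalk_def graph_on_def intro: R_plus_nonneg)
        then have "ereal (1 + 1 / real K) * distance (graph_on n A) w u v \<le> ereal (1 + \<epsilon>) * distance (graph_on n A) w u v"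
          using K by (intro ereal_mult_right_mono) auto
        then show ?thesis using r by (meson order_trans)
      qed
      ultimately show "\<exists>t s' D. exec (approx_word \<kappa>' n \<epsilon> W) (APSP_com b P) s t s' \<and>
        real t \<le> approx_time C' k (k + l + 3) c n \<epsilon> \<and>
        holds_float_matrix (approx_word \<kappa>' n \<epsilon> W) s' 2 n D \<and>
        (\<forall>u<n. \<forall>v<n. distance (graph_on n A) w u v \<le> D u v \<and>
           D u v \<le> ereal (1 + \<epsilon>) * distance (graph_on n A) w u v)"
        using t(1) unfolding B_def by blast
    qed
  qed
qed

theorem theorem4:
  fixes c :: real
  assumes "c \<ge> 2"
    and "approx_APSP_solvable c \<or> approx_min_plus_solvable c \<or>
         min_max_solvable c \<or> bottleneck_solvable c"
  shows "approx_APSP_solvable c \<and> approx_min_plus_solvable c \<and>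
         min_max_solvable c \<and> bottleneck_solvable c"
proof -
  have "min_max_solvable c"
    using assms(2) min_max_if_min_plus[OF assms(1)] min_plus_if_APSP[OF assms(1)] min_max_if_bottleneck[OF assms(1)]
    by blast
  moreover from this have "approx_APSP_solvable c" by (rule APSP_if_min_max[OF assms(1)])
  ultimately show ?thesis using min_plus_if_APSP[OF assms(1)] bottleneck_if_APSP[OF assms(1)] by blast
qed

end
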